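(* Let $V>0$ be such that $F_\ell(V)<V$. Then there exists a minimizer $(u,h)\in\mathcal{A}^\ell_V$ of the problem defining $F_\ell(V)$, i.e. a pair with $\int_{\Omega_h}|\nabla u|^2\,dx\,dy+\int_{\mathbb{R}}|h'|=F_\ell(V)$.
   Context: For $h:\mathbb{R}\to[0,\infty)$ lower semicontinuous, let $\Omega_h:=\{(x,y)\in\mathbb{R}^2:0<y<h(x)\}$ and let $\int_{\mathbb{R}}|h'|$ denote the pointwise variation $\sup\{\sum_{i}|h(x_i)-h(x_{i-1})|: x_1<\dots<x_n\}$. For $V>0$, let $\mathcal{A}^\ell_V$ be the set of pairs $(u,h)$ with $h\in BV(\mathbb{R})$ lower semicontinuous, $h\ge0$, $u\in H^1(\Omega_h)$ real-valued, $\int_{\mathbb{R}}h\,dx=V$, and $u(x,0)=x$ (in the sense of traces) for $x\in\operatorname{supp}h$. Set $$F_\ell(V):=\inf\left\{\int_{\Omega_h}|\nabla u|^2\,dx\,dy+\int_{\mathbb{R}}|h'| : (u,h)\in\mathcal{A}^\ell_V\right\}.$$ *)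

theory Defs
  imports "HOL-Analysis.Analysis"
begin

definition lsc :: "(real \<Rightarrow> real) \<Rightarrow> bool" where
  "lsc h \<longleftrightarrow> (\<forall>x. \<forall>c<h x. \<forall>\<^sub>F y in at x. c < h y)"

text \<open>The pointwise variation depends on all values of \<open>h\<close>, not only on its class modulo null
  sets, and may be infinite.\<close>

definition pointwise_variation :: "(real \<Rightarrow> real) \<Rightarrow> ennreal" where
  "pointwise_variation h =
     (SUP xs\<in>{xs. sorted_wrt (<) xs}. \<Sum>i<length xs - 1. ennreal \<bar>h (xs ! Suc i) - h (xs ! i)\<bar>)"

text \<open>\<open>C\<^sup>1\<close> functions on the whole space with gradient \<open>D\<close> and compact support contained in \<open>\<Omega>\<close>.\<close>

definition test_function :: "'a::euclidean_space set \<Rightarrow> ('a \<Rightarrow> real) \<Rightarrow> ('a \<Rightarrow> 'a) \<Rightarrow> bool" where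
  "test_function \<Omega> \<phi> D \<longleftrightarrow>
     (\<forall>x. GDERIV \<phi> x :> D x) \<and> continuous_on UNIV D \<and>
     compact (closure (support_on UNIV \<phi>)) \<and> closure (support_on UNIV \<phi>) \<subseteq> \<Omega>"

definition BV :: "(real \<Rightarrow> real) \<Rightarrow> bool" where
  "BV h \<longleftrightarrow> integrable lborel h \<and>
     (\<exists>C. \<forall>\<phi> D. test_function UNIV \<phi> D \<longrightarrow> (\<forall>x. \<bar>\<phi> x\<bar> \<le> 1) \<longrightarrow> (LBINT x. h x * D x) \<le> C)"

text \<open>Elements of \<open>L\<^sup>2\<close> and \<open>H\<^sup>1\<close> are represented by Borel functions; values outside \<open>\<Omega>\<close> are
  irrelevant.\<close>

definition L2 :: "'a::euclidean_space set \<Rightarrow> ('a \<Rightarrow> 'b::euclidean_space) \<Rightarrow> bool" where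
  "L2 \<Omega> f \<longleftrightarrow> set_borel_measurable lborel \<Omega> f \<and> set_integrable lborel \<Omega> (\<lambda>z. (norm (f z))\<^sup>2)"

definition has_L2_weak_gradient ::
    "'a::euclidean_space set \<Rightarrow> ('a \<Rightarrow> real) \<Rightarrow> ('a \<Rightarrow> 'a) \<Rightarrow> bool" where
  "has_L2_weak_gradient \<Omega> u G \<longleftrightarrow> L2 \<Omega> G \<and>
     (\<forall>\<phi> D. test_function \<Omega> \<phi> D \<longrightarrow>
        (LINT z:\<Omega>|lborel. u z *\<^sub>R D z) = - (LINT z:\<Omega>|lborel. \<phi> z *\<^sub>R G z))"

definition H1 :: "'a::euclidean_space set \<Rightarrow> ('a \<Rightarrow> real) \<Rightarrow> bool" where
  "H1 \<Omega> u \<longleftrightarrow> L2 \<Omega> u \<and> (\<exists>G. has_L2_weak_gradient \<Omega> u G)"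

text \<open>On open \<open>\<Omega>\<close> the weak gradient of an \<open>H\<^sup>1\<close> function is unique almost everywhere, so integrals
  over \<open>\<Omega>\<close> do not depend on the choice.\<close>

definition weak_gradient :: "'a::euclidean_space set \<Rightarrow> ('a \<Rightarrow> real) \<Rightarrow> 'a \<Rightarrow> 'a" where
  "weak_gradient \<Omega> u = (SOME G. has_L2_weak_gradient \<Omega> u G)"

definition H1_norm :: "'a::euclidean_space set \<Rightarrow> ('a \<Rightarrow> real) \<Rightarrow> real" where
  "H1_norm \<Omega> u = sqrt ((LINT z:\<Omega>|lborel. (u z)\<^sup>2) +
                        (LINT z:\<Omega>|lborel. (norm (weak_gradient \<Omega> u z))\<^sup>2))"

text \<open>The trace operator of a rectangle, restricted to its bottom edge, is the continuous extension
  (from \<open>H\<^sup>1\<close> to \<open>L\<^sup>2\<close>) of the restriction map on \<open>H\<^sup>1\<close> functions that are continuous up to the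
  boundary. The following relation is the graph of this operator.\<close>

definition has_bottom_trace ::
    "real \<Rightarrow> real \<Rightarrow> real \<Rightarrow> (real \<times> real \<Rightarrow> real) \<Rightarrow> (real \<Rightarrow> real) \<Rightarrow> bool" where
  "has_bottom_trace a b c u g \<longleftrightarrow>
     (let Q = {a<..<b} \<times> {0<..<c} in
      H1 Q u \<and> L2 {a<..<b} g \<and>
      (\<exists>w. (\<forall>n. continuous_on ({a..b} \<times> {0..c}) (w n) \<and> H1 Q (w n)) \<and>
           (\<lambda>n. H1_norm Q (\<lambda>z. w n z - u z)) \<longlonglongrightarrow> 0 \<and>
           (\<lambda>n. LINT x:{a<..<b}|lborel. (w n (x, 0) - g x)\<^sup>2) \<longlonglongrightarrow> 0))"

definition subgraph :: "(real \<Rightarrow> real) \<Rightarrow> (real \<times> real) set" where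
  "subgraph h = {(x, y). 0 < y \<and> y < h x}"

text \<open>The trace condition is local: it is imposed on every rectangle contained in \<open>subgraph h\<close> and
  standing on the axis. For \<open>h\<close> lower semicontinuous the bottom edges of these rectangles cover
  \<open>{x. 0 < h x}\<close>. At the remaining points of the closed support of \<open>h\<close> no part of the domain lies
  above the axis, and the trace carries no information.\<close>

definition trace_on_support :: "(real \<Rightarrow> real) \<Rightarrow> (real \<times> real \<Rightarrow> real) \<Rightarrow> (real \<Rightarrow> real) \<Rightarrow> bool" where
  "trace_on_support h u g \<longleftrightarrow>
     (\<forall>a b c. a < b \<longrightarrow> 0 < c \<longrightarrow> {a<..<b} \<times> {0<..<c} \<subseteq> subgraph h \<longrightarrow> has_bottom_trace a b c u g)"

definition admissible :: "real \<Rightarrow> ((real \<times> real \<Rightarrow> real) \<times> (real \<Rightarrow> real)) set" where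
  "admissible V = {(u, h).
     BV h \<and> lsc h \<and> (\<forall>x. 0 \<le> h x) \<and> H1 (subgraph h) u \<and>
     (LBINT x. h x) = V \<and> trace_on_support h u (\<lambda>x. x)}"

definition energy :: "(real \<times> real \<Rightarrow> real) \<Rightarrow> (real \<Rightarrow> real) \<Rightarrow> ennreal" where
  "energy u h =
     (\<integral>\<^sup>+z\<in>subgraph h. ennreal ((norm (weak_gradient (subgraph h) u z))\<^sup>2) \<partial>lborel)
     + pointwise_variation h"

definition F_l :: "real \<Rightarrow> ennreal" where
  "F_l V = (INF (u, h)\<in>admissible V. energy u h)"

end

theory Submission
  imports Defs
begin

text \<open>Given \<open>h\<close>, the trace condition forces \<open>u (x, y) = x + (\<integral>\<^sub>0\<^sup>y G\<^sub>2 (x, s) ds)\<close> with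
  \<open>G = \<nabla>u\<close>, and by Fubini the admissible gradients are the square integrable fields \<open>G\<close> whose pairing
  with \<open>(\<phi>, \<integral>\<^sub>y\<^sup>\<infinity> \<partial>\<^sub>x \<phi>)\<close> is \<open>\<integral> \<phi>\<close> for every test function \<open>\<phi>\<close>. So the minimal Dirichlet energy on the
  subgraph of \<open>h\<close> is a supremum over test functions, and \<open>u\<close> disappears from the problem: one minimizes
  the sum \<open>E(h)\<close> of this supremum and the variation of \<open>h\<close>.

  This reduced energy is lower semicontinuous under \<open>\<Gamma>\<close>-convergence of profiles, for which bounded
  sequences are compact. A minimizing sequence does not vanish: a profile with little mass on every
  interval of a fixed length is almost exhausted by flat rectangles, whose Dirichlet part is close to
  their area, so its energy is almost \<open>V\<close>. After translation the \<open>\<Gamma>\<close>-limit \<open>g\<close> is therefore nonzero. The mass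
  does not split either: cutting the sequence far away, where it is small, and comparing the outer parts,
  rescaled to mass \<open>V\<close>, with the infimum \<open>m\<close> gives \<open>E(g) + m/V (V - \<integral> g) \<le> m\<close>; if \<open>\<integral> g < V\<close>, then
  rescaling \<open>g\<close> itself to mass \<open>V\<close> strictly gains variation, a contradiction.

  The same cutting argument bounds \<open>\<integral>\<^sub>R\<^sup>\<infinity> h\<close> by a multiple of \<open>h(R)\<close> for a minimizer \<open>h\<close>. Hence \<open>h\<close> has a finite
  second moment, and the function \<open>u\<close> built from the optimal field is square integrable.\<close>

subsection \<open>Variation along finite lists\<close>

text \<open>The domain varies with \<open>h\<close>, so a limit of functions \<open>u\<close> would
  have to be taken on moving sets. The dual form avoids this: a test function has compact support in
  the subgraph of the limit profile, hence is eventually a test function for the approximating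
  profiles, and semicontinuity of the Dirichlet part follows at once. The dual form is a Riesz
  representation of the functional sending \<open>\<phi>\<close> to its integral, on the pairs
  (\<open>\<phi>\<close>, \<open>tail D\<close>). It is bounded because the subgraph has finite
  area, and the field (1, 0), the gradient of x, shows that its value is at most that area.
  Spreading the mass over longer and thinner rectangles sends the variation to 0 and the Dirichlet
  part to \<open>V\<close>. Thus \<open>V\<close> is the cost of vanishing, and
  \<open>F_l V < V\<close> says that some pair does better. A bound on the energy gives no control
  of x^2 over the subgraph, while \<open>u\<close> has to be square integrable with boundary values
  x; decay must come from minimality. The trace is given by approximation in H^1, so the formula for
  \<open>u\<close> is derived from the trace for competitors, and approximants are built from the
  formula for the minimizer.\<close>

fun vsum :: "(real \<Rightarrow> real) \<Rightarrow> real list \<Rightarrow> real" where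
  "vsum h [] = 0"
| "vsum h [x] = 0"
| "vsum h (x # y # xs) = \<bar>h y - h x\<bar> + vsum h (y # xs)"

lemma vsum_nonneg: "0 \<le> vsum h xs"
  by (induction h xs rule: vsum.induct) auto

lemma vsum_le_Cons: "vsum h xs \<le> vsum h (x # xs)"
  by (cases xs) auto

lemma vsum_append: "vsum h (xs @ a # ys) = vsum h (xs @ [a]) + vsum h (a # ys)"
  by (induction h xs rule: vsum.induct) auto

lemma vsum_le_append: "vsum h xs \<le> vsum h (xs @ [a])"
proof (cases xs rule: rev_cases)
  case Nil then show ?thesis by simp
next
  case (snoc ys y)
  show ?thesis using vsum_append[of h ys y "[a]"] snoc by simp
qed

lemma vsum_conv_sum: "vsum h xs = (\<Sum>i<length xs - 1. \<bar>h (xs ! Suc i) - h (xs ! i)\<bar>)"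
proof (induction h xs rule: vsum.induct)
  case (3 h x y xs)
  show ?case using 3 by (simp add: sum.lessThan_Suc_shift del: sum.lessThan_Suc)
qed auto

lemma vsum_remdups_adj: "vsum h (remdups_adj xs) = vsum h xs"
proof (induction xs rule: remdups_adj.induct)
  case (3 x y xs)
  show ?case
  proof (cases "x = y")
    case False
    obtain zs where "remdups_adj (y # xs) = y # zs" by (metis remdups_adj_Cons_alt)
    then show ?thesis using 3 False by simp
  qed (use 3 in simp)
qed auto

text \<open>Repeated points add nothing to the sum, so nondecreasing lists have the same supremum as
  strictly increasing ones; they can be joined and enlarged without removing repetitions.\<close>

definition bdd_var :: "(real \<Rightarrow> real) \<Rightarrow> bool" where
  "bdd_var h \<longleftrightarrow> bdd_above (vsum h ` {xs. sorted xs})"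

text \<open>A real supremum is meaningful only for bounded sets. This is why \<open>bdd_var\<close>
  is carried along; under it the value agrees with \<open>pointwise_variation\<close>.\<close>

definition tv :: "(real \<Rightarrow> real) \<Rightarrow> real" where
  "tv h = (SUP xs\<in>{xs. sorted xs}. vsum h xs)"

lemma vsum_le_tv: "bdd_var h \<Longrightarrow> sorted xs \<Longrightarrow> vsum h xs \<le> tv h"
  unfolding tv_def bdd_var_def by (rule cSUP_upper) auto

lemma tv_nonneg: "bdd_var h \<Longrightarrow> 0 \<le> tv h"
  using vsum_le_tv[of h "[]"] by simp

lemma bdd_varI: "(\<And>xs. sorted xs \<Longrightarrow> vsum h xs \<le> C) \<Longrightarrow> bdd_var h"
  unfolding bdd_var_def by (rule bdd_aboveI2) auto

lemma tv_le: "(\<And>xs. sorted xs \<Longrightarrow> vsum h xs \<le> C) \<Longrightarrow> tv h \<le> C"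
  unfolding tv_def by (rule cSUP_least) (use sorted_wrt.simps(1) in auto)

lemma tv_approx:
  assumes "bdd_var h" "e > 0"
  shows "\<exists>xs. sorted xs \<and> tv h - e < vsum h xs"
proof -
  have "\<exists>xs\<in>{xs. sorted xs}. tv h - e < vsum h xs"
    using assms unfolding bdd_var_def
    by (subst less_cSUP_iff[symmetric]) (auto simp: tv_def intro!: exI[of _ "[]"])
  then show ?thesis by auto
qed

lemma distinct_remdups_adj_sorted: "sorted (xs :: real list) \<Longrightarrow> sorted_wrt (<) (remdups_adj xs)"
proof (induction xs rule: remdups_adj.induct)
  case (3 x y xs)
  show ?case
  proof (cases "x = y")
    case True then show ?thesis using 3 by simp
  next
    case False
    have "sorted_wrt (<) (remdups_adj (y # xs))" using 3 False by auto
    moreover have "\<forall>z\<in>set (y # xs). x < z" using 3 False by fastforce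
    ultimately show ?thesis using False by (simp add: remdups_adj_set)
  qed
qed auto

lemma pointwise_variation_vsum:
  "pointwise_variation h = (SUP xs\<in>{xs. sorted xs}. ennreal (vsum h xs))"
proof -
  have *: "(\<Sum>i<length xs - 1. ennreal \<bar>h (xs ! Suc i) - h (xs ! i)\<bar>) = ennreal (vsum h xs)" for xs
    by (subst vsum_conv_sum) (rule sum_ennreal, simp)
  show ?thesis unfolding pointwise_variation_def *
  proof (rule antisym)
    show "(SUP xs\<in>{xs. sorted_wrt (<) xs}. ennreal (vsum h xs)) \<le> (SUP xs\<in>{xs. sorted xs}. ennreal (vsum h xs))"
      by (rule SUP_subset_mono) (auto simp: strict_sorted_iff)
    show "(SUP xs\<in>{xs. sorted xs}. ennreal (vsum h xs)) \<le> (SUP xs\<in>{xs. sorted_wrt (<) xs}. ennreal (vsum h xs))"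
    proof (rule SUP_least)
      fix xs :: "real list" assume "xs \<in> {xs. sorted xs}"
      then have "sorted_wrt (<) (remdups_adj xs)" using distinct_remdups_adj_sorted by auto
      then show "ennreal (vsum h xs) \<le> (SUP xs\<in>{xs. sorted_wrt (<) xs}. ennreal (vsum h xs))"
        by (subst vsum_remdups_adj[symmetric]) (rule SUP_upper, simp)
    qed
  qed
qed

lemma pointwise_variation_eq: "bdd_var h \<Longrightarrow> pointwise_variation h = ennreal (tv h)"
proof (rule antisym)
  assume b: "bdd_var h"
  show "pointwise_variation h \<le> ennreal (tv h)" unfolding pointwise_variation_vsum
    by (rule SUP_least) (auto intro!: ennreal_leI vsum_le_tv b)
  show "ennreal (tv h) \<le> pointwise_variation h"
  proof (rule ennreal_le_epsilon)
    fix e :: real assume "0 < e"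
    then obtain xs where xs: "sorted xs" "tv h - e < vsum h xs" using tv_approx[OF b] by blast
    have "ennreal (tv h) \<le> ennreal (vsum h xs + e)" by (rule ennreal_leI) (use xs in simp)
    also have "\<dots> = ennreal (vsum h xs) + ennreal e" using vsum_nonneg \<open>0 < e\<close> by (simp add: ennreal_plus)
    also have "\<dots> \<le> pointwise_variation h + ennreal e" unfolding pointwise_variation_vsum
      by (rule add_right_mono, rule SUP_upper) (use xs in simp)
    finally show "ennreal (tv h) \<le> pointwise_variation h + ennreal e" .
  qed
qed

lemma bdd_var_if_finite:
  assumes "pointwise_variation h < \<infinity>"
  shows "bdd_var h"
proof (rule bdd_varI)
  fix xs :: "real list" assume s: "sorted xs"
  have "ennreal (vsum h xs) \<le> pointwise_variation h"
    unfolding pointwise_variation_vsum by (rule SUP_upper) (use s in simp)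
  also have "\<dots> = ennreal (enn2real (pointwise_variation h))" using assms by (simp add: less_top)
  finally show "vsum h xs \<le> enn2real (pointwise_variation h)"
    by (subst (asm) ennreal_le_iff) auto
qed

text \<open>The pairs lie in consecutive cells. Listing the smaller point of each pair before the
  larger one gives a sorted list whose variation contains every term of the sum.\<close>

lemma sum_pairs_le_tv:
  assumes b: "bdd_var h"
    and p: "\<And>j. j < N \<Longrightarrow> c j \<le> p j \<and> p j \<le> c (Suc j)"
    and q: "\<And>j. j < N \<Longrightarrow> c j \<le> q j \<and> q j \<le> c (Suc j)"
  shows "(\<Sum>j<N. \<bar>h (p j) - h (q j)\<bar>) \<le> tv h"
proof -
  have "M \<le> N \<Longrightarrow> \<exists>xs. sorted xs \<and> set xs \<subseteq> {..c M} \<and> (\<Sum>j<M. \<bar>h (p j) - h (q j)\<bar>) \<le> vsum h xs" for M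
  proof (induction M)
    case 0 then show ?case by (intro exI[of _ "[]"]) auto
  next
    case (Suc M)
    then obtain xs where xs: "sorted xs" "set xs \<subseteq> {..c M}"
      "(\<Sum>j<M. \<bar>h (p j) - h (q j)\<bar>) \<le> vsum h xs" by auto
    let ?a = "min (p M) (q M)" and ?b = "max (p M) (q M)"
    have ab: "c M \<le> ?a" "?a \<le> ?b" "?b \<le> c (Suc M)" using p[of M] q[of M] Suc by auto
    have "vsum h (xs @ [?a, ?b]) = vsum h (xs @ [?a]) + \<bar>h ?b - h ?a\<bar>"
      using vsum_append[of h xs ?a "[?b]"] by simp
    moreover have "\<bar>h ?b - h ?a\<bar> = \<bar>h (p M) - h (q M)\<bar>" by (auto simp: min_def max_def)
    ultimately have "(\<Sum>j<Suc M. \<bar>h (p j) - h (q j)\<bar>) \<le> vsum h (xs @ [?a, ?b])"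
      using xs vsum_le_append[of h xs ?a] by simp
    moreover have "sorted (xs @ [?a, ?b])" using xs ab by (fastforce simp: sorted_append)
    moreover have "set (xs @ [?a, ?b]) \<subseteq> {..c (Suc M)}" using xs ab by force
    ultimately show ?case by blast
  qed
  from this[of N] obtain xs where "sorted xs" "(\<Sum>j<N. \<bar>h (p j) - h (q j)\<bar>) \<le> vsum h xs" by auto
  then show ?thesis using vsum_le_tv[OF b, of xs] by simp
qed

subsection \<open>Profiles\<close>

lemma lsc_open: "lsc h \<Longrightarrow> open {x. c < h x}"
proof -
  assume l: "lsc h"
  have "\<exists>e>0. ball x e \<subseteq> {x. c < h x}" if x: "c < h x" for x
  proof -
    have "\<forall>\<^sub>F y in at x. c < h y" using l x unfolding lsc_def by blast
    then obtain d where "d > 0" "\<And>y. y \<noteq> x \<Longrightarrow> dist y x < d \<Longrightarrow> c < h y"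
      unfolding eventually_at by auto
    then show ?thesis using x by (intro exI[of _ d]) (force simp: dist_commute)
  qed
  then show ?thesis unfolding open_contains_ball by auto
qed

lemma lscI: "(\<And>x c. c < h x \<Longrightarrow> \<exists>d>0. \<forall>y. \<bar>y - x\<bar> < d \<longrightarrow> c < h y) \<Longrightarrow> lsc h"
  unfolding lsc_def eventually_at dist_real_def by blast

lemma lscD:
  assumes "lsc h" "c < h x"
  shows "\<exists>d>0. \<forall>y. \<bar>y - x\<bar> < d \<longrightarrow> c < h y"
proof -
  obtain e where "e > 0" "ball x e \<subseteq> {x. c < h x}"
    using lsc_open[OF assms(1), of c] assms(2) unfolding open_contains_ball by blast
  then show ?thesis by (intro exI[of _ e]) (auto simp: subset_iff dist_real_def abs_minus_commute)
qed

lemma lsc_measurable: "lsc h \<Longrightarrow> h \<in> borel_measurable borel"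
  unfolding borel_measurable_iff_greater using lsc_open by (auto intro: borel_open)

text \<open>This is what remains of an admissible pair of finite energy once \<open>u\<close> is
  eliminated. The condition \<open>bdd_var\<close> speaks of pointwise values and implies
  \<open>BV\<close>.\<close>

definition profile :: "(real \<Rightarrow> real) \<Rightarrow> bool" where
  "profile h \<longleftrightarrow> lsc h \<and> (\<forall>x. 0 \<le> h x) \<and> integrable lborel h \<and> bdd_var h"

lemma profileD:
  assumes "profile h"
  shows "lsc h" "0 \<le> h x" "integrable lborel h" "bdd_var h" "h \<in> borel_measurable borel"
  using assms lsc_measurable unfolding profile_def by auto

lemma emeasure_Ici_infinite: "emeasure lborel {a::real..} = \<infinity>"
proof -
  have "ennreal (real n) \<le> emeasure lborel {a..}" for n
  proof -
    have "emeasure lborel {a..a + real n} \<le> emeasure lborel {a..}" by (rule emeasure_mono) auto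
    then show ?thesis by simp
  qed
  then show ?thesis
    by (metis ennreal_of_nat_eq_real_of_nat ennreal_Ex_less_of_nat linorder_not_less infinity_ennreal_def top.not_eq_extremum)
qed

text \<open>A lower bound \<open>e\<close> on a half-line would make the integral infinite. Points
  of this kind are cheap places to cut, and comparing with one of them bounds every value of
  \<open>h\<close> by its variation.\<close>

lemma profile_small_outside:
  assumes h: "profile h" and e: "0 < e"
  shows "\<exists>x\<ge>a. h x < e"
proof (rule ccontr)
  assume "\<not> ?thesis"
  then have g: "\<And>x. x \<ge> a \<Longrightarrow> e \<le> h x" by force
  have fin: "(\<integral>\<^sup>+x. ennreal (h x) \<partial>lborel) < \<infinity>"
    using profileD(2,3)[OF h] by (simp add: nn_integral_eq_integral)
  have "\<infinity> = ennreal e * emeasure lborel {a..}" using e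
    by (simp add: emeasure_Ici_infinite ennreal_mult_top)
  also have "\<dots> = (\<integral>\<^sup>+x. ennreal e * indicator {a..} x \<partial>lborel)"
    by (rule nn_integral_cmult_indicator[symmetric]) simp
  also have "\<dots> \<le> (\<integral>\<^sup>+x. ennreal (h x) \<partial>lborel)"
    by (rule nn_integral_mono) (auto simp: indicator_def intro!: ennreal_leI g)
  finally show False using fin by simp
qed

lemma profile_le_tv: assumes h: "profile h" shows "h x \<le> tv h"
proof (rule field_le_epsilon)
  fix e :: real assume "0 < e"
  then obtain y where y: "y \<ge> x" "h y < e" using profile_small_outside[OF h] by blast
  have "vsum h [x, y] \<le> tv h" by (rule vsum_le_tv) (use profileD[OF h] y in auto)
  then show "h x \<le> tv h + e" using y by simp
qed

subsection \<open>Splitting a profile at two points\<close>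

text \<open>Both cuts keep an open half-line: setting a nonnegative lower semicontinuous function to
  0 on a closed set preserves lower semicontinuity.\<close>

definition lcut :: "real \<Rightarrow> (real \<Rightarrow> real) \<Rightarrow> real \<Rightarrow> real" where
  "lcut a h x = (if x < a then h x else 0)"

definition rcut :: "real \<Rightarrow> (real \<Rightarrow> real) \<Rightarrow> real \<Rightarrow> real" where
  "rcut b h x = (if b < x then h x else 0)"

lemma vsum_cong: "(\<And>x. x \<in> set xs \<Longrightarrow> f x = g x) \<Longrightarrow> vsum f xs = vsum g xs"
  by (induction f xs rule: vsum.induct) auto

lemma vsum_zero: "(\<And>x. x \<in> set xs \<Longrightarrow> f x = 0) \<Longrightarrow> vsum f xs = 0"
  by (induction f xs rule: vsum.induct) auto

lemma sorted_filter_split: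
  "sorted (xs :: real list) \<Longrightarrow> (\<And>x y. x \<le> y \<Longrightarrow> P y \<Longrightarrow> P x) \<Longrightarrow>
    filter P xs @ filter (\<lambda>x. \<not> P x) xs = xs"
proof (induction xs)
  case (Cons x xs)
  show ?case
  proof (cases "P x")
    case False
    then have "\<forall>y\<in>set xs. \<not> P y" using Cons.prems by fastforce
    then have "filter P xs = []" "filter (\<lambda>x. \<not> P x) xs = xs" by (auto simp: filter_empty_conv filter_id_conv)
    then show ?thesis using False by simp
  qed (use Cons in auto)
qed simp

text \<open>The drop from the last value before \<open>a\<close> to 0 is at most the increment to
  \<open>h a\<close> plus \<open>h a\<close> itself, so a cut costs no more than the height at which
  it is made.\<close>

lemma vsum_lcut:
  assumes s: "sorted xs" and h: "0 \<le> h a"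
  shows "vsum (lcut a h) xs \<le> vsum h (filter (\<lambda>x. x < a) xs @ [a]) + h a"
proof -
  define ys where "ys = filter (\<lambda>x. x < a) xs"
  define zs where "zs = filter (\<lambda>x. \<not> x < a) xs"
  have xs: "xs = ys @ zs" unfolding ys_def zs_def
    by (rule sorted_filter_split[symmetric]) (use s in auto)
  have eq: "vsum (lcut a h) ys = vsum h ys" by (rule vsum_cong) (auto simp: ys_def lcut_def)
  have "vsum (lcut a h) xs \<le> vsum h (ys @ [a]) + h a"
  proof (cases zs)
    case Nil then show ?thesis using eq xs vsum_le_append[of h ys a] h by simp
  next
    case (Cons z ws)
    have z: "lcut a h z = 0" using Cons by (auto simp: zs_def lcut_def filter_eq_Cons_iff)
    have 0: "vsum (lcut a h) (z # ws) = 0" using Cons[symmetric]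
      by (intro vsum_zero) (auto simp: zs_def lcut_def)
    have "vsum (lcut a h) (ys @ [z]) \<le> vsum h (ys @ [a]) + h a"
    proof (cases ys rule: rev_cases)
      case Nil then show ?thesis using h by simp
    next
      case (snoc vs v)
      have v: "lcut a h v = h v" using snoc[symmetric] ys_def by (metis (mono_tags, lifting) lcut_def filter_set in_set_conv_decomp mem_Collect_eq set_filter)
      show ?thesis using vsum_append[of "lcut a h" vs v "[z]"] vsum_append[of h vs v "[a]"] eq snoc z v h by simp
    qed
    then show ?thesis using vsum_append[of "lcut a h" ys z ws] 0 xs Cons by simp
  qed
  then show ?thesis unfolding ys_def .
qed

lemma vsum_rcut:
  assumes s: "sorted xs" and h: "0 \<le> h b"
  shows "vsum (rcut b h) xs \<le> vsum h (b # filter (\<lambda>x. b < x) xs) + h b"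
proof -
  define zs where "zs = filter (\<lambda>x. b < x) xs"
  define ys where "ys = filter (\<lambda>x. \<not> b < x) xs"
  have xs: "xs = ys @ zs" unfolding ys_def zs_def
    using sorted_filter_split[of xs "\<lambda>x. \<not> b < x"] s by auto
  have eq: "vsum (rcut b h) zs = vsum h zs" by (rule vsum_cong) (auto simp: zs_def rcut_def)
  have 0: "vsum (rcut b h) ys = 0" by (intro vsum_zero) (auto simp: ys_def rcut_def)
  have "vsum (rcut b h) xs \<le> vsum h (b # zs) + h b"
  proof (cases ys rule: rev_cases)
    case Nil then show ?thesis using eq xs vsum_le_Cons[of h zs b] h by simp
  next
    case (snoc vs v)
    have v: "rcut b h v = 0" using snoc[symmetric] ys_def by (metis (mono_tags, lifting) rcut_def filter_set in_set_conv_decomp mem_Collect_eq set_filter)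
    have "vsum (rcut b h) (v # zs) \<le> vsum h (b # zs) + h b"
    proof (cases zs)
      case Nil then show ?thesis using h by simp
    next
      case (Cons z ws)
      have z: "rcut b h z = h z" using Cons by (auto simp: zs_def rcut_def filter_eq_Cons_iff)
      show ?thesis using Cons z v h eq by simp
    qed
    then show ?thesis using vsum_append[of "rcut b h" vs v zs] 0 xs snoc by simp
  qed
  then show ?thesis unfolding zs_def .
qed

lemma lsc_lcut: assumes "lsc h" "\<And>x. 0 \<le> h x" shows "lsc (lcut a h)"
proof (rule lscI)
  fix x c assume c: "c < lcut a h x"
  show "\<exists>d>0. \<forall>y. \<bar>y - x\<bar> < d \<longrightarrow> c < lcut a h y"
  proof (cases "x < a")
    case True
    then obtain d where d: "d > 0" "\<And>y. \<bar>y - x\<bar> < d \<Longrightarrow> c < h y"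
      using lscD[OF assms(1), of c x] c by (auto simp: lcut_def)
    show ?thesis using d True by (intro exI[of _ "min d (a - x)"]) (auto simp: lcut_def abs_if split: if_splits)
  next
    case False
    have "c < lcut a h y" for y using False c assms(2)[of y] by (auto simp: lcut_def)
    then show ?thesis by (intro exI[of _ 1]) auto
  qed
qed

lemma lsc_rcut: assumes "lsc h" "\<And>x. 0 \<le> h x" shows "lsc (rcut b h)"
proof (rule lscI)
  fix x c assume c: "c < rcut b h x"
  show "\<exists>d>0. \<forall>y. \<bar>y - x\<bar> < d \<longrightarrow> c < rcut b h y"
  proof (cases "b < x")
    case True
    then obtain d where d: "d > 0" "\<And>y. \<bar>y - x\<bar> < d \<Longrightarrow> c < h y"
      using lscD[OF assms(1), of c x] c by (auto simp: rcut_def)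
    show ?thesis using d True by (intro exI[of _ "min d (x - b)"]) (auto simp: rcut_def abs_if split: if_splits)
  next
    case False
    have "c < rcut b h y" for y using False c assms(2)[of y] by (auto simp: rcut_def)
    then show ?thesis by (intro exI[of _ 1]) auto
  qed
qed

text \<open>The points left of \<open>a\<close>, the inner list and the points right of
  \<open>b\<close>, joined through \<open>a\<close> and \<open>b\<close>, form one sorted list for
  \<open>h\<close>. The inner list is kept so that variation between the cuts is not lost.\<close>

lemma vsum_cuts:
  assumes h: "profile h" and ab: "a \<le> b" and i: "sorted is" "set is \<subseteq> {a..b}"
    and xs: "sorted xs" and ys: "sorted ys"
  shows "vsum (lcut a h) xs + vsum h is + vsum (rcut b h) ys \<le> tv h + h a + h b"
proof -
  let ?l = "filter (\<lambda>x. x < a) xs" and ?r = "filter (\<lambda>x. b < x) ys"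
  have "sorted (?l @ a # is @ b # ?r)"
    using ab i xs ys by (force simp: sorted_append intro: sorted_filter[of "\<lambda>x. x", simplified])
  then have "vsum h (?l @ a # is @ b # ?r) \<le> tv h" using profileD[OF h] vsum_le_tv by blast
  moreover have "vsum h (?l @ a # is @ b # ?r) = vsum h (?l @ [a]) + vsum h (a # is @ b # ?r)"
    by (rule vsum_append)
  moreover have "vsum h (a # is @ b # ?r) = vsum h (a # is @ [b]) + vsum h (b # ?r)"
    using vsum_append[of h "a # is" b ?r] by simp
  moreover have "vsum h is \<le> vsum h (a # is @ [b])"
    using vsum_le_append[of h "a # is" b] vsum_le_Cons[of h "is" a] by simp
  ultimately show ?thesis
    using vsum_lcut[OF xs, of h a] vsum_rcut[OF ys, of h b] profileD(2)[OF h] by fastforce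
qed

lemma tv_add_le:
  assumes "bdd_var f" "bdd_var g" "\<And>xs ys. sorted xs \<Longrightarrow> sorted ys \<Longrightarrow> vsum f xs + vsum g ys \<le> C"
  shows "tv f + tv g \<le> C"
proof -
  have "vsum g ys \<le> C - tv f" if "sorted ys" for ys
  proof -
    have "tv f \<le> C - vsum g ys" by (rule tv_le) (use assms(3) that in fastforce)
    then show ?thesis by simp
  qed
  then have "tv g \<le> C - tv f" by (rule tv_le)
  then show ?thesis by simp
qed

lemma profile_lcut: assumes h: "profile h" shows "profile (lcut a h)"
  unfolding profile_def
proof (intro conjI)
  have "integrable lborel (\<lambda>x. h x * indicator {..<a} x)"
    using profileD[OF h] by (intro integrable_real_mult_indicator) auto
  moreover have "lcut a h = (\<lambda>x. h x * indicator {..<a} x)" by (auto simp: lcut_def fun_eq_iff indicator_def)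
  ultimately show "integrable lborel (lcut a h)" by simp
  show "bdd_var (lcut a h)"
    by (rule bdd_varI[of _ "tv h + h a + h a"])
      (use vsum_cuts[OF h, of a a "[]" _ "[]"] in simp)
qed (use profileD[OF h] lsc_lcut in \<open>auto simp: lcut_def\<close>)

lemma profile_rcut: assumes h: "profile h" shows "profile (rcut b h)"
  unfolding profile_def
proof (intro conjI)
  have "integrable lborel (\<lambda>x. h x * indicator {b<..} x)"
    using profileD[OF h] by (intro integrable_real_mult_indicator) auto
  moreover have "rcut b h = (\<lambda>x. h x * indicator {b<..} x)" by (auto simp: rcut_def fun_eq_iff indicator_def)
  ultimately show "integrable lborel (rcut b h)" by simp
  show "bdd_var (rcut b h)"
    by (rule bdd_varI[of _ "tv h + h b + h b"])
      (use vsum_cuts[OF h, of b b "[]" "[]"] in simp)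
qed (use profileD[OF h] lsc_rcut in \<open>auto simp: rcut_def\<close>)

lemma tv_cuts:
  assumes h: "profile h" and ab: "a \<le> b" and i: "sorted is" "set is \<subseteq> {a..b}"
  shows "tv (lcut a h) + vsum h is + tv (rcut b h) \<le> tv h + h a + h b"
proof -
  have "tv (lcut a h) + tv (rcut b h) \<le> tv h + h a + h b - vsum h is"
    by (rule tv_add_le) (use vsum_cuts[OF h ab i] profile_lcut[OF h] profile_rcut[OF h] profileD in force)+
  then show ?thesis by simp
qed

section \<open>Riemann sums over cells and the L^1 size of translations\<close>

lemma nn_integral_cells:
  fixes f :: "real \<Rightarrow> ennreal"
  assumes [measurable]: "f \<in> borel_measurable borel" and d: "0 < d"
  shows "(\<integral>\<^sup>+x\<in>{A..<A + real N * d}. f x \<partial>lborel) = (\<integral>\<^sup>+s\<in>{0..<d}. (\<Sum>j<N. f (A + real j * d + s)) \<partial>lborel)"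
proof (induction N)
  case 0 then show ?case by simp
next
  case (Suc N)
  let ?B = "A + real N * d"
  have eq: "indicator {A..<A + real (Suc N) * d} x = (indicator {A..<?B} x + indicator {?B..<?B + d} x :: ennreal)" for x
    using d by (auto simp: indicator_def algebra_simps) (smt (verit) mult_nonneg_nonneg of_nat_0_le_iff)
  have "(\<integral>\<^sup>+x\<in>{A..<A + real (Suc N) * d}. f x \<partial>lborel) =
      (\<integral>\<^sup>+x. f x * indicator {A..<?B} x + f x * indicator {?B..<?B + d} x \<partial>lborel)"
    unfolding eq by (simp add: distrib_left)
  also have "\<dots> = (\<integral>\<^sup>+x\<in>{A..<?B}. f x \<partial>lborel) + (\<integral>\<^sup>+x\<in>{?B..<?B + d}. f x \<partial>lborel)"
    by (rule nn_integral_add) auto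
  also have "(\<integral>\<^sup>+x\<in>{?B..<?B + d}. f x \<partial>lborel) = (\<integral>\<^sup>+s\<in>{0..<d}. f (?B + s) \<partial>lborel)"
    by (subst nn_integral_real_affine[where c = 1 and t = ?B])
      (auto intro!: nn_integral_cong simp: indicator_def)
  also have "(\<integral>\<^sup>+x\<in>{A..<?B}. f x \<partial>lborel) + \<dots> =
      (\<integral>\<^sup>+s. (\<Sum>j<N. f (A + real j * d + s)) * indicator {0..<d} s + f (?B + s) * indicator {0..<d} s \<partial>lborel)"
    unfolding Suc by (rule nn_integral_add[symmetric]) auto
  finally show ?case by (simp add: distrib_right)
qed

text \<open>Moving each sample \<open>y j\<close> to the point of its cell with a fixed offset
  changes the sum by at most \<open>tv h\<close>, whatever the offset; integrating over all offsets
  produces the integral of \<open>h\<close>.\<close>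

lemma nn_integral_le_cells:
  assumes h: "profile h" and d: "0 < d"
    and y: "\<And>j. j < N \<Longrightarrow> A + real j * d \<le> y j \<and> y j \<le> A + real (Suc j) * d"
  shows "(\<integral>\<^sup>+x\<in>{A..<A + real N * d}. ennreal (h x) \<partial>lborel) \<le> ennreal (d * ((\<Sum>j<N. h (y j)) + tv h))"
proof -
  note [measurable] = profileD(5)[OF h]
  have "(\<Sum>j<N. ennreal (h (A + real j * d + s))) \<le> ennreal ((\<Sum>j<N. h (y j)) + tv h)" if s: "s \<in> {0..<d}" for s
  proof -
    have "(\<Sum>j<N. \<bar>h (A + real j * d + s) - h (y j)\<bar>) \<le> tv h"
      by (rule sum_pairs_le_tv[where c = "\<lambda>j. A + real j * d"])
        (use profileD[OF h] y s in \<open>auto simp: algebra_simps\<close>)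
    moreover have "(\<Sum>j<N. h (A + real j * d + s)) - (\<Sum>j<N. h (y j)) \<le> (\<Sum>j<N. \<bar>h (A + real j * d + s) - h (y j)\<bar>)"
      unfolding sum_subtractf[symmetric] by (rule sum_mono) simp
    moreover have "(\<Sum>j<N. ennreal (h (A + real j * d + s))) = ennreal (\<Sum>j<N. h (A + real j * d + s))"
      by (rule sum_ennreal) (use profileD[OF h] in auto)
    ultimately show ?thesis by (auto intro!: ennreal_leI)
  qed
  then have "(\<integral>\<^sup>+x\<in>{A..<A + real N * d}. ennreal (h x) \<partial>lborel)
      \<le> (\<integral>\<^sup>+s. ennreal ((\<Sum>j<N. h (y j)) + tv h) * indicator {0..<d} s \<partial>lborel)"
    by (subst nn_integral_cells[OF _ d]) (auto intro!: nn_integral_mono simp: indicator_def)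
  also have "\<dots> = ennreal ((\<Sum>j<N. h (y j)) + tv h) * ennreal d" using d
    by (subst nn_integral_cmult_indicator) auto
  also have "\<dots> = ennreal (d * ((\<Sum>j<N. h (y j)) + tv h))"
    using d profileD[OF h] tv_nonneg by (subst ennreal_mult[symmetric]) (auto intro!: sum_nonneg add_nonneg_nonneg simp: mult.commute)
  finally show ?thesis .
qed

text \<open>Folding the line into cells of length \<open>t\<close> turns the integrand, at each
  offset, into a sum of increments between consecutive points of a sorted list.\<close>

lemma nn_integral_shift_le_tv:
  assumes h: "profile h" and t: "0 < t"
  shows "(\<integral>\<^sup>+x. ennreal \<bar>h (x + t) - h x\<bar> \<partial>lborel) \<le> ennreal (t * tv h)"
proof -
  note [measurable] = profileD(5)[OF h]
  let ?I = "\<lambda>n. {- (real n * t)..<- (real n * t) + real (2 * n) * t}"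
  have b: "(\<integral>\<^sup>+x\<in>?I n. ennreal \<bar>h (x + t) - h x\<bar> \<partial>lborel) \<le> ennreal (t * tv h)" for n
  proof -
    let ?A = "- (real n * t)"
    have "(\<Sum>j<2 * n. ennreal \<bar>h (?A + real j * t + s + t) - h (?A + real j * t + s)\<bar>) \<le> ennreal (tv h)"
      if s: "s \<in> {0..<t}" for s
    proof -
      have "(\<Sum>j<2 * n. \<bar>h (?A + real j * t + s + t) - h (?A + real j * t + s)\<bar>) \<le> tv h"
        by (rule sum_pairs_le_tv[where c = "\<lambda>j. ?A + real j * t + s"])
          (use profileD[OF h] s t in \<open>auto simp: algebra_simps\<close>)
      then show ?thesis by (subst sum_ennreal) (auto intro!: ennreal_leI)
    qed
    then have "(\<integral>\<^sup>+x\<in>?I n. ennreal \<bar>h (x + t) - h x\<bar> \<partial>lborel)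
        \<le> (\<integral>\<^sup>+s. ennreal (tv h) * indicator {0..<t} s \<partial>lborel)"
      by (subst nn_integral_cells[OF _ t]) (auto intro!: nn_integral_mono simp: indicator_def)
    also have "\<dots> = ennreal (tv h) * ennreal t" using t by (subst nn_integral_cmult_indicator) auto
    also have "\<dots> = ennreal (t * tv h)" using t profileD[OF h] tv_nonneg
      by (subst ennreal_mult[symmetric]) (auto simp: mult.commute)
    finally show ?thesis .
  qed
  have lim: "(\<lambda>n. ennreal \<bar>h (x + t) - h x\<bar> * indicator (?I n) x) \<longlonglongrightarrow> ennreal \<bar>h (x + t) - h x\<bar>" for x
  proof (rule tendsto_eventually)
    obtain m :: nat where m: "\<bar>x\<bar> / t < real m" using reals_Archimedean2 by blast
    have "\<bar>x\<bar> < real n * t" if "n \<ge> m" for n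
    proof -
      have "\<bar>x\<bar> / t < real n" using m that by linarith
      then show ?thesis using t by (simp add: pos_divide_less_eq)
    qed
    then have "x \<in> ?I n" if "n \<ge> m" for n
      using that by (auto simp: algebra_simps) (smt (verit) that)+
    then show "\<forall>\<^sub>F n in sequentially. ennreal \<bar>h (x + t) - h x\<bar> * indicator (?I n) x = ennreal \<bar>h (x + t) - h x\<bar>"
      unfolding eventually_sequentially by (intro exI[of _ m]) simp
  qed
  have "(\<integral>\<^sup>+x. ennreal \<bar>h (x + t) - h x\<bar> \<partial>lborel) =
      (\<integral>\<^sup>+x. liminf (\<lambda>n. ennreal \<bar>h (x + t) - h x\<bar> * indicator (?I n) x) \<partial>lborel)"
    by (intro nn_integral_cong lim_imp_Liminf[OF _ lim, symmetric]) simp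
  also have "\<dots> \<le> liminf (\<lambda>n. \<integral>\<^sup>+x\<in>?I n. ennreal \<bar>h (x + t) - h x\<bar> \<partial>lborel)"
    by (rule nn_integral_liminf) auto
  also have "\<dots> \<le> ennreal (t * tv h)" using b
    by (intro Liminf_le) (auto simp: eventually_sequentially)
  finally show ?thesis .
qed

subsection \<open>Test functions\<close>

lemma test_function_zero:
  assumes t: "test_function \<Omega> \<phi> D" and x: "x \<notin> closure (support_on UNIV \<phi>)"
  shows "\<phi> x = 0" "D x = 0"
proof -
  let ?K = "closure (support_on UNIV \<phi>)"
  have z: "\<phi> y = 0" if "y \<notin> ?K" for y
    using that closure_subset[of "support_on UNIV \<phi>"] by (auto simp: support_on_def)
  show "\<phi> x = 0" using z x by blast
  have "(\<phi> has_derivative (\<lambda>h. h \<bullet> D x)) (at x)" using t unfolding test_function_def gderiv_def by blast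
  moreover have "(\<phi> has_derivative (\<lambda>h. 0)) (at x)"
    by (rule has_derivative_transform_within_open[of "\<lambda>_. 0" _ _ _ "- ?K"]) (use x z in auto)
  ultimately have "(\<lambda>h. h \<bullet> D x) = (\<lambda>h. 0)" by (rule has_derivative_unique)
  then show "D x = 0" by (metis inner_eq_zero_iff)
qed

lemma test_functionD:
  assumes "test_function \<Omega> \<phi> D"
  shows "GDERIV \<phi> x :> D x" "continuous_on UNIV D" "continuous_on UNIV \<phi>"
    "\<And>x. \<phi> x \<noteq> 0 \<or> D x \<noteq> 0 \<Longrightarrow> x \<in> \<Omega>"
    "D \<in> borel_measurable borel" "\<phi> \<in> borel_measurable borel"
proof -
  show 1: "GDERIV \<phi> x :> D x" for x using assms unfolding test_function_def by blast
  show "continuous_on UNIV D" using assms unfolding test_function_def by blast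
  then show "D \<in> borel_measurable borel" by (rule borel_measurable_continuous_onI)
  show "continuous_on UNIV \<phi>" using 1 unfolding gderiv_def
    by (metis continuous_at_imp_continuous_on has_derivative_continuous)
  then show "\<phi> \<in> borel_measurable borel" by (rule borel_measurable_continuous_onI)
  show "x \<in> \<Omega>" if "\<phi> x \<noteq> 0 \<or> D x \<noteq> 0" for x
    using test_function_zero[OF assms, of x] that assms unfolding test_function_def by blast
qed

lemma test_function_bounds:
  assumes t: "test_function \<Omega> \<phi> D"
  shows "\<exists>R>0. (\<forall>x. norm (\<phi> x) \<le> R) \<and> (\<forall>x. norm (D x) \<le> R) \<and> (\<forall>x. R < norm x \<longrightarrow> \<phi> x = 0 \<and> D x = 0)"
proof -
  let ?K = "closure (support_on UNIV \<phi>)"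
  have K: "compact ?K" using t unfolding test_function_def by blast
  obtain a where a: "\<And>x. x \<in> ?K \<Longrightarrow> norm x \<le> a" using compact_imp_bounded[OF K] bounded_iff by blast
  have "bounded (D ` ?K)" "bounded (\<phi> ` ?K)"
    by (auto intro!: compact_imp_bounded compact_continuous_image K intro: continuous_on_subset test_functionD[OF t])
  then obtain b c where b: "\<And>x. x \<in> ?K \<Longrightarrow> norm (D x) \<le> b" and c: "\<And>x. x \<in> ?K \<Longrightarrow> norm (\<phi> x) \<le> c"
    unfolding bounded_iff by blast
  show ?thesis
  proof (intro exI[of _ "max 1 (max a (max b c))"] conjI allI impI)
    fix x
    show "norm (\<phi> x) \<le> max 1 (max a (max b c))" "norm (D x) \<le> max 1 (max a (max b c))"
      using b[of x] c[of x] test_function_zero[OF t, of x] by (cases "x \<in> ?K"; force)+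
    assume "max 1 (max a (max b c)) < norm x"
    then have "x \<notin> ?K" using a by force
    then show "\<phi> x = 0" "D x = 0" using test_function_zero[OF t] by auto
  qed simp
qed

text \<open>In the difference quotient of \<open>\<phi>\<close> the translation can be moved to
  \<open>h\<close>, where a step of size s costs at most s times \<open>tv h\<close> in L^1. The
  quotients are bounded by the mean value theorem, so they may be replaced by \<open>D\<close> in
  the limit.\<close>

lemma profile_BV: assumes h: "profile h" shows "BV h"
  unfolding BV_def
proof (intro conjI exI[of _ "tv h"] allI impI)
  show int: "integrable lborel h" by (rule profileD[OF h])
  note [measurable] = profileD(5)[OF h]
  fix \<phi> D :: "real \<Rightarrow> real" assume t: "test_function UNIV \<phi> D" and 1: "\<forall>x. \<bar>\<phi> x\<bar> \<le> 1"
  note [measurable] = test_functionD(5,6)[OF t]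
  obtain R where R: "\<And>x. \<bar>D x\<bar> \<le> R" using test_function_bounds[OF t] by auto
  have der: "(\<phi> has_real_derivative D x) (at x)" for x
    using test_functionD(1)[OF t, of x] by (simp add: gderiv_def has_field_derivative_def mult_commute_abs)
  define s where "s n = inverse (real (Suc n))" for n
  have s: "s n > 0" for n by (simp add: s_def)
  have s0: "s \<longlonglongrightarrow> 0" unfolding s_def by (rule LIMSEQ_inverse_real_of_nat)
  define q where "q n x = h x * ((\<phi> (x + s n) - \<phi> x) / s n)" for n x
  have lip: "\<bar>\<phi> (x + s n) - \<phi> x\<bar> / s n \<le> R" for x n
  proof -
    have "\<exists>z. z > x \<and> z < x + s n \<and> \<phi> (x + s n) - \<phi> x = (x + s n - x) * D z"
      by (rule MVT2) (use s der in auto)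
    then obtain z where "\<phi> (x + s n) - \<phi> x = s n * D z" by auto
    then show ?thesis using R[of z] s[of n] by (simp add: abs_mult)
  qed
  have "(\<lambda>n. LBINT x. q n x) \<longlonglongrightarrow> (LBINT x. h x * D x)"
  proof (rule integral_dominated_convergence[where w = "\<lambda>x. R * h x"])
    show "AE x in lborel. (\<lambda>n. q n x) \<longlonglongrightarrow> h x * D x"
    proof (rule AE_I2)
      fix x
      have "(\<lambda>n. (\<phi> (x + s n) - \<phi> x) / s n) \<longlonglongrightarrow> D x"
        using der[of x] unfolding DERIV_def
        by (rule filterlim_compose) (use s s0 in \<open>auto simp: filterlim_at less_imp_neq[THEN not_sym]\<close>)
      then show "(\<lambda>n. q n x) \<longlonglongrightarrow> h x * D x" unfolding q_def by (rule tendsto_mult_left)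
    qed
    show "AE x in lborel. norm (q n x) \<le> R * h x" for n
    proof (rule AE_I2)
      fix x
      have "\<bar>h x\<bar> * (\<bar>\<phi> (x + s n) - \<phi> x\<bar> / s n) \<le> \<bar>h x\<bar> * R" by (rule mult_left_mono[OF lip]) simp
      then show "norm (q n x) \<le> R * h x" using profileD(2)[OF h, of x] s[of n]
        by (simp add: q_def abs_mult mult.commute)
    qed
  qed (use int in \<open>auto simp: q_def\<close>)
  moreover have "(LBINT x. q n x) \<le> tv h" for n
  proof -
    have i1: "integrable lborel (\<lambda>x. h x * \<phi> x)"
      by (rule Bochner_Integration.integrable_bound[OF int]) (use 1 in \<open>auto simp: abs_mult mult_left_le\<close>)
    have i2: "integrable lborel (\<lambda>x. h (x + s n) * \<phi> (x + s n))"
      using lborel_integrable_real_affine[OF i1, of 1 "s n"] by (simp add: add.commute)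
    have i3: "integrable lborel (\<lambda>x. h x * \<phi> (x + s n))"
      by (rule Bochner_Integration.integrable_bound[OF int]) (use 1 in \<open>auto simp: abs_mult mult_left_le\<close>)
    have i4: "integrable lborel (\<lambda>x. h (x + s n))"
      using lborel_integrable_real_affine[OF int, of 1 "s n"] by (simp add: add.commute)
    have "(LBINT x. h x * \<phi> x) = (LBINT x. h (x + s n) * \<phi> (x + s n))"
      using lborel_integral_real_affine[of 1 "\<lambda>x. h x * \<phi> x" "s n"] by (simp add: add.commute)
    then have "(LBINT x. h x * \<phi> (x + s n)) - (LBINT x. h x * \<phi> x) =
        (LBINT x. (h x - h (x + s n)) * \<phi> (x + s n))"
      using i2 i3 by (simp add: left_diff_distrib)
    also have "\<dots> \<le> (LBINT x. \<bar>h (x + s n) - h x\<bar>)"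
    proof (rule integral_mono)
      show "integrable lborel (\<lambda>x. (h x - h (x + s n)) * \<phi> (x + s n))"
        using i2 i3 by (simp add: left_diff_distrib)
      show "integrable lborel (\<lambda>x. \<bar>h (x + s n) - h x\<bar>)" using i4 int by simp
      fix x
      have "\<bar>h x - h (x + s n)\<bar> * \<bar>\<phi> (x + s n)\<bar> \<le> \<bar>h x - h (x + s n)\<bar> * 1"
        by (rule mult_left_mono) (use 1 in auto)
      then show "(h x - h (x + s n)) * \<phi> (x + s n) \<le> \<bar>h (x + s n) - h x\<bar>"
        by (simp add: abs_minus_commute abs_mult[symmetric] abs_le_iff)
    qed
    also have "\<dots> \<le> s n * tv h"
    proof -
      have "ennreal (LBINT x. \<bar>h (x + s n) - h x\<bar>) = (\<integral>\<^sup>+x. ennreal \<bar>h (x + s n) - h x\<bar> \<partial>lborel)"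
        by (rule nn_integral_eq_integral[symmetric]) (use i4 int in auto)
      then show ?thesis using nn_integral_shift_le_tv[OF h s, of n] s[of n] tv_nonneg[OF profileD(4)[OF h]]
        by (metis ennreal_le_iff mult_nonneg_nonneg order_less_imp_le)
    qed
    finally have "((LBINT x. h x * \<phi> (x + s n)) - (LBINT x. h x * \<phi> x)) / s n \<le> tv h"
      using s[of n] by (simp add: pos_divide_le_eq mult.commute)
    moreover have "(LBINT x. q n x) = ((LBINT x. h x * \<phi> (x + s n)) - (LBINT x. h x * \<phi> x)) / s n"
      using i1 i3 by (simp add: q_def right_diff_distrib diff_divide_distrib)
    ultimately show ?thesis by simp
  qed
  ultimately show "(LBINT x. h x * D x) \<le> tv h"
    by (intro LIMSEQ_le_const2) auto
qed

subsection \<open>Gamma limits of profiles\<close>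

text \<open>Gamma convergence on the line in neighbourhood form: lower bounds hold uniformly near
  \<open>x\<close>, and values close to \<open>g x\<close> are attained arbitrarily near
  \<open>x\<close>.\<close>

definition gamma_lim :: "(nat \<Rightarrow> real \<Rightarrow> real) \<Rightarrow> (real \<Rightarrow> real) \<Rightarrow> bool" where
  "gamma_lim h g \<longleftrightarrow>
     (\<forall>x c. c < g x \<longrightarrow> (\<exists>d>0. \<forall>\<^sub>F n in sequentially. \<forall>y. \<bar>y - x\<bar> < d \<longrightarrow> c < h n y)) \<and>
     (\<forall>x e d. 0 < e \<longrightarrow> 0 < d \<longrightarrow> (\<forall>\<^sub>F n in sequentially. \<exists>y. \<bar>y - x\<bar> < d \<and> h n y < g x + e))"

text \<open>Infima over intervals with rational end points form a bounded sequence in a countable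
  product, so a subsequence converges for all of them at once. The limit at \<open>x\<close> is the
  supremum over the intervals around \<open>x\<close>.\<close>

lemma gamma_compactness:
  fixes h :: "nat \<Rightarrow> real \<Rightarrow> real"
  assumes h: "\<And>n x. 0 \<le> h n x" "\<And>n x. h n x \<le> C"
  shows "\<exists>r g. strict_mono r \<and> gamma_lim (h \<circ> r) g"
proof -
  have C: "0 \<le> C" using h[of 0 0] by linarith
  \<comment> \<open>The value 0 for degenerate intervals keeps every coordinate in
    \<open>{0..C}\<close>.\<close>
  define L where "L n = (\<lambda>(p::rat, q::rat). if p < q then INF x\<in>{real_of_rat p<..<real_of_rat q}. h n x else 0)" for n
  have ne: "{real_of_rat p<..<real_of_rat q} \<noteq> {}" if "p < q" for p q
    using that of_rat_less[of p q] by (auto simp del: of_rat_less simp: not_le)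
  have L01: "L n i \<in> {0..C}" for n i
  proof (cases i)
    case (Pair p q)
    show ?thesis
    proof (cases "p < q")
      case True
      obtain x where x: "x \<in> {real_of_rat p<..<real_of_rat q}" using ne[OF True] by blast
      have "(INF x\<in>{real_of_rat p<..<real_of_rat q}. h n x) \<le> h n x"
        by (rule cINF_lower) (use h x in \<open>auto intro!: bdd_belowI2[of _ 0]\<close>)
      moreover have "0 \<le> (INF x\<in>{real_of_rat p<..<real_of_rat q}. h n x)"
        by (rule cINF_greatest) (use h ne[OF True] in auto)
      ultimately show ?thesis using True Pair h(2)[of n x] by (simp add: L_def)
    qed (use Pair C in \<open>simp add: L_def\<close>)
  qed
  have "compactin (product_topology (\<lambda>i. euclidean) UNIV) (\<Pi>\<^sub>E i\<in>(UNIV :: (rat \<times> rat) set). {0..C})"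
    by (subst compactin_PiE) (simp add: compactin_euclidean_iff)
  then have "compact (\<Pi>\<^sub>E i\<in>(UNIV :: (rat \<times> rat) set). {0..C})"
    by (simp add: euclidean_product_topology compactin_euclidean_iff)
  \<comment> \<open>Compactness yields subsequences here because a product over a countable index
    type is first countable.\<close>
  then have "seq_compact (\<Pi>\<^sub>E i\<in>(UNIV :: (rat \<times> rat) set). {0..C})" by (rule compact_imp_seq_compact)
  moreover have "\<forall>n. L n \<in> (\<Pi>\<^sub>E i\<in>UNIV. {0..C})" using L01 by auto
  ultimately obtain l r where l: "l \<in> (\<Pi>\<^sub>E i\<in>(UNIV :: (rat \<times> rat) set). {0..C})"
    and r: "strict_mono r" and lim: "(L \<circ> r) \<longlonglongrightarrow> l" by (rule seq_compactE)
  have limi: "(\<lambda>n. L (r n) i) \<longlonglongrightarrow> l i" for i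
  proof -
    have "continuous_on UNIV (\<lambda>f::rat \<times> rat \<Rightarrow> real. f i)" by (rule continuous_on_product_coordinates)
    then have "isCont (\<lambda>f::rat \<times> rat \<Rightarrow> real. f i) l" using continuous_on_eq_continuous_at open_UNIV by blast
    from isCont_tendsto_compose[OF this lim] show ?thesis by (simp add: o_def)
  qed
  define S where "S x = {(p, q). real_of_rat p < x \<and> x < real_of_rat q}" for x
  define g where "g x = (SUP i\<in>S x. l i)" for x
  have Sne: "S x \<noteq> {}" for x
    using of_rat_dense[of "x - 1" x] of_rat_dense[of x "x + 1"] unfolding S_def by fastforce
  have bdd: "bdd_above (l ` S x)" for x
    by (rule bdd_aboveI2[of _ _ C]) (use l in \<open>auto simp: PiE_iff\<close>)
  have "gamma_lim (h \<circ> r) g" unfolding gamma_lim_def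
  proof (intro conjI allI impI)
    fix x c assume "c < g x"
    then obtain p q where pq: "(p, q) \<in> S x" "c < l (p, q)"
      unfolding g_def less_cSUP_iff[OF Sne bdd] by auto
    let ?p = "real_of_rat p" and ?q = "real_of_rat q"
    have x: "?p < x" "x < ?q" using pq by (auto simp: S_def)
    then have "p < q" using of_rat_less less_trans by blast
    have ev: "\<forall>\<^sub>F n in sequentially. c < L (r n) (p, q)" using limi pq(2) by (rule order_tendstoD)
    show "\<exists>d>0. \<forall>\<^sub>F n in sequentially. \<forall>y. \<bar>y - x\<bar> < d \<longrightarrow> c < (h \<circ> r) n y"
    proof (intro exI[of _ "min (x - ?p) (?q - x)"] conjI)
      show "\<forall>\<^sub>F n in sequentially. \<forall>y. \<bar>y - x\<bar> < min (x - ?p) (?q - x) \<longrightarrow> c < (h \<circ> r) n y"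
        using ev
      proof eventually_elim
        case (elim n)
        show ?case
        proof (intro allI impI)
          fix y assume "\<bar>y - x\<bar> < min (x - ?p) (?q - x)"
          then have "y \<in> {?p<..<?q}" by auto
          then have "L (r n) (p, q) \<le> h (r n) y" unfolding L_def using \<open>p < q\<close>
            by (auto intro!: cINF_lower bdd_belowI2[of _ 0] h)
          then show "c < (h \<circ> r) n y" using elim by simp
        qed
      qed
    qed (use x in auto)
  next
    fix x e d :: real assume e: "0 < e" and d: "0 < d"
    obtain p where p: "x - d < real_of_rat p" "real_of_rat p < x" using of_rat_dense[of "x - d" x] d by auto
    obtain q where q: "x < real_of_rat q" "real_of_rat q < x + d" using of_rat_dense[of x "x + d"] d by auto
    have pq: "p < q" using p q of_rat_less less_trans by blast
    have "l (p, q) \<le> g x" unfolding g_def by (rule cSUP_upper[OF _ bdd]) (use p q in \<open>simp add: S_def\<close>)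
    then have "l (p, q) < g x + e" using e by simp
    then have "\<forall>\<^sub>F n in sequentially. L (r n) (p, q) < g x + e" using limi order_tendstoD(2) by blast
    then show "\<forall>\<^sub>F n in sequentially. \<exists>y. \<bar>y - x\<bar> < d \<and> (h \<circ> r) n y < g x + e"
    proof eventually_elim
      case (elim n)
      then have "(INF y\<in>{real_of_rat p<..<real_of_rat q}. h (r n) y) < g x + e" using pq by (simp add: L_def)
      then obtain y where "y \<in> {real_of_rat p<..<real_of_rat q}" "h (r n) y < g x + e"
        by (subst (asm) cINF_less_iff) (use ne[OF pq] h in \<open>auto intro!: bdd_belowI2[of _ 0]\<close>)
      then show ?case using p q by (intro exI[of _ y]) auto
    qed
  qed
  then show ?thesis using r by blast
qed

lemma gamma_lim_lower: "gamma_lim h g \<Longrightarrow> c < g x \<Longrightarrow> \<exists>d>0. \<forall>\<^sub>F n in sequentially. \<forall>y. \<bar>y - x\<bar> < d \<longrightarrow> c < h n y"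
  unfolding gamma_lim_def by blast

lemma gamma_lim_upper: "gamma_lim h g \<Longrightarrow> 0 < e \<Longrightarrow> 0 < d \<Longrightarrow> \<forall>\<^sub>F n in sequentially. \<exists>y. \<bar>y - x\<bar> < d \<and> h n y < g x + e"
  unfolding gamma_lim_def by blast

lemma gamma_lim_recovery:
  assumes g: "gamma_lim h g" and e: "0 < e" and d: "0 < d"
  shows "\<forall>\<^sub>F n in sequentially. \<exists>y. \<bar>y - x\<bar> < d \<and> \<bar>h n y - g x\<bar> < e"
proof -
  obtain d' where d': "d' > 0" "\<forall>\<^sub>F n in sequentially. \<forall>y. \<bar>y - x\<bar> < d' \<longrightarrow> g x - e < h n y"
    using gamma_lim_lower[OF g, of "g x - e" x] e by auto
  have "\<forall>\<^sub>F n in sequentially. \<exists>y. \<bar>y - x\<bar> < min d d' \<and> h n y < g x + e"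
    using gamma_lim_upper[OF g e, of "min d d'" x] d d' by auto
  with d'(2) show ?thesis
  proof eventually_elim
    case (elim n)
    then obtain y where "\<bar>y - x\<bar> < min d d'" "h n y < g x + e" by blast
    then show ?case using elim by (intro exI[of _ y]) force
  qed
qed

lemma gamma_lim_nonneg:
  assumes g: "gamma_lim h g" and h: "\<And>n x. 0 \<le> h n x"
  shows "0 \<le> g x"
proof (rule field_le_epsilon)
  fix e :: real assume "0 < e"
  then obtain n y where "h n y < g x + e"
    using eventually_happens[OF gamma_lim_upper[OF g, of e 1 x]] by auto
  then show "0 \<le> g x + e" using h[of n y] by simp
qed

text \<open>A value of \<open>g\<close> below \<open>c'\<close> near \<open>x\<close> would be
  almost attained by \<open>h n\<close> inside the neighbourhood where \<open>h n\<close> exceeds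
  \<open>c'\<close>.\<close>

lemma gamma_lim_lsc: assumes g: "gamma_lim h g" shows "lsc g"
proof (rule lscI)
  fix x c assume "c < g x"
  then obtain c' where c': "c < c'" "c' < g x" using dense by blast
  obtain d where d: "d > 0" "\<forall>\<^sub>F n in sequentially. \<forall>y. \<bar>y - x\<bar> < d \<longrightarrow> c' < h n y"
    using gamma_lim_lower[OF g c'(2)] by blast
  show "\<exists>d>0. \<forall>y. \<bar>y - x\<bar> < d \<longrightarrow> c < g y"
  proof (intro exI[of _ d] conjI allI impI)
    fix y assume y: "\<bar>y - x\<bar> < d"
    have "\<not> g y < c'"
    proof
      assume "g y < c'"
      then have "\<forall>\<^sub>F n in sequentially. \<exists>z. \<bar>z - y\<bar> < d - \<bar>y - x\<bar> \<and> h n z < g y + (c' - g y)"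
        using gamma_lim_upper[OF g, of "c' - g y" "d - \<bar>y - x\<bar>" y] y by auto
      with d(2) have "\<forall>\<^sub>F n::nat in sequentially. False" 
      proof eventually_elim
        case (elim n)
        then obtain z where z: "\<bar>z - y\<bar> < d - \<bar>y - x\<bar>" "h n z < c'" by auto
        then have "\<bar>z - x\<bar> < d" by linarith
        then show False using elim z by force
      qed
      then show False by simp
    qed
    then show "c < g y" using c' by simp
  qed (use d in simp)
qed

text \<open>Each point of \<open>K\<close> has a box over which \<open>h n\<close> stays above the
  box, and finitely many boxes cover \<open>K\<close>. This is what lets a test function of the
  limit act on the sequence.\<close>

lemma gamma_lim_subgraph:
  assumes g: "gamma_lim h g" and K: "compact K" "K \<subseteq> subgraph g"
  shows "\<forall>\<^sub>F n in sequentially. K \<subseteq> subgraph (h n)"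
proof -
  have "\<exists>U. open U \<and> z \<in> U \<and> (\<forall>\<^sub>F n in sequentially. \<forall>w\<in>U. 0 < snd w \<longrightarrow> w \<in> subgraph (h n))"
    if "z \<in> K" for z
  proof -
    obtain x y where z: "z = (x, y)" by force
    then have "y < g x" using that K by (auto simp: subgraph_def)
    then obtain c where c: "y < c" "c < g x" using dense by blast
    obtain d where d: "d > 0" "\<forall>\<^sub>F n in sequentially. \<forall>y. \<bar>y - x\<bar> < d \<longrightarrow> c < h n y"
      using gamma_lim_lower[OF g c(2)] by blast
    show ?thesis
    proof (intro exI[of _ "{x - d<..<x + d} \<times> {..<c}"] conjI)
      show "\<forall>\<^sub>F n in sequentially. \<forall>w\<in>{x - d<..<x + d} \<times> {..<c}. 0 < snd w \<longrightarrow> w \<in> subgraph (h n)"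
        using d(2)
      proof eventually_elim
        case (elim n)
        show ?case
        proof (clarsimp simp: subgraph_def)
          fix a b assume *: "x - d < a" "a < x + d" "b < c"
          then have "\<bar>a - x\<bar> < d" by linarith
          then show "b < h n a" using elim * by force
        qed
      qed
      show "open ({x - d<..<x + d} \<times> {..<c})" by (intro open_Times) auto
    qed (use z c d in auto)
  qed
  then have "\<forall>z\<in>K. \<exists>U. open U \<and> z \<in> U \<and> (\<forall>\<^sub>F n in sequentially. \<forall>w\<in>U. 0 < snd w \<longrightarrow> w \<in> subgraph (h n))"
    by blast
  from bchoice[OF this] obtain U where "\<forall>z\<in>K. open (U z) \<and> z \<in> U z \<and>
      (\<forall>\<^sub>F n in sequentially. \<forall>w\<in>U z. 0 < snd w \<longrightarrow> w \<in> subgraph (h n))" by (rule exE)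
  then have U: "\<And>z. z \<in> K \<Longrightarrow> open (U z)" "\<And>z. z \<in> K \<Longrightarrow> z \<in> U z"
    "\<And>z. z \<in> K \<Longrightarrow> \<forall>\<^sub>F n in sequentially. \<forall>w\<in>U z. 0 < snd w \<longrightarrow> w \<in> subgraph (h n)" by auto
  obtain T where T: "T \<subseteq> K" "finite T" "K \<subseteq> (\<Union>z\<in>T. U z)"
    by (rule compactE_image[OF K(1), of K U]) (use U(1,2) in auto)
  have "\<forall>\<^sub>F n in sequentially. \<forall>z\<in>T. \<forall>w\<in>U z. 0 < snd w \<longrightarrow> w \<in> subgraph (h n)"
    using U(3) T(1) by (intro eventually_ball_finite[OF T(2)]) blast
  then show ?thesis
  proof eventually_elim
    case (elim n)
    show ?case
    proof
      fix w assume w: "w \<in> K"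
      then obtain z where "z \<in> T" "w \<in> U z" using T(3) by blast
      moreover have "0 < snd w" using w K(2) by (auto simp: subgraph_def)
      ultimately show "w \<in> subgraph (h n)" using elim by blast
    qed
  qed
qed

text \<open>The margin \<open>2 * d\<close> preserves the order when every point moves by less than
  \<open>d\<close>.\<close>

lemma strict_sorted_gap: "sorted_wrt (<) xs \<Longrightarrow> \<exists>d>0. sorted_wrt (\<lambda>x y. x + 2 * d \<le> (y::real)) xs"
proof (induction xs)
  case (Cons x xs)
  then obtain d where d: "d > 0" "sorted_wrt (\<lambda>x y. x + 2 * d \<le> y) xs" by auto
  have "\<exists>d'>0. \<forall>y\<in>set xs. x + 2 * d' \<le> y"
  proof (cases "xs = []")
    case False
    then have "Min (set xs) \<in> set xs" by simp
    moreover have "\<forall>y\<in>set xs. Min (set xs) \<le> y" by simp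
    ultimately show ?thesis using Cons.prems
      by (intro exI[of _ "(Min (set xs) - x) / 2"]) (auto simp: field_simps)
  qed (auto intro: exI[of _ 1])
  then obtain d' where d': "d' > 0" "\<forall>y\<in>set xs. x + 2 * d' \<le> y" by blast
  show ?case
  proof (intro exI[of _ "min d d'"] conjI)
    have "sorted_wrt (\<lambda>x y. x + 2 * min d d' \<le> y) xs"
      by (rule sorted_wrt_mono_rel[OF _ d(2)]) auto
    then show "sorted_wrt (\<lambda>x y. x + 2 * min d d' \<le> y) (x # xs)" using d' by auto
  qed (use d d' in simp)
qed (auto intro: exI[of _ 1])

lemma gamma_lim_recovery_list:
  assumes g: "gamma_lim h g" and e: "0 < e" and d: "0 < d"
  shows "\<forall>\<^sub>F n in sequentially. \<exists>ys. list_all2 (\<lambda>x y. \<bar>y - x\<bar> < d \<and> \<bar>h n y - g x\<bar> < e) xs ys"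
proof (induction xs)
  case Nil then show ?case by (auto intro: always_eventually)
next
  case (Cons x xs)
  show ?case using Cons gamma_lim_recovery[OF g e d, of x]
  proof eventually_elim
    case (elim n)
    then obtain y ys where "\<bar>y - x\<bar> < d \<and> \<bar>h n y - g x\<bar> < e"
      "list_all2 (\<lambda>x y. \<bar>y - x\<bar> < d \<and> \<bar>h n y - g x\<bar> < e) xs ys" by blast
    then show ?case by (intro exI[of _ "y # ys"]) simp
  qed
qed

text \<open>Each point enters at most two increments, so an error \<open>e\<close> in every value
  costs at most \<open>2 * e\<close> per point.\<close>

lemma list_all2_vsum:
  "list_all2 (\<lambda>x y. \<bar>f y - g x\<bar> < e) xs ys \<Longrightarrow> vsum g xs - 2 * e * length xs \<le> vsum f ys"
proof (induction g xs arbitrary: ys rule: vsum.induct)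
  case (1 h) then show ?case by simp
next
  case (2 h x)
  then obtain y where "ys = [y]" "\<bar>f y - h x\<bar> < e" by (auto simp: list_all2_Cons1)
  then show ?case by simp
next
  case (3 h x1 x2 xs)
  then obtain y1 y2 zs where ys: "ys = y1 # y2 # zs" by (auto simp: list_all2_Cons1)
  have "vsum h (x2 # xs) - 2 * e * length (x2 # xs) \<le> vsum f (y2 # zs)"
    by (rule 3(1)) (use 3 ys in simp)
  moreover have "\<bar>f y1 - h x1\<bar> < e" "\<bar>f y2 - h x2\<bar> < e" using 3 ys by auto
  ultimately show ?case using ys by (simp add: algebra_simps)
qed

text \<open>Recovery points keep their order if they move by less than half the smallest gap. Their
  distance to \<open>xs\<close> is recorded because they must later fit between two cuts.\<close>

lemma gamma_lim_vsum:
  assumes g: "gamma_lim h g" and xs: "sorted xs" and e: "0 < e" and d: "0 < d"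
  shows "\<forall>\<^sub>F n in sequentially. \<exists>ys. sorted ys \<and> (\<forall>y\<in>set ys. \<exists>x\<in>set xs. \<bar>y - x\<bar> < d) \<and> vsum g xs - e \<le> vsum (h n) ys"
proof -
  \<comment> \<open>Without repetitions all gaps are positive.\<close>
  define ws where "ws = remdups_adj xs"
  have ws: "sorted_wrt (<) ws" using distinct_remdups_adj_sorted[OF xs] by (simp add: ws_def)
  obtain d' where d': "d' > 0" "sorted_wrt (\<lambda>x y. x + 2 * d' \<le> y) ws" using strict_sorted_gap[OF ws] by blast
  \<comment> \<open>Chosen for the total error \<open>2 * e' * length ws\<close>; the
    \<open>+ 1\<close> covers the empty list.\<close>
  define e' where "e' = e / (2 * (length ws + 1))"
  have e': "0 < e'" using e by (simp add: e'_def)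
  have le: "2 * e' * length ws \<le> e" using e by (simp add: e'_def field_simps)
  have "\<forall>\<^sub>F n in sequentially. \<exists>ys. list_all2 (\<lambda>x y. \<bar>y - x\<bar> < min d d' \<and> \<bar>h n y - g x\<bar> < e') ws ys"
    by (rule gamma_lim_recovery_list[OF g e']) (use d d' in simp)
  then show ?thesis
  proof eventually_elim
    case (elim n)
    then obtain ys where ys: "list_all2 (\<lambda>x y. \<bar>y - x\<bar> < min d d' \<and> \<bar>h n y - g x\<bar> < e') ws ys" by blast
    have "vsum g ws - 2 * e' * length ws \<le> vsum (h n) ys"
      by (rule list_all2_vsum) (use ys in \<open>auto elim: list_all2_mono\<close>)
    then have "vsum g xs - e \<le> vsum (h n) ys" using le by (simp add: ws_def vsum_remdups_adj)
    moreover have "\<forall>y\<in>set ys. \<exists>x\<in>set xs. \<bar>y - x\<bar> < d"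
    proof
      fix y assume "y \<in> set ys"
      then obtain i where i: "i < length ys" "y = ys ! i" by (auto simp: in_set_conv_nth)
      then have "\<bar>y - ws ! i\<bar> < d" "i < length ws" using ys by (auto simp: list_all2_conv_all_nth)
      then show "\<exists>x\<in>set xs. \<bar>y - x\<bar> < d" using nth_mem[of i ws] by (auto simp: ws_def)
    qed
    moreover have "sorted ys" unfolding sorted_iff_nth_mono_less
    proof (intro allI impI)
      fix i j assume ij: "i < j" "j < length ys"
      have len: "length ws = length ys" using ys by (simp add: list_all2_conv_all_nth)
      have "ws ! i + 2 * d' \<le> ws ! j" using d'(2) ij len by (auto simp: sorted_wrt_iff_nth_less)
      moreover have "\<bar>ys ! i - ws ! i\<bar> < d'" "\<bar>ys ! j - ws ! j\<bar> < d'"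
        using ys ij len by (auto simp: list_all2_conv_all_nth)
      ultimately show "ys ! i \<le> ys ! j" by linarith
    qed
    ultimately show ?case by blast
  qed
qed

text \<open>The lower half of the convergence puts \<open>g\<close> below the pointwise lower
  limit.\<close>

lemma gamma_lim_fatou:
  assumes g: "gamma_lim h g" and h: "\<And>n. profile (h n)"
  shows "(\<integral>\<^sup>+x. ennreal (g x) \<partial>lborel) \<le> liminf (\<lambda>n. \<integral>\<^sup>+x. ennreal (h n x) \<partial>lborel)"
proof -
  have g0: "0 \<le> g x" for x using gamma_lim_nonneg[OF g] profileD(2)[OF h] by blast
  have "ennreal (g x) \<le> liminf (\<lambda>n. ennreal (h n x))" for x
    unfolding le_Liminf_iff
  proof (intro allI impI)
    fix c assume c: "c < ennreal (g x)"
    then obtain r where r: "c = ennreal r" "0 \<le> r" by (cases c) auto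
    then have "r < g x" using c g0 by (simp add: ennreal_less_iff)
    then obtain d where "d > 0" "\<forall>\<^sub>F n in sequentially. \<forall>y. \<bar>y - x\<bar> < d \<longrightarrow> r < h n y"
      using gamma_lim_lower[OF g] by blast
    then show "\<forall>\<^sub>F n in sequentially. c < ennreal (h n x)"
      by (elim eventually_mono) (use r profileD(2)[OF h] in \<open>auto simp: ennreal_less_iff\<close>)
  qed
  then have "(\<integral>\<^sup>+x. ennreal (g x) \<partial>lborel) \<le> (\<integral>\<^sup>+x. liminf (\<lambda>n. ennreal (h n x)) \<partial>lborel)"
    by (intro nn_integral_mono) auto
  also have "\<dots> \<le> liminf (\<lambda>n. \<integral>\<^sup>+x. ennreal (h n x) \<partial>lborel)"
    by (rule nn_integral_liminf) (use profileD(5)[OF h] in measurable)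
  finally show ?thesis .
qed

lemma gamma_lim_profile:
  assumes g: "gamma_lim h g" and h: "\<And>n. profile (h n)" and C: "\<And>n. tv (h n) \<le> C"
    and V: "\<And>n. (LBINT x. h n x) \<le> V"
  shows "profile g" "(LBINT x. g x) \<le> V"
proof -
  have g0: "0 \<le> g x" for x using gamma_lim_nonneg[OF g] profileD(2)[OF h] by blast
  have V0: "0 \<le> V" using V[of 0] Bochner_Integration.integral_nonneg[of lborel "h 0"] profileD(2)[OF h, of 0] by fastforce
  note [measurable] = lsc_measurable[OF gamma_lim_lsc[OF g]]
  have "(\<integral>\<^sup>+x. ennreal (h n x) \<partial>lborel) \<le> ennreal V" for n
    using profileD(2,3)[OF h] V by (subst nn_integral_eq_integral) (auto intro: ennreal_leI)
  then have "liminf (\<lambda>n. \<integral>\<^sup>+x. ennreal (h n x) \<partial>lborel) \<le> ennreal V"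
    by (intro Liminf_le) auto
  then have le: "(\<integral>\<^sup>+x. ennreal (g x) \<partial>lborel) \<le> ennreal V" using gamma_lim_fatou[OF g h] by simp
  then have int: "integrable lborel g"
    by (intro integrableI_nonneg) (auto simp: g0 le_less_trans)
  have "bdd_var g"
  proof (rule bdd_varI)
    fix xs :: "real list" assume xs: "sorted xs"
    obtain n ys where "sorted ys" "vsum g xs - 1 \<le> vsum (h n) ys"
      using eventually_happens[OF gamma_lim_vsum[OF g xs, of 1 1]] by auto
    then show "vsum g xs \<le> C + 1" using vsum_le_tv[OF profileD(4)[OF h], of ys n] C[of n] by simp
  qed
  then show "profile g" using int g0 gamma_lim_lsc[OF g] unfolding profile_def by blast
  show "(LBINT x. g x) \<le> V" using le int g0 V0 by (subst (asm) nn_integral_eq_integral) auto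
qed

text \<open>The converse of Fatou on a bounded interval. The variation bound excludes oscillations
  on the scale of the mesh: up to mesh times \<open>C\<close>, the integral of \<open>h n\<close> is
  a Riemann sum at recovery points, whose values stay close to a lower sum of
  \<open>g\<close>.\<close>

lemma gamma_lim_interval:
  assumes g: "gamma_lim h g" and h: "\<And>n. profile (h n)" and C: "\<And>n. tv (h n) \<le> C"
    and AB: "A < B" and e: "0 < e"
  shows "\<forall>\<^sub>F n in sequentially. (\<integral>\<^sup>+x\<in>{A..<B}. ennreal (h n x) \<partial>lborel)
    \<le> (\<integral>\<^sup>+x\<in>{A..<B}. ennreal (g x) \<partial>lborel) + ennreal e"
proof -
  have g0: "0 \<le> g x" for x using gamma_lim_nonneg[OF g] profileD(2)[OF h] by blast
  note [measurable] = lsc_measurable[OF gamma_lim_lsc[OF g]]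
  have C0: "0 \<le> C" using C[of 0] tv_nonneg[OF profileD(4)[OF h], of 0] by simp
  \<comment> \<open>Makes mesh times variation bound at most \<open>e / 2\<close>.\<close>
  obtain N :: nat where N: "2 * (B - A) * C / e < real N" using reals_Archimedean2 by blast
  then have N0: "0 < N" using AB C0 e by (cases N) (auto simp: divide_less_0_iff mult_less_0_iff)
  define d where "d = (B - A) / real N"
  have d: "0 < d" using AB N0 by (simp add: d_def)
  have Nd: "A + real N * d = B" using N0 by (simp add: d_def)
  have dC: "d * C \<le> e / 2" using N N0 e by (simp add: d_def field_simps)
  \<comment> \<open>It enters twice, for almost minimal points of \<open>g\<close> and for recovery,
    and each use costs \<open>e / 4\<close> over the whole interval.\<close>
  define e' where "e' = e / (4 * (B - A))"
  have e': "0 < e'" using e AB by (simp add: e'_def)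
  let ?I = "\<lambda>j::nat. {A + real j * d<..<A + real (Suc j) * d}"
  have "\<exists>z\<in>?I j. \<forall>x\<in>?I j. g z \<le> g x + e'" for j
  proof -
    have ne: "?I j \<noteq> {}" using d by (simp add: algebra_simps)
    have bb: "bdd_below (g ` ?I j)" by (rule bdd_belowI2[of _ 0]) (rule g0)
    have "(INF x\<in>?I j. g x) < (INF x\<in>?I j. g x) + e'" using e' by simp
    then obtain z where z: "z \<in> ?I j" "g z < (INF x\<in>?I j. g x) + e'"
      unfolding cINF_less_iff[OF ne bb] by blast
    have "(INF x\<in>?I j. g x) \<le> g x" if "x \<in> ?I j" for x by (rule cINF_lower[OF bb that])
    then show ?thesis using z by (intro bexI[of _ z]) force+
  qed
  then obtain z where z: "\<And>j. z j \<in> ?I j" "\<And>j x. x \<in> ?I j \<Longrightarrow> g (z j) \<le> g x + e'" by metis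
  have "ennreal (d * (\<Sum>j<N. g (z j))) \<le> (\<integral>\<^sup>+x\<in>{A..<B}. ennreal (g x) \<partial>lborel) + ennreal (d * real N * e')"
  proof -
    have "ennreal (d * (\<Sum>j<N. g (z j))) = (\<integral>\<^sup>+s. ennreal (\<Sum>j<N. g (z j)) * indicator {0<..<d} s \<partial>lborel)"
      using d by (subst nn_integral_cmult_indicator) (auto simp: ennreal_mult'' sum_nonneg g0 mult.commute)
    also have "\<dots> \<le> (\<integral>\<^sup>+s. (\<Sum>j<N. ennreal (g (A + real j * d + s))) * indicator {0..<d} s
        + ennreal (real N * e') * indicator {0..<d} s \<partial>lborel)"
    proof (rule nn_integral_mono)
      fix s :: real
      show "ennreal (\<Sum>j<N. g (z j)) * indicator {0<..<d} s \<le>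
        (\<Sum>j<N. ennreal (g (A + real j * d + s))) * indicator {0..<d} s + ennreal (real N * e') * indicator {0..<d} s"
      proof (cases "s \<in> {0<..<d}")
        case True
        have "(\<Sum>j<N. g (z j)) \<le> (\<Sum>j<N. g (A + real j * d + s) + e')"
          by (rule sum_mono, rule z) (use True in \<open>auto simp: algebra_simps\<close>)
        also have "\<dots> = (\<Sum>j<N. g (A + real j * d + s)) + real N * e'" by (simp add: sum.distrib)
        finally have "ennreal (\<Sum>j<N. g (z j)) \<le> ennreal ((\<Sum>j<N. g (A + real j * d + s)) + real N * e')"
          by (rule ennreal_leI)
        also have "\<dots> = (\<Sum>j<N. ennreal (g (A + real j * d + s))) + ennreal (real N * e')"
          using g0 e' by (simp add: sum_nonneg)
        finally show ?thesis using True by simp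
      qed simp
    qed
    also have "\<dots> = (\<integral>\<^sup>+s\<in>{0..<d}. (\<Sum>j<N. ennreal (g (A + real j * d + s))) \<partial>lborel)
        + (\<integral>\<^sup>+s. ennreal (real N * e') * indicator {0..<d} s \<partial>lborel)"
      by (rule nn_integral_add) auto
    also have "(\<integral>\<^sup>+s\<in>{0..<d}. (\<Sum>j<N. ennreal (g (A + real j * d + s))) \<partial>lborel) = (\<integral>\<^sup>+x\<in>{A..<B}. ennreal (g x) \<partial>lborel)"
      using nn_integral_cells[of "\<lambda>x. ennreal (g x)" d A N] d Nd by simp
    also have "(\<integral>\<^sup>+s. ennreal (real N * e') * indicator {0..<d} s \<partial>lborel) = ennreal (d * real N * e')"
      using d e' by (subst nn_integral_cmult_indicator) (auto simp: ennreal_mult[symmetric] mult_ac)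
    finally show ?thesis .
  qed
  moreover have dN: "d * real N * e' = e / 4" using AB N0 by (simp add: d_def e'_def divide_simps)
  moreover have "\<forall>\<^sub>F n in sequentially. \<forall>j\<in>{..<N}. \<exists>y\<in>?I j. h n y < g (z j) + e'"
  proof (intro eventually_ball_finite ballI)
    fix j
    let ?r = "min (z j - (A + real j * d)) (A + real (Suc j) * d - z j)"
    have "0 < ?r" using z(1)[of j] by auto
    from gamma_lim_upper[OF g e' this, of "z j"]
    show "\<forall>\<^sub>F n in sequentially. \<exists>y\<in>?I j. h n y < g (z j) + e'"
    proof eventually_elim
      case (elim n)
      then obtain y where "\<bar>y - z j\<bar> < ?r" "h n y < g (z j) + e'" by blast
      then show ?case by (intro bexI[of _ y]) auto
    qed
  qed simp
  then show ?thesis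
  proof eventually_elim
    case (elim n)
    then obtain y where y: "\<And>j. j < N \<Longrightarrow> y j \<in> ?I j \<and> h n (y j) < g (z j) + e'" by (metis lessThan_iff)
    have "(\<integral>\<^sup>+x\<in>{A..<B}. ennreal (h n x) \<partial>lborel) \<le> ennreal (d * ((\<Sum>j<N. h n (y j)) + tv (h n)))"
      using nn_integral_le_cells[OF h d, of N A y n] y Nd by (auto simp: less_imp_le)
    also have "\<dots> \<le> ennreal (d * (\<Sum>j<N. g (z j)) + (d * real N * e' + d * C))"
    proof (rule ennreal_leI)
      have "(\<Sum>j<N. h n (y j)) \<le> (\<Sum>j<N. g (z j) + e')" by (rule sum_mono) (use y in force)
      then have "d * ((\<Sum>j<N. h n (y j)) + tv (h n)) \<le> d * ((\<Sum>j<N. g (z j)) + real N * e' + C)"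
        using d C[of n] by (intro mult_left_mono) (auto simp: sum.distrib)
      then show "d * ((\<Sum>j<N. h n (y j)) + tv (h n)) \<le> d * (\<Sum>j<N. g (z j)) + (d * real N * e' + d * C)"
        by (simp add: algebra_simps)
    qed
    also have "\<dots> = ennreal (d * (\<Sum>j<N. g (z j))) + ennreal (d * real N * e' + d * C)"
      using d g0 e' C0 by (intro ennreal_plus) (auto intro!: mult_nonneg_nonneg sum_nonneg add_nonneg_nonneg)
    also have "\<dots> \<le> (\<integral>\<^sup>+x\<in>{A..<B}. ennreal (g x) \<partial>lborel) + ennreal (d * real N * e') + ennreal (d * real N * e' + d * C)"
      using calculation(1) \<open>ennreal (d * (\<Sum>j<N. g (z j))) \<le> _\<close> by (intro add_right_mono) auto
    also have "\<dots> = (\<integral>\<^sup>+x\<in>{A..<B}. ennreal (g x) \<partial>lborel) + ennreal (d * real N * e' + (d * real N * e' + d * C))"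
      using d e' C0 by (subst add.assoc, subst ennreal_plus[symmetric]) auto
    also have "\<dots> \<le> (\<integral>\<^sup>+x\<in>{A..<B}. ennreal (g x) \<partial>lborel) + ennreal e"
      using dN dC by (intro add_left_mono ennreal_leI) linarith
    finally show ?case .
  qed
qed

section \<open>Bounded support and operations on test functions\<close>

lemma integrable_bounded_support:
  fixes f :: "'a::euclidean_space \<Rightarrow> real"
  assumes [measurable]: "f \<in> borel_measurable borel"
    and b: "\<And>x. \<bar>f x\<bar> \<le> B" and s: "\<And>x. R < norm x \<Longrightarrow> f x = 0"
  shows "integrable lborel f"
proof (rule Bochner_Integration.integrable_bound)
  show "integrable lborel (\<lambda>x::'a. B * indicator (cball 0 R) x)"
    using emeasure_bounded_finite[of "cball (0::'a) R"] by auto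
  show "AE x in lborel. norm (f x) \<le> norm (B * indicator (cball 0 R) x)"
  proof (rule AE_I2)
    fix x show "norm (f x) \<le> norm (B * indicator (cball 0 R) x)"
      using b[of x] s[of x] by (cases "norm x \<le> R") auto
  qed
qed simp

lemma borel_measurable_fst_snd[measurable]:
  "fst \<in> borel_measurable (borel :: ('a::topological_space \<times> 'b::topological_space) measure)"
  "snd \<in> borel_measurable (borel :: ('a::topological_space \<times> 'b::topological_space) measure)"
  by (intro borel_measurable_continuous_onI continuous_intros)+

lemma test_function_mono: "test_function A \<phi> D \<Longrightarrow> A \<subseteq> B \<Longrightarrow> test_function B \<phi> D"
  unfolding test_function_def by blast

lemma test_functionI:
  assumes "\<And>x. GDERIV \<phi> x :> D x" "continuous_on UNIV D" "compact K" "K \<subseteq> \<Omega>" "\<And>x. x \<notin> K \<Longrightarrow> \<phi> x = 0"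
  shows "test_function \<Omega> \<phi> D"
proof -
  have "closure (support_on UNIV \<phi>) \<subseteq> K"
    by (rule closure_minimal) (use assms in \<open>auto simp: support_on_def compact_imp_closed\<close>)
  moreover from this have "compact (closure (support_on UNIV \<phi>))"
    using assms(3) compact_Int_closed[of K "closure (support_on UNIV \<phi>)"] by (simp add: Int_absorb1)
  ultimately show ?thesis using assms unfolding test_function_def by blast
qed

lemma test_function_compact:
  assumes "test_function \<Omega> \<phi> D"
  shows "\<exists>K. compact K \<and> K \<subseteq> \<Omega> \<and> (\<forall>x. x \<notin> K \<longrightarrow> \<phi> x = 0 \<and> D x = 0)"
  using assms test_function_zero[OF assms] unfolding test_function_def by blast

text \<open>The set enters the definition through the support alone, so a test function can change
  its domain, in particular from the limit subgraph to those of the sequence.\<close>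

lemma test_function_restrict:
  assumes t: "test_function \<Omega> \<phi> D" and K: "compact K" "K \<subseteq> \<Omega>'" "\<And>x. x \<notin> K \<Longrightarrow> \<phi> x = 0"
  shows "test_function \<Omega>' \<phi> D"
  using t K by (intro test_functionI[of _ _ K]) (auto simp: test_function_def)

lemma test_function_lin:
  assumes f: "test_function \<Omega> f Df" and g: "test_function \<Omega> g Dg"
  shows "test_function \<Omega> (\<lambda>x. a * f x + b * g x) (\<lambda>x. a *\<^sub>R Df x + b *\<^sub>R Dg x)"
proof -
  obtain K where K: "compact K" "K \<subseteq> \<Omega>" "\<And>x. x \<notin> K \<Longrightarrow> f x = 0" using test_function_compact[OF f] by blast
  obtain L where L: "compact L" "L \<subseteq> \<Omega>" "\<And>x. x \<notin> L \<Longrightarrow> g x = 0" using test_function_compact[OF g] by blast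
  show ?thesis
  proof (rule test_functionI[of _ _ "K \<union> L"])
    fix x
    show "GDERIV (\<lambda>x. a * f x + b * g x) x :> a *\<^sub>R Df x + b *\<^sub>R Dg x"
      using test_functionD(1)[OF f, of x] test_functionD(1)[OF g, of x] unfolding gderiv_def
      by (auto intro!: derivative_eq_intros simp: inner_add_right)
  qed (use K L in \<open>auto intro!: continuous_intros test_functionD(2)[OF f] test_functionD(2)[OF g]\<close>)
qed

lemma test_function_null: "test_function \<Omega> (\<lambda>_. 0) (\<lambda>_. 0)"
  by (rule test_functionI[of _ _ "{}"]) (auto simp: gderiv_def)

text \<open>The two factors are separate because three cases occur: equal factors for rescaling
  profiles, a vertical one for blowing up the layer at the bottom edge, and a horizontal one for
  contractions of a rectangle.\<close>

definition dilate :: "real \<times> real \<Rightarrow> real \<Rightarrow> real \<Rightarrow> real \<times> real \<Rightarrow> real \<times> real" where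
  "dilate c l m z = (fst c + l * fst z, snd c + m * snd z)"

lemma test_function_dilate:
  assumes t: "test_function \<Omega> \<phi> D" and l: "l \<noteq> 0" "m \<noteq> 0"
    and sub: "\<And>z. dilate c l m z \<in> \<Omega> \<Longrightarrow> z \<in> \<Omega>'"
  shows "test_function \<Omega>' (\<lambda>z. \<phi> (dilate c l m z)) (\<lambda>z. (l * fst (D (dilate c l m z)), m * snd (D (dilate c l m z))))"
proof -
  obtain K where K: "compact K" "K \<subseteq> \<Omega>" "\<And>x. x \<notin> K \<Longrightarrow> \<phi> x = 0" using test_function_compact[OF t] by blast
  define S where "S z = ((fst z - fst c) / l, (snd z - snd c) / m)" for z :: "real \<times> real"
  have ST: "S (dilate c l m z) = z" "dilate c l m (S z) = z" for z
    using l by (auto simp: S_def dilate_def)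
  have "continuous_on K S" unfolding S_def using l by (intro continuous_intros) auto
  show ?thesis
  proof (rule test_functionI[of _ _ "S ` K"])
    show "compact (S ` K)" using \<open>continuous_on K S\<close> K(1) by (rule compact_continuous_image)
    show "S ` K \<subseteq> \<Omega>'" using K(2) ST(2) by (auto intro!: sub)
    show "\<phi> (dilate c l m z) = 0" if "z \<notin> S ` K" for z using K(3) that ST by (metis image_eqI)
    show "continuous_on UNIV (\<lambda>z. (l * fst (D (dilate c l m z)), m * snd (D (dilate c l m z))))"
      by (intro continuous_intros continuous_on_compose2[OF test_functionD(2)[OF t]])
        (auto simp: dilate_def intro!: continuous_intros)
    fix z
    have d: "(dilate c l m has_derivative (\<lambda>h. (l * fst h, m * snd h))) (at z)"
      unfolding dilate_def[abs_def] by (auto intro!: derivative_eq_intros)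
    have "(\<phi> has_derivative (\<lambda>h. h \<bullet> D (dilate c l m z))) (at (dilate c l m z))"
      using test_functionD(1)[OF t] unfolding gderiv_def by blast
    from has_derivative_compose[OF d this]
    show "GDERIV (\<lambda>z. \<phi> (dilate c l m z)) z :> (l * fst (D (dilate c l m z)), m * snd (D (dilate c l m z)))"
      unfolding gderiv_def by (simp add: inner_prod_def mult_ac)
  qed
qed

subsection \<open>The dual functional\<close>

text \<open>If \<open>D\<close> is the gradient of \<open>\<phi>\<close>, then \<open>- tail D\<close> has vertical derivative \<open>\<partial>\<^sub>x \<phi>\<close> in the upper
  half plane. For \<open>u (x, y) = x + (\<integral>\<^sub>0\<^sup>y G\<^sub>2 (x, s) ds)\<close>, Fubini turns the
  weak equation \<open>\<partial>\<^sub>x u = G\<^sub>1\<close> into \<open>\<integral> (\<phi> G\<^sub>1 + tail D G\<^sub>2) = \<integral> \<phi>\<close>, so \<open>dual_energy\<close> is the minimal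
  Dirichlet energy.\<close>

definition tail :: "(real \<times> real \<Rightarrow> real \<times> real) \<Rightarrow> real \<times> real \<Rightarrow> real" where
  "tail D z = (if 0 < snd z then LBINT t. indicator {snd z<..} t * fst (D (fst z, t)) else 0)"

text \<open>If a field G pairs with (\<open>\<phi>\<close>, \<open>tail D\<close>) to the integral
  of \<open>\<phi>\<close>, then expanding the squared norm of their difference shows that this
  functional is at most the squared norm of G, with equality when the pair equals G.\<close>

definition dual_functional :: "(real \<times> real \<Rightarrow> real) \<Rightarrow> (real \<times> real \<Rightarrow> real \<times> real) \<Rightarrow> real" where
  "dual_functional \<phi> D = 2 * (LBINT z. \<phi> z) - (LBINT z. (\<phi> z)\<^sup>2) - (LBINT z. (tail D z)\<^sup>2)"

definition dual_energy :: "(real \<Rightarrow> real) \<Rightarrow> real" where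
  "dual_energy h = (SUP (\<phi>, D)\<in>{(\<phi>, D). test_function (subgraph h) \<phi> D}. dual_functional \<phi> D)"

lemma tail_measurable[measurable]:
  assumes [measurable]: "D \<in> borel_measurable borel"
  shows "tail D \<in> borel_measurable borel"
proof -
  have "(\<lambda>z. fst (D z)) \<in> borel_measurable borel"
    by (rule measurable_compose[OF assms]) (intro borel_measurable_continuous_onI continuous_intros)
  then have [measurable]: "(\<lambda>z. fst (D z)) \<in> borel_measurable (borel \<Otimes>\<^sub>M borel)" unfolding borel_prod .
  have [measurable]: "(\<lambda>z::real \<times> real. LBINT t. indicator {snd z<..} t * fst (D (fst z, t))) \<in> borel_measurable borel"
    unfolding indicator_def greaterThan_iff by measurable
  show ?thesis unfolding tail_def[abs_def] by measurable
qed

lemma slice_integrable: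
  fixes D :: "real \<times> real \<Rightarrow> real \<times> real"
  assumes t: "test_function \<Omega> \<phi> D"
  shows "integrable lborel (\<lambda>t. indicator {s<..} t * fst (D (x, t)))"
proof -
  obtain R where R: "\<And>z. norm (D z) \<le> R" "\<And>z. R < norm z \<Longrightarrow> D z = 0" using test_function_bounds[OF t] by blast
  have "(\<lambda>z. fst (D z)) \<in> borel_measurable borel"
    by (rule measurable_compose[OF test_functionD(5)[OF t]]) (intro borel_measurable_continuous_onI continuous_intros)
  then have [measurable]: "(\<lambda>z. fst (D z)) \<in> borel_measurable (borel \<Otimes>\<^sub>M borel)" unfolding borel_prod .
  show ?thesis
  proof (rule integrable_bounded_support[of _ R R])
    fix t
    have "\<bar>fst (D (x, t))\<bar> \<le> R" using R(1)[of "(x, t)"] norm_fst_le[of "fst (D (x,t))" "snd (D (x,t))"] by simp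
    then show "\<bar>indicator {s<..} t * fst (D (x, t))\<bar> \<le> R" by (auto simp: indicator_def intro: order_trans[OF abs_ge_zero])
    assume "R < norm t"
    then have "R < norm (x, t)" using norm_snd_le[of t x] by simp
    then show "indicator {s<..} t * fst (D (x, t)) = 0" using R(2) by simp
  qed measurable
qed

lemma tail_bounds:
  assumes t: "test_function \<Omega> \<phi> D"
  shows "\<exists>B R. (\<forall>z. \<bar>tail D z\<bar> \<le> B) \<and> (\<forall>z. R < norm z \<longrightarrow> tail D z = 0)"
proof -
  obtain R where R: "R > 0" "\<And>z. norm (D z) \<le> R" "\<And>z. R < norm z \<Longrightarrow> D z = 0" using test_function_bounds[OF t] by blast
  have f: "\<bar>fst (D z)\<bar> \<le> R" for z using R(2)[of z] norm_fst_le[of "fst (D z)" "snd (D z)"] by simp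
  have z: "fst (D (x, t)) = 0" if "R < \<bar>x\<bar> \<or> R < \<bar>t\<bar>" for x t
  proof -
    have "R < norm (x, t)" using that norm_snd_le[of t x] norm_fst_le[of x t] by auto
    then show ?thesis using R(3) by simp
  qed
  show ?thesis
  proof (intro exI conjI allI impI)
    fix z :: "real \<times> real"
    have "\<bar>LBINT t. indicator {snd z<..} t * fst (D (fst z, t))\<bar> \<le> (LBINT t. \<bar>indicator {snd z<..} t * fst (D (fst z, t))\<bar>)"
      by (rule integral_abs_bound)
    also have "\<dots> \<le> (LBINT t. R * indicator {-R..R} t)"
    proof (rule integral_mono)
      show "integrable lborel (\<lambda>t. \<bar>indicator {snd z<..} t * fst (D (fst z, t))\<bar>)"
        using slice_integrable[OF t] by (rule integrable_abs)
      fix s show "\<bar>indicator {snd z<..} s * fst (D (fst z, s))\<bar> \<le> R * indicator {-R..R} s"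
      proof (cases "s \<in> {-R..R}")
        case True
        then show ?thesis using f[of "(fst z, s)"] R(1) by (auto simp: indicator_def)
      next
        case False
        then have "R < \<bar>s\<bar>" by auto
        then show ?thesis using z[of "fst z" s] R(1) by simp
      qed
      show "integrable lborel (\<lambda>t. R * indicator {-R..R} t)"
        using R(1) by (intro integrable_mult_right integrable_real_indicator) (auto simp: less_top[symmetric])
    qed
    also have "\<dots> = R * (2 * R)" using R(1) by simp
    finally show "\<bar>tail D z\<bar> \<le> R * (2 * R)" using R(1) by (simp add: tail_def)
  next
    fix z :: "real \<times> real" assume n: "2 * R < norm z"
    show "tail D z = 0"
    proof (cases "0 < snd z")
      case True
      have "norm z \<le> \<bar>fst z\<bar> + \<bar>snd z\<bar>" using norm_Pair_le[of "fst z" "snd z"] by simp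
      then have "R < \<bar>fst z\<bar> \<or> R < snd z" using n True by linarith
      have "(LBINT t. indicator {snd z<..} t * fst (D (fst z, t))) = (LBINT t::real. 0)"
        by (rule Bochner_Integration.integral_cong) (use \<open>R < \<bar>fst z\<bar> \<or> R < snd z\<close> in \<open>auto simp: indicator_def intro!: z\<close>)
      then show ?thesis by (simp add: tail_def)
    qed (simp add: tail_def)
  qed
qed

lemma tail_nonzero:
  assumes "tail D z \<noteq> 0"
  shows "0 < snd z \<and> (\<exists>t>snd z. D (fst z, t) \<noteq> 0)"
proof (rule ccontr)
  assume n: "\<not> ?thesis"
  have "(LBINT t. indicator {snd z<..} t * fst (D (fst z, t))) = (LBINT t::real. 0)" if "0 < snd z"
    by (rule Bochner_Integration.integral_cong) (use n that in \<open>auto simp: indicator_def\<close>)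
  then show False using assms by (auto simp: tail_def split: if_splits)
qed

text \<open>Vertical sections of the subgraph are intervals starting at the axis, so integrating
  \<open>D\<close> from above does not leave it.\<close>

lemma tail_subgraph:
  assumes t: "test_function (subgraph h) \<phi> D" and z: "tail D z \<noteq> 0"
  shows "z \<in> subgraph h"
proof -
  obtain s where "0 < snd z" "snd z < s" "(fst z, s) \<in> subgraph h"
    using tail_nonzero[OF z] test_functionD(4)[OF t] by blast
  then show ?thesis by (cases z) (auto simp: subgraph_def)
qed

lemma tail_lin:
  assumes f: "test_function \<Omega> f Df" and g: "test_function \<Omega>' g Dg"
  shows "tail (\<lambda>x. a *\<^sub>R Df x + b *\<^sub>R Dg x) z = a * tail Df z + b * tail Dg z"
proof -
  have "(LBINT t. indicator {snd z<..} t * (a * fst (Df (fst z, t)) + b * fst (Dg (fst z, t)))) =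
     (LBINT t. a * (indicator {snd z<..} t * fst (Df (fst z, t))) + b * (indicator {snd z<..} t * fst (Dg (fst z, t))))"
    by (simp add: algebra_simps)
  also have "\<dots> = a * (LBINT t. indicator {snd z<..} t * fst (Df (fst z, t)))
      + b * (LBINT t. indicator {snd z<..} t * fst (Dg (fst z, t)))"
    using slice_integrable[OF f] slice_integrable[OF g] by simp
  finally show ?thesis by (simp add: tail_def)
qed

lemma test_integrable:
  assumes t: "test_function \<Omega> \<phi> D" and p: "test_function \<Omega>' \<psi> E"
  shows "integrable lborel \<phi>" "integrable lborel (\<lambda>z. \<phi> z * \<psi> z)"
proof -
  obtain R where R: "\<And>z. \<bar>\<phi> z\<bar> \<le> R" "\<And>z. R < norm z \<Longrightarrow> \<phi> z = 0" using test_function_bounds[OF t] by auto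
  obtain S where S: "\<And>z. \<bar>\<psi> z\<bar> \<le> S" using test_function_bounds[OF p] by auto
  note [measurable] = test_functionD(5,6)[OF t] test_functionD(5,6)[OF p]
  have R0: "0 \<le> R" using R(1) abs_ge_zero order_trans by blast
  show "integrable lborel \<phi>" by (rule integrable_bounded_support[OF _ R]) auto
  show "integrable lborel (\<lambda>z. \<phi> z * \<psi> z)"
    by (rule integrable_bounded_support[of _ "R * S" R]) (use R S R0 in \<open>auto simp: abs_mult intro!: mult_mono\<close>)
qed

lemma tail_integrable:
  assumes t: "test_function \<Omega> \<phi> D" and p: "test_function \<Omega>' \<psi> E"
  shows "integrable lborel (\<lambda>z. tail D z * tail E z)"
proof -
  obtain B R where R: "\<And>z. \<bar>tail D z\<bar> \<le> B" "\<And>z. R < norm z \<Longrightarrow> tail D z = 0" using tail_bounds[OF t] by blast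
  obtain C S where S: "\<And>z. \<bar>tail E z\<bar> \<le> C" using tail_bounds[OF p] by blast
  note [measurable] = test_functionD(5,6)[OF t] test_functionD(5,6)[OF p]
  have R0: "0 \<le> B" using R(1) abs_ge_zero order_trans by blast
  show "integrable lborel (\<lambda>z. tail D z * tail E z)"
    by (rule integrable_bounded_support[of _ "B * C" R]) (use R S R0 in \<open>auto simp: abs_mult intro!: mult_mono\<close>)
qed

lemma square_integrable:
  assumes t: "test_function \<Omega> \<phi> D"
  shows "integrable lborel (\<lambda>z. (\<phi> z)\<^sup>2)"
  using test_integrable(2)[OF t t] by (simp add: power2_eq_square)

lemma tail_square_integrable:
  assumes t: "test_function \<Omega> \<phi> D"
  shows "integrable lborel (\<lambda>z. (tail D z)\<^sup>2)"
  using tail_integrable[OF t t] by (simp add: power2_eq_square)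

lemma dual_functional_null: "dual_functional (\<lambda>_. 0) (\<lambda>_. 0) = 0"
  by (simp add: dual_functional_def tail_def fst_zero cong: if_cong)

lemma dual_functional_lin:
  assumes f: "test_function \<Omega> f Df" and g: "test_function \<Omega>' g Dg"
  shows "dual_functional (\<lambda>x. a * f x + b * g x) (\<lambda>x. a *\<^sub>R Df x + b *\<^sub>R Dg x) =
    2 * (a * (LBINT z. f z) + b * (LBINT z. g z))
    - (a\<^sup>2 * ((LBINT z. (f z)\<^sup>2) + (LBINT z. (tail Df z)\<^sup>2)) + 2 * a * b * ((LBINT z. f z * g z) + (LBINT z. tail Df z * tail Dg z))
      + b\<^sup>2 * ((LBINT z. (g z)\<^sup>2) + (LBINT z. (tail Dg z)\<^sup>2)))"
proof -
  note i = test_integrable[OF f g] test_integrable[OF g f] tail_integrable[OF f g] tail_integrable[OF g f]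
    square_integrable[OF f] square_integrable[OF g] tail_square_integrable[OF f] tail_square_integrable[OF g]
  have *: "(LBINT z. (a * u z + b * v z)\<^sup>2) = a\<^sup>2 * (LBINT z. (u z)\<^sup>2) + 2 * a * b * (LBINT z. u z * v z) + b\<^sup>2 * (LBINT z. (v z)\<^sup>2)"
    if "integrable lborel (\<lambda>z. (u z)\<^sup>2)" "integrable lborel (\<lambda>z. (v z)\<^sup>2)" "integrable lborel (\<lambda>z. u z * v z)"
    for u v :: "real \<times> real \<Rightarrow> real"
  proof -
    have "(LBINT z. (a * u z + b * v z)\<^sup>2) = (LBINT z. a\<^sup>2 * (u z)\<^sup>2 + (2 * a * b * (u z * v z) + b\<^sup>2 * (v z)\<^sup>2))"
      by (intro Bochner_Integration.integral_cong) (auto simp: power2_eq_square algebra_simps)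
    then show ?thesis using that by simp
  qed
  show ?thesis unfolding dual_functional_def tail_lin[OF f g]
    using i by (simp add: * algebra_simps)
qed

text \<open>Tails act along vertical lines. Functions that live over disjoint sets of abscissae have
  tails over the same sets, and all mixed terms of the quadratic form vanish.\<close>

lemma dual_functional_add:
  assumes f: "test_function \<Omega> f Df" and g: "test_function \<Omega>' g Dg"
    and d: "\<And>x. (\<forall>y. f (x, y) = 0 \<and> Df (x, y) = 0) \<or> (\<forall>y. g (x, y) = 0 \<and> Dg (x, y) = 0)"
  shows "dual_functional (\<lambda>x. 1 * f x + 1 * g x) (\<lambda>x. 1 *\<^sub>R Df x + 1 *\<^sub>R Dg x) = dual_functional f Df + dual_functional g Dg"
proof -
  have 1: "f z * g z = 0" for z using d[of "fst z"] by (cases z) auto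
  have 2: "tail Df z * tail Dg z = 0" for z
    using d[of "fst z"] tail_nonzero[of Df z] tail_nonzero[of Dg z] by auto
  show ?thesis unfolding dual_functional_lin[OF f g] 1 2 by (simp add: dual_functional_def)
qed

lemma subgraph_measurable: "h \<in> borel_measurable borel \<Longrightarrow> subgraph h \<in> sets borel"
proof -
  assume [measurable]: "h \<in> borel_measurable borel"
  have "{z \<in> space (borel \<Otimes>\<^sub>M borel). 0 < snd z \<and> snd z < h (fst z)} \<in> sets (borel \<Otimes>\<^sub>M borel)" by measurable
  moreover have "subgraph h = {z \<in> space (borel \<Otimes>\<^sub>M borel). 0 < snd z \<and> snd z < h (fst z)}"
    by (auto simp: subgraph_def space_pair_measure)
  ultimately show ?thesis unfolding borel_prod by simp
qed

lemma emeasure_subgraph: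
  assumes [measurable]: "h \<in> borel_measurable borel" and h0: "\<And>x. 0 \<le> h x"
  shows "emeasure lborel (subgraph h) = (\<integral>\<^sup>+x. ennreal (h x) \<partial>lborel)"
proof -
  have "emeasure lborel (subgraph h) = emeasure (lborel \<Otimes>\<^sub>M lborel) (subgraph h)" by (simp add: lborel_prod)
  also have "\<dots> = (\<integral>\<^sup>+x. emeasure lborel (Pair x -` subgraph h) \<partial>lborel)"
    by (rule lborel.emeasure_pair_measure_alt) (simp only: lborel_prod sets_lborel subgraph_measurable assms)
  also have "\<dots> = (\<integral>\<^sup>+x. ennreal (h x) \<partial>lborel)"
  proof (rule nn_integral_cong)
    fix x have "Pair x -` subgraph h = {0<..<h x}" by (auto simp: subgraph_def)
    then show "emeasure lborel (Pair x -` subgraph h) = ennreal (h x)" using h0 by simp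
  qed
  finally show ?thesis .
qed

text \<open>Dropping the tail, \<open>2 * \<phi> z - (\<phi> z)\<^sup>2\<close> is at most 1 on the
  subgraph, whose area is the mass. The bound is the Dirichlet energy of the function x.\<close>

lemma dual_functional_le:
  assumes h: "profile h" and t: "test_function (subgraph h) \<phi> D"
  shows "dual_functional \<phi> D \<le> (LBINT x. h x)"
proof -
  note i = test_integrable[OF t t] square_integrable[OF t]
  have fin: "emeasure lborel (subgraph h) = ennreal (LBINT x. h x)"
    using emeasure_subgraph[of h] profileD[OF h] by (simp add: nn_integral_eq_integral)
  have m: "measure lborel (subgraph h) = (LBINT x. h x)"
    using fin profileD(2)[OF h] by (simp add: measure_def integral_nonneg)
  have "0 \<le> (LBINT z. (tail D z)\<^sup>2)" by (rule Bochner_Integration.integral_nonneg) simp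
  then have "dual_functional \<phi> D \<le> 2 * (LBINT z. \<phi> z) - (LBINT z. (\<phi> z)\<^sup>2)" by (simp only: dual_functional_def)
  moreover have "2 * (LBINT z. \<phi> z) - (LBINT z. (\<phi> z)\<^sup>2) = (LBINT z. 2 * \<phi> z - (\<phi> z)\<^sup>2)" using i by simp
  moreover have "\<dots> \<le> (LBINT z. indicator (subgraph h) z)"
  proof (rule integral_mono)
    show "integrable lborel (indicator (subgraph h) :: _ \<Rightarrow> real)"
      using fin subgraph_measurable[of h] profileD[OF h] by (intro integrable_real_indicator) auto
    fix z
    show "2 * \<phi> z - (\<phi> z)\<^sup>2 \<le> indicator (subgraph h) z"
    proof (cases "z \<in> subgraph h")
      case True
      have "0 \<le> (1 - \<phi> z)\<^sup>2" by simp
      then show ?thesis using True by (simp add: power2_eq_square algebra_simps)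
    next
      case False
      then have "\<phi> z = 0" using test_functionD(4)[OF t] by blast
      then show ?thesis by simp
    qed
  qed (use i in simp)
  ultimately show ?thesis using m by simp
qed

lemma dual_energy_upper:
  assumes h: "profile h" and t: "test_function (subgraph h) \<phi> D"
  shows "dual_functional \<phi> D \<le> dual_energy h"
proof -
  have "bdd_above ((\<lambda>(\<phi>, D). dual_functional \<phi> D) ` {(\<phi>, D). test_function (subgraph h) \<phi> D})"
    by (rule bdd_aboveI2[of _ _ "LBINT x. h x"]) (use dual_functional_le[OF h] in auto)
  from cSUP_upper[OF _ this, of "(\<phi>, D)"] show ?thesis using t by (simp add: dual_energy_def)
qed

lemma dual_energy_least:
  assumes "\<And>\<phi> D. test_function (subgraph h) \<phi> D \<Longrightarrow> dual_functional \<phi> D \<le> C"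
  shows "dual_energy h \<le> C"
  unfolding dual_energy_def
proof (rule cSUP_least)
  show "{(\<phi>, D). test_function (subgraph h) \<phi> D} \<noteq> {}" using test_function_null by blast
qed (use assms in auto)

lemma dual_energy_nonneg: "profile h \<Longrightarrow> 0 \<le> dual_energy h"
  using dual_energy_upper[OF _ test_function_null] by (simp add: dual_functional_null)

lemma dual_energy_approx:
  assumes "0 < e"
  shows "\<exists>\<phi> D. test_function (subgraph h) \<phi> D \<and> dual_energy h - e < dual_functional \<phi> D"
proof (rule ccontr)
  assume "\<not> ?thesis"
  then have "dual_energy h \<le> dual_energy h - e" by (intro dual_energy_least) force
  then show False using assms by simp
qed

text \<open>Test functions for the two outer pieces and \<open>\<phi>\<close> occupy disjoint
  columns, so their sum competes for \<open>h\<close> with the sum of their values.\<close>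

lemma dual_energy_cuts:
  assumes h: "profile h" and ab: "a \<le> b" and t: "test_function (subgraph h) \<phi> D"
    and s: "\<And>x y. x < a \<or> b < x \<Longrightarrow> \<phi> (x, y) = 0 \<and> D (x, y) = 0"
  shows "dual_energy (lcut a h) + dual_functional \<phi> D + dual_energy (rcut b h) \<le> dual_energy h"
proof -
  have 1: "dual_functional f Df + dual_functional \<phi> D + dual_functional g Dg \<le> dual_energy h"
    if f: "test_function (subgraph (lcut a h)) f Df" and g: "test_function (subgraph (rcut b h)) g Dg" for f Df g Dg
  proof -
    have f0: "f (x, y) = 0 \<and> Df (x, y) = 0" if "\<not> x < a" for x y
    proof -
      have "(x, y) \<notin> subgraph (lcut a h)" using that by (simp add: subgraph_def lcut_def)
      then show ?thesis using test_functionD(4)[OF f] by blast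
    qed
    have g0: "g (x, y) = 0 \<and> Dg (x, y) = 0" if "\<not> b < x" for x y
    proof -
      have "(x, y) \<notin> subgraph (rcut b h)" using that by (simp add: subgraph_def rcut_def)
      then show ?thesis using test_functionD(4)[OF g] by blast
    qed
    have sub: "subgraph (lcut a h) \<subseteq> subgraph h" "subgraph (rcut b h) \<subseteq> subgraph h"
      by (auto simp: subgraph_def lcut_def rcut_def split: if_splits)
    note f' = test_function_mono[OF f sub(1)] and g' = test_function_mono[OF g sub(2)]
    let ?p = "\<lambda>x. 1 * f x + 1 * \<phi> x" and ?D = "\<lambda>x. 1 *\<^sub>R Df x + 1 *\<^sub>R D x"
    have p: "test_function (subgraph h) ?p ?D" by (rule test_function_lin[OF f' t])
    have "dual_functional ?p ?D = dual_functional f Df + dual_functional \<phi> D"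
      by (rule dual_functional_add[OF f' t]) (use f0 s in auto)
    moreover have "dual_functional (\<lambda>x. 1 * ?p x + 1 * g x) (\<lambda>x. 1 *\<^sub>R ?D x + 1 *\<^sub>R Dg x)
        = dual_functional ?p ?D + dual_functional g Dg"
    proof (rule dual_functional_add[OF p g'])
      fix x
      show "(\<forall>y. ?p (x, y) = 0 \<and> ?D (x, y) = 0) \<or> (\<forall>y. g (x, y) = 0 \<and> Dg (x, y) = 0)"
      proof (cases "b < x")
        case True
        then show ?thesis using f0[of x] s[of x] ab by simp
      next
        case False
        then show ?thesis using g0[of x] by simp
      qed
    qed
    moreover have "dual_functional (\<lambda>x. 1 * ?p x + 1 * g x) (\<lambda>x. 1 *\<^sub>R ?D x + 1 *\<^sub>R Dg x) \<le> dual_energy h"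
      by (rule dual_energy_upper[OF h test_function_lin[OF p g']])
    ultimately show ?thesis by simp
  qed
  have "dual_energy (lcut a h) \<le> dual_energy h - dual_functional \<phi> D - dual_energy (rcut b h)"
  proof (rule dual_energy_least)
    fix f Df assume f: "test_function (subgraph (lcut a h)) f Df"
    have "dual_energy (rcut b h) \<le> dual_energy h - dual_functional \<phi> D - dual_functional f Df"
      by (rule dual_energy_least) (use 1[OF f] in force)
    then show "dual_functional f Df \<le> dual_energy h - dual_functional \<phi> D - dual_energy (rcut b h)" by simp
  qed
  then show ?thesis by simp
qed

subsection \<open>Dilations\<close>

lemma integral_lborel_affine:
  fixes f :: "'a::euclidean_space \<Rightarrow> real"
  assumes [measurable]: "f \<in> borel_measurable borel" and t: "t \<noteq> 0"
  shows "(LBINT z. f z) = \<bar>t\<bar> ^ DIM('a) * (LBINT z. f (c + t *\<^sub>R z))"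
proof -
  have "(LBINT z. f z) = integral\<^sup>L (density (distr lborel borel (\<lambda>x. c + t *\<^sub>R x)) (\<lambda>x. ennreal (\<bar>t\<bar> ^ DIM('a)))) f"
    using lborel_affine[OF t, of c] by simp
  also have "\<dots> = \<bar>t\<bar> ^ DIM('a) * (LBINT z. f (c + t *\<^sub>R z))"
    by (subst integral_density) (auto simp: integral_distr)
  finally show ?thesis .
qed

text \<open>The offset is horizontal, so the subgraph keeps standing on the axis;
  \<open>t = 1\<close> gives the translations that recentre a minimizing sequence.\<close>

definition rescale :: "real \<Rightarrow> real \<Rightarrow> (real \<Rightarrow> real) \<Rightarrow> real \<Rightarrow> real" where
  "rescale a t h x = t * h ((x - a) / t)"

text \<open>The factor \<open>t\<close> in the pulled back gradient is the Jacobian of the vertical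
  integration, hence tails are merely transported and the area factor is all that remains.\<close>

lemma dual_energy_rescale:
  assumes h: "profile h" and t: "0 < t"
  shows "dual_energy (rescale a t h) \<le> t\<^sup>2 * dual_energy h"
proof (rule dual_energy_least)
  fix \<phi> D assume p: "test_function (subgraph (rescale a t h)) \<phi> D"
  let ?T = "dilate (a, 0) t t"
  have T: "?T z = (a, 0) + t *\<^sub>R z" for z by (simp add: dilate_def prod_eq_iff)
  have q: "test_function (subgraph h) (\<lambda>z. \<phi> (?T z)) (\<lambda>z. (t * fst (D (?T z)), t * snd (D (?T z))))"
    by (rule test_function_dilate[OF p]) (use t in \<open>auto simp: subgraph_def dilate_def rescale_def zero_less_mult_iff split: prod.splits\<close>)
  note [measurable] = test_functionD(5,6)[OF p]
  have tl: "tail (\<lambda>z. (t * fst (D (?T z)), t * snd (D (?T z)))) z = tail D (?T z)" for z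
  proof -
    have "(LBINT s. indicator {t * snd z<..} s * fst (D (a + t * fst z, s))) =
        t * (LBINT s. indicator {t * snd z<..} (0 + t * s) * fst (D (a + t * fst z, 0 + t * s)))"
      using lborel_integral_real_affine[of t "\<lambda>s. indicator {t * snd z<..} s * fst (D (a + t * fst z, s))" 0] t by simp
    also have "\<dots> = (LBINT s. indicator {snd z<..} s * (t * fst (D (?T (fst z, s)))))"
      unfolding integral_mult_right_zero[symmetric] using t
      by (intro Bochner_Integration.integral_cong) (auto simp: dilate_def indicator_def)
    finally show ?thesis using t by (simp add: tail_def dilate_def zero_less_mult_iff)
  qed
  have "dual_functional \<phi> D = t\<^sup>2 * dual_functional (\<lambda>z. \<phi> (?T z)) (\<lambda>z. (t * fst (D (?T z)), t * snd (D (?T z))))"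
    unfolding dual_functional_def tl unfolding T
    using integral_lborel_affine[of \<phi> t "(a, 0)"] integral_lborel_affine[of "\<lambda>z. (\<phi> z)\<^sup>2" t "(a, 0)"]
      integral_lborel_affine[of "\<lambda>z. (tail D z)\<^sup>2" t "(a, 0)"] t by (simp add: algebra_simps power2_eq_square)
  also have "\<dots> \<le> t\<^sup>2 * dual_energy h" by (rule mult_left_mono[OF dual_energy_upper[OF h q]]) simp
  finally show "dual_functional \<phi> D \<le> t\<^sup>2 * dual_energy h" .
qed

lemma vsum_rescale: "0 < t \<Longrightarrow> vsum (rescale a t h) xs = t * vsum h (map (\<lambda>x. (x - a) / t) xs)"
proof (induction h xs rule: vsum.induct)
  case (3 h x y xs)
  have "\<bar>t * h ((y - a) / t) - t * h ((x - a) / t)\<bar> = t * \<bar>h ((y - a) / t) - h ((x - a) / t)\<bar>"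
    using 3(2) by (simp add: right_diff_distrib[symmetric] abs_mult)
  then show ?case using 3 by (simp add: rescale_def distrib_left)
qed auto

lemma profile_rescale:
  assumes h: "profile h" and t: "0 < t"
  shows "profile (rescale a t h)" "tv (rescale a t h) \<le> t * tv h"
    "(LBINT x. rescale a t h x) = t\<^sup>2 * (LBINT x. h x)"
proof -
  have le: "vsum (rescale a t h) xs \<le> t * tv h" if "sorted xs" for xs
  proof -
    have "sorted (map (\<lambda>x. (x - a) / t) xs)" using that t
      by (simp add: sorted_map) (rule sorted_wrt_mono_rel[OF _ that], simp add: divide_right_mono)
    then show ?thesis unfolding vsum_rescale[OF t] using t profileD[OF h] by (intro mult_left_mono vsum_le_tv) auto
  qed
  show "tv (rescale a t h) \<le> t * tv h" using le by (rule tv_le)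
  have eq: "rescale a t h = (\<lambda>x. t * h (- a / t + (1 / t) * x))" using t
    by (auto simp: rescale_def fun_eq_iff diff_divide_distrib)
  have "lsc (rescale a t h)"
  proof (rule lscI)
    fix x c assume "c < rescale a t h x"
    then have "c / t < h ((x - a) / t)" using t by (simp add: rescale_def divide_simps mult.commute)
    then obtain d where d: "d > 0" "\<And>y. \<bar>y - (x - a) / t\<bar> < d \<Longrightarrow> c / t < h y"
      using lscD[OF profileD(1)[OF h]] by blast
    show "\<exists>d>0. \<forall>y. \<bar>y - x\<bar> < d \<longrightarrow> c < rescale a t h y"
    proof (intro exI[of _ "t * d"] conjI allI impI)
      fix y assume y: "\<bar>y - x\<bar> < t * d"
      have "(y - a) / t - (x - a) / t = (y - x) / t" by (simp add: diff_divide_distrib)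
      then have "\<bar>(y - a) / t - (x - a) / t\<bar> < d" using y t by (simp add: divide_simps mult.commute)
      from d(2)[OF this] show "c < rescale a t h y" using t by (simp add: rescale_def divide_simps mult.commute)
    qed (use d t in simp)
  qed
  moreover have "integrable lborel (rescale a t h)" unfolding eq
    using lborel_integrable_real_affine[OF profileD(3)[OF h], of "1 / t" "- a / t"] t by simp
  ultimately show "profile (rescale a t h)" unfolding profile_def
    using t profileD[OF h] bdd_varI[OF le] by (auto simp: rescale_def)
  have "(LBINT x. h x) = \<bar>1 / t\<bar> *\<^sub>R (LBINT x. h (- a / t + (1 / t) * x))"
    by (rule lborel_integral_real_affine) (use t in simp)
  then show "(LBINT x. rescale a t h x) = t\<^sup>2 * (LBINT x. h x)" unfolding eq using t
    by (simp add: power2_eq_square)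
qed

subsection \<open>Smooth boxes\<close>

lemma has_real_derivative_max_square:
  "((\<lambda>x::real. (max 0 x)\<^sup>2) has_real_derivative 2 * max 0 x) (at x)"
proof (cases x "0::real" rule: linorder_cases)
  case less
  have "((\<lambda>x::real. 0) has_real_derivative 2 * max 0 x) (at x)" using less by simp
  then show ?thesis
    by (rule has_field_derivative_transform_within_open[of _ _ _ "{..<0}"]) (use less in auto)
next
  case greater
  have "((\<lambda>x::real. x\<^sup>2) has_real_derivative 2 * max 0 x) (at x)"
    using greater by (auto intro!: derivative_eq_intros)
  then show ?thesis
    by (rule has_field_derivative_transform_within_open[of _ _ _ "{0<..}"]) (use greater in auto)
next
  case equal
  have "((\<lambda>h::real. max 0 h) \<longlongrightarrow> max 0 0) (at 0)" by (intro tendsto_intros)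
  moreover have "\<forall>\<^sub>F h in at (0::real). max 0 h = ((max 0 (0 + h))\<^sup>2 - (max 0 0)\<^sup>2) / h"
    by (auto simp: eventually_at_filter max_def power2_eq_square)
  ultimately have "((\<lambda>h::real. ((max 0 (0 + h))\<^sup>2 - (max 0 0)\<^sup>2) / h) \<longlongrightarrow> max 0 0) (at 0)"
    by (rule tendsto_cong[THEN iffD1, rotated])
  then show ?thesis using equal by (simp add: DERIV_def)
qed

text \<open>The quadratic B-spline step: \<open>ramp\<close> is \<open>C\<^sup>1\<close> and rises from \<open>0\<close> at \<open>0\<close> to \<open>1\<close> at \<open>2\<close>.\<close>

definition ramp :: "real \<Rightarrow> real" where
  "ramp x = ((max 0 x)\<^sup>2 - 2 * (max 0 (x - 1))\<^sup>2 + (max 0 (x - 2))\<^sup>2) / 2"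

definition ramp' :: "real \<Rightarrow> real" where
  "ramp' x = max 0 x - 2 * max 0 (x - 1) + max 0 (x - 2)"

lemma ramp_deriv[derivative_intros]:
  assumes "(f has_real_derivative f') (at x)"
  shows "((\<lambda>x. ramp (f x)) has_real_derivative f' * ramp' (f x)) (at x)"
proof -
  have "((\<lambda>x. (max 0 (x - c))\<^sup>2) has_real_derivative 2 * max 0 (y - c)) (at y)" for c y :: real
  proof -
    have "((\<lambda>x. x - c) has_real_derivative 1) (at y)" by (auto intro!: derivative_eq_intros)
    from DERIV_chain2[where f = "\<lambda>x::real. (max 0 x)\<^sup>2" and g = "\<lambda>x. x - c", OF has_real_derivative_max_square this]
    show ?thesis by simp
  qed
  note d = this
  have "(ramp has_real_derivative ramp' y) (at y)" for y
    unfolding ramp_def[abs_def] ramp'_def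
    by (rule DERIV_cong[OF DERIV_cdivide[OF DERIV_add[OF DERIV_diff[OF d[of 0 y, unfolded diff_0_right] DERIV_cmult[OF d]] d]]]) simp
  from DERIV_chain2[OF this assms] show ?thesis by (simp add: mult.commute)
qed

lemma ramp'_bounds: "0 \<le> ramp' x" "ramp' x \<le> 1" by (auto simp: ramp'_def max_def)

lemma ramp_0: "x \<le> 0 \<Longrightarrow> ramp x = 0" by (simp add: ramp_def max_def)

lemma ramp_1: "2 \<le> x \<Longrightarrow> ramp x = 1" by (simp add: ramp_def max_def power2_eq_square algebra_simps)

lemma ramp'_0: "x \<le> 0 \<or> 2 \<le> x \<Longrightarrow> ramp' x = 0" by (auto simp: ramp'_def max_def)

lemma ramp_mono: "x \<le> y \<Longrightarrow> ramp x \<le> ramp y"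
  by (rule DERIV_nonneg_imp_nondecreasing) (use ramp_deriv[of "\<lambda>x. x" 1] ramp'_bounds in auto)

lemma ramp_bounds: "0 \<le> ramp x" "ramp x \<le> 1"
  using ramp_mono[of "min x 0" x] ramp_mono[of x "max x 2"] ramp_0[of "min x 0"] ramp_1[of "max x 2"] by auto

lemma continuous_ramp[continuous_intros]:
  "continuous_on S f \<Longrightarrow> continuous_on S (\<lambda>x. ramp (f x))"
  "continuous_on S f \<Longrightarrow> continuous_on S (\<lambda>x. ramp' (f x))"
  unfolding ramp_def ramp'_def by (intro continuous_intros; simp)+

text \<open>The shift by 1 leaves a margin \<open>d\<close> at both ends, so that the support is
  compact in the open interval; each flank then has width \<open>2 * d\<close>.\<close>

definition bump :: "real \<Rightarrow> real \<Rightarrow> real \<Rightarrow> real \<Rightarrow> real" where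
  "bump a b d x = ramp ((x - a) / d - 1) * ramp ((b - x) / d - 1)"

definition bump' :: "real \<Rightarrow> real \<Rightarrow> real \<Rightarrow> real \<Rightarrow> real" where
  "bump' a b d x = (ramp' ((x - a) / d - 1) * ramp ((b - x) / d - 1) - ramp ((x - a) / d - 1) * ramp' ((b - x) / d - 1)) / d"

lemma bump_deriv: "(bump a b d has_real_derivative bump' a b d x) (at x)"
  unfolding bump_def[abs_def] bump'_def by (cases "d = 0") (auto intro!: derivative_eq_intros simp: field_simps)

lemma continuous_bump:
  assumes "0 < d"
  shows "continuous_on S (bump a b d)" "continuous_on S (bump' a b d)"
  unfolding bump_def bump'_def using assms by (intro continuous_intros; simp)+

lemma bump_bounds: "0 \<le> bump a b d x" "bump a b d x \<le> 1"
  unfolding bump_def using ramp_bounds by (auto intro!: mult_nonneg_nonneg mult_le_one)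

lemma bump_0: "0 < d \<Longrightarrow> x \<notin> {a + d..b - d} \<Longrightarrow> bump a b d x = 0"
  by (auto simp: bump_def ramp_0 field_simps)

lemma bump_1: "0 < d \<Longrightarrow> x \<in> {a + 3 * d..b - 3 * d} \<Longrightarrow> bump a b d x = 1"
  by (auto simp: bump_def ramp_1 field_simps)

lemma bump'_bound: "0 < d \<Longrightarrow> \<bar>bump' a b d x\<bar> \<le> 1 / d"
proof -
  assume d: "0 < d"
  let ?p = "(x - a) / d - 1" and ?q = "(b - x) / d - 1"
  have "0 \<le> ramp' ?p * ramp ?q" "ramp' ?p * ramp ?q \<le> 1" "0 \<le> ramp ?p * ramp' ?q" "ramp ?p * ramp' ?q \<le> 1"
    using ramp_bounds ramp'_bounds by (auto intro!: mult_nonneg_nonneg mult_le_one)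
  then have "\<bar>ramp' ?p * ramp ?q - ramp ?p * ramp' ?q\<bar> \<le> 1" by linarith
  then show ?thesis using d by (simp add: bump'_def abs_divide divide_right_mono)
qed

section \<open>Product test functions and flat rectangles\<close>

lemma test_function_product:
  fixes f g f' g' :: "real \<Rightarrow> real"
  assumes f: "\<And>x. (f has_real_derivative f' x) (at x)" "continuous_on UNIV f'" "\<And>x. x \<notin> {a..b} \<Longrightarrow> f x = 0"
    and g: "\<And>x. (g has_real_derivative g' x) (at x)" "continuous_on UNIV g'" "\<And>x. x \<notin> {p..q} \<Longrightarrow> g x = 0"
    and s: "{a..b} \<times> {p..q} \<subseteq> \<Omega>"
  shows "test_function \<Omega> (\<lambda>z. f (fst z) * g (snd z)) (\<lambda>z. (f' (fst z) * g (snd z), f (fst z) * g' (snd z)))"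
proof (rule test_functionI[of _ _ "{a..b} \<times> {p..q}"])
  have cf: "continuous_on UNIV f" "continuous_on UNIV g"
    using f(1) g(1) by (auto intro!: continuous_at_imp_continuous_on DERIV_isCont)
  show "continuous_on UNIV (\<lambda>z. (f' (fst z) * g (snd z), f (fst z) * g' (snd z)))"
    by (intro continuous_intros continuous_on_compose2[OF f(2)] continuous_on_compose2[OF g(2)]
        continuous_on_compose2[OF cf(1)] continuous_on_compose2[OF cf(2)]) auto
  fix z :: "real \<times> real"
  show "GDERIV (\<lambda>z. f (fst z) * g (snd z)) z :> (f' (fst z) * g (snd z), f (fst z) * g' (snd z))"
    using has_derivative_compose[OF has_derivative_fst[OF has_derivative_ident] f(1)[of "fst z", unfolded has_field_derivative_def], of UNIV]
      has_derivative_compose[OF has_derivative_snd[OF has_derivative_ident] g(1)[of "snd z", unfolded has_field_derivative_def], of UNIV]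
    unfolding gderiv_def inner_prod_def
    by (auto intro!: derivative_eq_intros simp: algebra_simps)
  show "z \<notin> {a..b} \<times> {p..q} \<Longrightarrow> f (fst z) * g (snd z) = 0" using f(3) g(3) by (cases z) auto
qed (use s in \<open>auto intro: compact_Times\<close>)

lemma test_function_box:
  assumes "0 < d" "0 < e"
  shows "test_function ({a<..<b} \<times> {p<..<q}) (\<lambda>z. bump a b d (fst z) * bump p q e (snd z))
    (\<lambda>z. (bump' a b d (fst z) * bump p q e (snd z), bump a b d (fst z) * bump' p q e (snd z)))"
  by (rule test_function_product[OF bump_deriv continuous_bump(2)[OF assms(1)] bump_0[OF assms(1)]
        bump_deriv continuous_bump(2)[OF assms(2)] bump_0[OF assms(2)]])
    (use assms in auto)

lemma emeasure_lborel_Times: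
  "A \<in> sets borel \<Longrightarrow> B \<in> sets borel \<Longrightarrow>
    emeasure lborel (A \<times> B :: ('a::euclidean_space \<times> 'b::euclidean_space) set) = emeasure lborel A * emeasure lborel B"
  using lborel.emeasure_pair_measure_Times[of A lborel B] by (simp add: lborel_prod)

text \<open>The condition on \<open>c\<close> makes the rectangle flat: a cutoff at horizontal distance \<open>d\<close> has a tail of size
  at most \<open>c / d\<close>, so the functional of a smoothed indicator is close to the area.\<close>

lemma rect_dual_functional:
  assumes th: "0 < \<theta>" "\<theta> < 1" and ab: "a < b" and c: "0 < c" "12 * c \<le> \<theta>\<^sup>2 * (b - a)"
  shows "\<exists>\<phi> D. test_function ({a<..<b} \<times> {0<..<c}) \<phi> D \<and> (1 - 3 * \<theta>) * ((b - a) * c) \<le> dual_functional \<phi> D"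
proof -
  define r where "r = b - a"
  have r: "0 < r" using ab by (simp add: r_def)
  \<comment> \<open>Margin and flank together take \<open>3 * d\<close> on each side, so the plateau
    has length \<open>(1 - \<theta>) * r\<close>; likewise for \<open>e\<close> and the
    height.\<close>
  define d where "d = \<theta> * r / 6"
  define e where "e = \<theta> * c / 6"
  have d: "0 < d" and e: "0 < e" using th r c by (auto simp: d_def e_def)
  let ?f = "bump a b d" and ?g = "bump 0 c e"
  let ?\<phi> = "\<lambda>z. ?f (fst z) * ?g (snd z)"
  let ?D = "\<lambda>z. (bump' a b d (fst z) * ?g (snd z), ?f (fst z) * bump' 0 c e (snd z))"
  have t: "test_function ({a<..<b} \<times> {0<..<c}) ?\<phi> ?D" by (rule test_function_box[OF d e])
  have p01: "0 \<le> ?\<phi> z" "?\<phi> z \<le> 1" for z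
    using bump_bounds by (auto intro!: mult_nonneg_nonneg mult_le_one)
  have meas: "measure lborel ({s..t} \<times> {u..v}) = (t - s) * (v - u)" if "s \<le> t" "u \<le> v" for s t u v :: real
    using that by (simp add: measure_def emeasure_lborel_Times ennreal_mult[symmetric])
  have fin: "emeasure lborel ({s..t} \<times> {u..v}) < \<infinity>" for s t u v :: real
    by (rule emeasure_bounded_finite) (simp add: bounded_Times)
  let ?A = "{a + 3 * d..b - 3 * d} \<times> {0 + 3 * e..c - 3 * e}"
  have "measure lborel ?A = (LBINT z. indicator ?A z)" by simp
  also have "\<dots> \<le> (LBINT z. ?\<phi> z)"
  proof (rule integral_mono)
    show "integrable lborel (indicator ?A :: _ \<Rightarrow> real)" using fin by (intro integrable_real_indicator) (auto simp: borel_prod[symmetric])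
    show "integrable lborel ?\<phi>" by (rule test_integrable[OF t t])
    fix z show "indicator ?A z \<le> ?\<phi> z"
      using bump_1[OF d, of "fst z" a b] bump_1[OF e, of "snd z" 0 c] p01[of z] by (cases z) (auto simp: indicator_def)
  qed
  also have "measure lborel ?A = (r - 6 * d) * (c - 6 * e)"
  proof -
    have "6 * d \<le> r" "6 * e \<le> c" using th r c by (auto simp: d_def e_def mult_left_le_one_le)
    then show ?thesis by (subst meas) (auto simp: r_def)
  qed
  also have "\<dots> = (1 - \<theta>)\<^sup>2 * (r * c)" by (simp add: d_def e_def power2_eq_square algebra_simps)
  finally have 1: "(1 - \<theta>)\<^sup>2 * (r * c) \<le> (LBINT z. ?\<phi> z)" .
  \<comment> \<open>With this, twice the integral minus that of the square is at least the integral
    of the cutoff itself.\<close>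
  have 2: "(LBINT z. (?\<phi> z)\<^sup>2) \<le> (LBINT z. ?\<phi> z)"
  proof (rule integral_mono[OF square_integrable[OF t] test_integrable(1)[OF t t]])
    fix z show "(?\<phi> z)\<^sup>2 \<le> ?\<phi> z" using p01[of z] by (simp add: power2_eq_square mult_left_le)
  qed
  let ?B = "{a..b} \<times> {0..c}"
  have tl: "\<bar>tail ?D z\<bar> \<le> c / d" for z
  proof -
    have "\<bar>LBINT t. indicator {snd z<..} t * fst (?D (fst z, t))\<bar> \<le> (LBINT t. \<bar>indicator {snd z<..} t * fst (?D (fst z, t))\<bar>)"
      by (rule integral_abs_bound)
    also have "\<dots> \<le> (LBINT t. (1 / d) * indicator {0..c} t)"
    proof (rule integral_mono)
      show "integrable lborel (\<lambda>t. \<bar>indicator {snd z<..} t * fst (?D (fst z, t))\<bar>)"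
        by (rule integrable_abs[OF slice_integrable[OF t]])
      show "integrable lborel (\<lambda>t. (1 / d) * indicator {0..c} t)"
        using c by (intro integrable_mult_right integrable_real_indicator) (auto simp: less_top[symmetric])
      fix s
      have "\<bar>bump' a b d (fst z) * ?g s\<bar> \<le> (1 / d) * 1" unfolding abs_mult
        by (rule mult_mono) (use bump'_bound[OF d] bump_bounds d in auto)
      moreover have "?g s = 0" if "s \<notin> {0..c}" by (rule bump_0[OF e]) (use that e in auto)
      ultimately show "\<bar>indicator {snd z<..} s * fst (?D (fst z, s))\<bar> \<le> (1 / d) * indicator {0..c} s"
        using d by (cases "s \<in> {0..c}") (auto simp: indicator_def)
    qed
    also have "\<dots> = c / d" using c by simp
    finally show ?thesis using c d by (simp add: tail_def)
  qed
  have "(LBINT z. (tail ?D z)\<^sup>2) \<le> (LBINT z. (c / d)\<^sup>2 * indicator ?B z)"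
  proof (rule integral_mono[OF tail_square_integrable[OF t]])
    show "integrable lborel (\<lambda>z. (c / d)\<^sup>2 * indicator ?B z :: real)"
      using fin by (intro integrable_mult_right integrable_real_indicator) (auto simp: borel_prod[symmetric])
    fix z
    show "(tail ?D z)\<^sup>2 \<le> (c / d)\<^sup>2 * indicator ?B z"
    proof (cases "tail ?D z = 0")
      case False
      then obtain s where s: "0 < snd z" "snd z < s" "?D (fst z, s) \<noteq> 0" using tail_nonzero by blast
      then have "(fst z, s) \<in> {a<..<b} \<times> {0<..<c}" using test_functionD(4)[OF t, of "(fst z, s)"] by blast
      then have "z \<in> ?B" using s by (cases z) auto
      moreover have "\<bar>tail ?D z\<bar>\<^sup>2 \<le> (c / d)\<^sup>2" by (rule power_mono[OF tl]) simp
      ultimately show ?thesis by simp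
    qed simp
  qed
  also have "\<dots> = (c / d)\<^sup>2 * (r * c)" using meas[of a b 0 c] ab c by (simp add: r_def)
  \<comment> \<open>With \<open>d = \<theta> * r / 6\<close>, the flatness condition says that
    \<open>c / d\<close> is at most \<open>\<theta> / 2\<close>.\<close>
  also have "\<dots> \<le> \<theta>\<^sup>2 / 4 * (r * c)"
  proof (rule mult_right_mono)
    have "c / d = 6 * c / (\<theta> * r)" by (simp add: d_def)
    also have "\<dots> \<le> \<theta> / 2" using c(2) th r by (simp add: r_def field_simps power2_eq_square)
    finally have "c / d \<le> \<theta> / 2" .
    then have "(c / d)\<^sup>2 \<le> (\<theta> / 2)\<^sup>2" using c d by (intro power_mono) auto
    then show "(c / d)\<^sup>2 \<le> \<theta>\<^sup>2 / 4" by (simp add: power_divide)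
  qed (use r c in simp)
  finally have 3: "(LBINT z. (tail ?D z)\<^sup>2) \<le> \<theta>\<^sup>2 / 4 * (r * c)" .
  have "(1 - 3 * \<theta>) * (r * c) \<le> ((1 - \<theta>)\<^sup>2 - \<theta>\<^sup>2 / 4) * (r * c)"
  proof (rule mult_right_mono)
    have "0 \<le> \<theta> + (3 / 4) * \<theta>\<^sup>2" using th by simp
    then show "1 - 3 * \<theta> \<le> (1 - \<theta>)\<^sup>2 - \<theta>\<^sup>2 / 4" by (simp add: power2_eq_square algebra_simps)
  qed (use r c in simp)
  also have "\<dots> \<le> dual_functional ?\<phi> ?D" unfolding dual_functional_def using 1 2 3 by (simp add: left_diff_distrib)
  finally show ?thesis using t unfolding r_def by blast
qed

text \<open>One flat rectangle per cell: their test functions sit in disjoint columns and add up. A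
  cell of height 0 contributes the zero function.\<close>

lemma cells_dual_functional:
  assumes th: "0 < \<theta>" "\<theta> < 1" and r: "0 < r"
    and c: "\<And>j. j < N \<Longrightarrow> 0 \<le> c j \<and> 12 * c j \<le> \<theta>\<^sup>2 * r"
    and h: "\<And>j x. j < N \<Longrightarrow> x \<in> {A + real j * r<..<A + real (Suc j) * r} \<Longrightarrow> c j \<le> h x"
  shows "\<exists>\<phi> D. test_function (subgraph h \<inter> {A<..<A + real N * r} \<times> UNIV) \<phi> D \<and>
    (1 - 3 * \<theta>) * (r * (\<Sum>j<N. c j)) \<le> dual_functional \<phi> D"
  using c h
proof (induction N)
  case 0
  show ?case using test_function_null[of "subgraph h \<inter> {A<..<A + real 0 * r} \<times> UNIV"]
    by (intro exI[of _ "\<lambda>_. 0"]) (simp add: dual_functional_null)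
next
  case (Suc N)
  obtain f Df where f: "test_function (subgraph h \<inter> {A<..<A + real N * r} \<times> UNIV) f Df"
    "(1 - 3 * \<theta>) * (r * (\<Sum>j<N. c j)) \<le> dual_functional f Df" using Suc by auto
  let ?a = "A + real N * r" and ?b = "A + real (Suc N) * r"
  have ab: "?a < ?b" "?b - ?a = r" using r by (auto simp: algebra_simps)
  have "\<exists>g Dg. test_function (subgraph h \<inter> {?a<..<?b} \<times> UNIV) g Dg \<and> (1 - 3 * \<theta>) * (r * c N) \<le> dual_functional g Dg"
  proof (cases "c N = 0")
    case True
    then show ?thesis using test_function_null[of "subgraph h \<inter> {?a<..<?b} \<times> UNIV"]
      by (intro exI[of _ "\<lambda>_. 0"]) (simp add: dual_functional_null)
  next
    case False
    then have "0 < c N" "12 * c N \<le> \<theta>\<^sup>2 * (?b - ?a)" using Suc.prems(1)[of N] ab by auto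
    from rect_dual_functional[OF th ab(1) this] obtain g Dg where
      g: "test_function ({?a<..<?b} \<times> {0<..<c N}) g Dg" "(1 - 3 * \<theta>) * (r * c N) \<le> dual_functional g Dg"
      unfolding ab(2) by blast
    have "{?a<..<?b} \<times> {0<..<c N} \<subseteq> subgraph h \<inter> {?a<..<?b} \<times> UNIV"
      using Suc.prems(2)[of N] by (auto simp: subgraph_def intro: less_le_trans)
    from test_function_mono[OF g(1) this] g(2) show ?thesis by blast
  qed
  then obtain g Dg where g: "test_function (subgraph h \<inter> {?a<..<?b} \<times> UNIV) g Dg"
    "(1 - 3 * \<theta>) * (r * c N) \<le> dual_functional g Dg" by blast
  have "A \<le> ?a" using r by simp
  then have sub: "subgraph h \<inter> {A<..<?a} \<times> UNIV \<subseteq> subgraph h \<inter> {A<..<?b} \<times> UNIV"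
    "subgraph h \<inter> {?a<..<?b} \<times> UNIV \<subseteq> subgraph h \<inter> {A<..<?b} \<times> UNIV"
    using ab(1) by (force simp del: of_nat_Suc)+
  note t = test_function_lin[OF test_function_mono[OF f(1) sub(1)] test_function_mono[OF g(1) sub(2)], of 1 1]
  have "dual_functional (\<lambda>x. 1 * f x + 1 * g x) (\<lambda>x. 1 *\<^sub>R Df x + 1 *\<^sub>R Dg x) = dual_functional f Df + dual_functional g Dg"
  proof (rule dual_functional_add[OF f(1) g(1)])
    fix x
    show "(\<forall>y. f (x, y) = 0 \<and> Df (x, y) = 0) \<or> (\<forall>y. g (x, y) = 0 \<and> Dg (x, y) = 0)"
    proof (cases "x < ?a")
      case True
      then have "(x, y) \<notin> subgraph h \<inter> {?a<..<?b} \<times> UNIV" for y by auto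
      then show ?thesis using test_functionD(4)[OF g(1)] by blast
    next
      case False
      then have "(x, y) \<notin> subgraph h \<inter> {A<..<?a} \<times> UNIV" for y by auto
      then show ?thesis using test_functionD(4)[OF f(1)] by blast
    qed
  qed
  then have "(1 - 3 * \<theta>) * (r * (\<Sum>j<Suc N. c j)) \<le> dual_functional (\<lambda>x. 1 * f x + 1 * g x) (\<lambda>x. 1 *\<^sub>R Df x + 1 *\<^sub>R Dg x)"
    using f(2) g(2) by (simp add: algebra_simps)
  then show ?case using t by blast
qed

section \<open>Mass on intervals and vanishing profiles\<close>

lemma profile_nn_mass:
  assumes h: "profile h" and S: "S \<in> sets borel"
  shows "(\<integral>\<^sup>+x\<in>S. ennreal (h x) \<partial>lborel) = ennreal (LBINT x:S. h x)"
proof -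
  have i: "integrable lborel (\<lambda>x. indicator S x *\<^sub>R h x)"
    using profileD(3)[OF h] S by (intro integrable_mult_indicator) auto
  have "(\<integral>\<^sup>+x\<in>S. ennreal (h x) \<partial>lborel) = (\<integral>\<^sup>+x. ennreal (indicator S x *\<^sub>R h x) \<partial>lborel)"
    by (rule nn_integral_cong) (auto simp: indicator_def)
  also have "\<dots> = ennreal (LBINT x:S. h x)" unfolding set_lebesgue_integral_def
    by (rule nn_integral_eq_integral[OF i]) (use profileD(2)[OF h] in \<open>auto simp: indicator_def\<close>)
  finally show ?thesis .
qed

lemma profile_mass_nonneg: "profile h \<Longrightarrow> 0 \<le> (LBINT x:S. h x)"
  unfolding set_lebesgue_integral_def
  by (rule Bochner_Integration.integral_nonneg) (use profileD(2) in \<open>auto simp: indicator_def\<close>)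

lemma profile_mass_mono:
  assumes h: "profile h" and S: "S \<in> sets borel" "T \<in> sets borel" "S \<subseteq> T"
  shows "(LBINT x:S. h x) \<le> (LBINT x:T. h x)" "(LBINT x:S. h x) \<le> (LBINT x. h x)"
proof -
  have *: "(\<integral>\<^sup>+x\<in>S. ennreal (h x) \<partial>lborel) \<le> (\<integral>\<^sup>+x\<in>T. ennreal (h x) \<partial>lborel)"
    if "S \<subseteq> T" for S T by (rule nn_integral_mono) (use that in \<open>auto simp: indicator_def\<close>)
  show "(LBINT x:S. h x) \<le> (LBINT x:T. h x)"
    using *[OF S(3)] profile_nn_mass[OF h] S profile_mass_nonneg[OF h] by (simp add: ennreal_le_iff)
  show "(LBINT x:S. h x) \<le> (LBINT x. h x)"
    using *[of S UNIV] profile_nn_mass[OF h, of S] profile_nn_mass[OF h, of UNIV] S profile_mass_nonneg[OF h, of UNIV]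
    by (simp add: ennreal_le_iff set_lebesgue_integral_def)
qed

lemma profile_mass_exhaust:
  assumes h: "profile h" and e: "0 < e"
  shows "\<exists>R>0. (LBINT x. h x) - e < (LBINT x:{-R..<R}. h x)"
proof -
  have "(\<lambda>n. LBINT x. indicator {-real n..<real n} x *\<^sub>R h x) \<longlonglongrightarrow> (LBINT x. h x)"
  proof (rule integral_dominated_convergence[OF _ _ profileD(3)[OF h]])
    show "AE x in lborel. (\<lambda>n. indicator {-real n..<real n} x *\<^sub>R h x) \<longlonglongrightarrow> h x"
    proof (rule AE_I2)
      fix x
      obtain m :: nat where "\<bar>x\<bar> < real m" using reals_Archimedean2 by blast
      then have "\<forall>\<^sub>F n in sequentially. indicator {-real n..<real n} x *\<^sub>R h x = h x"
        unfolding eventually_sequentially by (intro exI[of _ m]) (auto simp: indicator_def)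
      then show "(\<lambda>n. indicator {-real n..<real n} x *\<^sub>R h x) \<longlonglongrightarrow> h x" by (rule tendsto_eventually)
    qed
  qed (use profileD[OF h] in \<open>auto simp: indicator_def\<close>)
  then have "\<forall>\<^sub>F n in sequentially. (LBINT x. h x) - e < (LBINT x. indicator {-real n..<real n} x *\<^sub>R h x)"
    by (rule order_tendstoD) (use e in simp)
  then have "\<forall>\<^sub>F n in sequentially. (LBINT x. h x) - e < (LBINT x. indicator {-real n..<real n} x *\<^sub>R h x) \<and> 0 < n"
    using eventually_gt_at_top by (rule eventually_conj)
  then obtain n where "(LBINT x. h x) - e < (LBINT x. indicator {-real n..<real n} x *\<^sub>R h x)" "0 < n"
    using eventually_happens by fastforce
  then show ?thesis by (intro exI[of _ "real n"]) (simp add: set_lebesgue_integral_def)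
qed

text \<open>Little mass in every window forces the infimum on each cell of length \<open>r\<close>
  to be small enough for a flat rectangle. These rectangles miss at most \<open>r * tv h\<close> of
  the mass, the error of a lower Riemann sum.\<close>

lemma dual_energy_vanishing:
  assumes h: "profile h" and th: "0 < \<theta>" "3 * \<theta> < 1" and r: "0 < r"
    and v: "\<And>a. (LBINT x:{a..<a + r}. h x) \<le> \<theta>\<^sup>2 * r\<^sup>2 / 12"
  shows "(1 - 3 * \<theta>) * ((LBINT x. h x) - r * tv h) \<le> dual_energy h"
proof (rule field_le_epsilon)
  fix e :: real assume e: "0 < e"
  obtain R where R: "R > 0" "(LBINT x. h x) - e / 2 < (LBINT x:{-R..<R}. h x)"
    using profile_mass_exhaust[OF h, of "e / 2"] e by auto
  obtain N :: nat where N: "2 * R / r < real N" using reals_Archimedean2 by blast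
  have RN: "R \<le> - R + real N * r" using N r by (simp add: field_simps)
  have N0: "0 < real N" using N R r by (meson divide_pos_pos less_trans mult_pos_pos zero_less_numeral)
  \<comment> \<open>Over \<open>N\<close> cells of length \<open>r\<close> the defect
    \<open>e'\<close> adds up to \<open>e / 2\<close>; the other half of \<open>e\<close> is the
    mass outside the interval.\<close>
  define e' where "e' = e / (2 * r * real N)"
  have e': "0 < e'" using e r N0 by (simp add: e'_def)
  let ?I = "\<lambda>j::nat. {- R + real j * r<..<- R + real (Suc j) * r}"
  define c where "c j = (INF x\<in>?I j. h x)" for j
  have ne: "?I j \<noteq> {}" for j using r by (simp add: algebra_simps)
  have bb: "bdd_below (h ` ?I j)" for j by (rule bdd_belowI2[of _ 0]) (rule profileD[OF h])
  have c0: "0 \<le> c j" for j unfolding c_def by (rule cINF_greatest[OF ne]) (rule profileD[OF h])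
  have cle: "c j \<le> h x" if "x \<in> ?I j" for j x unfolding c_def by (rule cINF_lower[OF bb that])
  have "\<exists>y\<in>?I j. h y < c j + e'" for j
    using cINF_less_iff[OF ne bb, of j "c j + e'"] e' by (simp add: c_def)
  then obtain y where y: "\<And>j. y j \<in> ?I j" "\<And>j. h (y j) < c j + e'" by metis
  \<comment> \<open>Infimum times length is at most the mass of the cell, which turns the window
    bound into the flatness condition for rectangles.\<close>
  have csmall: "12 * c j \<le> \<theta>\<^sup>2 * r" for j
  proof -
    have "ennreal (c j * r) = (\<integral>\<^sup>+x. ennreal (c j) * indicator (?I j) x \<partial>lborel)"
      using r c0 by (subst nn_integral_cmult_indicator) (auto simp: ennreal_mult[symmetric] algebra_simps)
    also have "\<dots> \<le> (\<integral>\<^sup>+x\<in>{- R + real j * r..<- R + real j * r + r}. ennreal (h x) \<partial>lborel)"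
      by (rule nn_integral_mono) (auto simp: indicator_def algebra_simps intro!: ennreal_leI cle)
    also have "\<dots> = ennreal (LBINT x:{- R + real j * r..<- R + real j * r + r}. h x)"
      by (rule profile_nn_mass[OF h]) simp
    finally have "c j * r \<le> (LBINT x:{- R + real j * r..<- R + real j * r + r}. h x)"
      using profile_mass_nonneg[OF h] by (simp add: ennreal_le_iff)
    also have "\<dots> \<le> \<theta>\<^sup>2 * r\<^sup>2 / 12" by (rule v)
    finally have "12 * c j * r \<le> \<theta>\<^sup>2 * r * r" by (simp add: power2_eq_square)
    then show ?thesis using r by simp
  qed
  have "(1 - 3 * \<theta>) * (r * (\<Sum>j<N. c j)) \<le> dual_energy h"
  proof -
    obtain \<phi> D where t: "test_function (subgraph h \<inter> {-R<..<-R + real N * r} \<times> UNIV) \<phi> D"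
      and l: "(1 - 3 * \<theta>) * (r * (\<Sum>j<N. c j)) \<le> dual_functional \<phi> D"
      using cells_dual_functional[of \<theta> r N c "-R" h] th r c0 csmall cle by auto
    have "test_function (subgraph h) \<phi> D" by (rule test_function_mono[OF t]) auto
    from dual_energy_upper[OF h this] l show ?thesis by simp
  qed
  moreover have "(LBINT x. h x) - r * tv h - e \<le> r * (\<Sum>j<N. c j)"
  proof -
    have "(LBINT x:{-R..<R}. h x) \<le> (LBINT x:{-R..<-R + real N * r}. h x)"
      by (rule profile_mass_mono[OF h]) (use RN in auto)
    moreover have "ennreal (LBINT x:{-R..<-R + real N * r}. h x) \<le> ennreal (r * ((\<Sum>j<N. h (y j)) + tv h))"
      using nn_integral_le_cells[OF h r, of N "-R" y] y(1) profile_nn_mass[OF h, of "{-R..<-R + real N * r}"]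
      by (auto simp: less_imp_le)
    then have "(LBINT x:{-R..<-R + real N * r}. h x) \<le> r * ((\<Sum>j<N. h (y j)) + tv h)"
      using r profileD[OF h] tv_nonneg by (subst (asm) ennreal_le_iff) (auto intro!: mult_nonneg_nonneg add_nonneg_nonneg sum_nonneg)
    moreover have "(\<Sum>j<N. h (y j)) \<le> (\<Sum>j<N. c j + e')" by (rule sum_mono) (use y in \<open>auto intro: less_imp_le\<close>)
    then have "r * ((\<Sum>j<N. h (y j)) + tv h) \<le> r * ((\<Sum>j<N. c j) + real N * e' + tv h)"
      using r by (intro mult_left_mono) (auto simp: sum.distrib)
    moreover have "r * (real N * e') = e / 2" using r N0 by (simp add: e'_def)
    ultimately show ?thesis using R(2) by (simp add: algebra_simps)
  qed
  then have "(1 - 3 * \<theta>) * ((LBINT x. h x) - r * tv h - e) \<le> (1 - 3 * \<theta>) * (r * (\<Sum>j<N. c j))"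
    using th by (intro mult_left_mono) auto
  moreover have "(1 - 3 * \<theta>) * e \<le> 1 * e" using th e by (intro mult_right_mono) auto
  ultimately show "(1 - 3 * \<theta>) * ((LBINT x. h x) - r * tv h) \<le> dual_energy h + e"
    by (simp add: algebra_simps)
qed

subsection \<open>Existence for the reduced problem\<close>

definition denergy :: "(real \<Rightarrow> real) \<Rightarrow> real" where
  "denergy h = dual_energy h + tv h"

definition is_minimizer :: "(real \<Rightarrow> real) \<Rightarrow> bool" where
  "is_minimizer h \<longleftrightarrow> profile h \<and> (\<forall>g. profile g \<longrightarrow> (LBINT x. g x) = (LBINT x. h x) \<longrightarrow> denergy h \<le> denergy g)"

lemma denergy_nonneg: "profile h \<Longrightarrow> 0 \<le> denergy h"
  unfolding denergy_def using dual_energy_nonneg tv_nonneg profileD by (simp add: add_nonneg_nonneg)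

text \<open>Dilation by \<open>t \<ge> 1\<close> multiplies the Dirichlet part by \<open>t\<^sup>2\<close> but the variation only by \<open>t\<close>.
  The gain, quantified in the second summand, rules out splitting of mass.\<close>

lemma denergy_lower_bound:
  assumes V: "0 < V" and m: "\<And>g. profile g \<Longrightarrow> (LBINT x. g x) = V \<Longrightarrow> m \<le> denergy g" and m0: "0 \<le> m"
    and k: "profile k" "(LBINT x. k x) \<le> V"
  shows "m / V * (LBINT x. k x) + (V - (LBINT x. k x)) / (2 * V) * tv k \<le> denergy k"
proof (cases "(LBINT x. k x) = 0")
  case True
  then show ?thesis using V dual_energy_nonneg[OF k(1)] tv_nonneg[OF profileD(4)[OF k(1)]]
    by (simp add: denergy_def)
next
  case False
  define v where "v = (LBINT x. k x)"
  have v: "0 < v" "v \<le> V" using False k profileD(2)[OF k(1)] unfolding v_def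
    by (auto simp: less_le intro!: Bochner_Integration.integral_nonneg)
  \<comment> \<open>Mass scales with the square of the ratio, so this ratio raises the mass of
    \<open>k\<close> to \<open>V\<close>.\<close>
  define t where "t = sqrt (V / v)"
  have t: "0 < t" "t\<^sup>2 = V / v" using v V by (auto simp: t_def)
  have "profile (rescale 0 t k)" "(LBINT x. rescale 0 t k x) = V"
    using profile_rescale[OF k(1) t(1), of 0] t v by (auto simp: v_def)
  then have "m \<le> denergy (rescale 0 t k)" by (rule m)
  also have "\<dots> \<le> t\<^sup>2 * dual_energy k + t * tv k" unfolding denergy_def
    by (intro add_mono dual_energy_rescale[OF k(1) t(1)] profile_rescale(2)[OF k(1) t(1)])
  finally have "m * (v / V) \<le> (t\<^sup>2 * dual_energy k + t * tv k) * (v / V)"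
    using v V by (intro mult_right_mono) auto
  also have "\<dots> = dual_energy k + sqrt (v / V) * tv k"
  proof -
    have "t * (v / V) = sqrt (v / V)" using v V by (simp add: t_def real_sqrt_divide field_simps)
    moreover have "t\<^sup>2 * (v / V) = 1" using t v V by simp
    moreover have "(t\<^sup>2 * dual_energy k + t * tv k) * (v / V) = (t\<^sup>2 * (v / V)) * dual_energy k + (t * (v / V)) * tv k"
      by (simp add: algebra_simps)
    ultimately show ?thesis by (simp only: mult_1_left)
  qed
  finally have 1: "m * (v / V) \<le> dual_energy k + sqrt (v / V) * tv k" .
  \<comment> \<open>The tangent bound sqrt s \<le> (1 + s) / 2 turns the lower scaling power of the
    variation into a gain linear in the missing mass.\<close>
  have "sqrt (v / V) \<le> 1 - (V - v) / (2 * V)"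
  proof (rule real_le_lsqrt)
    have eq: "1 - (V - v) / (2 * V) = (1 + v / V) / 2" using V by (simp add: field_simps)
    have "s \<le> ((1 + s) / 2)\<^sup>2" for s :: real
      using zero_le_power2[of "1 - s"] by (simp add: power2_eq_square algebra_simps)
    then show "v / V \<le> (1 - (V - v) / (2 * V))\<^sup>2" unfolding eq .
    show "0 \<le> 1 - (V - v) / (2 * V)" using v V by (simp add: field_simps)
  qed
  then have "sqrt (v / V) * tv k \<le> (1 - (V - v) / (2 * V)) * tv k"
    by (rule mult_right_mono) (rule tv_nonneg[OF profileD(4)[OF k(1)]])
  then show ?thesis using 1 by (simp add: denergy_def v_def[symmetric] algebra_simps)
qed

lemma profile_cut_masses:
  assumes h: "profile h" and ab: "a \<le> b"
  shows "(LBINT x. lcut a h x) + (LBINT x:{a..b}. h x) + (LBINT x. rcut b h x) = (LBINT x. h x)"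
proof -
  have i: "integrable lborel (\<lambda>x. indicator {a..b} x *\<^sub>R h x)"
    using profileD(3)[OF h] by (intro integrable_mult_indicator) auto
  have "(LBINT x. h x) = (LBINT x. lcut a h x + indicator {a..b} x *\<^sub>R h x + rcut b h x)"
    by (rule Bochner_Integration.integral_cong) (use ab in \<open>auto simp: lcut_def rcut_def indicator_def\<close>)
  also have "\<dots> = (LBINT x. lcut a h x) + (LBINT x. indicator {a..b} x *\<^sub>R h x) + (LBINT x. rcut b h x)"
    using i profileD(3)[OF profile_lcut[OF h]] profileD(3)[OF profile_rcut[OF h]] by simp
  finally show ?thesis by (simp add: set_lebesgue_integral_def)
qed

lemma profile_small_left:
  assumes h: "profile h" and e: "0 < e"
  shows "\<exists>x\<le>a. h x < e"
proof -
  define k where "k x = h (- x)" for x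
  have i: "integrable lborel k" unfolding k_def
    using lborel_integrable_real_affine[OF profileD(3)[OF h], of "-1" 0] by simp
  show ?thesis
  proof (rule ccontr)
    assume n: "\<not> ?thesis"
    have g: "e \<le> k x" if "x \<ge> - a" for x
    proof -
      have "- x \<le> a" using that by simp
      then show ?thesis using n unfolding k_def by (meson not_less)
    qed
    have "\<infinity> = ennreal e * emeasure lborel {-a..}" using e
      by (simp add: emeasure_Ici_infinite ennreal_mult_top)
    also have "\<dots> = (\<integral>\<^sup>+x. ennreal e * indicator {-a..} x \<partial>lborel)"
      by (rule nn_integral_cmult_indicator[symmetric]) simp
    also have "\<dots> \<le> (\<integral>\<^sup>+x. ennreal (k x) \<partial>lborel)"
      by (rule nn_integral_mono) (auto simp: indicator_def intro!: ennreal_leI g)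
    also have "\<dots> < \<infinity>" using i profileD(2)[OF h] by (subst nn_integral_eq_integral) (auto simp: k_def)
    finally show False by simp
  qed
qed

text \<open>Almost optimal data for \<open>g\<close>, a test function and a sorted list, live in a
  bounded region and transfer to \<open>h n\<close>. The cuts lie outside this region, at points
  where \<open>h n\<close> is small because \<open>g\<close> is small nearby, and the pieces beyond
  them pay at least \<open>m / V\<close> per unit of mass.\<close>

lemma gamma_limit_energy:
  assumes V: "0 < V" and m: "\<And>g. profile g \<Longrightarrow> (LBINT x. g x) = V \<Longrightarrow> m \<le> denergy g" and m0: "0 \<le> m"
    and h: "\<And>n. profile (h n)" "\<And>n. (LBINT x. h n x) = V"
    and lim: "(\<lambda>n. denergy (h n)) \<longlonglongrightarrow> m" and C: "\<And>n. tv (h n) \<le> C"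
    and g: "gamma_lim h g" "profile g"
  shows "denergy g + m / V * (V - (LBINT x. g x)) \<le> m"
proof (rule field_le_epsilon)
  fix e0 :: real assume e0: "0 < e0"
  define \<rho> where "\<rho> = m / V"
  have rho: "0 \<le> \<rho>" using m0 V by (simp add: \<rho>_def)
  \<comment> \<open>Eight errors \<open>e\<close> accumulate: one each from the test function, the
    list for \<open>g\<close>, its recovery and the energy of \<open>h n\<close>, and two from each
    cut. The mass between the cuts contributes \<open>\<rho> * e\<close>.\<close>
  define e where "e = e0 / (8 + 2 * \<rho>)"
  have e: "0 < e" using e0 rho by (simp add: e_def)
  have g0: "0 \<le> g x" for x using profileD(2)[OF g(2)] .
  obtain \<phi> D where t: "test_function (subgraph g) \<phi> D" "dual_energy g - e < dual_functional \<phi> D"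
    using dual_energy_approx[OF e] by blast
  obtain K where K: "compact K" "K \<subseteq> subgraph g" "\<And>x. x \<notin> K \<Longrightarrow> \<phi> x = 0 \<and> D x = 0"
    using test_function_compact[OF t(1)] by blast
  obtain xs where xs: "sorted xs" "tv g - e < vsum g xs" using tv_approx[OF profileD(4)[OF g(2)] e] by blast
  obtain R1 where R1: "\<And>x. x \<in> set xs \<Longrightarrow> \<bar>x\<bar> \<le> R1"
  proof -
    have "bounded (set xs)" by (simp add: finite_imp_bounded)
    then show thesis using that by (auto simp: bounded_iff)
  qed
  obtain R2 where R2: "\<And>z. z \<in> K \<Longrightarrow> norm z \<le> R2" using compact_imp_bounded[OF K(1)] by (auto simp: bounded_iff)
  define R where "R = max 0 (max R1 R2)"
  \<comment> \<open>The margin 2 absorbs a displacement by less than 1 of the cut point and another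
    one of the points of the recovered list.\<close>
  obtain a where a: "a \<le> - R - 2" "g a < e" using profile_small_left[OF g(2) e] by blast
  obtain b where b: "R + 2 \<le> b" "g b < e" using profile_small_outside[OF g(2) e] by blast
  let ?V1 = "LBINT x. g x"
  have ev1: "\<forall>\<^sub>F n in sequentially. K \<subseteq> subgraph (h n)" by (rule gamma_lim_subgraph[OF g(1) K(1,2)])
  have ev2: "\<forall>\<^sub>F n in sequentially. \<exists>ys. sorted ys \<and> (\<forall>y\<in>set ys. \<exists>x\<in>set xs. \<bar>y - x\<bar> < 1) \<and> vsum g xs - e \<le> vsum (h n) ys"
    by (rule gamma_lim_vsum[OF g(1) xs(1) e]) simp
  have ev3: "\<forall>\<^sub>F n in sequentially. \<exists>y. \<bar>y - a\<bar> < 1 \<and> h n y < g a + e" by (rule gamma_lim_upper[OF g(1) e]) simp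
  have ev4: "\<forall>\<^sub>F n in sequentially. \<exists>y. \<bar>y - b\<bar> < 1 \<and> h n y < g b + e" by (rule gamma_lim_upper[OF g(1) e]) simp
  have ev5: "\<forall>\<^sub>F n in sequentially. (\<integral>\<^sup>+x\<in>{a - 1..<b + 1}. ennreal (h n x) \<partial>lborel)
      \<le> (\<integral>\<^sup>+x\<in>{a - 1..<b + 1}. ennreal (g x) \<partial>lborel) + ennreal e"
    by (rule gamma_lim_interval[OF g(1) h(1) C _ e]) (use a b R_def in auto)
  have ev6: "\<forall>\<^sub>F n in sequentially. denergy (h n) < m + e" using lim by (rule order_tendstoD) (use e in simp)
  obtain n where n: "K \<subseteq> subgraph (h n)"
    "\<exists>ys. sorted ys \<and> (\<forall>y\<in>set ys. \<exists>x\<in>set xs. \<bar>y - x\<bar> < 1) \<and> vsum g xs - e \<le> vsum (h n) ys"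
    "\<exists>y. \<bar>y - a\<bar> < 1 \<and> h n y < g a + e" "\<exists>y. \<bar>y - b\<bar> < 1 \<and> h n y < g b + e"
    "(\<integral>\<^sup>+x\<in>{a - 1..<b + 1}. ennreal (h n x) \<partial>lborel) \<le> (\<integral>\<^sup>+x\<in>{a - 1..<b + 1}. ennreal (g x) \<partial>lborel) + ennreal e"
    "denergy (h n) < m + e"
    using eventually_happens[OF eventually_conj[OF ev1 eventually_conj[OF ev2 eventually_conj[OF ev3 eventually_conj[OF ev4 eventually_conj[OF ev5 ev6]]]]]]
    by auto
  obtain ys where ys: "sorted ys" "\<And>y. y \<in> set ys \<Longrightarrow> \<exists>x\<in>set xs. \<bar>y - x\<bar> < 1" "vsum g xs - e \<le> vsum (h n) ys"
    using n(2) by blast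
  obtain p where p: "\<bar>p - a\<bar> < 1" "h n p < g a + e" using n(3) by blast
  obtain q where q: "\<bar>q - b\<bar> < 1" "h n q < g b + e" using n(4) by blast
  have pR: "p < - R - 1" "R + 1 < q" using p q a b by linarith+
  have pq: "p \<le> q" using pR by (simp add: R_def)
  have "set ys \<subseteq> {p..q}"
  proof
    fix y assume "y \<in> set ys"
    then obtain x where x: "x \<in> set xs" "\<bar>y - x\<bar> < 1" using ys(2) by blast
    then have "\<bar>x\<bar> \<le> R" using R1[OF x(1)] by (simp add: R_def)
    then show "y \<in> {p..q}" using x pR by auto
  qed
  then have tvc: "tv (lcut p (h n)) + vsum (h n) ys + tv (rcut q (h n)) \<le> tv (h n) + h n p + h n q"
    by (rule tv_cuts[OF h(1) pq ys(1)])
  have tn: "test_function (subgraph (h n)) \<phi> D" by (rule test_function_restrict[OF t(1) K(1) n(1)]) (use K(3) in blast)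
  have dc: "dual_energy (lcut p (h n)) + dual_functional \<phi> D + dual_energy (rcut q (h n)) \<le> dual_energy (h n)"
  proof (rule dual_energy_cuts[OF h(1) pq tn])
    fix x y assume x: "x < p \<or> q < x"
    have "(x, y) \<notin> K"
    proof
      assume "(x, y) \<in> K"
      then have "\<bar>x\<bar> \<le> R" using R2[of "(x, y)"] norm_fst_le[of x y] by (simp add: R_def)
      then show False using x pR by auto
    qed
    then show "\<phi> (x, y) = 0 \<and> D (x, y) = 0" using K(3) by blast
  qed
  have mass: "(LBINT x:{p..q}. h n x) \<le> ?V1 + e"
  proof -
    have "(LBINT x:{p..q}. h n x) \<le> (LBINT x:{a - 1..<b + 1}. h n x)"
      by (rule profile_mass_mono[OF h(1)]) (use p q in auto)
    also have "\<dots> \<le> (LBINT x:{a - 1..<b + 1}. g x) + e"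
    proof -
      have "ennreal (LBINT x:{a - 1..<b + 1}. h n x) \<le> ennreal ((LBINT x:{a - 1..<b + 1}. g x) + e)"
        using n(5) profile_nn_mass[OF h(1), of "{a - 1..<b + 1}" n] profile_nn_mass[OF g(2), of "{a - 1..<b + 1}"]
          profile_mass_nonneg[OF g(2)] e by simp
      then show ?thesis using profile_mass_nonneg[OF g(2)] e by (subst (asm) ennreal_le_iff) (auto intro: add_nonneg_nonneg)
    qed
    also have "(LBINT x:{a - 1..<b + 1}. g x) \<le> ?V1" by (rule profile_mass_mono(2)[OF g(2), of _ UNIV]) auto
    finally show ?thesis by simp
  qed
  let ?l = "lcut p (h n)" and ?r = "rcut q (h n)"
  note pl = profile_lcut[OF h(1), of p n] and pr = profile_rcut[OF h(1), of q n]
  have l0: "0 \<le> (LBINT x. ?l x)" "0 \<le> (LBINT x. ?r x)" "0 \<le> (LBINT x:{p..q}. h n x)"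
    using profileD(2)[OF pl] profileD(2)[OF pr] profile_mass_nonneg[OF h(1)] by (auto intro!: Bochner_Integration.integral_nonneg)
  have cm: "(LBINT x. ?l x) + (LBINT x:{p..q}. h n x) + (LBINT x. ?r x) = V"
    using profile_cut_masses[OF h(1) pq, of n] h(2) by simp
  \<comment> \<open>Here the variation gain of the outer pieces is dropped; the gain of
    \<open>g\<close> is exploited only after the limit.\<close>
  have lb: "\<rho> * (LBINT x. k x) \<le> denergy k" if k: "profile k" "(LBINT x. k x) \<le> V" for k
  proof -
    have "0 \<le> (V - (LBINT x. k x)) / (2 * V) * tv k"
      using k V tv_nonneg[OF profileD(4)[OF k(1)]] by (intro mult_nonneg_nonneg) auto
    then show ?thesis using denergy_lower_bound[OF V m m0 k] by (simp add: \<rho>_def)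
  qed
  have "\<rho> * (LBINT x. ?l x) + \<rho> * (LBINT x. ?r x) \<le> denergy ?l + denergy ?r"
    using lb[OF pl] lb[OF pr] l0 cm by simp
  moreover have "\<rho> * (V - ?V1 - e) \<le> \<rho> * ((LBINT x. ?l x) + (LBINT x. ?r x))"
    using rho mass cm by (intro mult_left_mono) auto
  ultimately have "\<rho> * (V - ?V1) + dual_energy g + tv g \<le> m + 8 * e + \<rho> * e"
    using tvc dc n(6) p(2) q(2) a(2) b(2) ys(3) xs(2) t(2) unfolding denergy_def
    by (simp add: algebra_simps)
  also have "\<dots> \<le> m + e0"
  proof -
    have "(8 + 2 * \<rho>) * e = e0" using rho by (simp add: e_def)
    moreover have "0 \<le> \<rho> * e" using rho e by simp
    ultimately show ?thesis by (simp add: distrib_right)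
  qed
  finally show "denergy g + m / V * (V - ?V1) \<le> m + e0" by (simp add: denergy_def \<rho>_def)
qed

lemma profile_tv_pos:
  assumes g: "profile g" and p: "0 < (LBINT x. g x)"
  shows "0 < tv g"
proof -
  have "\<exists>x. 0 < g x"
  proof (rule ccontr)
    assume "\<not> ?thesis"
    then have "g x = 0" for x using profileD(2)[OF g, of x] by (meson antisym not_less)
    then show False using p by simp
  qed
  then show ?thesis using profile_le_tv[OF g] less_le_trans by blast
qed

theorem dual_minimizer:
  assumes V: "0 < V" and k: "profile k" "(LBINT x. k x) = V" "denergy k < V"
  shows "\<exists>h. is_minimizer h \<and> (LBINT x. h x) = V"
proof -
  let ?S = "{h. profile h \<and> (LBINT x. h x) = V}"
  define m where "m = (INF h\<in>?S. denergy h)"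
  have bb: "bdd_below (denergy ` ?S)" by (rule bdd_belowI2[of _ 0]) (auto intro: denergy_nonneg)
  have ne: "?S \<noteq> {}" using k by blast
  have m: "m \<le> denergy g" if "profile g" "(LBINT x. g x) = V" for g
    unfolding m_def by (rule cINF_lower[OF bb]) (use that in simp)
  have m0: "0 \<le> m" unfolding m_def by (rule cINF_greatest[OF ne]) (auto intro: denergy_nonneg)
  have mV: "m < V" using m[OF k(1,2)] k(3) by simp
  \<comment> \<open>\<open>m + d = V - d\<close> is the midpoint of \<open>m\<close> and
    \<open>V\<close>. The energies of the sequence stay below it, while vanishing would lift them to
    at least this value.\<close>
  define d where "d = (V - m) / 2"
  have d: "0 < d" using mV by (simp add: d_def)
  define s where "s n = d / real (Suc n)" for n
  have s: "0 < s n" "s n \<le> d" for n using d by (auto simp: s_def divide_simps)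
  have "\<exists>h\<in>?S. denergy h < m + s n" for n
    using cINF_less_iff[OF ne bb, of "m + s n"] s[of n] by (simp add: m_def)
  then obtain h where h: "\<And>n. profile (h n)" "\<And>n. (LBINT x. h n x) = V" "\<And>n. denergy (h n) < m + s n"
    by (metis (mono_tags, lifting) mem_Collect_eq)
  define C where "C = m + d"
  have C0: "0 < C" using m0 d by (simp add: C_def)
  have C: "tv (h n) \<le> C" for n
    using h(3)[of n] s(2)[of n] dual_energy_nonneg[OF h(1), of n] by (simp add: C_def denergy_def)
  \<comment> \<open>Both losses in the vanishing bound, \<open>3 * \<theta> * V\<close> and
    \<open>r * C\<close>, are adjusted to \<open>d / 2\<close>.\<close>
  define \<theta> where "\<theta> = d / (6 * V)"
  define r where "r = d / (2 * C)"
  have th: "0 < \<theta>" "3 * \<theta> < 1" using d V m0 by (auto simp: \<theta>_def d_def field_simps)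
  have r: "0 < r" using d C0 by (simp add: r_def)
  define \<eta> where "\<eta> = \<theta>\<^sup>2 * r\<^sup>2 / 12"
  have eta: "0 < \<eta>" using th r by (simp add: \<eta>_def)
  have "\<exists>a. \<eta> < (LBINT x:{a..<a + r}. h n x)" for n
  proof (rule ccontr)
    assume "\<not> ?thesis"
    then have "(LBINT x:{a..<a + r}. h n x) \<le> \<theta>\<^sup>2 * r\<^sup>2 / 12" for a by (simp add: \<eta>_def not_less)
    from dual_energy_vanishing[OF h(1) th r this]
    have "(1 - 3 * \<theta>) * (V - r * tv (h n)) \<le> dual_energy (h n)" by (simp add: h(2))
    moreover have "(1 - 3 * \<theta>) * (V - r * C) \<le> (1 - 3 * \<theta>) * (V - r * tv (h n))"
      using th r C[of n] by (intro mult_left_mono) auto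
    moreover have "(1 - 3 * \<theta>) * (V - r * C) = V - d / 2 - d / 2 + 3 * \<theta> * (d / 2)"
    proof -
      have *: "r * C = d / 2" "3 * \<theta> * V = d / 2" using C0 V by (auto simp: r_def \<theta>_def)
      have **: "(1 - 3 * \<theta>) * (V - r * C) = V - 3 * \<theta> * V - r * C + 3 * \<theta> * (r * C)" by (simp add: algebra_simps)
      show ?thesis unfolding ** unfolding * ..
    qed
    moreover have "0 \<le> 3 * \<theta> * (d / 2)" using th d by simp
    moreover have "dual_energy (h n) \<le> m + d"
      using h(3)[of n] s(2)[of n] tv_nonneg[OF profileD(4)[OF h(1)], of n] by (simp add: denergy_def)
    moreover have "dual_energy (h n) < m + d"
      using h(3)[of n] s(2)[of n] tv_nonneg[OF profileD(4)[OF h(1)], of n] by (simp add: denergy_def)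
    ultimately have "V - d < m + d" by linarith
    then show False by (simp add: d_def field_simps)
  qed
  then obtain a where a: "\<And>n. \<eta> < (LBINT x:{a n..<a n + r}. h n x)" by metis
  \<comment> \<open>Moving the nonvanishing mass into the fixed window \<open>{0..<r}\<close>
    prevents it from escaping in the limit.\<close>
  define k' where "k' n = rescale (- a n) 1 (h n)" for n
  have k'x: "k' n x = h n (x + a n)" for n x by (simp add: k'_def rescale_def)
  have k'p: "profile (k' n)" "(LBINT x. k' n x) = V" "tv (k' n) \<le> C" for n
    using profile_rescale[OF h(1), of 1 "- a n" n] h(2) C[of n] by (auto simp: k'_def)
  have k'e: "denergy (k' n) \<le> denergy (h n)" for n
    using profile_rescale(2)[OF h(1), of 1 "- a n" n] dual_energy_rescale[OF h(1), of 1 "- a n" n]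
    by (simp add: k'_def denergy_def)
  have k'm: "\<eta> < (LBINT x:{0..<r}. k' n x)" for n
  proof -
    have "(LBINT x. indicator {a n..<a n + r} x *\<^sub>R h n x) = (LBINT x. indicator {a n..<a n + r} (a n + 1 * x) *\<^sub>R h n (a n + 1 * x))"
      using lborel_integral_real_affine[of 1 "\<lambda>x. indicator {a n..<a n + r} x *\<^sub>R h n x" "a n"] by simp
    also have "\<dots> = (LBINT x. indicator {0..<r} x *\<^sub>R k' n x)"
      by (rule Bochner_Integration.integral_cong) (auto simp: k'x indicator_def add.commute)
    finally show ?thesis using a[of n] by (simp add: set_lebesgue_integral_def)
  qed
  have "\<exists>f g. strict_mono f \<and> gamma_lim (k' \<circ> f) g"
    by (rule gamma_compactness[of k' C])
      (use profileD(2)[OF k'p(1)] order_trans[OF profile_le_tv[OF k'p(1)] k'p(3)] in auto)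
  then obtain f g where f: "strict_mono f" and g: "gamma_lim (k' \<circ> f) g" by blast
  have hp: "profile ((k' \<circ> f) n)" "(LBINT x. (k' \<circ> f) n x) = V" "tv ((k' \<circ> f) n) \<le> C" for n using k'p by auto
  have gp: "profile g" "(LBINT x. g x) \<le> V"
    using gamma_lim_profile[OF g hp(1) hp(3), of V] hp(2) by auto
  have "(\<lambda>n. denergy ((k' \<circ> f) n)) \<longlonglongrightarrow> m"
  proof (rule tendsto_sandwich[of "\<lambda>_. m" _ _ "\<lambda>n. m + s (f n)"])
    have "s \<longlonglongrightarrow> 0" unfolding s_def using tendsto_mult_right_zero[OF LIMSEQ_inverse_real_of_nat, of d] by (simp add: divide_inverse)
    then have "(\<lambda>n. s (f n)) \<longlonglongrightarrow> 0" using LIMSEQ_subseq_LIMSEQ[OF _ f] by (simp add: o_def)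
    then show "(\<lambda>n. m + s (f n)) \<longlonglongrightarrow> m" using tendsto_add[OF tendsto_const[of m]] by fastforce
    show "\<forall>\<^sub>F n in sequentially. denergy ((k' \<circ> f) n) \<le> m + s (f n)"
      using k'e h(3) by (auto intro!: always_eventually less_imp_le intro: le_less_trans)
  qed (use m hp in auto)
  from gamma_limit_energy[OF V m m0 hp(1,2) this hp(3) g gp(1)]
  have E: "denergy g + m / V * (V - (LBINT x. g x)) \<le> m" by simp
  let ?V1 = "LBINT x. g x"
  \<comment> \<open>On the fixed window the limit loses at most \<open>\<eta> / 2\<close> of the
    mass \<open>\<eta>\<close>.\<close>
  have V1: "0 < ?V1"
  proof -
    have "\<forall>\<^sub>F n in sequentially. (\<integral>\<^sup>+x\<in>{0..<r}. ennreal ((k' \<circ> f) n x) \<partial>lborel)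
      \<le> (\<integral>\<^sup>+x\<in>{0..<r}. ennreal (g x) \<partial>lborel) + ennreal (\<eta> / 2)"
      by (rule gamma_lim_interval[OF g hp(1,3) r]) (use eta in simp)
    then obtain n where "(\<integral>\<^sup>+x\<in>{0..<r}. ennreal ((k' \<circ> f) n x) \<partial>lborel)
      \<le> (\<integral>\<^sup>+x\<in>{0..<r}. ennreal (g x) \<partial>lborel) + ennreal (\<eta> / 2)" using eventually_happens by fastforce
    then have "ennreal (LBINT x:{0..<r}. k' (f n) x) \<le> ennreal ((LBINT x:{0..<r}. g x) + \<eta> / 2)"
      using profile_nn_mass[OF hp(1), of "{0..<r}" n] profile_nn_mass[OF gp(1), of "{0..<r}"] profile_mass_nonneg[OF gp(1)] eta
      by simp
    then have "(LBINT x:{0..<r}. k' (f n) x) \<le> (LBINT x:{0..<r}. g x) + \<eta> / 2"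
      using profile_mass_nonneg[OF gp(1)] eta by (subst (asm) ennreal_le_iff) (auto intro: add_nonneg_nonneg)
    moreover have "(LBINT x:{0..<r}. g x) \<le> ?V1" by (rule profile_mass_mono(2)[OF gp(1), of _ UNIV]) auto
    ultimately show ?thesis using k'm[of "f n"] eta by linarith
  qed
  have lower: "m / V * ?V1 + (V - ?V1) / (2 * V) * tv g \<le> denergy g"
    by (rule denergy_lower_bound[OF V m m0 gp])
  have "m / V * (V - ?V1) = m - m / V * ?V1" using V by (simp add: right_diff_distrib)
  then have upper: "denergy g + (m - m / V * ?V1) \<le> m" using E by simp
  \<comment> \<open>The energy of \<open>g\<close> and the terms proportional to mass cancel between
    the two bounds. Only the gain survives, and positive variation then excludes missing
    mass.\<close>
  have "x \<le> 0" if "a + x \<le> d" "d + (m - a) \<le> m" for a x d :: real using that by linarith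
  from this[OF lower upper] have "(V - ?V1) / (2 * V) * tv g \<le> 0" .
  then have "V \<le> ?V1" using V profile_tv_pos[OF gp(1) V1] by (auto simp: mult_le_0_iff divide_le_0_iff)
  then have V1V: "?V1 = V" using gp(2) by simp
  then have "denergy g \<le> m" using E by simp
  then show ?thesis using gp(1) V1V m unfolding is_minimizer_def by (intro exI[of _ g]) fastforce
qed

subsection \<open>Decay of minimizers\<close>

text \<open>Cutting raises the variation by at most \<open>2 * h R\<close>. The masses of the pieces
  add up to that of \<open>h\<close>, so the linear parts of their lower bounds add up to the
  minimal energy and cancel; the two gains are left.\<close>

lemma minimizer_cut:
  assumes h: "is_minimizer h" and V: "0 < (LBINT x. h x)"
  shows "(LBINT x. lcut R h x) / (2 * (LBINT x. h x)) * tv (rcut R h)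
     + (LBINT x. rcut R h x) / (2 * (LBINT x. h x)) * tv (lcut R h) \<le> 2 * h R"
proof -
  define V where "V = (LBINT x. h x)"
  have p: "profile h" and m: "\<And>g. profile g \<Longrightarrow> (LBINT x. g x) = V \<Longrightarrow> denergy h \<le> denergy g"
    using h by (auto simp: is_minimizer_def V_def)
  have V0: "0 < V" using V by (simp add: V_def)
  let ?l = "lcut R h" and ?r = "rcut R h" and ?m = "denergy h"
  note pl = profile_lcut[OF p, of R] and pr = profile_rcut[OF p, of R]
  have s0: "(LBINT x:{R..R}. h x) = 0"
  proof -
    have "AE x in lborel. x \<noteq> R" by (rule AE_lborel_singleton)
    then have "(LBINT x. indicator {R..R} x *\<^sub>R h x) = (LBINT x::real. 0)"
      using profileD(5)[OF p] by (intro integral_cong_AE) auto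
    then show ?thesis by (simp add: set_lebesgue_integral_def)
  qed
  have l0: "0 \<le> (LBINT x. ?l x)" "0 \<le> (LBINT x. ?r x)"
    using profileD(2)[OF pl] profileD(2)[OF pr] by (auto intro!: Bochner_Integration.integral_nonneg)
  have cm: "(LBINT x. ?l x) + (LBINT x. ?r x) = V"
    using profile_cut_masses[OF p, of R R] s0 by (simp add: V_def)
  have "?m / V * (LBINT x. ?l x) + (V - (LBINT x. ?l x)) / (2 * V) * tv ?l \<le> denergy ?l"
    by (rule denergy_lower_bound[OF V0 m denergy_nonneg[OF p] pl]) (use l0 cm in auto)
  moreover have "?m / V * (LBINT x. ?r x) + (V - (LBINT x. ?r x)) / (2 * V) * tv ?r \<le> denergy ?r"
    by (rule denergy_lower_bound[OF V0 m denergy_nonneg[OF p] pr]) (use l0 cm in auto)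
  moreover have "tv ?l + tv ?r \<le> tv h + 2 * h R" using tv_cuts[OF p, of R R "[]"] by simp
  moreover have "dual_energy ?l + dual_energy ?r \<le> dual_energy h"
    using dual_energy_cuts[OF p order_refl test_function_null, of R] by (simp add: dual_functional_null)
  moreover have "?m / V * (LBINT x. ?l x) + ?m / V * (LBINT x. ?r x) = ?m"
  proof -
    have "?m / V * ((LBINT x. ?l x) + (LBINT x. ?r x)) = ?m" using cm V0 by simp
    then show ?thesis by (simp only: distrib_left)
  qed
  moreover have "V - (LBINT x. ?l x) = (LBINT x. ?r x)" "V - (LBINT x. ?r x) = (LBINT x. ?l x)" using cm by auto
  ultimately show ?thesis unfolding V_def[symmetric] denergy_def by simp
qed

text \<open>Tonelli: a point \<open>x\<close> is counted by all \<open>R\<close> between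
  \<open>x0\<close> and \<open>x\<close>, so the weight is replaced by its primitive.\<close>

lemma nn_integral_tails:
  fixes f w :: "real \<Rightarrow> ennreal"
  assumes [measurable]: "f \<in> borel_measurable borel" "w \<in> borel_measurable borel"
  shows "(\<integral>\<^sup>+R\<in>{x0<..}. w R * (\<integral>\<^sup>+x\<in>{R<..}. f x \<partial>lborel) \<partial>lborel) =
    (\<integral>\<^sup>+x. f x * (\<integral>\<^sup>+R\<in>{x0<..<x}. w R \<partial>lborel) \<partial>lborel)"
proof -
  have [measurable]: "(\<lambda>(R, x). w R * f x * indicator {(R::real, x::real). x0 < R \<and> R < x} (R, x)) \<in> borel_measurable (lborel \<Otimes>\<^sub>M lborel)"
    by measurable
  have "(\<integral>\<^sup>+R\<in>{x0<..}. w R * (\<integral>\<^sup>+x\<in>{R<..}. f x \<partial>lborel) \<partial>lborel) =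
      (\<integral>\<^sup>+R. \<integral>\<^sup>+x. w R * f x * indicator {(R, x). x0 < R \<and> R < x} (R, x) \<partial>lborel \<partial>lborel)"
  proof (rule nn_integral_cong)
    fix R
    have "w R * (\<integral>\<^sup>+x\<in>{R<..}. f x \<partial>lborel) * indicator {x0<..} R
        = w R * indicator {x0<..} R * (\<integral>\<^sup>+x\<in>{R<..}. f x \<partial>lborel)" by (simp add: mult_ac)
    also have "\<dots> = (\<integral>\<^sup>+x. w R * indicator {x0<..} R * (f x * indicator {R<..} x) \<partial>lborel)"
      by (rule nn_integral_cmult[symmetric]) measurable
    also have "\<dots> = (\<integral>\<^sup>+x. w R * f x * indicator {(R, x). x0 < R \<and> R < x} (R, x) \<partial>lborel)"
      by (rule nn_integral_cong) (auto simp: indicator_def)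
    finally show "w R * (\<integral>\<^sup>+x\<in>{R<..}. f x \<partial>lborel) * indicator {x0<..} R =
      (\<integral>\<^sup>+x. w R * f x * indicator {(R, x). x0 < R \<and> R < x} (R, x) \<partial>lborel)" .
  qed
  also have "\<dots> = (\<integral>\<^sup>+x. \<integral>\<^sup>+R. w R * f x * indicator {(R, x). x0 < R \<and> R < x} (R, x) \<partial>lborel \<partial>lborel)"
    by (rule lborel_pair.Fubini'[symmetric]) measurable
  also have "\<dots> = (\<integral>\<^sup>+x. f x * (\<integral>\<^sup>+R\<in>{x0<..<x}. w R \<partial>lborel) \<partial>lborel)"
  proof (rule nn_integral_cong)
    fix x
    have "(\<integral>\<^sup>+R. w R * f x * indicator {(R, x). x0 < R \<and> R < x} (R, x) \<partial>lborel) = (\<integral>\<^sup>+R. f x * (w R * indicator {x0<..<x} R) \<partial>lborel)"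
      by (rule nn_integral_cong) (auto simp: indicator_def mult_ac)
    also have "\<dots> = f x * (\<integral>\<^sup>+R\<in>{x0<..<x}. w R \<partial>lborel)" by (rule nn_integral_cmult) measurable
    finally show "(\<integral>\<^sup>+R. w R * f x * indicator {(R, x). x0 < R \<and> R < x} (R, x) \<partial>lborel) = f x * (\<integral>\<^sup>+R\<in>{x0<..<x}. w R \<partial>lborel)" .
  qed
  finally show ?thesis .
qed

text \<open>Integrating \<open>tl\<close> against \<open>1\<close> and then against \<open>R - x0\<close> gains one moment each time.\<close>

lemma second_moment_finite:
  fixes f :: "real \<Rightarrow> ennreal"
  assumes [measurable]: "f \<in> borel_measurable borel" and c: "0 < c"
    and fin: "(\<integral>\<^sup>+x. f x \<partial>lborel) < \<infinity>"
    and tl: "\<And>R. x0 < R \<Longrightarrow> ennreal c * (\<integral>\<^sup>+x\<in>{R<..}. f x \<partial>lborel) \<le> f R"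
  shows "(\<integral>\<^sup>+x\<in>{x0<..}. ennreal ((x - x0)\<^sup>2) * f x \<partial>lborel) < \<infinity>"
proof -
  have [measurable]: "(\<lambda>R. \<integral>\<^sup>+x\<in>{R<..}. f x \<partial>lborel) \<in> borel_measurable borel"
  proof -
    have "(\<lambda>R. \<integral>\<^sup>+x. f x * indicator {(R, x). R < x} (R, x) \<partial>lborel) \<in> borel_measurable borel" by measurable
    moreover have "(\<lambda>R. \<integral>\<^sup>+x. f x * indicator {(R, x). R < x} (R, x) \<partial>lborel) = (\<lambda>R. \<integral>\<^sup>+x\<in>{R<..}. f x \<partial>lborel)"
      by (intro ext nn_integral_cong) (auto simp: indicator_def)
    ultimately show ?thesis by simp
  qed
  have bound: "ennreal c * (\<integral>\<^sup>+R\<in>{x0<..}. w R * (\<integral>\<^sup>+x\<in>{R<..}. f x \<partial>lborel) \<partial>lborel) \<le> (\<integral>\<^sup>+R\<in>{x0<..}. w R * f R \<partial>lborel)"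
    if [measurable]: "w \<in> borel_measurable borel" for w :: "real \<Rightarrow> ennreal"
  proof -
    have "ennreal c * (\<integral>\<^sup>+R\<in>{x0<..}. w R * (\<integral>\<^sup>+x\<in>{R<..}. f x \<partial>lborel) \<partial>lborel)
      = (\<integral>\<^sup>+R. ennreal c * (w R * (\<integral>\<^sup>+x\<in>{R<..}. f x \<partial>lborel) * indicator {x0<..} R) \<partial>lborel)"
      by (rule nn_integral_cmult[symmetric]) measurable
    also have "\<dots> \<le> (\<integral>\<^sup>+R\<in>{x0<..}. w R * f R \<partial>lborel)"
    proof (rule nn_integral_mono)
      fix R
      show "ennreal c * (w R * (\<integral>\<^sup>+x\<in>{R<..}. f x \<partial>lborel) * indicator {x0<..} R) \<le> w R * f R * indicator {x0<..} R"
        using mult_left_mono[OF tl[of R], of "w R"] by (auto simp: indicator_def mult_ac)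
    qed
    finally show ?thesis .
  qed
  have fin': "a < \<infinity>" if "ennreal c * a < \<infinity>" for a :: ennreal
    using that c by (auto simp: ennreal_mult_less_top)
  have "(\<integral>\<^sup>+R\<in>{x0<..}. 1 * f R \<partial>lborel) \<le> (\<integral>\<^sup>+x. f x \<partial>lborel)"
    by (rule nn_integral_mono) (auto simp: indicator_def)
  then have "(\<integral>\<^sup>+R\<in>{x0<..}. 1 * (\<integral>\<^sup>+x\<in>{R<..}. f x \<partial>lborel) \<partial>lborel) < \<infinity>"
    by (intro fin'[OF le_less_trans[OF bound le_less_trans[OF _ fin]]]) auto
  then have "(\<integral>\<^sup>+x. f x * (\<integral>\<^sup>+R\<in>{x0<..<x}. 1 \<partial>lborel) \<partial>lborel) < \<infinity>"
    by (subst nn_integral_tails[symmetric]) auto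
  also have "(\<integral>\<^sup>+x. f x * (\<integral>\<^sup>+R\<in>{x0<..<x}. 1 \<partial>lborel) \<partial>lborel) = (\<integral>\<^sup>+R\<in>{x0<..}. ennreal (R - x0) * f R \<partial>lborel)"
  proof (rule nn_integral_cong)
    fix x show "f x * (\<integral>\<^sup>+R\<in>{x0<..<x}. 1 \<partial>lborel) = ennreal (x - x0) * f x * indicator {x0<..} x"
      by (cases "x0 < x") (auto simp: mult.commute)
  qed
  finally have "(\<integral>\<^sup>+R\<in>{x0<..}. ennreal (R - x0) * (\<integral>\<^sup>+x\<in>{R<..}. f x \<partial>lborel) \<partial>lborel) < \<infinity>"
    by (intro fin'[OF le_less_trans[OF bound]]) auto
  then have "(\<integral>\<^sup>+x. f x * (\<integral>\<^sup>+R\<in>{x0<..<x}. ennreal (R - x0) \<partial>lborel) \<partial>lborel) < \<infinity>"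
    by (subst nn_integral_tails[symmetric]) auto
  then have "ennreal 4 * (\<integral>\<^sup>+x. f x * (\<integral>\<^sup>+R\<in>{x0<..<x}. ennreal (R - x0) \<partial>lborel) \<partial>lborel) < \<infinity>"
    by (simp add: ennreal_mult_less_top)
  moreover have "(\<integral>\<^sup>+x\<in>{x0<..}. ennreal ((x - x0)\<^sup>2) * f x \<partial>lborel) \<le>
      (\<integral>\<^sup>+x. ennreal 4 * (f x * (\<integral>\<^sup>+R\<in>{x0<..<x}. ennreal (R - x0) \<partial>lborel)) \<partial>lborel)"
  proof (rule nn_integral_mono)
    fix x
    show "ennreal ((x - x0)\<^sup>2) * f x * indicator {x0<..} x \<le> ennreal 4 * (f x * (\<integral>\<^sup>+R\<in>{x0<..<x}. ennreal (R - x0) \<partial>lborel))"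
    proof (cases "x0 < x")
      case True
      \<comment> \<open>On the right half of the interval the integrand is at least
        \<open>(x - x0) / 2\<close>. This gives a quarter of the square as a lower bound for the
        integral, whence the factor 4.\<close>
      let ?y = "(x0 + x) / 2"
      have "ennreal ((x - x0)\<^sup>2 / 4) = ennreal ((x - x0) / 2) * emeasure lborel {?y<..<x}"
        using True by (simp add: ennreal_mult[symmetric] power2_eq_square field_simps)
      also have "\<dots> = (\<integral>\<^sup>+R. ennreal ((x - x0) / 2) * indicator {?y<..<x} R \<partial>lborel)"
        by (rule nn_integral_cmult_indicator[symmetric]) simp
      also have "\<dots> \<le> (\<integral>\<^sup>+R\<in>{x0<..<x}. ennreal (R - x0) \<partial>lborel)"
        by (rule nn_integral_mono) (use True in \<open>auto simp: indicator_def intro!: ennreal_leI\<close>)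
      finally have "ennreal 4 * ennreal ((x - x0)\<^sup>2 / 4) \<le> ennreal 4 * (\<integral>\<^sup>+R\<in>{x0<..<x}. ennreal (R - x0) \<partial>lborel)"
        by (rule mult_left_mono) simp
      also have "ennreal 4 * ennreal ((x - x0)\<^sup>2 / 4) = ennreal ((x - x0)\<^sup>2)" by (subst ennreal_mult[symmetric]) auto
      finally have "ennreal ((x - x0)\<^sup>2) * f x \<le> ennreal 4 * (\<integral>\<^sup>+R\<in>{x0<..<x}. ennreal (R - x0) \<partial>lborel) * f x"
        by (rule mult_right_mono) simp
      then show ?thesis using True by (simp add: mult_ac)
    qed simp
  qed
  moreover have "\<dots> = ennreal 4 * (\<integral>\<^sup>+x. f x * (\<integral>\<^sup>+R\<in>{x0<..<x}. ennreal (R - x0) \<partial>lborel) \<partial>lborel)"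
  proof (rule nn_integral_cmult)
    have "(\<lambda>x. f x * (\<integral>\<^sup>+R. ennreal (R - x0) * indicator {(x, R). x0 < R \<and> R < x} (x, R) \<partial>lborel)) \<in> borel_measurable borel" by measurable
    moreover have "(\<integral>\<^sup>+R. ennreal (R - x0) * indicator {(x, R). x0 < R \<and> R < x} (x, R) \<partial>lborel) = (\<integral>\<^sup>+R\<in>{x0<..<x}. ennreal (R - x0) \<partial>lborel)" for x
      by (intro nn_integral_cong) (auto simp: indicator_def)
    ultimately show "(\<lambda>x. f x * (\<integral>\<^sup>+R\<in>{x0<..<x}. ennreal (R - x0) \<partial>lborel)) \<in> borel_measurable lborel" by simp
  qed
  ultimately show ?thesis by simp
qed

text \<open>For a cut to the right of \<open>x0\<close> the left piece has variation at least
  \<open>h x0\<close>, so the gain attached to it bounds the mass beyond \<open>R\<close> by a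
  multiple of \<open>h R\<close>. The left side is symmetric.\<close>

lemma minimizer_second_moment:
  assumes h: "is_minimizer h" and V: "0 < (LBINT x. h x)"
  shows "(\<integral>\<^sup>+x. ennreal (x\<^sup>2 * h x) \<partial>lborel) < \<infinity>"
proof -
  define V where "V = (LBINT x. h x)"
  have p: "profile h" using h by (simp add: is_minimizer_def)
  note [measurable] = profileD(5)[OF p]
  have V0: "0 < V" using V by (simp add: V_def)
  obtain x0 where x0: "0 < h x0"
    using V profileD(2)[OF p] by (metis Bochner_Integration.integral_cong integral_zero less_irrefl order_antisym_conv not_less)
  \<comment> \<open>The denominator collects \<open>2 * V\<close> and the factor 2 on the right of
    \<open>minimizer_cut\<close>.\<close>
  define c where "c = h x0 / (4 * V)"
  have c: "0 < c" using x0 V0 by (simp add: c_def)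
  have hn: "0 \<le> h x" for x by (rule profileD(2)[OF p])
  have nn: "0 \<le> (LBINT x. lcut R h x)" "0 \<le> (LBINT x. rcut R h x)" "0 \<le> tv (lcut R h)" "0 \<le> tv (rcut R h)" for R
    using profileD(2)[OF profile_lcut[OF p]] profileD(2)[OF profile_rcut[OF p]]
      tv_nonneg[OF profileD(4)[OF profile_lcut[OF p]]] tv_nonneg[OF profileD(4)[OF profile_rcut[OF p]]]
    by (auto intro!: Bochner_Integration.integral_nonneg)
  have fin: "(\<integral>\<^sup>+x. ennreal (h x) \<partial>lborel) < \<infinity>"
    using profileD(3)[OF p] hn by (subst nn_integral_eq_integral) auto
  have R: "c * (LBINT x. rcut R h x) \<le> h R" if "x0 < R" for R
  proof -
    have "h x0 \<le> tv (lcut R h)" using profile_le_tv[OF profile_lcut[OF p], of R x0] that by (simp add: lcut_def)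
    then have "(LBINT x. rcut R h x) / (2 * V) * h x0 \<le> (LBINT x. rcut R h x) / (2 * V) * tv (lcut R h)"
      using nn V0 by (intro mult_left_mono) auto
    moreover have "0 \<le> (LBINT x. lcut R h x) / (2 * V) * tv (rcut R h)" using nn V0 by auto
    ultimately have "(LBINT x. rcut R h x) / (2 * V) * h x0 \<le> 2 * h R"
      using minimizer_cut[OF h V, of R] by (simp add: V_def)
    then show ?thesis using V0 by (simp add: c_def field_simps)
  qed
  have L: "c * (LBINT x. lcut R h x) \<le> h R" if "R < x0" for R
  proof -
    have "h x0 \<le> tv (rcut R h)" using profile_le_tv[OF profile_rcut[OF p], of R x0] that by (simp add: rcut_def)
    then have "(LBINT x. lcut R h x) / (2 * V) * h x0 \<le> (LBINT x. lcut R h x) / (2 * V) * tv (rcut R h)"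
      using nn V0 by (intro mult_left_mono) auto
    moreover have "0 \<le> (LBINT x. rcut R h x) / (2 * V) * tv (lcut R h)" using nn V0 by auto
    ultimately have "(LBINT x. lcut R h x) / (2 * V) * h x0 \<le> 2 * h R"
      using minimizer_cut[OF h V, of R] by (simp add: V_def)
    then show ?thesis using V0 by (simp add: c_def field_simps)
  qed
  have 1: "(\<integral>\<^sup>+x\<in>{x0<..}. ennreal ((x - x0)\<^sup>2) * ennreal (h x) \<partial>lborel) < \<infinity>"
  proof (rule second_moment_finite[OF _ c fin])
    fix R assume "x0 < R"
    have "(\<integral>\<^sup>+x\<in>{R<..}. ennreal (h x) \<partial>lborel) = (\<integral>\<^sup>+x. ennreal (rcut R h x) \<partial>lborel)"
      by (rule nn_integral_cong) (auto simp: rcut_def indicator_def)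
    also have "\<dots> = ennreal (LBINT x. rcut R h x)"
      by (rule nn_integral_eq_integral[OF profileD(3)[OF profile_rcut[OF p]]]) (simp add: profileD(2)[OF profile_rcut[OF p]])
    finally show "ennreal c * (\<integral>\<^sup>+x\<in>{R<..}. ennreal (h x) \<partial>lborel) \<le> ennreal (h R)"
      using R[OF \<open>x0 < R\<close>] c nn by (simp add: ennreal_mult[symmetric] ennreal_leI)
  qed measurable
  have refl: "(\<integral>\<^sup>+x. f (- x) \<partial>lborel) = (\<integral>\<^sup>+x. f x \<partial>lborel)" if [measurable]: "f \<in> borel_measurable borel" for f :: "real \<Rightarrow> ennreal"
    using nn_integral_real_affine[of f "-1" 0] by simp
  \<comment> \<open>Reflection at the origin turns left cuts into right tails starting at
    \<open>- x0\<close>.\<close>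
  have 2: "(\<integral>\<^sup>+x\<in>{-x0<..}. ennreal ((x - (- x0))\<^sup>2) * ennreal (h (- x)) \<partial>lborel) < \<infinity>"
  proof (rule second_moment_finite[OF _ c])
    show "(\<integral>\<^sup>+x. ennreal (h (- x)) \<partial>lborel) < \<infinity>" using refl[of "\<lambda>x. ennreal (h x)"] fin by simp
    fix R assume "- x0 < R"
    have "(\<integral>\<^sup>+x\<in>{R<..}. ennreal (h (- x)) \<partial>lborel) = (\<integral>\<^sup>+x. ennreal (lcut (- R) h (- x)) \<partial>lborel)"
      by (rule nn_integral_cong) (auto simp: lcut_def indicator_def)
    also have "\<dots> = (\<integral>\<^sup>+x. ennreal (lcut (- R) h x) \<partial>lborel)"
      using profileD(5)[OF profile_lcut[OF p]] by (intro refl) auto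
    also have "\<dots> = ennreal (LBINT x. lcut (- R) h x)"
      by (rule nn_integral_eq_integral[OF profileD(3)[OF profile_lcut[OF p]]]) (simp add: profileD(2)[OF profile_lcut[OF p]])
    finally show "ennreal c * (\<integral>\<^sup>+x\<in>{R<..}. ennreal (h (- x)) \<partial>lborel) \<le> ennreal (h (- R))"
      using L[of "- R"] \<open>- x0 < R\<close> c nn by (simp add: ennreal_mult[symmetric] ennreal_leI)
  qed measurable
  have 3: "(\<integral>\<^sup>+x\<in>{-x0<..}. ennreal ((x - (- x0))\<^sup>2) * ennreal (h (- x)) \<partial>lborel) = (\<integral>\<^sup>+x\<in>{..<x0}. ennreal ((x - x0)\<^sup>2) * ennreal (h x) \<partial>lborel)"
  proof -
    have "(\<integral>\<^sup>+x\<in>{-x0<..}. ennreal ((x - (- x0))\<^sup>2) * ennreal (h (- x)) \<partial>lborel) =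
        (\<integral>\<^sup>+x. (\<lambda>x. ennreal ((x - x0)\<^sup>2) * ennreal (h x) * indicator {..<x0} x) (- x) \<partial>lborel)"
      by (rule nn_integral_cong) (auto simp: indicator_def power2_eq_square algebra_simps)
    also have "\<dots> = (\<integral>\<^sup>+x\<in>{..<x0}. ennreal ((x - x0)\<^sup>2) * ennreal (h x) \<partial>lborel)" by (rule refl) measurable
    finally show ?thesis .
  qed
  have "(\<integral>\<^sup>+x. ennreal (x\<^sup>2 * h x) \<partial>lborel) \<le>
    (\<integral>\<^sup>+x. 2 * (ennreal ((x - x0)\<^sup>2) * ennreal (h x) * indicator {x0<..} x) +
      (2 * (ennreal ((x - x0)\<^sup>2) * ennreal (h x) * indicator {..<x0} x) + ennreal (2 * x0\<^sup>2) * ennreal (h x)) \<partial>lborel)"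
  proof (rule nn_integral_mono)
    fix x
    have "0 \<le> (x - 2 * x0)\<^sup>2" by simp
    then have "x\<^sup>2 \<le> 2 * (x - x0)\<^sup>2 + 2 * x0\<^sup>2" by (simp add: power2_eq_square algebra_simps)
    then have "x\<^sup>2 * h x \<le> (2 * (x - x0)\<^sup>2 + 2 * x0\<^sup>2) * h x" by (rule mult_right_mono) (rule hn)
    then have "ennreal (x\<^sup>2 * h x) \<le> ennreal (2 * ((x - x0)\<^sup>2 * h x) + 2 * x0\<^sup>2 * h x)"
      by (intro ennreal_leI) (simp add: algebra_simps)
    also have "\<dots> = 2 * (ennreal ((x - x0)\<^sup>2) * ennreal (h x)) + ennreal (2 * x0\<^sup>2) * ennreal (h x)"
      using hn by (simp add: ennreal_mult mult.assoc)
    also have "\<dots> \<le> 2 * (ennreal ((x - x0)\<^sup>2) * ennreal (h x) * indicator {x0<..} x) +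
      (2 * (ennreal ((x - x0)\<^sup>2) * ennreal (h x) * indicator {..<x0} x) + ennreal (2 * x0\<^sup>2) * ennreal (h x))"
      by (cases x x0 rule: linorder_cases) auto
    finally show "ennreal (x\<^sup>2 * h x) \<le> \<dots>" .
  qed
  also have "\<dots> = 2 * (\<integral>\<^sup>+x\<in>{x0<..}. ennreal ((x - x0)\<^sup>2) * ennreal (h x) \<partial>lborel) +
     (2 * (\<integral>\<^sup>+x\<in>{..<x0}. ennreal ((x - x0)\<^sup>2) * ennreal (h x) \<partial>lborel) + ennreal (2 * x0\<^sup>2) * (\<integral>\<^sup>+x. ennreal (h x) \<partial>lborel))"
    by (simp add: nn_integral_add nn_integral_cmult)
  also have "\<dots> < \<infinity>" using 1 2 fin unfolding 3 by (simp add: ennreal_mult_less_top)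
  finally show ?thesis .
qed

subsection \<open>Square integrable functions\<close>

definition sqint :: "'a measure \<Rightarrow> ('a \<Rightarrow> 'b::euclidean_space) \<Rightarrow> bool" where
  "sqint M f \<longleftrightarrow> f \<in> borel_measurable M \<and> integrable M (\<lambda>x. (norm (f x))\<^sup>2)"

lemma sqintD: "sqint M f \<Longrightarrow> f \<in> borel_measurable M" "sqint M f \<Longrightarrow> integrable M (\<lambda>x. (norm (f x))\<^sup>2)"
  unfolding sqint_def by auto

lemma sqint_bound:
  assumes f: "f \<in> borel_measurable M" and g: "integrable M g" and b: "\<And>x. (norm (f x))\<^sup>2 \<le> g x"
  shows "sqint M f"
  unfolding sqint_def
proof
  show "integrable M (\<lambda>x. (norm (f x))\<^sup>2)"
  proof (rule Bochner_Integration.integrable_bound[OF g])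
    show "AE x in M. norm ((norm (f x))\<^sup>2) \<le> norm (g x)" using b abs_ge_self order_trans by (intro AE_I2) fastforce
  qed (use f in measurable)
qed (rule f)

lemma norm_add_square_le: "(norm (a + b))\<^sup>2 \<le> 2 * (norm a)\<^sup>2 + 2 * (norm (b :: 'b::real_normed_vector))\<^sup>2"
proof -
  have "(norm (a + b))\<^sup>2 \<le> (norm a + norm b)\<^sup>2" by (rule power_mono[OF norm_triangle_ineq]) simp
  also have "\<dots> \<le> 2 * (norm a)\<^sup>2 + 2 * (norm b)\<^sup>2"
    using zero_le_power2[of "norm a - norm b"] by (simp add: power2_eq_square algebra_simps)
  finally show ?thesis .
qed

lemma norm_diff_square_le: "(norm (a - b))\<^sup>2 \<le> 2 * (norm a)\<^sup>2 + 2 * (norm (b :: 'b::real_normed_vector))\<^sup>2"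
  using norm_add_square_le[of a "- b"] by simp

lemma sqint_add: assumes "sqint M f" "sqint M g" shows "sqint M (\<lambda>x. f x + g x)"
  by (rule sqint_bound[OF _ _ norm_add_square_le]) (use sqintD[OF assms(1)] sqintD[OF assms(2)] in auto)

lemma sqint_diff: assumes "sqint M f" "sqint M g" shows "sqint M (\<lambda>x. f x - g x)"
  by (rule sqint_bound[OF _ _ norm_diff_square_le]) (use sqintD[OF assms(1)] sqintD[OF assms(2)] in auto)

lemma sqint_scale: assumes "sqint M f" shows "sqint M (\<lambda>x. c *\<^sub>R f x)"
proof (rule sqint_bound)
  show "(\<lambda>x. c *\<^sub>R f x) \<in> borel_measurable M" using sqintD(1)[OF assms] by measurable
  show "integrable M (\<lambda>x. c\<^sup>2 * (norm (f x))\<^sup>2)" using sqintD(2)[OF assms] by simp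
qed (simp add: power_mult_distrib)

lemma sqint_inner:
  assumes f: "sqint M f" and g: "sqint M g"
  shows "integrable M (\<lambda>x. f x \<bullet> g x)"
proof (rule Bochner_Integration.integrable_bound)
  show "integrable M (\<lambda>x. (norm (f x))\<^sup>2 + (norm (g x))\<^sup>2)" using sqintD[OF f] sqintD[OF g] by auto
  show "(\<lambda>x. f x \<bullet> g x) \<in> borel_measurable M" using sqintD(1)[OF f] sqintD(1)[OF g] by measurable
  show "AE x in M. norm (f x \<bullet> g x) \<le> norm ((norm (f x))\<^sup>2 + (norm (g x))\<^sup>2)"
  proof (rule AE_I2)
    fix x
    have "\<bar>f x \<bullet> g x\<bar> \<le> norm (f x) * norm (g x)" by (rule Cauchy_Schwarz_ineq2)
    also have "\<dots> \<le> (norm (f x))\<^sup>2 + (norm (g x))\<^sup>2"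
    proof -
      have "0 \<le> (norm (f x) - norm (g x))\<^sup>2" "0 \<le> norm (f x) * norm (g x)" by auto
      then show ?thesis unfolding power2_diff by linarith
    qed
    finally show "norm (f x \<bullet> g x) \<le> norm ((norm (f x))\<^sup>2 + (norm (g x))\<^sup>2)" by simp
  qed
qed

lemma sqint_add_integral:
  assumes f: "sqint M f" and g: "sqint M g"
  shows "(LINT x|M. (norm (f x + t *\<^sub>R g x))\<^sup>2) =
    (LINT x|M. (norm (f x))\<^sup>2) + 2 * t * (LINT x|M. f x \<bullet> g x) + t\<^sup>2 * (LINT x|M. (norm (g x))\<^sup>2)"
proof -
  have "(LINT x|M. (norm (f x + t *\<^sub>R g x))\<^sup>2) =
      (LINT x|M. (norm (f x))\<^sup>2 + (2 * t * (f x \<bullet> g x) + t\<^sup>2 * (norm (g x))\<^sup>2))"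
  proof (rule Bochner_Integration.integral_cong[OF refl])
    fix x
    have "g x \<bullet> f x = f x \<bullet> g x" by (rule inner_commute)
    then have "(f x + t *\<^sub>R g x) \<bullet> (f x + t *\<^sub>R g x) = f x \<bullet> f x + (2 * t * (f x \<bullet> g x) + t\<^sup>2 * (g x \<bullet> g x))"
      by (simp add: inner_add_left inner_add_right power2_eq_square algebra_simps)
    then show "(norm (f x + t *\<^sub>R g x))\<^sup>2 = (norm (f x))\<^sup>2 + (2 * t * (f x \<bullet> g x) + t\<^sup>2 * (norm (g x))\<^sup>2)"
      by (simp only: power2_norm_eq_inner)
  qed
  then show ?thesis using sqintD(2)[OF f] sqintD(2)[OF g] sqint_inner[OF f g] by simp
qed

lemma sqint_Cauchy_Schwarz:
  assumes f: "sqint M f" and g: "sqint M g"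
  shows "(LINT x|M. f x \<bullet> g x)\<^sup>2 \<le> (LINT x|M. (norm (f x))\<^sup>2) * (LINT x|M. (norm (g x))\<^sup>2)"
proof -
  let ?A = "LINT x|M. (norm (f x))\<^sup>2" and ?B = "LINT x|M. f x \<bullet> g x" and ?C = "LINT x|M. (norm (g x))\<^sup>2"
  have q: "0 \<le> ?A + 2 * t * ?B + t\<^sup>2 * ?C" for t
    unfolding sqint_add_integral[OF f g, symmetric] by (rule Bochner_Integration.integral_nonneg) simp
  have C: "0 \<le> ?C" by (rule Bochner_Integration.integral_nonneg) simp
  show ?thesis
  proof (cases "?C = 0")
    case True
    have "?B = 0"
    proof (rule ccontr)
      assume "?B \<noteq> 0"
      \<comment> \<open>At this argument a quadratic without leading term takes the value
        -1.\<close>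
      then have "2 * (- (?A + 1) / (2 * ?B)) * ?B = - (?A + 1)" by simp
      then show False using q[of "- (?A + 1) / (2 * ?B)"] unfolding True by simp
    qed
    then show ?thesis using True by simp
  next
    case False
    with C have C: "0 < ?C" by (metis order.not_eq_order_implies_strict)
    have "0 \<le> ?C * (?A + 2 * (- ?B / ?C) * ?B + (- ?B / ?C)\<^sup>2 * ?C)" using q[of "- ?B / ?C"] C by (intro mult_nonneg_nonneg) auto
    also have "\<dots> = ?A * ?C - ?B\<^sup>2" using C by (simp add: field_simps power2_eq_square)
    finally show ?thesis by simp
  qed
qed

lemma sqint_inner_tendsto:
  assumes F: "\<And>n. sqint M (F n)" and G: "sqint M G" and g: "sqint M g"
    and lim: "(\<lambda>n. LINT x|M. (norm (F n x - G x))\<^sup>2) \<longlonglongrightarrow> 0"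
  shows "(\<lambda>n. LINT x|M. F n x \<bullet> g x) \<longlonglongrightarrow> (LINT x|M. G x \<bullet> g x)"
proof -
  have "(\<lambda>n. (LINT x|M. F n x \<bullet> g x) - (LINT x|M. G x \<bullet> g x)) \<longlonglongrightarrow> 0"
  proof (rule tendsto_0_le[where K = 1])
    have "(\<lambda>n. sqrt ((LINT x|M. (norm (F n x - G x))\<^sup>2) * (LINT x|M. (norm (g x))\<^sup>2))) \<longlonglongrightarrow> sqrt (0 * (LINT x|M. (norm (g x))\<^sup>2))"
      by (intro tendsto_intros lim)
    then show "(\<lambda>n. sqrt ((LINT x|M. (norm (F n x - G x))\<^sup>2) * (LINT x|M. (norm (g x))\<^sup>2))) \<longlonglongrightarrow> 0" by simp
    show "\<forall>\<^sub>F n in sequentially. norm ((LINT x|M. F n x \<bullet> g x) - (LINT x|M. G x \<bullet> g x)) \<le>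
      norm (sqrt ((LINT x|M. (norm (F n x - G x))\<^sup>2) * (LINT x|M. (norm (g x))\<^sup>2))) * 1"
    proof (intro always_eventually allI)
      fix n
      have eq: "(LINT x|M. F n x \<bullet> g x) - (LINT x|M. G x \<bullet> g x) = (LINT x|M. (F n x - G x) \<bullet> g x)"
        using sqint_inner[OF F g] sqint_inner[OF G g] by (simp add: inner_diff_left)
      have "\<bar>LINT x|M. (F n x - G x) \<bullet> g x\<bar> \<le> sqrt ((LINT x|M. (norm (F n x - G x))\<^sup>2) * (LINT x|M. (norm (g x))\<^sup>2))"
        by (rule real_le_rsqrt) (use sqint_Cauchy_Schwarz[OF sqint_diff[OF F G] g] in simp)
      then show "norm ((LINT x|M. F n x \<bullet> g x) - (LINT x|M. G x \<bullet> g x)) \<le>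
        norm (sqrt ((LINT x|M. (norm (F n x - G x))\<^sup>2) * (LINT x|M. (norm (g x))\<^sup>2))) * 1" unfolding eq by simp
    qed
  qed
  then show ?thesis by (simp add: LIM_zero_iff)
qed

lemma sqint_norm_tendsto:
  assumes F: "\<And>n. sqint M (F n)" and G: "sqint M G"
    and lim: "(\<lambda>n. LINT x|M. (norm (F n x - G x))\<^sup>2) \<longlonglongrightarrow> 0"
  shows "(\<lambda>n. LINT x|M. (norm (F n x))\<^sup>2) \<longlonglongrightarrow> (LINT x|M. (norm (G x))\<^sup>2)"
proof -
  have "(LINT x|M. (norm (F n x))\<^sup>2) =
      (LINT x|M. (norm (F n x - G x))\<^sup>2) + 2 * (LINT x|M. F n x \<bullet> G x) - (LINT x|M. (norm (G x))\<^sup>2)" for n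
  proof -
    have "(LINT x|M. (norm (F n x - G x))\<^sup>2) = (LINT x|M. (norm (F n x))\<^sup>2) - 2 * (LINT x|M. F n x \<bullet> G x) + (LINT x|M. (norm (G x))\<^sup>2)"
      using sqint_add_integral[OF F[of n] G, of "-1"] by simp
    then show ?thesis by simp
  qed
  moreover have "(\<lambda>n. (LINT x|M. (norm (F n x - G x))\<^sup>2) + 2 * (LINT x|M. F n x \<bullet> G x) - (LINT x|M. (norm (G x))\<^sup>2))
    \<longlonglongrightarrow> 0 + 2 * (LINT x|M. G x \<bullet> G x) - (LINT x|M. (norm (G x))\<^sup>2)"
    by (intro tendsto_intros lim sqint_inner_tendsto[OF F G G lim])
  ultimately show ?thesis by (simp add: power2_norm_eq_inner)
qed

text \<open>Finiteness of the weighted sum bounds the increments by a geometric sequence of ratio 1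
  / sqrt 2, so they are summable.\<close>

lemma fast_subsequence_converges:
  fixes a :: "nat \<Rightarrow> 'b::banach"
  assumes "(\<Sum>k. ennreal (2 ^ k * (norm (a (Suc k) - a k))\<^sup>2)) < \<infinity>"
  shows "convergent a"
proof -
  define C where "C = enn2real (\<Sum>k. ennreal (2 ^ k * (norm (a (Suc k) - a k))\<^sup>2))"
  have C0: "0 \<le> C" by (simp add: C_def)
  have b: "norm (a (Suc k) - a k) \<le> sqrt C * (sqrt (1 / 2)) ^ k" for k
  proof -
    have "(\<Sum>i\<in>{k}. ennreal (2 ^ i * (norm (a (Suc i) - a i))\<^sup>2)) \<le> (\<Sum>k. ennreal (2 ^ k * (norm (a (Suc k) - a k))\<^sup>2))"
      by (rule sum_le_suminf) auto
    then have "ennreal (2 ^ k * (norm (a (Suc k) - a k))\<^sup>2) \<le> (\<Sum>k. ennreal (2 ^ k * (norm (a (Suc k) - a k))\<^sup>2))"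
      by (simp only: sum.insert sum.empty finite.emptyI empty_iff not_False_eq_True add_0_right)
    also have "\<dots> = ennreal C" using assms unfolding C_def by (simp add: less_top)
    finally have "2 ^ k * (norm (a (Suc k) - a k))\<^sup>2 \<le> C" using C0 by (subst (asm) ennreal_le_iff) auto
    then have "(norm (a (Suc k) - a k))\<^sup>2 \<le> C * (1 / 2) ^ k" by (simp add: field_simps)
    then have "norm (a (Suc k) - a k) \<le> sqrt (C * (1 / 2) ^ k)" by (rule real_le_rsqrt)
    then show ?thesis by (simp only: real_sqrt_mult real_sqrt_power)
  qed
  have "summable (\<lambda>k. sqrt C * (sqrt (1 / 2)) ^ k)"
    by (intro summable_mult summable_geometric) (simp add: real_sqrt_lt_1_iff)
  then have "summable (\<lambda>k. a (Suc k) - a k)" by (rule summable_comparison_test'[where N = 0]) (rule b)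
  then have "convergent (\<lambda>n. \<Sum>k<n. a (Suc k) - a k)" by (simp add: summable_iff_convergent)
  then have "convergent (\<lambda>n. a n - a 0)" by (simp add: sum_lessThan_telescope)
  then show ?thesis using convergent_add[OF _ convergent_const[of "a 0"]] by fastforce
qed

text \<open>Riesz-Fischer: a subsequence with rapidly decreasing increments converges almost
  everywhere, and Fatou turns the pointwise limit into an L^2 limit of the whole sequence.\<close>

lemma L2_complete:
  fixes F :: "nat \<Rightarrow> 'a \<Rightarrow> 'b::euclidean_space"
  assumes F: "\<And>n. sqint M (F n)"
    and C: "\<And>e. 0 < e \<Longrightarrow> \<exists>N. \<forall>m\<ge>N. \<forall>n\<ge>N. (LINT x|M. (norm (F m x - F n x))\<^sup>2) < e"
  shows "\<exists>G. sqint M G \<and> (\<lambda>n. LINT x|M. (norm (F n x - G x))\<^sup>2) \<longlonglongrightarrow> 0"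
proof -
  note [measurable] = sqintD(1)[OF F]
  have nn: "(\<integral>\<^sup>+x. ennreal ((norm (F m x - F n x))\<^sup>2) \<partial>M) = ennreal (LINT x|M. (norm (F m x - F n x))\<^sup>2)" for m n
    by (rule nn_integral_eq_integral) (use sqintD(2)[OF sqint_diff[OF F F]] in auto)
  \<comment> \<open>Against the weights \<open>2 ^ k\<close> the squared increments remain summable,
    with ratio 1 / 2.\<close>
  have "\<exists>N. \<forall>m\<ge>N. \<forall>n\<ge>N. (LINT x|M. (norm (F m x - F n x))\<^sup>2) < (1 / 4) ^ k" for k by (rule C) simp
  then obtain N where N: "\<And>k m n. m \<ge> N k \<Longrightarrow> n \<ge> N k \<Longrightarrow> (LINT x|M. (norm (F m x - F n x))\<^sup>2) < (1 / 4) ^ k" by metis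
  \<comment> \<open>Summing the thresholds makes the indices monotone and beyond \<open>N k\<close>;
    adding \<open>k\<close> sends them to infinity.\<close>
  define r where "r k = (\<Sum>i\<le>k. N i) + k" for k
  have r: "r k \<ge> N k" "r k \<ge> k" "r k \<le> r (Suc k)" for k
    unfolding r_def using member_le_sum[of k "{..k}" N] by auto
  let ?S = "\<lambda>x. \<Sum>k. ennreal (2 ^ k * (norm (F (r (Suc k)) x - F (r k) x))\<^sup>2)"
  have "(\<integral>\<^sup>+x. ?S x \<partial>M) = (\<Sum>k. \<integral>\<^sup>+x. ennreal (2 ^ k * (norm (F (r (Suc k)) x - F (r k) x))\<^sup>2) \<partial>M)"
    by (rule nn_integral_suminf) measurable
  also have "\<dots> \<le> (\<Sum>k. ennreal ((1 / 2) ^ k))"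
  proof (rule suminf_le)
    fix k
    have "(\<integral>\<^sup>+x. ennreal (2 ^ k * (norm (F (r (Suc k)) x - F (r k) x))\<^sup>2) \<partial>M) = ennreal (2 ^ k) * ennreal (LINT x|M. (norm (F (r (Suc k)) x - F (r k) x))\<^sup>2)"
      unfolding nn[symmetric] by (subst nn_integral_cmult[symmetric]) (auto simp: ennreal_mult')
    also have "\<dots> \<le> ennreal (2 ^ k) * ennreal ((1 / 4) ^ k)"
      using N[of k "r (Suc k)" "r k"] r(1)[of k] r(3)[of k] by (intro mult_left_mono ennreal_leI) auto
    also have "\<dots> = ennreal ((1 / 2) ^ k)" by (simp add: ennreal_mult[symmetric] power_mult_distrib[symmetric])
    finally show "(\<integral>\<^sup>+x. ennreal (2 ^ k * (norm (F (r (Suc k)) x - F (r k) x))\<^sup>2) \<partial>M) \<le> ennreal ((1 / 2) ^ k)" .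
  qed auto
  also have "\<dots> = ennreal (\<Sum>k. (1 / 2) ^ k)" by (rule suminf_ennreal2) (auto intro: summable_geometric)
  finally have "(\<integral>\<^sup>+x. ?S x \<partial>M) \<noteq> \<infinity>" by (auto simp: top_unique)
  then have "AE x in M. ?S x \<noteq> \<infinity>" by (intro nn_integral_PInf_AE) measurable
  then have conv: "AE x in M. convergent (\<lambda>k. F (r k) x)"
    by eventually_elim (rule fast_subsequence_converges, simp add: less_top)
  define G where "G x = lim (\<lambda>k. F (r k) x)" for x
  have Gm[measurable]: "G \<in> borel_measurable M" unfolding G_def[abs_def] by measurable
  have lim: "AE x in M. (\<lambda>k. F (r k) x) \<longlonglongrightarrow> G x"
    using conv by eventually_elim (simp add: G_def convergent_LIMSEQ_iff)
  \<comment> \<open>Comparing a fixed member with the subsequence reaches every index, not only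
    those in the subsequence.\<close>
  have fatou: "(\<integral>\<^sup>+x. ennreal ((norm (F n x - G x))\<^sup>2) \<partial>M) \<le> ennreal e"
    if e: "\<And>m. m \<ge> n0 \<Longrightarrow> (LINT x|M. (norm (F n x - F m x))\<^sup>2) \<le> e" for n n0 e
  proof -
    have "(\<integral>\<^sup>+x. ennreal ((norm (F n x - G x))\<^sup>2) \<partial>M) = (\<integral>\<^sup>+x. liminf (\<lambda>k. ennreal ((norm (F n x - F (r k) x))\<^sup>2)) \<partial>M)"
    proof (rule nn_integral_cong_AE)
      show "AE x in M. ennreal ((norm (F n x - G x))\<^sup>2) = liminf (\<lambda>k. ennreal ((norm (F n x - F (r k) x))\<^sup>2))"
        using lim
      proof eventually_elim
        case (elim x)
        have "(\<lambda>k. ennreal ((norm (F n x - F (r k) x))\<^sup>2)) \<longlonglongrightarrow> ennreal ((norm (F n x - G x))\<^sup>2)"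
          by (intro tendsto_intros elim)
        then show ?case by (intro lim_imp_Liminf[symmetric]) auto
      qed
    qed
    also have "\<dots> \<le> liminf (\<lambda>k. \<integral>\<^sup>+x. ennreal ((norm (F n x - F (r k) x))\<^sup>2) \<partial>M)"
      by (rule nn_integral_liminf) measurable
    also have "\<dots> \<le> ennreal e"
    proof (rule Liminf_le)
      show "\<forall>\<^sub>F k in sequentially. (\<integral>\<^sup>+x. ennreal ((norm (F n x - F (r k) x))\<^sup>2) \<partial>M) \<le> ennreal e"
        unfolding nn eventually_sequentially using r(2) e by (intro exI[of _ n0]) (auto intro!: ennreal_leI intro: order_trans)
    qed simp
    finally show ?thesis .
  qed
  have sqd: "sqint M (\<lambda>x. F n x - G x)" if "(\<integral>\<^sup>+x. ennreal ((norm (F n x - G x))\<^sup>2) \<partial>M) < \<infinity>" for n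
    unfolding sqint_def using that by (auto intro!: integrableI_nonneg)
  obtain N0 where N0: "\<And>m n. m \<ge> N0 \<Longrightarrow> n \<ge> N0 \<Longrightarrow> (LINT x|M. (norm (F m x - F n x))\<^sup>2) < 1" using C[of 1] by auto
  have "(\<integral>\<^sup>+x. ennreal ((norm (F N0 x - G x))\<^sup>2) \<partial>M) \<le> ennreal 1"
    by (rule fatou[of N0]) (use N0 in \<open>auto intro: less_imp_le\<close>)
  then have "sqint M (\<lambda>x. F N0 x - G x)" by (intro sqd) (auto intro: le_less_trans)
  then have G: "sqint M G" using sqint_diff[OF F[of N0]] by fastforce
  moreover have "(\<lambda>n. LINT x|M. (norm (F n x - G x))\<^sup>2) \<longlonglongrightarrow> 0"
  proof (rule LIMSEQ_I)
    fix e :: real assume e: "0 < e"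
    then obtain K where K: "\<And>m n. m \<ge> K \<Longrightarrow> n \<ge> K \<Longrightarrow> (LINT x|M. (norm (F m x - F n x))\<^sup>2) < e / 2" using C[of "e / 2"] by auto
    show "\<exists>no. \<forall>n\<ge>no. norm ((LINT x|M. (norm (F n x - G x))\<^sup>2) - 0) < e"
    proof (intro exI[of _ K] allI impI)
      fix n assume n: "K \<le> n"
      have "ennreal (LINT x|M. (norm (F n x - G x))\<^sup>2) = (\<integral>\<^sup>+x. ennreal ((norm (F n x - G x))\<^sup>2) \<partial>M)"
        by (rule nn_integral_eq_integral[symmetric]) (use sqintD(2)[OF sqint_diff[OF F G]] in auto)
      also have "\<dots> \<le> ennreal (e / 2)" by (rule fatou[of K]) (use K n in \<open>auto intro: less_imp_le\<close>)
      finally have "(LINT x|M. (norm (F n x - G x))\<^sup>2) \<le> e / 2" using e by (subst (asm) ennreal_le_iff) auto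
      moreover have "0 \<le> (LINT x|M. (norm (F n x - G x))\<^sup>2)" by (rule Bochner_Integration.integral_nonneg) simp
      ultimately show "norm ((LINT x|M. (norm (F n x - G x))\<^sup>2) - 0) < e" using e by simp
    qed
  qed
  ultimately show ?thesis by blast
qed

subsection \<open>The optimal field\<close>

definition dual_pair :: "(real \<times> real \<Rightarrow> real) \<Rightarrow> (real \<times> real \<Rightarrow> real \<times> real) \<Rightarrow> real \<times> real \<Rightarrow> real \<times> real" where
  "dual_pair \<phi> D z = (\<phi> z, tail D z)"

lemma norm_dual_pair: "(norm (dual_pair \<phi> D z))\<^sup>2 = (\<phi> z)\<^sup>2 + (tail D z)\<^sup>2"
  by (simp add: dual_pair_def norm_Pair)

lemma sqint_dual_pair:
  assumes t: "test_function \<Omega> \<phi> D"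
  shows "sqint lborel (dual_pair \<phi> D)"
proof -
  note [measurable] = test_functionD(5,6)[OF t]
  have "dual_pair \<phi> D \<in> borel_measurable borel" unfolding dual_pair_def[abs_def] by measurable
  then show ?thesis unfolding sqint_def norm_dual_pair
    using square_integrable[OF t] tail_square_integrable[OF t] by simp
qed

lemma dual_functional_pair:
  assumes t: "test_function \<Omega> \<phi> D"
  shows "dual_functional \<phi> D = 2 * (LBINT z. \<phi> z) - (LBINT z. (norm (dual_pair \<phi> D z))\<^sup>2)"
  unfolding norm_dual_pair dual_functional_def using square_integrable[OF t] tail_square_integrable[OF t] by simp

lemma dual_functional_pair_lin:
  assumes f: "test_function \<Omega> f Df" and g: "test_function \<Omega> g Dg"
  shows "dual_functional (\<lambda>x. a * f x + b * g x) (\<lambda>x. a *\<^sub>R Df x + b *\<^sub>R Dg x) =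
    2 * (a * (LBINT z. f z) + b * (LBINT z. g z)) - (a\<^sup>2 * (LBINT z. (norm (dual_pair f Df z))\<^sup>2)
      + 2 * a * b * (LBINT z. dual_pair f Df z \<bullet> dual_pair g Dg z) + b\<^sup>2 * (LBINT z. (norm (dual_pair g Dg z))\<^sup>2))"
proof -
  note i = test_integrable[OF f g] tail_integrable[OF f g] square_integrable[OF f] square_integrable[OF g]
    tail_square_integrable[OF f] tail_square_integrable[OF g]
  show ?thesis unfolding norm_dual_pair dual_functional_lin[OF f g] using i by (simp add: dual_pair_def)
qed

text \<open>A maximizing sequence of test functions has pairs that form a Cauchy sequence, and their
  L^2 limit represents the functional sending \<open>\<phi>\<close> to its integral. The limit
  itself need not come from a test function.\<close>

theorem optimal_field:
  assumes h: "profile h"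
  shows "\<exists>G. sqint lborel G \<and> (\<forall>z. z \<notin> subgraph h \<longrightarrow> G z = 0) \<and>
    (LBINT z. (norm (G z))\<^sup>2) = dual_energy h \<and>
    (\<forall>\<phi> D. test_function (subgraph h) \<phi> D \<longrightarrow> (LBINT z. G z \<bullet> dual_pair \<phi> D z) = (LBINT z. \<phi> z))"
proof -
  let ?E = "dual_energy h" and ?O = "subgraph h"
  have "\<exists>p. test_function ?O (fst p) (snd p) \<and> ?E - 1 / real (Suc n) < dual_functional (fst p) (snd p)" for n
    using dual_energy_approx[of "1 / real (Suc n)" h] by auto
  then obtain p where p: "\<And>n. test_function ?O (fst (p n)) (snd (p n))"
    "\<And>n. ?E - 1 / real (Suc n) < dual_functional (fst (p n)) (snd (p n))" by metis
  define F where "F n = dual_pair (fst (p n)) (snd (p n))" for n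
  have F: "sqint lborel (F n)" for n unfolding F_def by (rule sqint_dual_pair[OF p(1)])
  \<comment> \<open>Parallelogram identity: the value at the midpoint exceeds the mean of the two
    values by a quarter of the squared distance, and is still at most the supremum.\<close>
  have cauchy: "(LBINT z. (norm (F m z - F n z))\<^sup>2) \<le> 2 / real (Suc m) + 2 / real (Suc n)" for m n
  proof -
    have "(LBINT z. (norm (F m z - F n z))\<^sup>2) = (LBINT z. (norm (F m z))\<^sup>2) - 2 * (LBINT z. F m z \<bullet> F n z) + (LBINT z. (norm (F n z))\<^sup>2)"
      using sqint_add_integral[OF F[of m] F[of n], of "-1"] by simp
    moreover have "dual_functional (\<lambda>x. (1/2) * fst (p m) x + (1/2) * fst (p n) x) (\<lambda>x. (1/2) *\<^sub>R snd (p m) x + (1/2) *\<^sub>R snd (p n) x) \<le> ?E"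
      by (rule dual_energy_upper[OF h test_function_lin[OF p(1) p(1)]])
    ultimately show ?thesis
      using p(2)[of m] p(2)[of n] unfolding dual_functional_pair_lin[OF p(1) p(1)] dual_functional_pair[OF p(1)] F_def[symmetric]
      by (simp add: power2_eq_square)
  qed
  have "\<exists>G. sqint lborel G \<and> (\<lambda>n. LBINT z. (norm (F n z - G z))\<^sup>2) \<longlonglongrightarrow> 0"
  proof (rule L2_complete[OF F])
    fix e :: real assume e: "0 < e"
    obtain N where N: "inverse (real (Suc N)) < e / 4" using reals_Archimedean[of "e / 4"] e by auto
    have "2 / real (Suc n) < e / 2" if "n \<ge> N" for n
    proof -
      have "inverse (real (Suc n)) \<le> inverse (real (Suc N))" using that by (intro le_imp_inverse_le) auto
      moreover have "2 / real (Suc n) = 2 * inverse (real (Suc n))" by (rule divide_inverse)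
      ultimately show ?thesis using N by linarith
    qed
    then have "2 / real (Suc m) + 2 / real (Suc n) < e" if "m \<ge> N" "n \<ge> N" for m n
      using add_strict_mono[of "2 / real (Suc m)" "e / 2" "2 / real (Suc n)" "e / 2"] that by simp
    then show "\<exists>N. \<forall>m\<ge>N. \<forall>n\<ge>N. (LBINT z. (norm (F m z - F n z))\<^sup>2) < e"
      using le_less_trans[OF cauchy] by (intro exI[of _ N]) blast
  qed
  then obtain G0 where G0: "sqint lborel G0" "(\<lambda>n. LBINT z. (norm (F n z - G0 z))\<^sup>2) \<longlonglongrightarrow> 0" by blast
  \<comment> \<open>The limit is determined almost everywhere only; this representative vanishes
    exactly where required.\<close>
  define G where "G z = indicator ?O z *\<^sub>R G0 z" for z
  have O[measurable]: "?O \<in> sets borel" by (rule subgraph_measurable[OF profileD(5)[OF h]])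
  have G: "sqint lborel G"
  proof (rule sqint_bound[OF _ sqintD(2)[OF G0(1)]])
    show "G \<in> borel_measurable lborel" unfolding G_def[abs_def] using sqintD(1)[OF G0(1)] by measurable
  qed (auto simp: G_def indicator_def)
  have F0: "F n z = 0" if "z \<notin> ?O" for n z
    using that test_functionD(4)[OF p(1)[of n], where x = z] tail_subgraph[OF p(1)[of n], where z = z] unfolding F_def dual_pair_def
    by (auto simp: zero_prod_def)
  have lim: "(\<lambda>n. LBINT z. (norm (F n z - G z))\<^sup>2) \<longlonglongrightarrow> 0"
  proof (rule tendsto_sandwich[OF _ _ tendsto_const G0(2)])
    show "\<forall>\<^sub>F n in sequentially. (LBINT z. (norm (F n z - G z))\<^sup>2) \<le> (LBINT z. (norm (F n z - G0 z))\<^sup>2)"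
    proof (intro always_eventually allI integral_mono sqintD(2) sqint_diff F G G0)
      fix n z show "(norm (F n z - G z))\<^sup>2 \<le> (norm (F n z - G0 z))\<^sup>2"
        using F0[of z n] by (cases "z \<in> ?O") (auto simp: G_def)
    qed
  qed (auto intro!: always_eventually Bochner_Integration.integral_nonneg)
  have Jlim: "(\<lambda>n. dual_functional (fst (p n)) (snd (p n))) \<longlonglongrightarrow> ?E"
  proof (rule tendsto_sandwich)
    show "(\<lambda>n. ?E - 1 / real (Suc n)) \<longlonglongrightarrow> ?E"
      using tendsto_diff[OF tendsto_const[of ?E] LIMSEQ_inverse_real_of_nat] by (simp add: divide_inverse)
    show "(\<lambda>n. ?E) \<longlonglongrightarrow> ?E" by simp
  qed (use p(2) dual_energy_upper[OF h p(1)] in \<open>auto intro!: always_eventually less_imp_le\<close>)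
  have normlim: "(\<lambda>n. LBINT z. (norm (F n z))\<^sup>2) \<longlonglongrightarrow> (LBINT z. (norm (G z))\<^sup>2)" by (rule sqint_norm_tendsto[OF F G lim])
  have eq: "(LBINT z. G z \<bullet> dual_pair \<phi> D z) = (LBINT z. \<phi> z)" if t: "test_function ?O \<phi> D" for \<phi> D
  proof -
    let ?g = "dual_pair \<phi> D"
    define d where "d = (LBINT z. \<phi> z) - (LBINT z. G z \<bullet> ?g z)"
    \<comment> \<open>The first variation: perturbing the maximizing sequence by \<open>s\<close>
      times \<open>\<phi>\<close> and passing to the limit cannot exceed the supremum.\<close>
    have q: "2 * s * d - s\<^sup>2 * (LBINT z. (norm (?g z))\<^sup>2) \<le> 0" for s
    proof -
      have "dual_functional (fst (p n)) (snd (p n)) + 2 * s * ((LBINT z. \<phi> z) - (LBINT z. F n z \<bullet> ?g z)) - s\<^sup>2 * (LBINT z. (norm (?g z))\<^sup>2) \<le> ?E" for n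
        using dual_energy_upper[OF h test_function_lin[OF p(1)[of n] t, of 1 s]]
        unfolding dual_functional_pair_lin[OF p(1) t] dual_functional_pair[OF p(1)] F_def[symmetric]
        by (simp add: algebra_simps)
      moreover have "(\<lambda>n. dual_functional (fst (p n)) (snd (p n)) + 2 * s * ((LBINT z. \<phi> z) - (LBINT z. F n z \<bullet> ?g z)) - s\<^sup>2 * (LBINT z. (norm (?g z))\<^sup>2))
        \<longlonglongrightarrow> ?E + 2 * s * ((LBINT z. \<phi> z) - (LBINT z. G z \<bullet> ?g z)) - s\<^sup>2 * (LBINT z. (norm (?g z))\<^sup>2)"
        by (intro tendsto_intros Jlim sqint_inner_tendsto[OF F G sqint_dual_pair[OF t] lim])
      ultimately have "?E + 2 * s * ((LBINT z. \<phi> z) - (LBINT z. G z \<bullet> ?g z)) - s\<^sup>2 * (LBINT z. (norm (?g z))\<^sup>2) \<le> ?E"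
        by (intro LIMSEQ_le_const2) auto
      then show ?thesis by (simp add: d_def)
    qed
    let ?c = "LBINT z. (norm (?g z))\<^sup>2"
    have c: "0 \<le> ?c" by (rule Bochner_Integration.integral_nonneg) simp
    \<comment> \<open>This choice of \<open>s\<close> makes the expression positive unless
      \<open>d = 0\<close>; the \<open>+ 1\<close> covers a vanishing norm.\<close>
    have "2 * (d / (?c + 1)) * d - (d / (?c + 1))\<^sup>2 * ?c = (d\<^sup>2 * (?c + 2)) / (?c + 1)\<^sup>2"
      using c by (simp add: divide_simps power2_eq_square) (simp add: algebra_simps)
    then have "(d\<^sup>2 * (?c + 2)) / (?c + 1)\<^sup>2 \<le> 0" using q[of "d / (?c + 1)"] by simp
    then have "d\<^sup>2 * (?c + 2) \<le> 0" using c by (simp add: divide_le_0_iff)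
    then have "d = 0" using c by (simp add: mult_le_0_iff)
    then show ?thesis by (simp add: d_def)
  qed
  have "(\<lambda>n. LBINT z. F n z \<bullet> G z) \<longlonglongrightarrow> (LBINT z. G z \<bullet> G z)" by (rule sqint_inner_tendsto[OF F G G lim])
  \<comment> \<open>Testing the identity with the maximizing sequence identifies the limit of the
    linear terms as the squared norm of \<open>G\<close>, and the value of the supremum
    follows.\<close>
  then have "(\<lambda>n. LBINT z. fst (p n) z) \<longlonglongrightarrow> (LBINT z. (norm (G z))\<^sup>2)"
    using eq[OF p(1)] by (simp add: F_def inner_commute power2_norm_eq_inner)
  then have "(\<lambda>n. dual_functional (fst (p n)) (snd (p n))) \<longlonglongrightarrow> 2 * (LBINT z. (norm (G z))\<^sup>2) - (LBINT z. (norm (G z))\<^sup>2)"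
    unfolding dual_functional_pair[OF p(1)] F_def[symmetric] by (intro tendsto_intros normlim)
  then have "?E = (LBINT z. (norm (G z))\<^sup>2)" using Jlim LIMSEQ_unique by fastforce
  then show ?thesis using G eq by (intro exI[of _ G]) (auto simp: G_def)
qed

section \<open>Change of variables and functions with vanishing rectangle integrals\<close>

lemma lborel_dilate:
  assumes l: "l \<noteq> 0" and m: "m \<noteq> 0"
  shows "lborel = density (distr lborel borel (dilate c l m)) (\<lambda>_. ennreal \<bar>l * m\<bar>)"
proof -
  let ?c = "\<lambda>j::real \<times> real. if j = (1, 0) then l else m"
  have B: "(Basis :: (real \<times> real) set) = {(1, 0), (0, 1)}" by (auto simp: Basis_prod_def)
  have "lborel = density (distr lborel borel (\<lambda>x. c + (\<Sum>j\<in>Basis. (?c j * (x \<bullet> j)) *\<^sub>R j))) (\<lambda>_. ennreal (\<Prod>j\<in>Basis. \<bar>?c j\<bar>))"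
    by (rule lborel_affine_euclidean) (use l m in auto)
  moreover have "(\<lambda>x. c + (\<Sum>j\<in>Basis. (?c j * (x \<bullet> j)) *\<^sub>R j)) = dilate c l m"
    by (auto simp: fun_eq_iff B dilate_def prod_eq_iff)
  moreover have "(\<Prod>j\<in>Basis. \<bar>?c j\<bar>) = \<bar>l * m\<bar>" by (simp add: B abs_mult)
  ultimately show ?thesis by simp
qed

lemma dilate_measurable[measurable]: "dilate c l m \<in> borel_measurable borel"
  unfolding dilate_def[abs_def] by (intro borel_measurable_continuous_onI continuous_intros)

lemma integral_dilate:
  fixes f :: "real \<times> real \<Rightarrow> 'b::{banach, second_countable_topology}"
  assumes [measurable]: "f \<in> borel_measurable borel" and l: "l \<noteq> 0" "m \<noteq> 0"
  shows "(LBINT z. f z) = \<bar>l * m\<bar> *\<^sub>R (LBINT z. f (dilate c l m z))"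
    and "integrable lborel f \<longleftrightarrow> integrable lborel (\<lambda>z. f (dilate c l m z))"
proof -
  have d: "lborel = density (distr lborel borel (dilate c l m)) (\<lambda>_. ennreal \<bar>l * m\<bar>)" by (rule lborel_dilate[OF l])
  have "(LBINT z. f z) = integral\<^sup>L (density (distr lborel borel (dilate c l m)) (\<lambda>_. ennreal \<bar>l * m\<bar>)) f" using d by simp
  also have "\<dots> = \<bar>l * m\<bar> *\<^sub>R (LBINT z. f (dilate c l m z))"
    by (subst integral_density) (auto simp: integral_distr)
  finally show "(LBINT z. f z) = \<bar>l * m\<bar> *\<^sub>R (LBINT z. f (dilate c l m z))" .
  have "integrable lborel f \<longleftrightarrow> integrable (density (distr lborel borel (dilate c l m)) (\<lambda>_. ennreal \<bar>l * m\<bar>)) f" using d by simp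
  also have "\<dots> \<longleftrightarrow> integrable lborel (\<lambda>z. f (dilate c l m z))"
  proof (subst integrable_density)
    have "integrable lborel (\<lambda>z. f (dilate c l m z))" if "integrable lborel (\<lambda>z. \<bar>l * m\<bar> *\<^sub>R f (dilate c l m z))"
    proof -
      have "integrable lborel (\<lambda>z. (1 / \<bar>l * m\<bar>) *\<^sub>R (\<bar>l * m\<bar> *\<^sub>R f (dilate c l m z)))"
        by (rule integrable_scaleR_right) (rule that)
      then show ?thesis using l by simp
    qed
    then show "integrable (distr lborel borel (dilate c l m)) (\<lambda>x. \<bar>l * m\<bar> *\<^sub>R f x) \<longleftrightarrow> integrable lborel (\<lambda>z. f (dilate c l m z))"
      by (auto simp: integrable_distr_eq)
  qed auto
  finally show "integrable lborel f \<longleftrightarrow> integrable lborel (\<lambda>z. f (dilate c l m z))" .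
qed

lemma box_pair: "box (a, p) (b, q) = {a<..<b} \<times> {p<..<(q::real)}" for a b :: real
  by (auto simp: box_def Basis_prod_def)

text \<open>The measures with densities the positive and the negative part of \<open>f\<close> agree
  on boxes, an intersection-stable generator of the Borel sets, hence everywhere; so the two parts
  agree almost everywhere.\<close>

lemma AE_zero_rectangles:
  fixes f :: "real \<times> real \<Rightarrow> real"
  assumes f: "integrable lborel f"
    and z: "\<And>a b p q. a < b \<Longrightarrow> p < q \<Longrightarrow> (LBINT z. f z * indicator ({a<..<b} \<times> {p<..<q}) z) = 0"
  shows "AE z in lborel. f z = 0"
proof -
  note [measurable] = borel_measurable_integrable[OF f, simplified]
  \<comment> \<open>\<open>ennreal\<close> sends negative numbers to 0, so these are the two parts
    of \<open>f\<close>, and at each point one of them vanishes.\<close>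
  let ?P = "\<lambda>z. ennreal (f z)" and ?N = "\<lambda>z. ennreal (- f z)"
  have fin: "(\<integral>\<^sup>+z. ennreal (f z) \<partial>lborel) \<noteq> \<infinity>" "(\<integral>\<^sup>+z. ennreal (- f z) \<partial>lborel) \<noteq> \<infinity>"
    using f by (auto simp: real_integrable_def)
  have ibox: "(LBINT z. f z * indicator (box a b) z) = 0" for a b :: "real \<times> real"
  proof (cases a, cases b)
    fix a1 a2 b1 b2 assume ab: "a = (a1, a2)" "b = (b1, b2)"
    show ?thesis
    proof (cases "a1 < b1 \<and> a2 < b2")
      case True then show ?thesis using z ab by (simp add: box_pair)
    next
      case False
      then have "box a b = {}" using ab by (auto simp: box_pair)
      then show ?thesis by simp
    qed
  qed
  have "density lborel ?P = density lborel ?N"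
  proof (rule measure_eqI_generator_eq)
    let ?E = "range (\<lambda>(a, b). box a b :: (real \<times> real) set)"
    show "Int_stable ?E" by (auto simp: Int_stable_def box_Int_box)
    show "?E \<subseteq> Pow UNIV" by auto
    show "sets (density lborel ?P) = sigma_sets UNIV ?E" "sets (density lborel ?N) = sigma_sets UNIV ?E"
      by (auto simp: borel_eq_box)
    show "range (\<lambda>i::nat. box (- real i, - real i) (real i, real i)) \<subseteq> ?E" by auto
    show "(\<Union>i::nat. box (- real i, - real i) (real i, real i)) = (UNIV :: (real \<times> real) set)"
    proof -
      have "\<exists>i::nat. z \<in> box (- real i, - real i) (real i, real i)" for z :: "real \<times> real"
      proof -
        obtain i :: nat where "max \<bar>fst z\<bar> \<bar>snd z\<bar> < real i" using reals_Archimedean2 by blast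
        then show ?thesis by (intro exI[of _ i]) (cases z, auto simp: box_pair)
      qed
      then show ?thesis by blast
    qed
    fix i :: nat
    show "emeasure (density lborel ?P) (box (- real i, - real i) (real i, real i)) \<noteq> \<infinity>"
    proof -
      have "emeasure (density lborel ?P) (box (- real i, - real i) (real i, real i)) \<le> (\<integral>\<^sup>+z. ennreal (f z) \<partial>lborel)"
        by (subst emeasure_density) (auto intro!: nn_integral_mono simp: indicator_def)
      then show ?thesis using fin by (auto simp: top_unique)
    qed
  next
    fix X assume "X \<in> range (\<lambda>(a, b). box a b :: (real \<times> real) set)"
    then obtain a b where X: "X = box a b" by auto
    have i: "integrable lborel (\<lambda>z. f z * indicator X z)" using integrable_real_mult_indicator[OF _ f, of X] X by simp
    have pn: "(\<integral>\<^sup>+z. ennreal (f z * indicator X z) \<partial>lborel) = (\<integral>\<^sup>+z. ennreal (- (f z * indicator X z)) \<partial>lborel)"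
    proof -
      have "enn2real (\<integral>\<^sup>+z. ennreal (f z * indicator X z) \<partial>lborel) = enn2real (\<integral>\<^sup>+z. ennreal (- (f z * indicator X z)) \<partial>lborel)"
        using real_lebesgue_integral_def[OF i] ibox[of a b] X by simp
      moreover have "(\<integral>\<^sup>+z. ennreal (f z * indicator X z) \<partial>lborel) < top" "(\<integral>\<^sup>+z. ennreal (- (f z * indicator X z)) \<partial>lborel) < top"
        using i by (auto simp: real_integrable_def less_top)
      ultimately show ?thesis by (metis ennreal_enn2real)
    qed
    have "emeasure (density lborel ?P) X = (\<integral>\<^sup>+z. ennreal (f z * indicator X z) \<partial>lborel)"
      using X by (subst emeasure_density) (auto intro!: nn_integral_cong simp: indicator_def)
    also have "\<dots> = emeasure (density lborel ?N) X" unfolding pn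
      using X by (subst emeasure_density) (auto intro!: nn_integral_cong simp: indicator_def)
    finally show "emeasure (density lborel ?P) X = emeasure (density lborel ?N) X" .
  qed
  then have "AE z in lborel. ?P z = ?N z"
    by (subst (asm) finite_density_unique) (use fin in auto)
  then show ?thesis
  proof eventually_elim
    case (elim z)
    then show ?case by (cases "0 \<le> f z") (auto simp: ennreal_neg ennreal_eq_0_iff)
  qed
qed

subsection \<open>Vertical primitives\<close>

text \<open>At nonpositive heights the interval is empty and the value is 0. A column that is not
  integrable also gives 0; for square integrable \<open>g\<close> this concerns a null set of
  abscissae.\<close>

definition vprim :: "(real \<times> real \<Rightarrow> real) \<Rightarrow> real \<times> real \<Rightarrow> real" where
  "vprim g z = (LBINT s. indicator {0<..<snd z} s * g (fst z, s))"

text \<open>The adjoint of \<open>vprim\<close> on the upper half plane, for a scalar function in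
  place of the gradient in \<open>tail\<close>.\<close>

definition vtail :: "(real \<times> real \<Rightarrow> real) \<Rightarrow> real \<times> real \<Rightarrow> real" where
  "vtail k z = (if 0 < snd z then LBINT t. indicator {snd z<..} t * k (fst z, t) else 0)"

lemma tail_eq_vtail: "tail D = vtail (\<lambda>z. fst (D z))"
  by (simp add: tail_def vtail_def fun_eq_iff)

lemma borel_measurable_pairI: "f \<in> borel_measurable borel \<Longrightarrow> f \<in> borel_measurable (borel \<Otimes>\<^sub>M borel)"
  for f :: "real \<times> real \<Rightarrow> real"
  unfolding borel_prod .

lemma vprim_measurable[measurable]:
  assumes "g \<in> borel_measurable borel"
  shows "vprim g \<in> borel_measurable borel"
proof -
  note [measurable] = borel_measurable_pairI[OF assms]
  show ?thesis unfolding vprim_def[abs_def] indicator_def greaterThanLessThan_iff by measurable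
qed

lemma vtail_measurable[measurable]:
  assumes "k \<in> borel_measurable borel"
  shows "vtail k \<in> borel_measurable borel"
proof -
  note [measurable] = borel_measurable_pairI[OF assms]
  have [measurable]: "(\<lambda>z. LBINT t. indicator {snd z<..} t * k (fst z, t)) \<in> borel_measurable borel"
    unfolding indicator_def greaterThan_iff by measurable
  show ?thesis unfolding vtail_def[abs_def] by measurable
qed

text \<open>Both sides integrate \<open>g s * k y\<close> over the triangle
  \<open>0 < s < y\<close>.\<close>

lemma fubini_tail_slice:
  fixes g k :: "real \<Rightarrow> real"
  assumes g: "integrable lborel g" and k: "integrable lborel k"
  shows "(LBINT y. (LBINT s. indicator {0<..<y} s * g s) * k y) =
    (LBINT s. g s * (if 0 < s then LBINT t. indicator {s<..} t * k t else 0))"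
proof -
  note [measurable] = borel_measurable_integrable[OF g, simplified] borel_measurable_integrable[OF k, simplified]
  define f where "f y s = (if 0 < s \<and> s < y then g s * k y else 0)" for y s
  have i0: "integrable (lborel \<Otimes>\<^sub>M lborel) (\<lambda>(y, s). k y * g s)"
  proof (rule lborel_pair.Fubini_integrable)
    show "integrable lborel (\<lambda>x. LBINT y. norm (case (x, y) of (y, s) \<Rightarrow> k y * g s))"
      using k by (simp add: abs_mult)
    show "AE x in lborel. integrable lborel (\<lambda>y. case (x, y) of (y, s) \<Rightarrow> k y * g s)"
      using g by simp
  qed measurable
  have i: "integrable (lborel \<Otimes>\<^sub>M lborel) (\<lambda>(y, s). f y s)"
    by (rule Bochner_Integration.integrable_bound[OF i0]) (auto simp: f_def abs_mult)
  have "(LBINT y. (LBINT s. indicator {0<..<y} s * g s) * k y) = (LBINT y. LBINT s. f y s)"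
  proof (rule Bochner_Integration.integral_cong[OF refl])
    fix y
    have "(LBINT s. indicator {0<..<y} s * g s) * k y = (LBINT s. indicator {0<..<y} s * g s * k y)" by simp
    also have "\<dots> = (LBINT s. f y s)" by (rule Bochner_Integration.integral_cong) (auto simp: f_def indicator_def)
    finally show "(LBINT s. indicator {0<..<y} s * g s) * k y = (LBINT s. f y s)" .
  qed
  also have "\<dots> = (LBINT s. LBINT y. f y s)" by (rule lborel_pair.Fubini_integral[OF i, symmetric])
  also have "\<dots> = (LBINT s. g s * (if 0 < s then LBINT t. indicator {s<..} t * k t else 0))"
  proof (rule Bochner_Integration.integral_cong[OF refl])
    fix s
    have "(LBINT y. f y s) = (LBINT t. g s * (if 0 < s then indicator {s<..} t * k t else 0))"
      by (rule Bochner_Integration.integral_cong) (auto simp: f_def indicator_def)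
    then show "(LBINT y. f y s) = g s * (if 0 < s then LBINT t. indicator {s<..} t * k t else 0)" by simp
  qed
  finally show ?thesis .
qed

lemma vtail_bounds:
  assumes [measurable]: "k \<in> borel_measurable borel"
    and k: "\<And>z. \<bar>k z\<bar> \<le> B" "\<And>x y. R < \<bar>x\<bar> \<or> R < \<bar>y\<bar> \<Longrightarrow> k (x, y) = 0" and R: "0 < R"
  shows "\<bar>vtail k z\<bar> \<le> B * (2 * R)" "R < \<bar>fst z\<bar> \<or> R < \<bar>snd z\<bar> \<Longrightarrow> vtail k z = 0"
    "integrable lborel (\<lambda>t. indicator {s<..} t * k (x, t))"
proof -
  note [measurable] = borel_measurable_pairI[OF assms(1)]
  have B: "0 \<le> B" using k(1)[of 0] by linarith
  have b: "\<bar>indicator {s<..} t * k (x, t)\<bar> \<le> B * indicator {-R..R} t" for s t x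
  proof (cases "t \<in> {-R..R}")
    case True
    then show ?thesis using k(1)[of "(x, t)"] B by (auto simp: indicator_def)
  next
    case False
    then have "R < \<bar>t\<bar>" by auto
    then show ?thesis using k(2)[of x t] B by simp
  qed
  have i: "integrable lborel (\<lambda>t. B * indicator {-R..R} t)"
    using R by (intro integrable_mult_right integrable_real_indicator) (auto simp: less_top[symmetric])
  show ii: "integrable lborel (\<lambda>t. indicator {s<..} t * k (x, t))" for s x
    by (rule Bochner_Integration.integrable_bound[OF i]) (use b B in \<open>auto intro: order_trans[OF b]\<close>)
  have "\<bar>LBINT t. indicator {snd z<..} t * k (fst z, t)\<bar> \<le> (LBINT t. B * indicator {-R..R} t)"
    by (rule order_trans[OF integral_abs_bound integral_mono[OF integrable_abs[OF ii] i b]])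
  also have "\<dots> = B * (2 * R)" using R by simp
  finally show "\<bar>vtail k z\<bar> \<le> B * (2 * R)" using B R by (simp add: vtail_def)
  assume z: "R < \<bar>fst z\<bar> \<or> R < \<bar>snd z\<bar>"
  show "vtail k z = 0"
  proof (cases "0 < snd z")
    case True
    have "(LBINT t. indicator {snd z<..} t * k (fst z, t)) = (LBINT t::real. 0)"
      by (rule Bochner_Integration.integral_cong) (use z True in \<open>auto simp: indicator_def intro!: k(2)\<close>)
    then show ?thesis by (simp add: vtail_def)
  qed (simp add: vtail_def)
qed

lemma integrable_rectangle:
  fixes g :: "real \<times> real \<Rightarrow> real"
  assumes g: "sqint lborel g" and S: "S \<in> sets borel" "emeasure lborel S < \<infinity>"
  shows "integrable lborel (\<lambda>z. indicator S z * g z)"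
proof -
  have "sqint lborel (indicator S :: _ \<Rightarrow> real)"
    by (rule sqint_bound[of _ _ "indicator S"]) (use S in \<open>auto simp: indicator_def\<close>)
  from sqint_inner[OF this g] show ?thesis by simp
qed

text \<open>The exchange on each column, integrated over the columns. Since \<open>g\<close> is
  merely square integrable, it is first cut off to a square carrying \<open>k\<close>, on which it
  is integrable.\<close>

lemma fubini_tail:
  fixes g k :: "real \<times> real \<Rightarrow> real"
  assumes g: "sqint lborel g" and km: "k \<in> borel_measurable borel"
    and k: "\<And>z. \<bar>k z\<bar> \<le> B" "\<And>x y. R < \<bar>x\<bar> \<or> R < \<bar>y\<bar> \<Longrightarrow> k (x, y) = 0" and R: "0 < R"
  shows "(LBINT z. vprim g z * k z) = (LBINT z. g z * vtail k z)" "integrable lborel (\<lambda>z. vprim g z * k z)"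
proof -
  have B: "0 \<le> B" using k(1)[of 0] by linarith
  have gm[measurable]: "g \<in> borel_measurable borel" using sqintD(1)[OF g] by simp
  note [measurable] = km borel_measurable_pairI[OF gm] borel_measurable_pairI[OF km]
  let ?S = "{-R..R} \<times> {-R..R} :: (real \<times> real) set"
  have S: "?S \<in> sets borel" by (auto intro!: borel_closed closed_Times)
  have Sfin: "emeasure lborel ?S < \<infinity>" by (rule emeasure_bounded_finite) (simp add: bounded_Times)
  define g' where "g' z = indicator ?S z * g z" for z
  have g': "integrable lborel g'" unfolding g'_def by (rule integrable_rectangle[OF g S Sfin])
  have g'm[measurable]: "g' \<in> borel_measurable borel" using borel_measurable_integrable[OF g'] by simp
  note [measurable] = borel_measurable_pairI[OF g'm]
  have g'p: "integrable (lborel \<Otimes>\<^sub>M lborel) g'" using g' by (simp add: lborel_prod)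
  \<comment> \<open>Below a point of the square the column down to the axis stays in the square, so
    the cutoff does not affect the primitive where \<open>k\<close> is nonzero.\<close>
  have UU: "vprim g z * k z = vprim g' z * k z" for z
  proof (cases "k z = 0")
    case False
    then have z: "\<bar>fst z\<bar> \<le> R" "\<bar>snd z\<bar> \<le> R" using k(2)[of "fst z" "snd z"] by (auto simp: not_less[symmetric])
    have "vprim g z = vprim g' z" unfolding vprim_def
      by (rule Bochner_Integration.integral_cong) (use z in \<open>auto simp: g'_def indicator_def\<close>)
    then show ?thesis by simp
  qed simp
  have gK: "g z * vtail k z = g' z * vtail k z" for z
  proof (cases "z \<in> ?S")
    case False
    then have "R < \<bar>fst z\<bar> \<or> R < \<bar>snd z\<bar>" by (cases z) auto
    then show ?thesis using vtail_bounds(2)[OF km k R, of z] by simp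
  qed (simp add: g'_def)
  \<comment> \<open>The L^1 norm of a column bounds its primitive at every height, and is integrable
    in the abscissa; this dominates the product.\<close>
  define m where "m x = (LBINT s. \<bar>g' (x, s)\<bar>)" for x
  have m: "integrable lborel m" unfolding m_def[abs_def]
    using lborel_pair.integrable_fst'[OF integrable_abs[OF g'p]] by simp
  have sl: "AE x in lborel. integrable lborel (\<lambda>s. g' (x, s))"
    using lborel_pair.AE_integrable_fst'[OF g'p] .
  have Ub: "\<bar>vprim g' (x, y)\<bar> \<le> m x" if "integrable lborel (\<lambda>s. g' (x, s))" for x y
  proof -
    have "\<bar>vprim g' (x, y)\<bar> \<le> (LBINT s. \<bar>indicator {0<..<y} s * g' (x, s)\<bar>)" unfolding vprim_def
      using integral_abs_bound[of lborel "\<lambda>s. indicator {0<..<y} s * g' (x, s)"] by simp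
    also have "\<dots> \<le> m x" unfolding m_def
    proof (rule integral_mono)
      show "integrable lborel (\<lambda>s. \<bar>indicator {0<..<y} s * g' (x, s)\<bar>)"
        by (rule Bochner_Integration.integrable_bound[OF integrable_abs[OF that]]) (auto simp: indicator_def)
      show "integrable lborel (\<lambda>s. \<bar>g' (x, s)\<bar>)" using that by simp
    qed (auto simp: indicator_def)
    finally show ?thesis .
  qed
  have i: "integrable (lborel \<Otimes>\<^sub>M lborel) (\<lambda>z. vprim g' z * k z)"
  proof (rule lborel_pair.Fubini_integrable)
    show meas: "(\<lambda>z. vprim g' z * k z) \<in> borel_measurable (lborel \<Otimes>\<^sub>M lborel)" unfolding lborel_prod by measurable
    have bd: "\<bar>vprim g' (x, y) * k (x, y)\<bar> \<le> m x * B * indicator {-R..R} y"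
      if "integrable lborel (\<lambda>s. g' (x, s))" for x y
    proof (cases "y \<in> {-R..R}")
      case True
      have "\<bar>vprim g' (x, y)\<bar> * \<bar>k (x, y)\<bar> \<le> m x * B" by (rule mult_mono[OF Ub[OF that] k(1)]) (auto simp: m_def)
      then show ?thesis using True by (simp add: abs_mult)
    next
      case False
      then have "R < \<bar>y\<bar>" by auto
      then show ?thesis using k(2)[of x y] False by simp
    qed
    have ri: "integrable lborel (\<lambda>y. c * indicator {-R..R} y)" for c :: real
      using R by (intro integrable_mult_right integrable_real_indicator) (auto simp: less_top[symmetric])
    show a: "AE x in lborel. integrable lborel (\<lambda>y. vprim g' (x, y) * k (x, y))"
      using sl
    proof eventually_elim
      case (elim x)
      show ?case
      proof (rule Bochner_Integration.integrable_bound[OF ri[of "m x * B"]])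
        show "AE y in lborel. norm (vprim g' (x, y) * k (x, y)) \<le> norm (m x * B * indicator {-R..R} y)"
          using bd[OF elim] by (intro AE_I2) (auto intro: order_trans[OF _ abs_ge_self])
        show "(\<lambda>y. vprim g' (x, y) * k (x, y)) \<in> borel_measurable lborel"
          using measurable_Pair2[OF meas, of x] by simp
      qed
    qed
    have "integrable lborel (\<lambda>x. m x * B * (2 * R))" using m by simp
    then show "integrable lborel (\<lambda>x. LBINT y. norm (vprim g' (x, y) * k (x, y)))"
    proof (rule Bochner_Integration.integrable_bound)
      have "(\<lambda>(x, y). norm (vprim g' (x, y) * k (x, y))) \<in> borel_measurable (lborel \<Otimes>\<^sub>M lborel)"
        using measurable_compose[OF meas borel_measurable_norm] by (simp add: case_prod_unfold)
      then show "(\<lambda>x. LBINT y. norm (vprim g' (x, y) * k (x, y))) \<in> borel_measurable lborel"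
        by (rule lborel.borel_measurable_lebesgue_integral)
      show "AE x in lborel. norm (LBINT y. norm (vprim g' (x, y) * k (x, y))) \<le> norm (m x * B * (2 * R))"
        using sl a
      proof eventually_elim
        case (elim x)
        have "(LBINT y. \<bar>vprim g' (x, y) * k (x, y)\<bar>) \<le> (LBINT y. m x * B * indicator {-R..R} y)"
          by (rule integral_mono[OF integrable_abs[OF elim(2)] ri bd[OF elim(1)]])
        also have "\<dots> = m x * B * (2 * R)" using R by simp
        finally have "(LBINT y. \<bar>vprim g' (x, y) * k (x, y)\<bar>) \<le> m x * B * (2 * R)" .
        moreover have "0 \<le> (LBINT y. \<bar>vprim g' (x, y) * k (x, y)\<bar>)" by (rule Bochner_Integration.integral_nonneg) simp
        ultimately show ?case by simp
      qed
    qed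
  qed
  show "integrable lborel (\<lambda>z. vprim g z * k z)" unfolding UU using i by (simp add: lborel_prod)
  have gKi: "integrable (lborel \<Otimes>\<^sub>M lborel) (\<lambda>z. g' z * vtail k z)"
  proof (rule Bochner_Integration.integrable_bound)
    show "integrable (lborel \<Otimes>\<^sub>M lborel) (\<lambda>z. B * (2 * R) * g' z)" using g'p by simp
    show "AE z in lborel \<Otimes>\<^sub>M lborel. norm (g' z * vtail k z) \<le> norm (B * (2 * R) * g' z)"
    proof (rule AE_I2)
      fix z
      have "\<bar>g' z\<bar> * \<bar>vtail k z\<bar> \<le> \<bar>g' z\<bar> * (B * (2 * R))" by (rule mult_left_mono[OF vtail_bounds(1)[OF km k R] abs_ge_zero])
      then show "norm (g' z * vtail k z) \<le> norm (B * (2 * R) * g' z)" using B R by (simp add: abs_mult mult_ac)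
    qed
    show "(\<lambda>z. g' z * vtail k z) \<in> borel_measurable (lborel \<Otimes>\<^sub>M lborel)" unfolding lborel_prod by measurable
  qed
  have ks: "integrable lborel (\<lambda>t. k (x, t))" for x
  proof (rule integrable_bounded_support[of _ B R])
    show "(\<lambda>t. k (x, t)) \<in> borel_measurable borel" by measurable
  qed (use k in auto)
  have "(LBINT z. vprim g z * k z) = (LBINT x. LBINT y. vprim g' (x, y) * k (x, y))"
    unfolding UU using lborel_pair.integral_fst'[OF i] by (simp add: lborel_prod)
  also have "\<dots> = (LBINT x. LBINT s. g' (x, s) * vtail k (x, s))"
  proof (rule integral_cong_AE)
    show "AE x in lborel. (LBINT y. vprim g' (x, y) * k (x, y)) = (LBINT s. g' (x, s) * vtail k (x, s))"
      using sl
    proof eventually_elim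
      case (elim x)
      show ?case using fubini_tail_slice[OF elim ks[of x]] by (simp only: vprim_def vtail_def fst_conv snd_conv)
    qed
    show "(\<lambda>x. LBINT y. vprim g' (x, y) * k (x, y)) \<in> borel_measurable lborel"
      using borel_measurable_integrable[OF lborel_pair.integrable_fst'[OF i]] .
    show "(\<lambda>x. LBINT s. g' (x, s) * vtail k (x, s)) \<in> borel_measurable lborel"
      using borel_measurable_integrable[OF lborel_pair.integrable_fst'[OF gKi]] .
  qed
  also have "\<dots> = (LBINT z. g z * vtail k z)"
    unfolding gK using lborel_pair.integral_fst'[OF gKi] by (simp add: lborel_prod)
  finally show "(LBINT z. vprim g z * k z) = (LBINT z. g z * vtail k z)" .
qed

subsection \<open>Weak gradients in components\<close>

text \<open>Integrals over the whole plane of functions extended by zero, and one equation per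
  component, replace set integrals with vector values; \<open>has_L2_weak_gradient_iff\<close>
  translates between the two.\<close>

definition wgrad :: "(real \<times> real) set \<Rightarrow> (real \<times> real \<Rightarrow> real) \<Rightarrow> (real \<times> real \<Rightarrow> real \<times> real) \<Rightarrow> bool" where
  "wgrad \<Omega> u G \<longleftrightarrow> sqint lborel u \<and> sqint lborel G \<and>
    (\<forall>\<phi> D. test_function \<Omega> \<phi> D \<longrightarrow>
      (LBINT z. u z * fst (D z)) = - (LBINT z. \<phi> z * fst (G z)) \<and>
      (LBINT z. u z * snd (D z)) = - (LBINT z. \<phi> z * snd (G z)))"

lemma wgradD:
  assumes "wgrad \<Omega> u G"
  shows "sqint lborel u" "sqint lborel G"
    "test_function \<Omega> \<phi> D \<Longrightarrow> (LBINT z. u z * fst (D z)) = - (LBINT z. \<phi> z * fst (G z))"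
    "test_function \<Omega> \<phi> D \<Longrightarrow> (LBINT z. u z * snd (D z)) = - (LBINT z. \<phi> z * snd (G z))"
  using assms unfolding wgrad_def by blast+

lemma L2_iff_sqint: "L2 \<Omega> f \<longleftrightarrow> sqint lborel (\<lambda>z. indicator \<Omega> z *\<^sub>R f z)"
proof -
  have "(norm (indicator \<Omega> z *\<^sub>R f z))\<^sup>2 = indicator \<Omega> z *\<^sub>R (norm (f z))\<^sup>2" for z
    by (auto simp: indicator_def)
  then show ?thesis
    unfolding L2_def sqint_def set_borel_measurable_def set_integrable_def by simp
qed

lemma sqint_bounded_support:
  fixes f :: "'a::euclidean_space \<Rightarrow> 'b::euclidean_space"
  assumes [measurable]: "f \<in> borel_measurable borel"
    and b: "\<And>x. norm (f x) \<le> B" and s: "\<And>x. R < norm x \<Longrightarrow> f x = 0"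
  shows "sqint lborel f"
  unfolding sqint_def
proof
  have "0 \<le> B" using b norm_ge_zero order_trans by blast
  then show "integrable lborel (\<lambda>x. (norm (f x))\<^sup>2)"
    by (intro integrable_bounded_support[of _ "B\<^sup>2" R]) (use b s in \<open>auto intro!: power_mono\<close>)
qed simp

lemma sqint_test:
  assumes t: "test_function \<Omega> \<phi> D"
  shows "sqint lborel \<phi>" "sqint lborel D"
proof -
  obtain R where R: "\<And>x. norm (\<phi> x) \<le> R" "\<And>x. norm (D x) \<le> R" "\<And>x. R < norm x \<Longrightarrow> \<phi> x = 0" "\<And>x. R < norm x \<Longrightarrow> D x = 0"
    using test_function_bounds[OF t] by blast
  show "sqint lborel \<phi>" by (rule sqint_bounded_support[OF test_functionD(6)[OF t] R(1) R(3)])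
  show "sqint lborel D" by (rule sqint_bounded_support[OF test_functionD(5)[OF t] R(2) R(4)])
qed

lemma sqint_scaleR_integrable:
  fixes f :: "'a \<Rightarrow> real" and g :: "'a \<Rightarrow> 'b::euclidean_space"
  assumes f: "sqint M f" and g: "sqint M g"
  shows "integrable M (\<lambda>x. f x *\<^sub>R g x)"
proof (rule Bochner_Integration.integrable_bound)
  show "integrable M (\<lambda>x. (norm (f x))\<^sup>2 + (norm (g x))\<^sup>2)" using sqintD[OF f] sqintD[OF g] by auto
  show "(\<lambda>x. f x *\<^sub>R g x) \<in> borel_measurable M" using sqintD(1)[OF f] sqintD(1)[OF g] by measurable
  show "AE x in M. norm (f x *\<^sub>R g x) \<le> norm ((norm (f x))\<^sup>2 + (norm (g x))\<^sup>2)"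
  proof (rule AE_I2)
    fix x
    have "0 \<le> (norm (f x) - norm (g x))\<^sup>2" "0 \<le> norm (f x) * norm (g x)" by auto
    then have "norm (f x) * norm (g x) \<le> (norm (f x))\<^sup>2 + (norm (g x))\<^sup>2" unfolding power2_diff by linarith
    then show "norm (f x *\<^sub>R g x) \<le> norm ((norm (f x))\<^sup>2 + (norm (g x))\<^sup>2)" by simp
  qed
qed

lemma sqint_components:
  fixes G :: "'a \<Rightarrow> real \<times> real"
  assumes G: "sqint M G"
  shows "sqint M (\<lambda>z. fst (G z))" "sqint M (\<lambda>z. snd (G z))"
proof -
  note [measurable] = sqintD(1)[OF G]
  have m: "(\<lambda>z. fst (G z)) \<in> borel_measurable M" "(\<lambda>z. snd (G z)) \<in> borel_measurable M" by measurable
  have "(norm (fst p))\<^sup>2 \<le> (norm p)\<^sup>2" "(norm (snd p))\<^sup>2 \<le> (norm p)\<^sup>2" for p :: "real \<times> real"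
    using norm_fst_le[of "fst p" "snd p"] norm_snd_le[of "snd p" "fst p"] by (auto intro!: power_mono simp del: real_norm_def)
  note n = this
  show "sqint M (\<lambda>z. fst (G z))" by (rule sqint_bound[OF m(1) sqintD(2)[OF G] n(1)])
  show "sqint M (\<lambda>z. snd (G z))" by (rule sqint_bound[OF m(2) sqintD(2)[OF G] n(2)])
qed

lemma sqint_indicator:
  assumes f: "sqint lborel f" and S: "S \<in> sets borel"
  shows "sqint lborel (\<lambda>z. indicator S z *\<^sub>R f z)"
  by (rule sqint_bound[OF _ sqintD(2)[OF f]]) (use sqintD(1)[OF f] S in \<open>auto simp: indicator_def\<close>)

lemma has_L2_weak_gradient_iff:
  fixes u :: "real \<times> real \<Rightarrow> real"
  assumes u: "L2 \<Omega> u"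
  shows "has_L2_weak_gradient \<Omega> u G \<longleftrightarrow> wgrad \<Omega> (\<lambda>z. indicator \<Omega> z *\<^sub>R u z) (\<lambda>z. indicator \<Omega> z *\<^sub>R G z)"
proof -
  let ?u = "\<lambda>z. indicator \<Omega> z *\<^sub>R u z" and ?G = "\<lambda>z. indicator \<Omega> z *\<^sub>R G z"
  have su: "sqint lborel ?u" using u by (simp add: L2_iff_sqint)
  have eq: "((LINT z:\<Omega>|lborel. u z *\<^sub>R D z) = - (LINT z:\<Omega>|lborel. \<phi> z *\<^sub>R G z)) \<longleftrightarrow>
     (LBINT z. ?u z * fst (D z)) = - (LBINT z. \<phi> z * fst (?G z)) \<and>
     (LBINT z. ?u z * snd (D z)) = - (LBINT z. \<phi> z * snd (?G z))"
    if sG: "sqint lborel ?G" and t: "test_function \<Omega> \<phi> D" for \<phi> D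
  proof -
    have i: "integrable lborel (\<lambda>z. ?u z *\<^sub>R D z)" "integrable lborel (\<lambda>z. \<phi> z *\<^sub>R ?G z)"
      using sqint_scaleR_integrable[OF su sqint_test(2)[OF t]] sqint_scaleR_integrable[OF sqint_test(1)[OF t] sG] by auto
    have c: "(LINT z:\<Omega>|lborel. u z *\<^sub>R D z) = (LBINT z. ?u z *\<^sub>R D z)"
      "(LINT z:\<Omega>|lborel. \<phi> z *\<^sub>R G z) = (LBINT z. \<phi> z *\<^sub>R ?G z)"
      unfolding set_lebesgue_integral_def by (simp_all add: mult.commute)
    have "(LBINT z. ?u z * fst (D z)) = fst (LBINT z. ?u z *\<^sub>R D z)" "(LBINT z. ?u z * snd (D z)) = snd (LBINT z. ?u z *\<^sub>R D z)"
      "(LBINT z. \<phi> z * fst (?G z)) = fst (LBINT z. \<phi> z *\<^sub>R ?G z)" "(LBINT z. \<phi> z * snd (?G z)) = snd (LBINT z. \<phi> z *\<^sub>R ?G z)"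
      using integral_bounded_linear[OF bounded_linear_fst i(1)] integral_bounded_linear[OF bounded_linear_snd i(1)]
        integral_bounded_linear[OF bounded_linear_fst i(2)] integral_bounded_linear[OF bounded_linear_snd i(2)]
      by (simp_all only: fst_scaleR[of "\<phi> _"] snd_scaleR[of "\<phi> _"] fst_scaleR[of "indicator \<Omega> _ *\<^sub>R u _"] snd_scaleR[of "indicator \<Omega> _ *\<^sub>R u _"] real_scaleR_def[of "\<phi> _"] real_scaleR_def[of "indicator \<Omega> _ *\<^sub>R u _"])
    then show ?thesis unfolding c prod_eq_iff by (simp only: fst_uminus snd_uminus)
  qed
  show ?thesis unfolding has_L2_weak_gradient_def wgrad_def L2_iff_sqint using su eq by blast
qed

lemma wgrad_lin:
  assumes u: "wgrad \<Omega> u G" and v: "wgrad \<Omega> v H"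
  shows "wgrad \<Omega> (\<lambda>z. u z + c * v z) (\<lambda>z. G z + c *\<^sub>R H z)"
  unfolding wgrad_def
proof (intro conjI allI impI)
  show "sqint lborel (\<lambda>z. u z + c * v z)" using sqint_add[OF wgradD(1)[OF u] sqint_scale[OF wgradD(1)[OF v], of c]] by simp
  show "sqint lborel (\<lambda>z. G z + c *\<^sub>R H z)" using sqint_add[OF wgradD(2)[OF u] sqint_scale[OF wgradD(2)[OF v], of c]] by simp
  fix \<phi> D assume t: "test_function \<Omega> \<phi> D"
  have D: "sqint lborel (\<lambda>z. fst (D z))" "sqint lborel (\<lambda>z. snd (D z))" using sqint_components[OF sqint_test(2)[OF t]] by auto
  have i: "integrable lborel (\<lambda>z. u z * fst (D z))" "integrable lborel (\<lambda>z. u z * snd (D z))"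
    "integrable lborel (\<lambda>z. v z * fst (D z))" "integrable lborel (\<lambda>z. v z * snd (D z))"
    "integrable lborel (\<lambda>z. \<phi> z * fst (G z))" "integrable lborel (\<lambda>z. \<phi> z * snd (G z))"
    "integrable lborel (\<lambda>z. \<phi> z * fst (H z))" "integrable lborel (\<lambda>z. \<phi> z * snd (H z))"
    using sqint_inner[OF wgradD(1)[OF u] D(1)] sqint_inner[OF wgradD(1)[OF u] D(2)]
      sqint_inner[OF wgradD(1)[OF v] D(1)] sqint_inner[OF wgradD(1)[OF v] D(2)]
      sqint_inner[OF sqint_test(1)[OF t] sqint_components(1)[OF wgradD(2)[OF u]]]
      sqint_inner[OF sqint_test(1)[OF t] sqint_components(2)[OF wgradD(2)[OF u]]]
      sqint_inner[OF sqint_test(1)[OF t] sqint_components(1)[OF wgradD(2)[OF v]]]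
      sqint_inner[OF sqint_test(1)[OF t] sqint_components(2)[OF wgradD(2)[OF v]]] by auto
  have e: "(u z + c * v z) * d = u z * d + c * (v z * d)" "\<phi> z * (x + c * y) = \<phi> z * x + c * (\<phi> z * y)" for z d x y
    by (simp_all add: algebra_simps)
  show "(LBINT z. (u z + c * v z) * fst (D z)) = - (LBINT z. \<phi> z * fst (G z + c *\<^sub>R H z))"
    unfolding e fst_add fst_scaleR real_scaleR_def using i wgradD(3)[OF u t] wgradD(3)[OF v t] by simp
  show "(LBINT z. (u z + c * v z) * snd (D z)) = - (LBINT z. \<phi> z * snd (G z + c *\<^sub>R H z))"
    unfolding e snd_add snd_scaleR real_scaleR_def using i wgradD(4)[OF u t] wgradD(4)[OF v t] by simp
qed

lemma wgrad_restrict: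
  assumes u: "wgrad \<Omega> u G" and s: "\<Omega>' \<subseteq> \<Omega>" "\<Omega>' \<in> sets borel"
  shows "wgrad \<Omega>' (\<lambda>z. indicator \<Omega>' z *\<^sub>R u z) (\<lambda>z. indicator \<Omega>' z *\<^sub>R G z)"
  unfolding wgrad_def
proof (intro conjI allI impI)
  show "sqint lborel (\<lambda>z. indicator \<Omega>' z *\<^sub>R u z)" "sqint lborel (\<lambda>z. indicator \<Omega>' z *\<^sub>R G z)"
    using sqint_indicator[OF wgradD(1)[OF u] s(2)] sqint_indicator[OF wgradD(2)[OF u] s(2)] by auto
  fix \<phi> D assume t: "test_function \<Omega>' \<phi> D"
  have t': "test_function \<Omega> \<phi> D" by (rule test_function_mono[OF t s(1)])
  have e: "indicator \<Omega>' z *\<^sub>R u z * fst (D z) = u z * fst (D z)" "indicator \<Omega>' z *\<^sub>R u z * snd (D z) = u z * snd (D z)"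
    "\<phi> z * fst (indicator \<Omega>' z *\<^sub>R G z) = \<phi> z * fst (G z)" "\<phi> z * snd (indicator \<Omega>' z *\<^sub>R G z) = \<phi> z * snd (G z)" for z
  proof -
    have "\<phi> z = 0 \<and> D z = 0" if "z \<notin> \<Omega>'" using test_functionD(4)[OF t, of z] that by blast
    then show "indicator \<Omega>' z *\<^sub>R u z * fst (D z) = u z * fst (D z)" "indicator \<Omega>' z *\<^sub>R u z * snd (D z) = u z * snd (D z)"
      "\<phi> z * fst (indicator \<Omega>' z *\<^sub>R G z) = \<phi> z * fst (G z)" "\<phi> z * snd (indicator \<Omega>' z *\<^sub>R G z) = \<phi> z * snd (G z)"
      by (cases "z \<in> \<Omega>'"; simp)+
  qed
  show "(LBINT z. indicator \<Omega>' z *\<^sub>R u z * fst (D z)) = - (LBINT z. \<phi> z * fst (indicator \<Omega>' z *\<^sub>R G z))"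
    unfolding e by (rule wgradD(3)[OF u t'])
  show "(LBINT z. indicator \<Omega>' z *\<^sub>R u z * snd (D z)) = - (LBINT z. \<phi> z * snd (indicator \<Omega>' z *\<^sub>R G z))"
    unfolding e by (rule wgradD(4)[OF u t'])
qed

subsection \<open>The fundamental lemma\<close>

lemma bump_tendsto: "(\<lambda>n. bump s t (inverse (real (Suc n))) x) \<longlonglongrightarrow> indicator {s<..<t} x"
proof (rule tendsto_eventually)
  have p: "0 < inverse (real (Suc n))" for n by simp
  show "\<forall>\<^sub>F n in sequentially. bump s t (inverse (real (Suc n))) x = indicator {s<..<t} x"
  proof (cases "x \<in> {s<..<t}")
    case True
    define e where "e = min (x - s) (t - x) / 3"
    have "\<forall>\<^sub>F n in sequentially. inverse (real (Suc n)) < e"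
      using LIMSEQ_inverse_real_of_nat by (rule order_tendstoD) (use True in \<open>simp add: e_def\<close>)
    then show ?thesis
    proof eventually_elim
      case (elim n)
      have "x \<in> {s + 3 * inverse (real (Suc n))..t - 3 * inverse (real (Suc n))}" using elim by (simp add: e_def)
      from bump_1[OF p this] show ?case using True by simp
    qed
  next
    case False
    have "x \<notin> {s + d..t - d}" if "0 < d" for d using False that by auto
    then have "bump s t (inverse (real (Suc n))) x = 0" for n
      using p by (intro bump_0) blast+
    then show ?thesis using False by simp
  qed
qed

lemma open_rectangle: "open ({a<..<b} \<times> {p<..<(q::real)})" for a b :: real
  by (intro open_Times open_greaterThanLessThan)

lemma emeasure_rectangle: "emeasure lborel ({a<..<b} \<times> {p<..<(q::real)}) < \<infinity>" for a b :: real
  by (rule emeasure_bounded_finite) (simp add: bounded_Times)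

lemma rectangle_integral_zero:
  fixes f :: "real \<times> real \<Rightarrow> real"
  assumes f: "integrable lborel f"
    and z: "\<And>d. 0 < d \<Longrightarrow> (LBINT z. f z * (bump s t d (fst z) * bump p q d (snd z))) = 0"
  shows "(LBINT z. f z * indicator ({s<..<t} \<times> {p<..<q}) z) = 0"
proof -
  note [measurable] = borel_measurable_integrable[OF f, simplified]
  let ?b = "\<lambda>n z. bump s t (inverse (real (Suc n))) (fst z) * bump p q (inverse (real (Suc n))) (snd z)"
  have [measurable]: "bump x y (inverse (real (Suc n))) \<in> borel_measurable borel" for n x y
    by (intro borel_measurable_continuous_onI continuous_bump) simp
  have "(\<lambda>n. LBINT z. f z * ?b n z) \<longlonglongrightarrow> (LBINT z. f z * indicator ({s<..<t} \<times> {p<..<q}) z)"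
  proof (rule integral_dominated_convergence[OF _ _ integrable_abs[OF f]])
    show "(\<lambda>z. f z * indicator ({s<..<t} \<times> {p<..<q}) z) \<in> borel_measurable lborel"
      using borel_open[OF open_rectangle[of s t p q]] borel_measurable_integrable[OF f]
      by (intro borel_measurable_times borel_measurable_indicator) auto
    show "AE z in lborel. (\<lambda>n. f z * ?b n z) \<longlonglongrightarrow> f z * indicator ({s<..<t} \<times> {p<..<q}) z"
    proof (rule AE_I2)
      fix z :: "real \<times> real"
      have "(\<lambda>n. ?b n z) \<longlonglongrightarrow> indicator {s<..<t} (fst z) * indicator {p<..<q} (snd z)"
        by (intro tendsto_mult bump_tendsto)
      moreover have "indicator {s<..<t} (fst z) * indicator {p<..<q} (snd z) = (indicator ({s<..<t} \<times> {p<..<q}) z :: real)"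
        by (cases z) (auto simp: indicator_def)
      ultimately show "(\<lambda>n. f z * ?b n z) \<longlonglongrightarrow> f z * indicator ({s<..<t} \<times> {p<..<q}) z"
        by (intro tendsto_mult_left) simp
    qed
    show "AE z in lborel. norm (f z * ?b n z) \<le> \<bar>f z\<bar>" for n
    proof (rule AE_I2)
      fix z
      have "0 \<le> ?b n z" "?b n z \<le> 1" using bump_bounds by (auto intro!: mult_nonneg_nonneg mult_le_one)
      then have "\<bar>f z\<bar> * \<bar>?b n z\<bar> \<le> \<bar>f z\<bar> * 1" by (intro mult_left_mono) auto
      then show "norm (f z * ?b n z) \<le> \<bar>f z\<bar>" by (simp add: abs_mult)
    qed
  qed measurable
  moreover have "(LBINT z. f z * ?b n z) = 0" for n by (rule z) simp
  ultimately have "(\<lambda>n::nat. 0::real) \<longlonglongrightarrow> (LBINT z. f z * indicator ({s<..<t} \<times> {p<..<q}) z)" by (simp only:)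
  then show ?thesis by (rule LIMSEQ_unique[OF _ tendsto_const])
qed

text \<open>A function vanishing off \<open>Q\<close> cannot distinguish a rectangle from its
  intersection with \<open>Q\<close>, so it is enough to test inside \<open>Q\<close>, where test
  functions are available.\<close>

lemma AE_zero_on_rectangle:
  fixes f :: "real \<times> real \<Rightarrow> real"
  assumes f: "integrable lborel f" and Q: "Q = {a<..<b} \<times> {p<..<q}" and f0: "\<And>z. z \<notin> Q \<Longrightarrow> f z = 0"
    and z: "\<And>s t u v. a \<le> s \<Longrightarrow> s < t \<Longrightarrow> t \<le> b \<Longrightarrow> p \<le> u \<Longrightarrow> u < v \<Longrightarrow> v \<le> q \<Longrightarrow>
      (LBINT z. f z * indicator ({s<..<t} \<times> {u<..<v}) z) = 0"
  shows "AE z in lborel. f z = 0"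
proof (rule AE_zero_rectangles[OF f])
  fix s t u v :: real assume "s < t" "u < v"
  let ?s = "max a s" and ?t = "min b t" and ?u = "max p u" and ?v = "min q v"
  have eq: "f z * indicator ({s<..<t} \<times> {u<..<v}) z = f z * indicator ({?s<..<?t} \<times> {?u<..<?v}) z" for z
    using f0[of z] Q by (cases z) (auto simp: indicator_def)
  show "(LBINT z. f z * indicator ({s<..<t} \<times> {u<..<v}) z) = 0"
  proof (cases "?s < ?t \<and> ?u < ?v")
    case True
    then show ?thesis unfolding eq by (intro z) auto
  next
    case False
    then have "{?s<..<?t} \<times> {?u<..<?v} = {}" by auto
    then have "f z * indicator ({?s<..<?t} \<times> {?u<..<?v}) z = 0" for z by (simp only: indicator_simps empty_iff mult_zero_right not_False_eq_True)
    then show ?thesis unfolding eq by (simp only: Bochner_Integration.integral_zero)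
  qed
qed

text \<open>Square integrability gives integrability only on sets of finite measure, so the argument
  runs on one rectangle at a time; countably many open boxes exhaust
  \<open>\<Omega>\<close>.\<close>

lemma fundamental_lemma:
  fixes f :: "real \<times> real \<Rightarrow> real"
  assumes O: "open \<Omega>" and f: "sqint lborel f"
    and z: "\<And>\<phi> D. test_function \<Omega> \<phi> D \<Longrightarrow> (LBINT z. \<phi> z * f z) = 0"
  shows "AE z in lborel. z \<in> \<Omega> \<longrightarrow> f z = 0"
proof -
  have rect: "AE z in lborel. z \<in> {a<..<b} \<times> {p<..<q} \<longrightarrow> f z = 0" if Q: "{a<..<b} \<times> {p<..<q} \<subseteq> \<Omega>" for a b p q
  proof -
    let ?Q = "{a<..<b} \<times> {p<..<q}"
    have i: "integrable lborel (\<lambda>z. indicator ?Q z * f z)"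
      by (rule integrable_rectangle[OF f borel_open[OF open_rectangle] emeasure_rectangle])
    have "AE z in lborel. indicator ?Q z * f z = 0"
    proof (rule AE_zero_on_rectangle[OF i refl])
      fix s t u v assume st: "a \<le> s" "s < t" "t \<le> b" "p \<le> u" "u < v" "v \<le> q"
      show "(LBINT z. indicator ?Q z * f z * indicator ({s<..<t} \<times> {u<..<v}) z) = 0"
      proof (rule rectangle_integral_zero[OF i])
        fix d :: real assume d: "0 < d"
        have sub: "{s<..<t} \<times> {u<..<v} \<subseteq> ?Q" using st by auto
        have t: "test_function \<Omega> (\<lambda>z. bump s t d (fst z) * bump u v d (snd z))
            (\<lambda>z. (bump' s t d (fst z) * bump u v d (snd z), bump s t d (fst z) * bump' u v d (snd z)))"
          by (rule test_function_mono[OF test_function_box[OF d d]]) (use sub Q in blast)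
        have "indicator ?Q z * f z * (bump s t d (fst z) * bump u v d (snd z)) = bump s t d (fst z) * bump u v d (snd z) * f z" for z
        proof (cases "z \<in> ?Q")
          case False
          then have "bump s t d (fst z) * bump u v d (snd z) = 0"
            using test_functionD(4)[OF test_function_box[OF d d, of s t u v], of z] sub by blast
          then show ?thesis by simp
        qed simp
        then show "(LBINT z. indicator ?Q z * f z * (bump s t d (fst z) * bump u v d (snd z))) = 0" using z[OF t] by (simp only:)
      qed
    qed simp
    then show ?thesis by eventually_elim (simp add: indicator_def split: if_splits)
  qed
  obtain \<D> where D: "countable \<D>" "\<D> \<subseteq> Pow \<Omega>" "\<And>X. X \<in> \<D> \<Longrightarrow> \<exists>a b. X = box a b" "\<Union>\<D> = \<Omega>"
    using open_countable_Union_open_box[OF O] by metis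
  have "AE z in lborel. \<forall>X\<in>\<D>. z \<in> X \<longrightarrow> f z = 0"
  proof (rule AE_ball_countable'[OF _ D(1)])
    fix X assume X: "X \<in> \<D>"
    then obtain a b where ab: "X = box a b" using D(3) by blast
    then have "X = {fst a<..<fst b} \<times> {snd a<..<snd b}" using box_pair[of "fst a" "snd a" "fst b" "snd b"] by simp
    then show "AE z in lborel. z \<in> X \<longrightarrow> f z = 0" using rect X D(2) by auto
  qed
  then show ?thesis by eventually_elim (use D(4) in blast)
qed

text \<open>The difference is a weak gradient of 0. This allows the arbitrary choice in
  \<open>weak_gradient\<close> to be replaced by an explicit field.\<close>

lemma wgrad_unique:
  assumes O: "open \<Omega>" and u: "wgrad \<Omega> u G" and v: "wgrad \<Omega> u H"
  shows "AE z in lborel. z \<in> \<Omega> \<longrightarrow> G z = H z"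
proof -
  have w: "wgrad \<Omega> (\<lambda>z. u z + (-1) * u z) (\<lambda>z. G z + (-1) *\<^sub>R H z)" by (rule wgrad_lin[OF u v])
  let ?K = "\<lambda>z. G z + (-1) *\<^sub>R H z"
  have "(LBINT z. \<phi> z * fst (?K z)) = 0 \<and> (LBINT z. \<phi> z * snd (?K z)) = 0" if t: "test_function \<Omega> \<phi> D" for \<phi> D
    using wgradD(3)[OF w t] wgradD(4)[OF w t] by simp
  then have "AE z in lborel. z \<in> \<Omega> \<longrightarrow> fst (?K z) = 0" "AE z in lborel. z \<in> \<Omega> \<longrightarrow> snd (?K z) = 0"
    by (intro fundamental_lemma[OF O] sqint_components[OF wgradD(2)[OF w]], blast)+
  then show ?thesis by eventually_elim (auto simp: prod_eq_iff)
qed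

subsection \<open>Plateaus with explicit primitives\<close>

text \<open>The primitive of \<open>ramp\<close> that vanishes on the negative half-line: the cubic
  companion of the quadratic spline.\<close>

definition ramp_int :: "real \<Rightarrow> real" where
  "ramp_int x = ((max 0 x)^3 - 2 * (max 0 (x - 1))^3 + (max 0 (x - 2))^3) / 6"

lemma has_real_derivative_max_cube:
  "((\<lambda>x::real. (max 0 x)^3) has_real_derivative 3 * (max 0 x)\<^sup>2) (at x)"
proof (cases x "0::real" rule: linorder_cases)
  case less
  have "((\<lambda>x::real. 0) has_real_derivative 3 * (max 0 x)\<^sup>2) (at x)" using less by simp
  then show ?thesis
    by (rule has_field_derivative_transform_within_open[of _ _ _ "{..<0}"]) (use less in auto)
next
  case greater
  have "((\<lambda>x::real. x^3) has_real_derivative 3 * (max 0 x)\<^sup>2) (at x)"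
    using greater by (auto intro!: derivative_eq_intros)
  then show ?thesis
    by (rule has_field_derivative_transform_within_open[of _ _ _ "{0<..}"]) (use greater in auto)
next
  case equal
  have "((\<lambda>h::real. (max 0 h)\<^sup>2) \<longlongrightarrow> (max 0 0)\<^sup>2) (at 0)" by (intro tendsto_intros)
  moreover have "\<forall>\<^sub>F h in at (0::real). (max 0 h)\<^sup>2 = ((max 0 (0 + h))^3 - (max 0 0)^3) / h"
    by (auto simp: eventually_at_filter max_def power2_eq_square power3_eq_cube)
  ultimately have "((\<lambda>h::real. ((max 0 (0 + h))^3 - (max 0 0)^3) / h) \<longlongrightarrow> (max 0 0)\<^sup>2) (at 0)"
    by (rule tendsto_cong[THEN iffD1, rotated])
  then show ?thesis using equal by (simp add: DERIV_def)
qed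

lemma ramp_int_deriv:
  assumes "(f has_real_derivative f') (at x)"
  shows "((\<lambda>x. ramp_int (f x)) has_real_derivative f' * ramp (f x)) (at x)"
proof -
  have d: "((\<lambda>x. (max 0 (x - c))^3) has_real_derivative 3 * (max 0 (y - c))\<^sup>2) (at y)" for c y :: real
  proof -
    have "((\<lambda>x. x - c) has_real_derivative 1) (at y)" by (auto intro!: derivative_eq_intros)
    from DERIV_chain2[where f = "\<lambda>x::real. (max 0 x)^3" and g = "\<lambda>x. x - c", OF has_real_derivative_max_cube this]
    show ?thesis by simp
  qed
  have "(ramp_int has_real_derivative ramp y) (at y)" for y
    unfolding ramp_int_def[abs_def] ramp_def
    by (rule DERIV_cong[OF DERIV_cdivide[OF DERIV_add[OF DERIV_diff[OF d[of 0 y, unfolded diff_0_right] DERIV_cmult[OF d]] d]]]) simp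
  from DERIV_chain2[OF this assms] show ?thesis by (simp add: mult.commute)
qed

lemma ramp_int_eq: "x \<le> 0 \<Longrightarrow> ramp_int x = 0" "2 \<le> x \<Longrightarrow> ramp_int x = x - 1"
  by (simp_all add: ramp_int_def max_def power3_eq_cube field_simps)

text \<open>A difference of two ramps has an explicit primitive, which the product
  \<open>bump\<close> lacks; the vertical factor of a test function is integrated from
  above.\<close>

definition plateau :: "real \<Rightarrow> real \<Rightarrow> real \<Rightarrow> real \<Rightarrow> real" where
  "plateau p q d y = ramp ((y - p) / d) - ramp ((y - q) / d + 2)"

text \<open>The integral of the plateau from \<open>y\<close> upwards; the constant
  \<open>q - 2 * d - p\<close> is its total integral.\<close>

definition plateau_int :: "real \<Rightarrow> real \<Rightarrow> real \<Rightarrow> real \<Rightarrow> real" where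
  "plateau_int p q d y = (q - 2 * d - p) - d * (ramp_int ((y - p) / d) - ramp_int ((y - q) / d + 2))"

lemma plateau_int_deriv: "0 < d \<Longrightarrow> (plateau_int p q d has_real_derivative - plateau p q d y) (at y)"
  unfolding plateau_int_def[abs_def] plateau_def
  by (auto intro!: derivative_eq_intros ramp_int_deriv simp: field_simps)

lemma continuous_plateau: "0 < d \<Longrightarrow> continuous_on S (plateau p q d)"
  unfolding plateau_def by (intro continuous_intros; simp)

lemma plateau_bounds:
  assumes d: "0 < d" "2 * d \<le> q - p"
  shows "0 \<le> plateau p q d y" "plateau p q d y \<le> 1"
proof -
  have "(y - q) / d + 2 = (y - q + 2 * d) / d" using d by (simp add: add_divide_distrib)
  also have "\<dots> \<le> (y - p) / d" using d by (intro divide_right_mono) auto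
  finally have "(y - q) / d + 2 \<le> (y - p) / d" .
  then show "0 \<le> plateau p q d y" using ramp_mono by (simp add: plateau_def)
  show "plateau p q d y \<le> 1" using ramp_bounds[of "(y - p) / d"] ramp_bounds[of "(y - q) / d + 2"]
    unfolding plateau_def by linarith
qed

lemma plateau_0:
  assumes d: "0 < d" "2 * d \<le> q - p" and y: "y \<le> p \<or> q \<le> y"
  shows "plateau p q d y = 0"
  using y
proof
  assume "y \<le> p"
  then have "(y - p) / d \<le> 0" "(y - q) / d + 2 \<le> 0" using d by (auto simp: field_simps)
  then show ?thesis by (simp add: plateau_def ramp_0)
next
  assume "q \<le> y"
  then have "2 \<le> (y - p) / d" "2 \<le> (y - q) / d + 2" using d by (auto simp: field_simps)
  then show ?thesis by (simp add: plateau_def ramp_1)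
qed

lemma plateau_int_eq:
  assumes d: "0 < d" "2 * d \<le> q - p"
  shows "q \<le> y \<Longrightarrow> plateau_int p q d y = 0" "y \<le> p \<Longrightarrow> plateau_int p q d y = q - 2 * d - p"
proof -
  assume "q \<le> y"
  then have "2 \<le> (y - p) / d" "2 \<le> (y - q) / d + 2" using d by (auto simp: field_simps)
  then show "plateau_int p q d y = 0" using d by (simp add: plateau_int_def ramp_int_eq field_simps)
next
  assume "y \<le> p"
  then have "(y - p) / d \<le> 0" "(y - q) / d + 2 \<le> 0" using d by (auto simp: field_simps)
  then show "plateau_int p q d y = q - 2 * d - p" by (simp add: plateau_int_def ramp_int_eq)
qed

lemma plateau_int_bounds:
  assumes d: "0 < d" "2 * d \<le> q - p"
  shows "0 \<le> plateau_int p q d y" "plateau_int p q d y \<le> q - p"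
proof -
  have anti: "plateau_int p q d y' \<le> plateau_int p q d y" if "y \<le> y'" for y y'
    by (rule DERIV_nonpos_imp_nonincreasing[OF that])
      (use plateau_int_deriv[OF d(1)] plateau_bounds[OF d] in \<open>auto intro!: exI\<close>)
  show "0 \<le> plateau_int p q d y" using anti[of y "max y q"] plateau_int_eq(1)[OF d, of "max y q"] by simp
  show "plateau_int p q d y \<le> q - p" using anti[of "min y p" y] plateau_int_eq(2)[OF d, of "min y p"] d by simp
qed

lemma plateau_tail:
  assumes d: "0 < d" "2 * d \<le> q - p"
  shows "(LBINT t. indicator {s<..} t * plateau p q d t) = plateau_int p q d s"
proof -
  have "has_bochner_integral lborel (\<lambda>t. plateau p q d t * indicator {s..max s q} t)
      ((- plateau_int p q d (max s q)) - (- plateau_int p q d s))"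
  proof (rule has_bochner_integral_FTC_Icc_real)
    fix t
    show "((\<lambda>y. - plateau_int p q d y) has_real_derivative plateau p q d t) (at t)"
      using DERIV_minus[OF plateau_int_deriv[OF d(1), of p q t]] by simp
    show "isCont (plateau p q d) t" using continuous_plateau[OF d(1), of UNIV p q] by (simp add: continuous_on_eq_continuous_at)
  qed simp
  then have "(LBINT t. plateau p q d t * indicator {s..max s q} t) = plateau_int p q d s"
    using plateau_int_eq(1)[OF d, of "max s q"] by (simp add: has_bochner_integral_integral_eq)
  moreover have "AE t in lborel. t \<noteq> s" by (rule AE_lborel_singleton)
  then have "AE t in lborel. indicator {s<..} t * plateau p q d t = plateau p q d t * indicator {s..max s q} t"
  proof eventually_elim
    case (elim t)
    then show ?case using plateau_0[OF d, of t] by (cases "t < s"; cases "q \<le> t") (auto simp: indicator_def)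
  qed
  then have "(LBINT t. indicator {s<..} t * plateau p q d t) = (LBINT t. plateau p q d t * indicator {s..max s q} t)"
    by (rule integral_cong_AE[rotated -1])
      (use borel_measurable_continuous_onI[OF continuous_plateau[OF d(1)]] in measurable)
  ultimately show ?thesis by simp
qed

lemma plateau_tendsto:
  assumes "p < q"
  shows "(\<lambda>n. plateau p (q - inverse (real (Suc n))) (inverse (real (Suc n))) y) \<longlonglongrightarrow> indicator {p<..<q} y"
proof (rule tendsto_eventually)
  have pos: "0 < inverse (real (Suc n))" for n by simp
  have ev: "\<forall>\<^sub>F n in sequentially. inverse (real (Suc n)) < e" if "0 < e" for e
    using LIMSEQ_inverse_real_of_nat that by (rule order_tendstoD)
  show "\<forall>\<^sub>F n in sequentially. plateau p (q - inverse (real (Suc n))) (inverse (real (Suc n))) y = indicator {p<..<q} y"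
  proof (cases "y \<in> {p<..<q}")
    case True
    then have "0 < min (y - p) (q - y) / 3" by simp
    from ev[OF this] show ?thesis
    proof eventually_elim
      case (elim n)
      let ?d = "inverse (real (Suc n))"
      have *: "2 \<le> (y - p) / d" "(y - (q - d)) / d + 2 \<le> 0" if "0 < d" "3 * d < y - p" "3 * d < q - y" for d
        using that by (auto simp: field_simps)
      have "2 \<le> (y - p) / ?d" "(y - (q - ?d)) / ?d + 2 \<le> 0" using elim by (auto intro!: * pos simp del: inverse_eq_divide of_nat_Suc)
      then show ?case using True by (simp add: plateau_def ramp_0 ramp_1)
    qed
  next
    case False
    have "0 < (q - p) / 3" using assms by simp
    from ev[OF this] show ?thesis
    proof eventually_elim
      case (elim n)
      have *: "plateau p (q - d) d y = 0" if "0 < d" "3 * d < q - p" for d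
        by (rule plateau_0[OF that(1)]) (use that False in auto)
      have "plateau p (q - inverse (real (Suc n))) (inverse (real (Suc n))) y = 0"
        using elim by (intro * pos) simp
      then show ?case using False by simp
    qed
  qed
qed

subsection \<open>The trace as a boundary term\<close>

lemma integral_product:
  fixes f g :: "real \<Rightarrow> real"
  assumes f: "integrable lborel f" and g: "integrable lborel g"
  shows "integrable lborel (\<lambda>z. f (fst z) * g (snd z))" "(LBINT z. f (fst z) * g (snd z)) = (LBINT x. f x) * (LBINT y. g y)"
proof -
  have m: "(\<lambda>z. f (fst z) * g (snd z)) \<in> borel_measurable (lborel \<Otimes>\<^sub>M lborel)"
    using borel_measurable_integrable[OF f] borel_measurable_integrable[OF g] by measurable
  have i: "integrable (lborel \<Otimes>\<^sub>M lborel) (\<lambda>z. f (fst z) * g (snd z))"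
  proof (rule lborel_pair.Fubini_integrable[OF m])
    show "AE x in lborel. integrable lborel (\<lambda>y. f (fst (x, y)) * g (snd (x, y)))" using g by simp
    have "(LBINT y. norm (f (fst (x, y)) * g (snd (x, y)))) = \<bar>f x\<bar> * (LBINT y. \<bar>g y\<bar>)" for x by (simp add: abs_mult)
    then show "integrable lborel (\<lambda>x. LBINT y. norm (f (fst (x, y)) * g (snd (x, y))))" using f by simp
  qed
  then show "integrable lborel (\<lambda>z. f (fst z) * g (snd z))" by (simp add: lborel_prod)
  have "(LBINT z. f (fst z) * g (snd z)) = (LBINT x. LBINT y. f x * g y)"
    using lborel_pair.integral_fst'[OF i] by (simp add: lborel_prod)
  then show "(LBINT z. f (fst z) * g (snd z)) = (LBINT x. f x) * (LBINT y. g y)" by simp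
qed

lemma ramp'_support:
  assumes "ramp' (t - 1) \<noteq> 0"
  shows "0 < t" "t < 4"
proof -
  have "\<not> (t - 1 \<le> 0 \<or> 2 \<le> t - 1)" using ramp'_0 assms by blast
  then show "0 < t" "t < 4" by linarith+
qed

lemma ramp'_integral: "(LBINT t. ramp' (t - 1)) = 1" "integrable lborel (\<lambda>t. ramp' (t - 1))"
proof -
  have "has_bochner_integral lborel (\<lambda>t. ramp' (t - 1) * indicator {1..3} t) (ramp (3 - 1) - ramp (1 - 1))"
  proof (rule has_bochner_integral_FTC_Icc_real)
    fix t :: real
    show "((\<lambda>t. ramp (t - 1)) has_real_derivative ramp' (t - 1)) (at t)"
      using ramp_deriv[of "\<lambda>t. t - 1" 1 t] by (auto intro!: derivative_eq_intros)
    have "continuous_on UNIV (\<lambda>t::real. ramp' (t - 1))" by (intro continuous_intros)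
    then show "isCont (\<lambda>t. ramp' (t - 1)) t" by (simp add: continuous_on_eq_continuous_at)
  qed simp
  moreover have "(\<lambda>t. ramp' (t - 1) * indicator {1..3} t) = (\<lambda>t. ramp' (t - 1))"
  proof
    fix t :: real
    show "ramp' (t - 1) * indicator {1..3} t = ramp' (t - 1)"
      using ramp'_0[of "t - 1"] by (cases "t \<in> {1..3}") auto
  qed
  ultimately have "has_bochner_integral lborel (\<lambda>t. ramp' (t - 1)) 1" by (simp add: ramp_0 ramp_1)
  then show "(LBINT t. ramp' (t - 1)) = 1" "integrable lborel (\<lambda>t. ramp' (t - 1))"
    by (auto simp: has_bochner_integral_iff)
qed

text \<open>Test functions \<open>\<alpha>(x) \<psi>(y)\<close> that reach the bottom edge are cut off by \<open>ramp (y / e - 1)\<close>; as \<open>e\<close> tends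
  to \<open>0\<close> the derivative of the cutoff produces the boundary integral.\<close>

locale trace_test =
  fixes a b c :: real and \<alpha> \<alpha>' \<beta> \<psi> :: "real \<Rightarrow> real" and s t q K :: real
  assumes a: "\<And>x. (\<alpha> has_real_derivative \<alpha>' x) (at x)" "continuous_on UNIV \<alpha>'"
    and a0: "\<And>x. x \<notin> {s..t} \<Longrightarrow> \<alpha> x = 0" and st: "a < s" "t < b"
    and p: "\<And>y. (\<psi> has_real_derivative - \<beta> y) (at y)" "continuous_on UNIV \<beta>"
    and p0: "\<And>y. q \<le> y \<Longrightarrow> \<psi> y = 0" and q: "0 < q" "q < c"
    and K: "\<And>x. \<bar>\<alpha> x\<bar> \<le> K" "\<And>x. \<bar>\<beta> x\<bar> \<le> K" "\<And>x. \<bar>\<psi> x\<bar> \<le> K"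
begin

abbreviation "Q \<equiv> {a<..<b} \<times> {0<..<c}"

lemma cont: "continuous_on S \<alpha>" "continuous_on S \<psi>" "continuous_on S \<beta>"
proof -
  show "continuous_on S \<alpha>" "continuous_on S \<psi>"
    using a(1) p(1) by (auto intro!: continuous_at_imp_continuous_on DERIV_isCont)
  show "continuous_on S \<beta>" using p(2) by (rule continuous_on_subset) simp
qed

lemma meas[measurable]: "\<alpha> \<in> borel_measurable borel" "\<psi> \<in> borel_measurable borel" "\<beta> \<in> borel_measurable borel"
  using cont by (auto intro: borel_measurable_continuous_onI)

lemma K0: "0 \<le> K" using K(1)[of 0] by linarith

lemma test_cutoff:
  assumes e: "0 < e"
  shows "test_function Q (\<lambda>z. \<alpha> (fst z) * (\<psi> (snd z) * ramp (snd z / e - 1)))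
    (\<lambda>z. (\<alpha>' (fst z) * (\<psi> (snd z) * ramp (snd z / e - 1)),
      \<alpha> (fst z) * (- \<beta> (snd z) * ramp (snd z / e - 1) + \<psi> (snd z) * (ramp' (snd z / e - 1) / e))))"
proof (rule test_function_product[OF a a0])
  fix y
  have "((\<lambda>y. ramp (y / e - 1)) has_real_derivative ramp' (y / e - 1) / e) (at y)"
    using ramp_deriv[of "\<lambda>y. y / e - 1" "1 / e" y] e by (auto intro!: derivative_eq_intros)
  from DERIV_mult[OF p(1)[of y] this]
  show "((\<lambda>y. \<psi> y * ramp (y / e - 1)) has_real_derivative - \<beta> y * ramp (y / e - 1) + \<psi> y * (ramp' (y / e - 1) / e)) (at y)"
    by (simp add: mult_ac)
  show "continuous_on UNIV (\<lambda>y. - \<beta> y * ramp (y / e - 1) + \<psi> y * (ramp' (y / e - 1) / e))"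
    using e by (intro continuous_intros cont) auto
  \<comment> \<open>If \<open>e\<close> exceeds \<open>q\<close> the product vanishes identically,
    and \<open>min\<close> keeps the interval inside the height of the rectangle.\<close>
  show "\<psi> y * ramp (y / e - 1) = 0" if "y \<notin> {min e q..q}"
  proof (cases "y < e")
    case True
    then have "y / e - 1 \<le> 0" using e by simp
    then show ?thesis by (simp add: ramp_0)
  next
    case False
    then have "q \<le> y" using that by auto
    then show ?thesis using p0 by simp
  qed
  show "{s..t} \<times> {min e q..q} \<subseteq> Q" using st q e by auto
qed


text \<open>Cutting off near the bottom edge adds a term with the kernel
  \<open>ramp' (y / e - 1) / e\<close>. Stretching the vertical variable by 1 / e fixes the kernel,
  whose integral is 1, and continuity of \<open>w\<close> up to the edge identifies the
  limit.\<close>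

lemma boundary_term:
  assumes w: "continuous_on ({a..b} \<times> {0..c}) w" and v: "wgrad Q (\<lambda>z. indicator Q z *\<^sub>R w z) H"
    and H0: "\<And>z. z \<notin> Q \<Longrightarrow> H z = 0"
  shows "(LBINT z. indicator Q z * w z * (\<alpha> (fst z) * \<beta> (snd z))) =
    (LBINT z. snd (H z) * (\<alpha> (fst z) * \<psi> (snd z))) + (LBINT x. indicator {a<..<b} x * w (x, 0) * \<alpha> x * \<psi> 0)"
proof -
  define e where "e n = inverse (real (Suc n))" for n
  have e: "0 < e n" for n by (simp add: e_def)
  have e0: "e \<longlonglongrightarrow> 0" unfolding e_def by (rule LIMSEQ_inverse_real_of_nat)
  define u where "u z = indicator Q z * w z" for z
  have v': "wgrad Q u H" using v by (simp add: u_def[abs_def])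
  have um[measurable]: "u \<in> borel_measurable borel" using sqintD(1)[OF wgradD(1)[OF v']] by simp
  have [measurable]: "(\<lambda>z. snd (H z)) \<in> borel_measurable borel" using sqintD(1)[OF sqint_components(2)[OF wgradD(2)[OF v']]] by simp
  have rm[measurable]: "ramp \<in> borel_measurable borel" "ramp' \<in> borel_measurable borel"
    by (intro borel_measurable_continuous_onI continuous_ramp[where f = "\<lambda>x. x"] continuous_intros)+
  have Qm: "Q \<in> sets borel" by (rule borel_open[OF open_rectangle])
  have ui: "integrable lborel u"
    using integrable_rectangle[OF wgradD(1)[OF v'] Qm emeasure_rectangle] by (simp add: u_def[abs_def] mult.assoc[symmetric] indicator_inter_arith[symmetric])
  have Hi: "integrable lborel (\<lambda>z. snd (H z))"
  proof -
    have "integrable lborel (\<lambda>z. indicator Q z * snd (H z))"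
      by (rule integrable_rectangle[OF sqint_components(2)[OF wgradD(2)[OF v']] Qm emeasure_rectangle])
    moreover have "(\<lambda>z. indicator Q z * snd (H z)) = (\<lambda>z. snd (H z))" 
    proof
      fix z show "indicator Q z * snd (H z) = snd (H z)" using H0[of z] by (cases "z \<in> Q") auto
    qed
    ultimately show ?thesis by simp
  qed
  have pos: "0 < snd z" if "z \<in> Q" for z using that by (cases z) auto
  have cut: "(\<lambda>n. ramp (snd z / e n - 1)) \<longlonglongrightarrow> 1" if "z \<in> Q" for z
  proof (rule tendsto_eventually)
    have "\<forall>\<^sub>F n in sequentially. e n < snd z / 3" using e0 pos[OF that] by (intro order_tendstoD) auto
    then show "\<forall>\<^sub>F n in sequentially. ramp (snd z / e n - 1) = 1"
    proof eventually_elim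
      case (elim n)
      then have "3 \<le> snd z / e n" using e[of n] by (simp add: pos_le_divide_eq)
      then show ?case by (intro ramp_1) simp
    qed
  qed
  have A: "(\<lambda>n. LBINT z. u z * (\<alpha> (fst z) * \<beta> (snd z)) * ramp (snd z / e n - 1)) \<longlonglongrightarrow> (LBINT z. u z * (\<alpha> (fst z) * \<beta> (snd z)))"
  proof (rule integral_dominated_convergence[where w = "\<lambda>z. K * K * \<bar>u z\<bar>"])
    show "integrable lborel (\<lambda>z. K * K * \<bar>u z\<bar>)" using ui by simp
    show "AE z in lborel. (\<lambda>n. u z * (\<alpha> (fst z) * \<beta> (snd z)) * ramp (snd z / e n - 1)) \<longlonglongrightarrow> u z * (\<alpha> (fst z) * \<beta> (snd z))"
    proof (rule AE_I2)
      fix z show "(\<lambda>n. u z * (\<alpha> (fst z) * \<beta> (snd z)) * ramp (snd z / e n - 1)) \<longlonglongrightarrow> u z * (\<alpha> (fst z) * \<beta> (snd z))"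
        using tendsto_mult_left[OF cut[of z], of "u z * (\<alpha> (fst z) * \<beta> (snd z))"] by (cases "z \<in> Q") (auto simp: u_def)
    qed
    show "AE z in lborel. norm (u z * (\<alpha> (fst z) * \<beta> (snd z)) * ramp (snd z / e n - 1)) \<le> K * K * \<bar>u z\<bar>" for n
    proof (rule AE_I2)
      fix z
      have "\<bar>\<alpha> (fst z)\<bar> * \<bar>\<beta> (snd z)\<bar> * \<bar>ramp (snd z / e n - 1)\<bar> \<le> K * K * 1"
        using K ramp_bounds[of "snd z / e n - 1"] K0 by (intro mult_mono) auto
      then have "\<bar>u z\<bar> * (\<bar>\<alpha> (fst z)\<bar> * \<bar>\<beta> (snd z)\<bar> * \<bar>ramp (snd z / e n - 1)\<bar>) \<le> \<bar>u z\<bar> * (K * K * 1)" by (rule mult_left_mono) simp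
      then show "norm (u z * (\<alpha> (fst z) * \<beta> (snd z)) * ramp (snd z / e n - 1)) \<le> K * K * \<bar>u z\<bar>" by (simp add: abs_mult mult_ac)
    qed
  qed measurable
  have B: "(\<lambda>n. LBINT z. snd (H z) * (\<alpha> (fst z) * \<psi> (snd z)) * ramp (snd z / e n - 1)) \<longlonglongrightarrow> (LBINT z. snd (H z) * (\<alpha> (fst z) * \<psi> (snd z)))"
  proof (rule integral_dominated_convergence[where w = "\<lambda>z. K * K * \<bar>snd (H z)\<bar>"])
    show "integrable lborel (\<lambda>z. K * K * \<bar>snd (H z)\<bar>)" using Hi by simp
    show "AE z in lborel. (\<lambda>n. snd (H z) * (\<alpha> (fst z) * \<psi> (snd z)) * ramp (snd z / e n - 1)) \<longlonglongrightarrow> snd (H z) * (\<alpha> (fst z) * \<psi> (snd z))"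
    proof (rule AE_I2)
      fix z show "(\<lambda>n. snd (H z) * (\<alpha> (fst z) * \<psi> (snd z)) * ramp (snd z / e n - 1)) \<longlonglongrightarrow> snd (H z) * (\<alpha> (fst z) * \<psi> (snd z))"
        using tendsto_mult_left[OF cut[of z], of "snd (H z) * (\<alpha> (fst z) * \<psi> (snd z))"] H0[of z] by (cases "z \<in> Q") auto
    qed
    show "AE z in lborel. norm (snd (H z) * (\<alpha> (fst z) * \<psi> (snd z)) * ramp (snd z / e n - 1)) \<le> K * K * \<bar>snd (H z)\<bar>" for n
    proof (rule AE_I2)
      fix z
      have "\<bar>\<alpha> (fst z)\<bar> * \<bar>\<psi> (snd z)\<bar> * \<bar>ramp (snd z / e n - 1)\<bar> \<le> K * K * 1"
        using K ramp_bounds[of "snd z / e n - 1"] K0 by (intro mult_mono) auto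
      then have "\<bar>snd (H z)\<bar> * (\<bar>\<alpha> (fst z)\<bar> * \<bar>\<psi> (snd z)\<bar> * \<bar>ramp (snd z / e n - 1)\<bar>) \<le> \<bar>snd (H z)\<bar> * (K * K * 1)" by (rule mult_left_mono) simp
      then show "norm (snd (H z) * (\<alpha> (fst z) * \<psi> (snd z)) * ramp (snd z / e n - 1)) \<le> K * K * \<bar>snd (H z)\<bar>" by (simp add: abs_mult mult_ac)
    qed
  qed measurable
  define T where "T n = (LBINT z. u z * (\<alpha> (fst z) * \<psi> (snd z)) * (ramp' (snd z / e n - 1) / e n))" for n
  have ub: "integrable lborel (\<lambda>z. u z * k z)" if [measurable]: "k \<in> borel_measurable borel" and k: "\<And>z. \<bar>k z\<bar> \<le> M" for k M
  proof (rule Bochner_Integration.integrable_bound)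
    show "integrable lborel (\<lambda>z. M * u z)" using ui by simp
    show "AE z in lborel. norm (u z * k z) \<le> norm (M * u z)"
    proof (rule AE_I2)
      fix z
      have "\<bar>u z\<bar> * \<bar>k z\<bar> \<le> \<bar>u z\<bar> * M" by (rule mult_left_mono[OF k abs_ge_zero])
      moreover have "0 \<le> M" using k[of z] by linarith
      ultimately show "norm (u z * k z) \<le> norm (M * u z)" by (simp add: abs_mult mult_ac)
    qed
  qed measurable
  have step: "T n = (LBINT z. u z * (\<alpha> (fst z) * \<beta> (snd z)) * ramp (snd z / e n - 1)) - (LBINT z. snd (H z) * (\<alpha> (fst z) * \<psi> (snd z)) * ramp (snd z / e n - 1))" for n
  proof -
    have 1: "integrable lborel (\<lambda>z. u z * (\<alpha> (fst z) * \<beta> (snd z) * ramp (snd z / e n - 1)))"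
    proof (rule ub[of _ "K * K * 1"])
      show "\<bar>\<alpha> (fst z) * \<beta> (snd z) * ramp (snd z / e n - 1)\<bar> \<le> K * K * 1" for z :: "real \<times> real"
        unfolding abs_mult using K ramp_bounds[of "snd z / e n - 1"] K0 by (intro mult_mono) auto
    qed measurable
    have 2: "integrable lborel (\<lambda>z. u z * (\<alpha> (fst z) * \<psi> (snd z) * (ramp' (snd z / e n - 1) / e n)))"
    proof (rule ub[of _ "K * K * (1 / e n)"])
      show "\<bar>\<alpha> (fst z) * \<psi> (snd z) * (ramp' (snd z / e n - 1) / e n)\<bar> \<le> K * K * (1 / e n)" for z :: "real \<times> real"
        unfolding abs_mult using K ramp'_bounds[of "snd z / e n - 1"] K0 e[of n]
        by (intro mult_mono) (auto simp: divide_right_mono)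
    qed measurable
    have "(LBINT z. u z * snd (\<alpha>' (fst z) * (\<psi> (snd z) * ramp (snd z / e n - 1)),
      \<alpha> (fst z) * (- \<beta> (snd z) * ramp (snd z / e n - 1) + \<psi> (snd z) * (ramp' (snd z / e n - 1) / e n)))) =
      - (LBINT z. \<alpha> (fst z) * (\<psi> (snd z) * ramp (snd z / e n - 1)) * snd (H z))"
      by (rule wgradD(4)[OF v' test_cutoff[OF e]])
    also have "(\<lambda>z. u z * snd (\<alpha>' (fst z) * (\<psi> (snd z) * ramp (snd z / e n - 1)),
      \<alpha> (fst z) * (- \<beta> (snd z) * ramp (snd z / e n - 1) + \<psi> (snd z) * (ramp' (snd z / e n - 1) / e n)))) =
      (\<lambda>z. u z * (\<alpha> (fst z) * \<psi> (snd z) * (ramp' (snd z / e n - 1) / e n)) - u z * (\<alpha> (fst z) * \<beta> (snd z) * ramp (snd z / e n - 1)))"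
      by (simp add: fun_eq_iff algebra_simps)
    finally have "(LBINT z. u z * (\<alpha> (fst z) * \<psi> (snd z) * (ramp' (snd z / e n - 1) / e n))) - (LBINT z. u z * (\<alpha> (fst z) * \<beta> (snd z) * ramp (snd z / e n - 1)))
      = - (LBINT z. \<alpha> (fst z) * (\<psi> (snd z) * ramp (snd z / e n - 1)) * snd (H z))" using 1 2 by simp
    then show ?thesis by (simp add: T_def mult_ac)
  qed
  have "compact ({a..b} \<times> {0..c})" by (intro compact_Times compact_Icc)
  then have "bounded (w ` ({a..b} \<times> {0..c}))" by (intro compact_imp_bounded compact_continuous_image[OF w])
  then obtain W' where W': "\<And>z. z \<in> {a..b} \<times> {0..c} \<Longrightarrow> \<bar>w z\<bar> \<le> W'" by (auto simp: bounded_iff)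
  define W where "W = max 0 W'"
  have W: "\<bar>w z\<bar> \<le> W" if "z \<in> {a..b} \<times> {0..c}" for z using W'[OF that] by (simp add: W_def)
  \<comment> \<open>The stretched limit: the edge values of \<open>w\<close> and
    \<open>\<psi> 0\<close> are independent of the height, and the kernel integrates to 1.\<close>
  define F where "F z = indicator {a<..<b} (fst z) * w (fst z, 0) * \<alpha> (fst z) * \<psi> 0 * ramp' (snd z - 1)" for z
  have W0: "0 \<le> W" by (simp add: W_def)
  have T: "T \<longlonglongrightarrow> (LBINT z. F z)"
  proof -
    \<comment> \<open>The factor \<open>e n\<close> from the substitution cancels the one in the
      kernel.\<close>
    define f where "f n z = u (fst z, e n * snd z) * (\<alpha> (fst z) * \<psi> (e n * snd z)) * ramp' (snd z - 1)" for n z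
    have "T n = (LBINT z. f n z)" for n
    proof -
      have "T n = \<bar>1 * e n\<bar> *\<^sub>R (LBINT z. u (dilate (0, 0) 1 (e n) z) * (\<alpha> (fst (dilate (0, 0) 1 (e n) z)) * \<psi> (snd (dilate (0, 0) 1 (e n) z))) *
         (ramp' (snd (dilate (0, 0) 1 (e n) z) / e n - 1) / e n))"
        unfolding T_def by (rule integral_dilate(1)) (use e[of n] in \<open>auto intro!: borel_measurable_times\<close>)
      also have "\<dots> = (LBINT z. e n * (u (dilate (0, 0) 1 (e n) z) * (\<alpha> (fst (dilate (0, 0) 1 (e n) z)) * \<psi> (snd (dilate (0, 0) 1 (e n) z))) *
         (ramp' (snd (dilate (0, 0) 1 (e n) z) / e n - 1) / e n)))" using e[of n] by simp
      also have "\<dots> = (LBINT z. f n z)"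
        by (rule Bochner_Integration.integral_cong) (use e[of n] in \<open>auto simp: f_def dilate_def\<close>)
      finally show ?thesis .
    qed
    moreover have "(\<lambda>n. LBINT z. f n z) \<longlonglongrightarrow> (LBINT z. F z)"
    proof (rule integral_dominated_convergence[where w = "\<lambda>z. K * K * W * indicator ({a<..<b} \<times> {0<..<4::real}) z"])
      have "emeasure lborel ({a<..<b} \<times> {0<..<4::real}) < \<infinity>" by (rule emeasure_rectangle)
      then show "integrable lborel (\<lambda>z. K * K * W * indicator ({a<..<b} \<times> {0<..<4::real}) z)"
        using borel_open[OF open_rectangle[of a b 0 4]] by (intro integrable_mult_right integrable_real_indicator) auto
      show fm: "f n \<in> borel_measurable lborel" for n unfolding f_def[abs_def] by measurable
      have lim: "(\<lambda>n. f n z) \<longlonglongrightarrow> F z" for z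
      proof (cases "fst z \<in> {a<..<b} \<and> ramp' (snd z - 1) \<noteq> 0")
        case False
        then have "f n z = F z" for n by (auto simp: f_def F_def u_def indicator_def)
        then show ?thesis by simp
      next
        case True
        then have z: "fst z \<in> {a<..<b}" "0 < snd z" "snd z < 4" using ramp'_support by auto
        have el: "(\<lambda>n. e n * snd z) \<longlonglongrightarrow> 0" using tendsto_mult_left_zero[OF e0] .
        then have ev: "\<forall>\<^sub>F n in sequentially. e n * snd z < c" using q by (intro order_tendstoD(2)[OF el]) auto
        then have inQ: "\<forall>\<^sub>F n in sequentially. (fst z, e n * snd z) \<in> Q"
          by eventually_elim (use z e in auto)
        have "(\<lambda>n. (fst z, e n * snd z)) \<longlonglongrightarrow> (fst z, 0)" by (intro tendsto_intros el)
        moreover have "(fst z, 0) \<in> {a..b} \<times> {0..c}" using z q by auto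
        moreover have "\<forall>\<^sub>F n in sequentially. (fst z, e n * snd z) \<in> {a..b} \<times> {0..c}"
          using inQ by eventually_elim auto
        ultimately have "(\<lambda>n. w (fst z, e n * snd z)) \<longlonglongrightarrow> w (fst z, 0)"
          by (rule continuous_on_tendsto_compose[OF w])
        moreover have "\<forall>\<^sub>F n in sequentially. w (fst z, e n * snd z) = u (fst z, e n * snd z)"
          using inQ by eventually_elim (simp add: u_def)
        ultimately have ul: "(\<lambda>n. u (fst z, e n * snd z)) \<longlonglongrightarrow> w (fst z, 0)" by (rule Lim_transform_eventually)
        have "isCont \<psi> 0" using p(1)[of 0] by (rule DERIV_isCont)
        then have "(\<lambda>n. \<psi> (e n * snd z)) \<longlonglongrightarrow> \<psi> 0" using el by (rule isCont_tendsto_compose)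
        then have "(\<lambda>n. f n z) \<longlonglongrightarrow> w (fst z, 0) * (\<alpha> (fst z) * \<psi> 0) * ramp' (snd z - 1)"
          unfolding f_def by (intro tendsto_intros ul)
        then show ?thesis using z by (simp add: F_def mult_ac)
      qed
      then show "AE z in lborel. (\<lambda>n. f n z) \<longlonglongrightarrow> F z" by simp
      show "F \<in> borel_measurable lborel" by (rule borel_measurable_LIMSEQ_real[OF lim fm])
      show "AE z in lborel. norm (f n z) \<le> K * K * W * indicator ({a<..<b} \<times> {0<..<4::real}) z" for n
      proof (rule AE_I2)
        fix z
        show "norm (f n z) \<le> K * K * W * indicator ({a<..<b} \<times> {0<..<4::real}) z"
        proof (cases "f n z = 0")
          case True then show ?thesis using K0 W0 by simp
        next
          case False
          then have "u (fst z, e n * snd z) \<noteq> 0" "ramp' (snd z - 1) \<noteq> 0" by (auto simp: f_def)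
          then have z: "(fst z, e n * snd z) \<in> Q" "0 < snd z" "snd z < 4" using ramp'_support[of "snd z"] by (auto simp: u_def indicator_def split: if_splits)
          then have "\<bar>u (fst z, e n * snd z)\<bar> \<le> W" using W[of "(fst z, e n * snd z)"] by (auto simp: u_def)
          then have "\<bar>u (fst z, e n * snd z)\<bar> * (\<bar>\<alpha> (fst z)\<bar> * \<bar>\<psi> (e n * snd z)\<bar>) * \<bar>ramp' (snd z - 1)\<bar> \<le> W * (K * K) * 1"
            using K ramp'_bounds[of "snd z - 1"] K0 W0 by (intro mult_mono) auto
          moreover have "z \<in> {a<..<b} \<times> {0<..<4::real}" using z by (cases z) auto
          ultimately show ?thesis by (simp add: f_def abs_mult mult_ac)
        qed
      qed
    qed
    ultimately have "(\<lambda>n. T n) \<longlonglongrightarrow> (LBINT z. F z)" by (simp only:)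
    then show ?thesis .
  qed
  have Fint: "(LBINT z. F z) = (LBINT x. indicator {a<..<b} x * w (x, 0) * \<alpha> x * \<psi> 0)"
  proof -
    let ?g = "\<lambda>x. indicator {a<..<b} x * w (x, 0) * \<alpha> x * \<psi> 0"
    have g: "integrable lborel ?g"
    proof -
      have c0: "continuous_on {a<..<b} (\<lambda>x. w (x, 0))"
        by (rule continuous_on_compose2[OF w]) (use q in \<open>auto intro!: continuous_intros\<close>)
      have "(\<lambda>x. indicator {a<..<b} x *\<^sub>R w (x, 0)) \<in> borel_measurable borel"
        by (rule borel_measurable_continuous_on_indicator[OF _ c0]) simp
      then have [measurable]: "(\<lambda>x. indicator {a<..<b} x * w (x, 0)) \<in> borel_measurable borel" by simp
      have ai: "integrable lborel (\<lambda>x. W * K * K * indicator {a<..<b} x)"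
        using emeasure_bounded_finite[of "{a<..<b}"] by (intro integrable_mult_right integrable_real_indicator) auto
      show ?thesis
      proof (rule Bochner_Integration.integrable_bound[OF ai])
        show "AE x in lborel. norm (?g x) \<le> norm (W * K * K * indicator {a<..<b} x)"
        proof (rule AE_I2)
          fix x
          show "norm (?g x) \<le> norm (W * K * K * indicator {a<..<b} x)"
          proof (cases "x \<in> {a<..<b}")
            case True
            have "\<bar>w (x, 0)\<bar> * \<bar>\<alpha> x\<bar> * \<bar>\<psi> 0\<bar> \<le> W * K * K"
              using W[of "(x, 0)"] True q K K0 W0 by (intro mult_mono) auto
            then show ?thesis using True K0 W0 by (simp add: abs_mult)
          qed simp
        qed
      qed measurable
    qed
    have "(LBINT z. F z) = (LBINT z. ?g (fst z) * ramp' (snd z - 1))" by (simp add: F_def)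
    also have "\<dots> = (LBINT x. ?g x)" unfolding integral_product(2)[OF g ramp'_integral(2)] ramp'_integral(1) by simp
    finally show ?thesis .
  qed
  have "T \<longlonglongrightarrow> (LBINT z. u z * (\<alpha> (fst z) * \<beta> (snd z))) - (LBINT z. snd (H z) * (\<alpha> (fst z) * \<psi> (snd z)))"
    unfolding step[abs_def] using tendsto_diff[OF A B] .
  from LIMSEQ_unique[OF this T] show ?thesis unfolding Fint by (simp add: u_def)
qed

end

lemma rectangle_integral_zero_plateau:
  fixes f :: "real \<times> real \<Rightarrow> real"
  assumes f: "integrable lborel f" and pq: "p < q"
    and z: "\<And>d. 0 < d \<Longrightarrow> 3 * d \<le> q - p \<Longrightarrow> (LBINT z. f z * (bump s t d (fst z) * plateau p (q - d) d (snd z))) = 0"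
  shows "(LBINT z. f z * indicator ({s<..<t} \<times> {p<..<q}) z) = 0"
proof -
  note [measurable] = borel_measurable_integrable[OF f, simplified]
  define e where "e n = inverse (real (Suc n))" for n
  have e: "0 < e n" for n by (simp add: e_def)
  have [measurable]: "bump x y (e n) \<in> borel_measurable borel" "plateau x y (e n) \<in> borel_measurable borel" for n x y
    by (intro borel_measurable_continuous_onI continuous_bump continuous_plateau e)+
  have "\<forall>\<^sub>F n in sequentially. e n < (q - p) / 3"
    unfolding e_def using LIMSEQ_inverse_real_of_nat by (rule order_tendstoD) (use pq in simp)
  \<comment> \<open>The hypothesis covers small \<open>d\<close> only, so the sequence starts at
    \<open>N\<close>.\<close>
  then obtain N where N0: "\<And>n. n \<ge> N \<Longrightarrow> e n < (q - p) / 3" unfolding eventually_sequentially by auto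
  have N: "3 * e n \<le> q - p" if "n \<ge> N" for n using N0[OF that] by simp
  let ?b = "\<lambda>n z. bump s t (e (n + N)) (fst z) * plateau p (q - e (n + N)) (e (n + N)) (snd z)"
  have "(\<lambda>n. LBINT z. f z * ?b n z) \<longlonglongrightarrow> (LBINT z. f z * indicator ({s<..<t} \<times> {p<..<q}) z)"
  proof (rule integral_dominated_convergence[OF _ _ integrable_abs[OF f]])
    show "(\<lambda>z. f z * indicator ({s<..<t} \<times> {p<..<q}) z) \<in> borel_measurable lborel"
      using borel_open[OF open_rectangle[of s t p q]] borel_measurable_integrable[OF f]
      by (intro borel_measurable_times borel_measurable_indicator) auto
    show "AE z in lborel. (\<lambda>n. f z * ?b n z) \<longlonglongrightarrow> f z * indicator ({s<..<t} \<times> {p<..<q}) z"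
    proof (rule AE_I2)
      fix z :: "real \<times> real"
      have "(\<lambda>n. ?b n z) \<longlonglongrightarrow> indicator {s<..<t} (fst z) * indicator {p<..<q} (snd z)"
        using LIMSEQ_ignore_initial_segment[OF bump_tendsto[of s t "fst z"], of N]
          LIMSEQ_ignore_initial_segment[OF plateau_tendsto[OF pq, of "snd z"], of N]
        unfolding e_def by (rule tendsto_mult)
      moreover have "indicator {s<..<t} (fst z) * indicator {p<..<q} (snd z) = (indicator ({s<..<t} \<times> {p<..<q}) z :: real)"
        by (cases z) (auto simp: indicator_def)
      ultimately show "(\<lambda>n. f z * ?b n z) \<longlonglongrightarrow> f z * indicator ({s<..<t} \<times> {p<..<q}) z"
        by (intro tendsto_mult_left) simp
    qed
    show "AE z in lborel. norm (f z * ?b n z) \<le> \<bar>f z\<bar>" for n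
    proof (rule AE_I2)
      fix z
      have "2 * e (n + N) \<le> q - e (n + N) - p" using N[of "n + N"] by simp
      note pb = plateau_bounds[OF e this]
      have "0 \<le> ?b n z" "?b n z \<le> 1" using bump_bounds pb by (auto intro!: mult_nonneg_nonneg mult_le_one)
      then have "\<bar>f z\<bar> * \<bar>?b n z\<bar> \<le> \<bar>f z\<bar> * 1" by (intro mult_left_mono) auto
      then show "norm (f z * ?b n z) \<le> \<bar>f z\<bar>" by (simp add: abs_mult)
    qed
  qed measurable
  moreover have "(LBINT z. f z * ?b n z) = 0" for n by (rule z[OF e N]) simp
  ultimately have "(\<lambda>n::nat. 0::real) \<longlonglongrightarrow> (LBINT z. f z * indicator ({s<..<t} \<times> {p<..<q}) z)" by (simp only:)
  then show ?thesis by (rule LIMSEQ_unique[OF _ tendsto_const])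
qed

section \<open>The trace condition as a formula for the function\<close>

lemma H1_wgrad:
  fixes u :: "real \<times> real \<Rightarrow> real"
  assumes "H1 \<Omega> u"
  shows "L2 \<Omega> u" "wgrad \<Omega> (\<lambda>z. indicator \<Omega> z *\<^sub>R u z) (\<lambda>z. indicator \<Omega> z *\<^sub>R weak_gradient \<Omega> u z)"
proof -
  show l: "L2 \<Omega> u" using assms by (simp add: H1_def)
  have "has_L2_weak_gradient \<Omega> u (weak_gradient \<Omega> u)"
    using assms unfolding H1_def weak_gradient_def by (metis someI_ex)
  then show "wgrad \<Omega> (\<lambda>z. indicator \<Omega> z *\<^sub>R u z) (\<lambda>z. indicator \<Omega> z *\<^sub>R weak_gradient \<Omega> u z)"
    using has_L2_weak_gradient_iff[OF l] by blast
qed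

lemma H1I:
  fixes u :: "real \<times> real \<Rightarrow> real"
  assumes G: "wgrad \<Omega> (\<lambda>z. indicator \<Omega> z *\<^sub>R u z) G" and G0: "\<And>z. z \<notin> \<Omega> \<Longrightarrow> G z = 0"
  shows "H1 \<Omega> u" "has_L2_weak_gradient \<Omega> u G"
proof -
  have l: "L2 \<Omega> u" using wgradD(1)[OF G] by (simp add: L2_iff_sqint)
  have "(\<lambda>z. indicator \<Omega> z *\<^sub>R G z) = G" using G0 by (force simp: indicator_def)
  then show "has_L2_weak_gradient \<Omega> u G" using G has_L2_weak_gradient_iff[OF l, of G] by simp
  then show "H1 \<Omega> u" using l by (auto simp: H1_def)
qed

lemma set_integral_norm_square:
  "(LINT z:\<Omega>|lborel. (norm (f z))\<^sup>2) = (LBINT z. (norm (indicator \<Omega> z *\<^sub>R f z))\<^sup>2)"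
  unfolding set_lebesgue_integral_def by (rule Bochner_Integration.integral_cong) (auto simp: indicator_def)

text \<open>Tested with a bump times a plateau, the approximants satisfy an identity with a boundary
  term. In the limit this term becomes an integral of x, and adjointness of \<open>vprim\<close> and
  \<open>vtail\<close> shows that \<open>u - fst z - vprim g z\<close> integrates to 0 against all
  such products.\<close>

lemma trace_representation:
  assumes tr: "has_bottom_trace a b c u (\<lambda>x. x)" and ab: "a < b" and c: "0 < c"
    and Q: "Q = {a<..<b} \<times> {0<..<c}"
    and G: "wgrad Q (\<lambda>z. indicator Q z *\<^sub>R u z) G" and G0: "\<And>z. z \<notin> Q \<Longrightarrow> G z = 0"
  shows "AE z in lborel. z \<in> Q \<longrightarrow> u z = fst z + vprim (\<lambda>z. snd (G z)) z"
proof -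
  have Qm[measurable]: "Q \<in> sets borel" unfolding Q by (rule borel_open[OF open_rectangle])
  have Qfin: "emeasure lborel Q < \<infinity>" unfolding Q by (rule emeasure_rectangle)
  let ?J = "{a<..<b}"
  obtain w where w: "\<And>n. continuous_on ({a..b} \<times> {0..c}) (w n)" "\<And>n. H1 Q (w n)"
    and n0: "(\<lambda>n. H1_norm Q (\<lambda>z. w n z - u z)) \<longlonglongrightarrow> 0"
    and t0: "(\<lambda>n. LINT x:?J|lborel. (w n (x, 0) - x)\<^sup>2) \<longlonglongrightarrow> 0"
    using tr unfolding has_bottom_trace_def Let_def Q[symmetric] by blast
  let ?R = "\<bar>a\<bar> + \<bar>b\<bar> + c"
  have far: "z \<notin> Q" if "?R < norm z" for z
  proof
    assume "z \<in> Q"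
    then have "\<bar>fst z\<bar> + \<bar>snd z\<bar> \<le> ?R" by (cases z) (auto simp: Q)
    then show False using that norm_Pair_le[of "fst z" "snd z"] by simp
  qed
  \<comment> \<open>\<open>H1_norm\<close> sees the chosen weak gradient of the difference, not that
    of \<open>w n\<close>. Hence \<open>w n\<close> is treated as \<open>u\<close> plus
    \<open>d n\<close>, with gradient \<open>G\<close> plus \<open>E n\<close>, where both
    corrections tend to 0.\<close>
  define d where "d n z = w n z - u z" for n z
  define E where "E n z = indicator Q z *\<^sub>R weak_gradient Q (d n) z" for n z
  have Hd: "H1 Q (d n)" for n
  proof -
    have "wgrad Q (\<lambda>z. indicator Q z *\<^sub>R w n z + (-1) * (indicator Q z *\<^sub>R u z)) (\<lambda>z. indicator Q z *\<^sub>R weak_gradient Q (w n) z + (-1) *\<^sub>R G z)"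
      by (rule wgrad_lin[OF H1_wgrad(2)[OF w(2)] G])
    moreover have "(\<lambda>z. indicator Q z *\<^sub>R w n z + (-1) * (indicator Q z *\<^sub>R u z)) = (\<lambda>z. indicator Q z *\<^sub>R d n z)"
      by (simp add: d_def fun_eq_iff algebra_simps)
    ultimately have "wgrad Q (\<lambda>z. indicator Q z *\<^sub>R d n z) (\<lambda>z. indicator Q z *\<^sub>R weak_gradient Q (w n) z + (-1) *\<^sub>R G z)"
      by (simp only:)
    then show ?thesis by (rule H1I(1)) (simp add: G0)
  qed
  note dw = H1_wgrad(2)[OF Hd, folded E_def]
  have sq: "(LBINT z. (norm (indicator Q z *\<^sub>R d n z))\<^sup>2) + (LBINT z. (norm (E n z))\<^sup>2) = (H1_norm Q (d n))\<^sup>2" for n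
  proof -
    have "0 \<le> (LBINT z. (norm (indicator Q z *\<^sub>R d n z))\<^sup>2) + (LBINT z. (norm (E n z))\<^sup>2)"
      by (intro add_nonneg_nonneg Bochner_Integration.integral_nonneg) auto
    then show ?thesis
      unfolding H1_norm_def E_def using set_integral_norm_square[of Q "d n"] set_integral_norm_square[of Q "weak_gradient Q (d n)"] by simp
  qed
  have "(\<lambda>n. (H1_norm Q (d n))\<^sup>2) \<longlonglongrightarrow> 0\<^sup>2" using n0 unfolding d_def[abs_def] by (rule tendsto_power)
  then have sq0: "(\<lambda>n. (LBINT z. (norm (indicator Q z *\<^sub>R d n z))\<^sup>2) + (LBINT z. (norm (E n z))\<^sup>2)) \<longlonglongrightarrow> 0"
    unfolding sq by simp
  have d0: "(\<lambda>n. LBINT z. (norm (indicator Q z *\<^sub>R d n z))\<^sup>2) \<longlonglongrightarrow> 0"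
    by (rule tendsto_sandwich[OF _ _ tendsto_const sq0]) (auto intro!: always_eventually Bochner_Integration.integral_nonneg)
  have E0: "(\<lambda>n. LBINT z. (norm (E n z))\<^sup>2) \<longlonglongrightarrow> 0"
    by (rule tendsto_sandwich[OF _ _ tendsto_const sq0]) (auto intro!: always_eventually Bochner_Integration.integral_nonneg)
  define g where "g z = snd (G z)" for z
  have gs: "sqint lborel g" unfolding g_def[abs_def] by (rule sqint_components[OF wgradD(2)[OF G]])
  have gm[measurable]: "g \<in> borel_measurable borel" using sqintD(1)[OF gs] by simp
  have us: "sqint lborel (\<lambda>z. indicator Q z *\<^sub>R u z)" by (rule wgradD(1)[OF G])
  have xs: "sqint lborel (\<lambda>x. indicator ?J x *\<^sub>R x)"
    by (rule sqint_bounded_support[of _ "\<bar>a\<bar> + \<bar>b\<bar>" "\<bar>a\<bar> + \<bar>b\<bar>"]) (auto simp: indicator_def)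
  have w0s: "sqint lborel (\<lambda>x. indicator ?J x *\<^sub>R w n (x, 0))" for n
  proof -
    have c0: "continuous_on {a..b} (\<lambda>x. w n (x, 0))"
      by (rule continuous_on_compose2[OF w(1)]) (use c in \<open>auto intro!: continuous_intros\<close>)
    have "bounded ((\<lambda>x. w n (x, 0)) ` {a..b})" by (intro compact_imp_bounded compact_continuous_image[OF c0]) simp
    then obtain W where "\<forall>x\<in>{a..b}. \<bar>w n (x, 0)\<bar> \<le> W" by (auto simp: bounded_iff)
    then have W: "\<bar>w n (x, 0)\<bar> \<le> W" if "x \<in> {a..b}" for x using that by blast
    show ?thesis
    proof (rule sqint_bounded_support[of _ "\<bar>W\<bar>" "\<bar>a\<bar> + \<bar>b\<bar>"])
      show "(\<lambda>x. indicator ?J x *\<^sub>R w n (x, 0)) \<in> borel_measurable borel"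
        by (rule borel_measurable_continuous_on_indicator) (auto intro: continuous_on_subset[OF c0])
      fix x show "norm (indicator ?J x *\<^sub>R w n (x, 0)) \<le> \<bar>W\<bar>"
        using W[of x] by (cases "x \<in> ?J") auto
    qed (auto simp: indicator_def)
  qed
  have vi: "integrable lborel (\<lambda>z. vprim g z * indicator Q z)"
  proof (rule fubini_tail(2)[OF gs, of _ 1 "\<bar>a\<bar> + \<bar>b\<bar> + c"])
    fix x y assume "\<bar>a\<bar> + \<bar>b\<bar> + c < \<bar>x\<bar> \<or> \<bar>a\<bar> + \<bar>b\<bar> + c < \<bar>y\<bar>"
    then show "indicator Q (x, y) = (0::real)" using c by (auto simp: Q indicator_def)
  qed (use c in \<open>auto simp: indicator_def\<close>)
  define f where "f z = indicator Q z * (u z - fst z - vprim g z)" for z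
  have ui: "integrable lborel (\<lambda>z. indicator Q z * (indicator Q z *\<^sub>R u z))" by (rule integrable_rectangle[OF us Qm Qfin])
  have xi: "integrable lborel (\<lambda>z. indicator Q z * fst z)"
  proof (rule integrable_bounded_support[of _ "\<bar>a\<bar> + \<bar>b\<bar>" ?R])
    fix z show "\<bar>indicator Q z * fst z\<bar> \<le> \<bar>a\<bar> + \<bar>b\<bar>"
      by (cases "z \<in> Q") (auto simp: Q)
    show "?R < norm z \<Longrightarrow> indicator Q z * fst z = 0" using far[of z] by simp
  qed measurable
  have fi: "integrable lborel f"
  proof -
    have "f = (\<lambda>z. indicator Q z * (indicator Q z *\<^sub>R u z) - indicator Q z * fst z - vprim g z * indicator Q z)"
      by (auto simp: f_def fun_eq_iff indicator_def)
    then show ?thesis using ui xi vi by simp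
  qed
  have "AE z in lborel. f z = 0"
  proof (rule AE_zero_on_rectangle[OF fi Q])
    fix z assume "z \<notin> Q" then show "f z = 0" by (simp add: f_def)
  next
    fix s t p q assume st: "a \<le> s" "s < t" "t \<le> b" "0 \<le> p" "p < q" "q \<le> c"
    show "(LBINT z. f z * indicator ({s<..<t} \<times> {p<..<q}) z) = 0"
    proof (rule rectangle_integral_zero_plateau[OF fi st(5)])
      fix e :: real assume e: "0 < e" "3 * e \<le> q - p"
      \<comment> \<open>The top of the plateau is lowered by \<open>e\<close>, so that its closed
        support stays strictly below the upper edge. All factors are bounded by
        \<open>1 + c\<close>, since \<open>?\<psi>\<close> is at most the height of the
        rectangle.\<close>
      let ?\<alpha> = "bump s t e" and ?\<beta> = "plateau p (q - e) e" and ?\<psi> = "plateau_int p (q - e) e"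
      have e2: "2 * e \<le> (q - e) - p" using e by simp
      interpret T: trace_test a b c ?\<alpha> "bump' s t e" ?\<beta> ?\<psi> "s + e" "t - e" "q - e" "1 + c"
      proof
        show "(?\<alpha> has_real_derivative bump' s t e x) (at x)" for x by (rule bump_deriv)
        show "continuous_on UNIV (bump' s t e)" by (rule continuous_bump[OF e(1)])
        show "x \<notin> {s + e..t - e} \<Longrightarrow> ?\<alpha> x = 0" for x by (rule bump_0[OF e(1)])
        show "(?\<psi> has_real_derivative - ?\<beta> y) (at y)" for y by (rule plateau_int_deriv[OF e(1)])
        show "continuous_on UNIV ?\<beta>" by (rule continuous_plateau[OF e(1)])
        show "q - e \<le> y \<Longrightarrow> ?\<psi> y = 0" for y by (rule plateau_int_eq(1)[OF e(1) e2])
        show "\<bar>?\<alpha> x\<bar> \<le> 1 + c" for x using bump_bounds[of s t e x] c by simp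
        show "\<bar>?\<beta> x\<bar> \<le> 1 + c" for x using plateau_bounds[OF e(1) e2, of x] c by simp
        show "\<bar>?\<psi> x\<bar> \<le> 1 + c" for x using plateau_int_bounds[OF e(1) e2, of x] c st e by simp
      qed (use st e in auto)
      have TQ: "{a<..<b} \<times> {0<..<c} = Q" by (simp add: Q)
      define k where "k z = ?\<alpha> (fst z) * ?\<beta> (snd z)" for z
      \<comment> \<open>Below the plateau \<open>?\<psi>\<close> is constant, also under the axis;
        the indicator restores bounded support and is harmless because \<open>G\<close> and
        \<open>E n\<close> vanish off \<open>Q\<close>.\<close>
      define k2 where "k2 z = indicator Q z * (?\<alpha> (fst z) * ?\<psi> (snd z))" for z
      have km[measurable]: "k \<in> borel_measurable borel" and k2m: "k2 \<in> borel_measurable borel"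
        unfolding k_def[abs_def] k2_def[abs_def] using T.meas by measurable
      have kQ: "k z = indicator Q z * k z" for z
      proof (cases "z \<in> Q")
        case False
        then have "fst z \<notin> {s + e..t - e} \<or> snd z \<le> p \<or> q - e \<le> snd z" using st e by (cases z) (auto simp: Q)
        then have "k z = 0" using T.a0[of "fst z"] plateau_0[OF e(1) e2, of "snd z"] by (auto simp: k_def)
        then show ?thesis by simp
      qed simp
      have kb: "\<bar>k z\<bar> \<le> (1 + c) * (1 + c)" "\<bar>k2 z\<bar> \<le> (1 + c) * (1 + c)" for z
      proof -
        show "\<bar>k z\<bar> \<le> (1 + c) * (1 + c)" unfolding k_def abs_mult using T.K c by (intro mult_mono) auto
        have "\<bar>?\<alpha> (fst z) * ?\<psi> (snd z)\<bar> \<le> (1 + c) * (1 + c)" unfolding abs_mult using T.K c by (intro mult_mono) auto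
        then show "\<bar>k2 z\<bar> \<le> (1 + c) * (1 + c)" using c by (cases "z \<in> Q") (auto simp: k2_def)
      qed
      have kfar: "k z = 0 \<and> k2 z = 0" if "?R < norm z" for z using far[OF that] kQ[of z] by (simp add: k2_def)
      have ks: "sqint lborel k" by (rule sqint_bounded_support[OF km, of _ ?R]) (use kb kfar in auto)
      have k2s: "sqint lborel k2" by (rule sqint_bounded_support[OF k2m, of _ ?R]) (use kb kfar in auto)
      have as: "sqint lborel (\<lambda>x. ?\<alpha> x * ?\<psi> 0)"
      proof (rule sqint_bounded_support[of _ "(1 + c) * (1 + c)" ?R])
        show "norm (?\<alpha> x * ?\<psi> 0) \<le> (1 + c) * (1 + c)" for x unfolding real_norm_def abs_mult using T.K c by (intro mult_mono) auto
        fix x :: real assume "?R < norm x"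
        then have "x \<notin> {s + e..t - e}" using st e c by auto
        then show "?\<alpha> x * ?\<psi> 0 = 0" using T.a0 by simp
      qed (use T.meas in measurable)
      have bt: "(LBINT z. (indicator Q z *\<^sub>R w n z) \<bullet> k z) =
          (LBINT z. (g z + snd (E n z)) \<bullet> k2 z) + (LBINT x. (indicator ?J x *\<^sub>R w n (x, 0)) \<bullet> (?\<alpha> x * ?\<psi> 0))" for n
      proof -
        have "wgrad Q (\<lambda>z. indicator Q z *\<^sub>R u z + 1 * (indicator Q z *\<^sub>R d n z)) (\<lambda>z. G z + 1 *\<^sub>R E n z)"
          by (rule wgrad_lin[OF G dw])
        moreover have "(\<lambda>z. indicator Q z *\<^sub>R u z + 1 * (indicator Q z *\<^sub>R d n z)) = (\<lambda>z. indicator Q z *\<^sub>R w n z)"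
          by (simp add: d_def fun_eq_iff algebra_simps)
        ultimately have "wgrad Q (\<lambda>z. indicator Q z *\<^sub>R w n z) (\<lambda>z. G z + 1 *\<^sub>R E n z)" by simp
        from T.boundary_term[OF w(1), unfolded TQ, OF this]
        have "(LBINT z. indicator Q z * w n z * (?\<alpha> (fst z) * ?\<beta> (snd z))) =
          (LBINT z. snd (G z + 1 *\<^sub>R E n z) * (?\<alpha> (fst z) * ?\<psi> (snd z))) + (LBINT x. indicator ?J x * w n (x, 0) * ?\<alpha> x * ?\<psi> 0)"
          using G0 by (simp add: E_def)
        moreover have "snd (G z + 1 *\<^sub>R E n z) * (?\<alpha> (fst z) * ?\<psi> (snd z)) = (g z + snd (E n z)) * k2 z" for z
          by (cases "z \<in> Q") (auto simp: g_def k2_def E_def G0)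
        ultimately show ?thesis by (simp add: k_def mult.assoc)
      qed
      have lim1: "(\<lambda>n. LBINT z. (indicator Q z *\<^sub>R w n z) \<bullet> k z) \<longlonglongrightarrow> (LBINT z. (indicator Q z *\<^sub>R u z) \<bullet> k z)"
      proof (rule sqint_inner_tendsto[OF wgradD(1)[OF H1_wgrad(2)[OF w(2)]] us ks])
        have "(\<lambda>n. LBINT z. (norm (indicator Q z *\<^sub>R w n z - indicator Q z *\<^sub>R u z))\<^sup>2) = (\<lambda>n. LBINT z. (norm (indicator Q z *\<^sub>R d n z))\<^sup>2)"
          by (simp add: d_def right_diff_distrib)
        then show "(\<lambda>n. LBINT z. (norm (indicator Q z *\<^sub>R w n z - indicator Q z *\<^sub>R u z))\<^sup>2) \<longlonglongrightarrow> 0" using d0 by simp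
      qed
      have lim2: "(\<lambda>n. LBINT z. (g z + snd (E n z)) \<bullet> k2 z) \<longlonglongrightarrow> (LBINT z. g z \<bullet> k2 z)"
      proof (rule sqint_inner_tendsto[OF sqint_add[OF gs sqint_components(2)[OF wgradD(2)[OF dw]]] gs k2s])
        show "(\<lambda>n. LBINT z. (norm (g z + snd (E n z) - g z))\<^sup>2) \<longlonglongrightarrow> 0"
        proof (rule tendsto_sandwich[OF _ _ tendsto_const E0])
          show "\<forall>\<^sub>F n in sequentially. (LBINT z. (norm (g z + snd (E n z) - g z))\<^sup>2) \<le> (LBINT z. (norm (E n z))\<^sup>2)"
          proof (intro always_eventually allI integral_mono)
            fix n
            show "integrable lborel (\<lambda>z. (norm (E n z))\<^sup>2)" by (rule sqintD(2)[OF wgradD(2)[OF dw]])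
            show "integrable lborel (\<lambda>z. (norm (g z + snd (E n z) - g z))\<^sup>2)"
              using sqintD(2)[OF sqint_components(2)[OF wgradD(2)[OF dw]], of n] by simp
            fix z show "(norm (g z + snd (E n z) - g z))\<^sup>2 \<le> (norm (E n z))\<^sup>2"
              using norm_snd_le[of "snd (E n z)" "fst (E n z)"] by (intro power_mono) auto
          qed
        qed (auto intro!: always_eventually Bochner_Integration.integral_nonneg)
      qed
      have lim3: "(\<lambda>n. LBINT x. (indicator ?J x *\<^sub>R w n (x, 0)) \<bullet> (?\<alpha> x * ?\<psi> 0)) \<longlonglongrightarrow> (LBINT x. (indicator ?J x *\<^sub>R x) \<bullet> (?\<alpha> x * ?\<psi> 0))"
      proof (rule sqint_inner_tendsto[OF w0s xs as])
        have "(LINT x:?J|lborel. (w n (x, 0) - x)\<^sup>2) = (LBINT x. (norm (indicator ?J x *\<^sub>R w n (x, 0) - indicator ?J x *\<^sub>R x))\<^sup>2)" for n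
          unfolding set_lebesgue_integral_def by (rule Bochner_Integration.integral_cong) (auto simp: indicator_def)
        then show "(\<lambda>n. LBINT x. (norm (indicator ?J x *\<^sub>R w n (x, 0) - indicator ?J x *\<^sub>R x))\<^sup>2) \<longlonglongrightarrow> 0" using t0 by simp
      qed
      have "(\<lambda>n. LBINT z. (indicator Q z *\<^sub>R w n z) \<bullet> k z) \<longlonglongrightarrow> (LBINT z. g z \<bullet> k2 z) + (LBINT x. (indicator ?J x *\<^sub>R x) \<bullet> (?\<alpha> x * ?\<psi> 0))"
        unfolding bt by (rule tendsto_add[OF lim2 lim3])
      from LIMSEQ_unique[OF lim1 this]
      have U: "(LBINT z. (indicator Q z *\<^sub>R u z) * k z) = (LBINT z. g z * k2 z) + (LBINT x. indicator ?J x * x * (?\<alpha> x * ?\<psi> 0))" by simp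
      have far2: "k (x, y) = 0" if "?R < \<bar>x\<bar> \<or> ?R < \<bar>y\<bar>" for x y
      proof -
        have "(x, y) \<notin> Q" using that c by (auto simp: Q)
        then show ?thesis using kQ[of "(x, y)"] by simp
      qed
      have R0: "0 < ?R" using c by simp
      have "(LBINT z. vprim g z * k z) = (LBINT z. g z * vtail k z)" and vki: "integrable lborel (\<lambda>z. vprim g z * k z)"
        using fubini_tail[OF gs km kb(1) far2 R0] by auto
      moreover have "g z * vtail k z = g z * k2 z" for z
      proof (cases "z \<in> Q")
        case True
        have "(LBINT t. indicator {snd z<..} t * k (fst z, t)) = (LBINT t. ?\<alpha> (fst z) * (indicator {snd z<..} t * ?\<beta> t))"
          by (rule Bochner_Integration.integral_cong) (auto simp: k_def)
        also have "\<dots> = ?\<alpha> (fst z) * ?\<psi> (snd z)" using plateau_tail[OF e(1) e2] by simp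
        finally show ?thesis using True by (cases z) (auto simp: vtail_def k2_def Q)
      qed (simp add: g_def G0)
      ultimately have V: "(LBINT z. vprim g z * k z) = (LBINT z. g z * k2 z)" by simp
      \<comment> \<open>The boundary factor \<open>?\<psi> 0\<close> is the full integral of the
        plateau, so the boundary integral of x equals an area integral against
        \<open>k\<close>.\<close>
      have \<beta>i: "(LBINT y. ?\<beta> y) = ?\<psi> 0" "integrable lborel ?\<beta>"
      proof -
        have "indicator {0<..} y * ?\<beta> y = ?\<beta> y" for y
          using plateau_0[OF e(1) e2, of y] st by (cases "0 < y") auto
        then show "(LBINT y. ?\<beta> y) = ?\<psi> 0" using plateau_tail[OF e(1) e2, of 0] by (simp only:)
        show "integrable lborel ?\<beta>"
        proof (rule integrable_bounded_support[of _ "1 + c" ?R])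
          fix y :: real assume "?R < norm y"
          then have "y \<le> p \<or> q - e \<le> y" using st e c by auto
          then show "?\<beta> y = 0" by (rule plateau_0[OF e(1) e2])
        qed (use T.meas T.K in auto)
      qed
      have \<alpha>i: "integrable lborel (\<lambda>x. indicator ?J x * x * ?\<alpha> x)"
      proof -
        have "sqint lborel ?\<alpha>"
        proof (rule sqint_bounded_support[of _ "1 + c" ?R])
          fix x :: real assume "?R < norm x"
          then have "x \<notin> {s + e..t - e}" using st e c by auto
          then show "?\<alpha> x = 0" by (rule T.a0)
        qed (use T.meas T.K in auto)
        from sqint_inner[OF xs this] show ?thesis by simp
      qed
      have X: "(LBINT z. fst z * k z) = (LBINT x. indicator ?J x * x * (?\<alpha> x * ?\<psi> 0))" and Xi: "integrable lborel (\<lambda>z. fst z * k z)"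
      proof -
        have eq: "fst z * k z = (indicator ?J (fst z) * fst z * ?\<alpha> (fst z)) * ?\<beta> (snd z)" for z
          using T.a0[of "fst z"] st e by (cases "fst z \<in> ?J") (auto simp: k_def)
        show "integrable lborel (\<lambda>z. fst z * k z)" unfolding eq by (rule integral_product(1)[OF \<alpha>i \<beta>i(2)])
        show "(LBINT z. fst z * k z) = (LBINT x. indicator ?J x * x * (?\<alpha> x * ?\<psi> 0))"
          unfolding eq integral_product(2)[OF \<alpha>i \<beta>i(2)] \<beta>i(1) by (simp add: mult.assoc[symmetric])
      qed
      have Ui: "integrable lborel (\<lambda>z. (indicator Q z *\<^sub>R u z) * k z)" using sqint_inner[OF us ks] by simp
      have "f z * k z = (indicator Q z *\<^sub>R u z) * k z - fst z * k z - vprim g z * k z" for z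
        using kQ[of z] by (cases "z \<in> Q") (auto simp: f_def algebra_simps)
      then have "(LBINT z. f z * k z) = (LBINT z. (indicator Q z *\<^sub>R u z) * k z) - (LBINT z. fst z * k z) - (LBINT z. vprim g z * k z)"
        using Ui Xi vki by simp
      also have "\<dots> = 0" unfolding U X V by simp
      finally show "(LBINT z. f z * (?\<alpha> (fst z) * ?\<beta> (snd z))) = 0" by (simp add: k_def)
    qed
  qed
  then show ?thesis unfolding g_def[abs_def, symmetric]
    by eventually_elim (auto simp: f_def indicator_def split: if_splits)
qed

subsection \<open>Coupling test functions with vertical primitives\<close>

lemma integral_derivative_zero:
  assumes F: "\<And>x. (F has_real_derivative f x) (at x)" and f: "continuous_on UNIV f"
    and 0: "\<And>x. R < \<bar>x\<bar> \<Longrightarrow> F x = 0" "\<And>x. R < \<bar>x\<bar> \<Longrightarrow> f x = 0" and R: "0 < R"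
  shows "(LBINT x. f x) = 0"
proof -
  have "has_bochner_integral lborel (\<lambda>x. f x * indicator {- R - 1..R + 1} x) (F (R + 1) - F (- R - 1))"
    by (rule has_bochner_integral_FTC_Icc_real) (use F f R in \<open>auto simp: continuous_on_eq_continuous_at\<close>)
  moreover have "(\<lambda>x. f x * indicator {- R - 1..R + 1} x) = f"
  proof
    fix x show "f x * indicator {- R - 1..R + 1} x = f x"
      using 0(2)[of x] by (cases "R < \<bar>x\<bar>") (auto simp: indicator_def)
  qed
  ultimately show ?thesis using 0(1)[of "R + 1"] 0(1)[of "- R - 1"] R by (simp add: has_bochner_integral_iff)
qed

lemma integral_derivative_tail:
  assumes F: "\<And>x. (F has_real_derivative f x) (at x)" and f: "continuous_on UNIV f"
    and 0: "\<And>x. R < \<bar>x\<bar> \<Longrightarrow> F x = 0" "\<And>x. R < \<bar>x\<bar> \<Longrightarrow> f x = 0" and R: "0 < R"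
  shows "(LBINT t. indicator {s<..} t * f t) = - F s"
proof -
  let ?S = "max s (R + 1)"
  have fm: "f \<in> borel_measurable borel" using f by (rule borel_measurable_continuous_onI)
  have "has_bochner_integral lborel (\<lambda>x. f x * indicator {s..?S} x) (F ?S - F s)"
    by (rule has_bochner_integral_FTC_Icc_real) (use F f in \<open>auto simp: continuous_on_eq_continuous_at\<close>)
  moreover have "F ?S = 0" using R by (intro 0(1)) auto
  ultimately have "(LBINT x. f x * indicator {s..?S} x) = - F s" by (simp add: has_bochner_integral_iff)
  moreover have "(LBINT t. indicator {s<..} t * f t) = (LBINT x. f x * indicator {s..?S} x)"
  proof (rule integral_cong_AE)
    have "AE t in lborel. t \<noteq> s" by (rule AE_lborel_singleton)
    then show "AE t in lborel. indicator {s<..} t * f t = f t * indicator {s..?S} t"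
    proof eventually_elim
      case (elim t)
      then show ?case using 0(2)[of t] by (cases "t < s"; cases "R + 1 \<le> t") (auto simp: indicator_def)
    qed
  qed (use fm in measurable)
  ultimately show ?thesis by simp
qed

lemma test_function_slices:
  fixes \<phi> :: "real \<times> real \<Rightarrow> real"
  assumes t: "test_function \<Omega> \<phi> D"
  shows "((\<lambda>x. \<phi> (x, y)) has_real_derivative fst (D (x, y))) (at x)"
    "((\<lambda>y. \<phi> (x, y)) has_real_derivative snd (D (x, y))) (at y)"
    "continuous_on S (\<lambda>x. fst (D (x, y)))" "continuous_on S (\<lambda>y. snd (D (x, y)))"
proof -
  have d: "(\<phi> has_derivative (\<lambda>h. h \<bullet> D z)) (at z)" for z
    using test_functionD(1)[OF t] unfolding gderiv_def by blast
  have "((\<lambda>x. (x, y)) has_derivative (\<lambda>h. (h, 0))) (at x)" by (auto intro!: derivative_eq_intros)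
  from has_derivative_compose[OF this d]
  show "((\<lambda>x. \<phi> (x, y)) has_real_derivative fst (D (x, y))) (at x)"
    by (simp add: has_field_derivative_def inner_prod_def mult_commute_abs)
  have "((\<lambda>y. (x, y)) has_derivative (\<lambda>h. (0, h))) (at y)" by (auto intro!: derivative_eq_intros)
  from has_derivative_compose[OF this d]
  show "((\<lambda>y. \<phi> (x, y)) has_real_derivative snd (D (x, y))) (at y)"
    by (simp add: has_field_derivative_def inner_prod_def mult_commute_abs)
  show "continuous_on S (\<lambda>x. fst (D (x, y)))" "continuous_on S (\<lambda>y. snd (D (x, y)))"
    by (intro continuous_intros continuous_on_compose2[OF test_functionD(2)[OF t]]; simp)+
qed

lemma test_function_box_support:
  fixes \<phi> :: "real \<times> real \<Rightarrow> real"
  assumes t: "test_function \<Omega> \<phi> D"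
  obtains R where "0 < R" "\<And>z. \<bar>\<phi> z\<bar> \<le> R" "\<And>z. \<bar>fst (D z)\<bar> \<le> R" "\<And>z. \<bar>snd (D z)\<bar> \<le> R"
    "\<And>x y. R < \<bar>x\<bar> \<or> R < \<bar>y\<bar> \<Longrightarrow> \<phi> (x, y) = 0 \<and> D (x, y) = 0"
proof -
  obtain R where R: "0 < R" "\<And>z. norm (\<phi> z) \<le> R" "\<And>z. norm (D z) \<le> R" "\<And>z. R < norm z \<Longrightarrow> \<phi> z = 0 \<and> D z = 0"
    using test_function_bounds[OF t] by blast
  show thesis
  proof (rule that[OF R(1)])
    show "\<bar>\<phi> z\<bar> \<le> R" for z using R(2)[of z] by simp
    show "\<bar>fst (D z)\<bar> \<le> R" "\<bar>snd (D z)\<bar> \<le> R" for z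
      using R(3)[of z] norm_fst_le[of "fst (D z)" "snd (D z)"] norm_snd_le[of "snd (D z)" "fst (D z)"] by auto
    fix x y :: real assume "R < \<bar>x\<bar> \<or> R < \<bar>y\<bar>"
    then have "R < norm (x, y)" using norm_fst_le[of x y] norm_snd_le[of y x] by auto
    then show "\<phi> (x, y) = 0 \<and> D (x, y) = 0" by (rule R(4))
  qed
qed

text \<open>The two summands of \<open>u\<close> tested separately: x has gradient (1, 0), and the
  primitive meets a horizontal derivative through its tail and a vertical one through the
  fundamental theorem. Test functions may reach below the axis, where \<open>vprim\<close> is 0;
  hence the case distinction.\<close>

lemma coupling:
  fixes \<phi> :: "real \<times> real \<Rightarrow> real"
  assumes g: "sqint lborel g" and t: "test_function \<Omega> \<phi> D"
  shows "integrable lborel (\<lambda>z. fst z * fst (D z))" "integrable lborel (\<lambda>z. fst z * snd (D z))"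
    "integrable lborel (\<lambda>z. vprim g z * fst (D z))" "integrable lborel (\<lambda>z. vprim g z * snd (D z))"
    "(LBINT z. fst z * fst (D z)) = - (LBINT z. \<phi> z)" "(LBINT z. fst z * snd (D z)) = 0"
    "(LBINT z. vprim g z * fst (D z)) = (LBINT z. g z * tail D z)"
    "(LBINT z. vprim g z * snd (D z)) = - (LBINT z. g z * (if 0 < snd z then \<phi> z else 0))"
proof -
  note [measurable] = test_functionD(5,6)[OF t]
  have m: "(\<lambda>z. fst (D z)) \<in> borel_measurable borel" "(\<lambda>z. snd (D z)) \<in> borel_measurable borel" by measurable
  obtain R where R: "0 < R" "\<And>z. \<bar>\<phi> z\<bar> \<le> R" "\<And>z. \<bar>fst (D z)\<bar> \<le> R" "\<And>z. \<bar>snd (D z)\<bar> \<le> R"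
    "\<And>x y. R < \<bar>x\<bar> \<or> R < \<bar>y\<bar> \<Longrightarrow> \<phi> (x, y) = 0 \<and> D (x, y) = 0" using test_function_box_support[OF t] by metis
  have far: "\<phi> z = 0 \<and> D z = 0" if "2 * R < norm z" for z
  proof -
    have "R < \<bar>fst z\<bar> \<or> R < \<bar>snd z\<bar>" using that norm_Pair_le[of "fst z" "snd z"] by simp linarith
    then show ?thesis using R(5)[of "fst z" "snd z"] by simp
  qed
  have b: "\<bar>fst z * fst (D z)\<bar> \<le> R * R" "\<bar>fst z * snd (D z)\<bar> \<le> R * R" for z
  proof -
    have "\<bar>fst z\<bar> * \<bar>fst (D z)\<bar> \<le> R * R" "\<bar>fst z\<bar> * \<bar>snd (D z)\<bar> \<le> R * R"
    proof (atomize(full), cases "\<bar>fst z\<bar> \<le> R")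
      case True
      then show "\<bar>fst z\<bar> * \<bar>fst (D z)\<bar> \<le> R * R \<and> \<bar>fst z\<bar> * \<bar>snd (D z)\<bar> \<le> R * R"
        using R(1) R(3)[of z] R(4)[of z] True by (auto intro!: mult_mono)
    next
      case False
      then have "D z = 0" using R(5)[of "fst z" "snd z"] by simp
      then show "\<bar>fst z\<bar> * \<bar>fst (D z)\<bar> \<le> R * R \<and> \<bar>fst z\<bar> * \<bar>snd (D z)\<bar> \<le> R * R" using R(1) by simp
    qed
    then show "\<bar>fst z * fst (D z)\<bar> \<le> R * R" "\<bar>fst z * snd (D z)\<bar> \<le> R * R" by (auto simp: abs_mult)
  qed
  show i1: "integrable lborel (\<lambda>z. fst z * fst (D z))"
    by (rule integrable_bounded_support[of _ "R * R" "2 * R", OF _ b(1)]) (use far in auto)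
  show i2: "integrable lborel (\<lambda>z. fst z * snd (D z))"
    by (rule integrable_bounded_support[of _ "R * R" "2 * R", OF _ b(2)]) (use far in auto)
  have k1: "fst (D (x, y)) = 0" "snd (D (x, y)) = 0" if "R < \<bar>x\<bar> \<or> R < \<bar>y\<bar>" for x y using R(5)[OF that] by auto
  show "integrable lborel (\<lambda>z. vprim g z * fst (D z))" by (rule fubini_tail(2)[OF g m(1) R(3) k1(1) R(1)])
  show "integrable lborel (\<lambda>z. vprim g z * snd (D z))" by (rule fubini_tail(2)[OF g m(2) R(4) k1(2) R(1)])
  show "(LBINT z. vprim g z * fst (D z)) = (LBINT z. g z * tail D z)"
    unfolding tail_eq_vtail by (rule fubini_tail(1)[OF g m(1) R(3) k1(1) R(1)])
  have vt: "vtail (\<lambda>z. snd (D z)) z = (if 0 < snd z then - \<phi> z else 0)" for z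
  proof -
    have "(LBINT t. indicator {snd z<..} t * snd (D (fst z, t))) = - \<phi> (fst z, snd z)"
      by (rule integral_derivative_tail[OF test_function_slices(2)[OF t] test_function_slices(4)[OF t] _ _ R(1)])
        (use R(5) in auto)
    then show ?thesis by (simp add: vtail_def)
  qed
  have "(LBINT z. vprim g z * snd (D z)) = (LBINT z. g z * vtail (\<lambda>z. snd (D z)) z)"
    by (rule fubini_tail(1)[OF g m(2) R(4) k1(2) R(1)])
  also have "\<dots> = (LBINT z. - (g z * (if 0 < snd z then \<phi> z else 0)))"
    by (rule Bochner_Integration.integral_cong) (auto simp: vt)
  finally show "(LBINT z. vprim g z * snd (D z)) = - (LBINT z. g z * (if 0 < snd z then \<phi> z else 0))" by simp
  have \<phi>i: "integrable lborel \<phi>" by (rule test_integrable(1)[OF t t])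
  have "(LBINT z. fst z * snd (D z)) = (LBINT x. LBINT y. x * snd (D (x, y)))"
    using lborel_pair.integral_fst'[of "\<lambda>z. fst z * snd (D z)"] i2 by (simp add: lborel_prod)
  also have "\<dots> = 0"
  proof -
    have "(LBINT y. x * snd (D (x, y))) = 0" for x
      using integral_derivative_zero[OF test_function_slices(2)[OF t] test_function_slices(4)[OF t] _ _ R(1), of x] R(5) by simp
    then show ?thesis by (simp only: Bochner_Integration.integral_zero)
  qed
  finally show "(LBINT z. fst z * snd (D z)) = 0" .
  \<comment> \<open>The sum is the integral of the horizontal derivative of x times
    \<open>\<phi>\<close>, which vanishes on every line.\<close>
  have "(LBINT z. fst z * fst (D z)) + (LBINT z. \<phi> z) = (LBINT z. fst z * fst (D z) + \<phi> z)" using i1 \<phi>i by simp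
  also have "\<dots> = (LBINT y. LBINT x. x * fst (D (x, y)) + \<phi> (x, y))"
  proof -
    have "integrable (lborel \<Otimes>\<^sub>M lborel) (\<lambda>(x, y). x * fst (D (x, y)) + \<phi> (x, y))"
      using i1 \<phi>i by (simp add: lborel_prod case_prod_unfold)
    from lborel_pair.integral_snd[OF this] show ?thesis by (simp add: lborel_prod case_prod_unfold)
  qed
  also have "\<dots> = 0"
  proof -
    have "(LBINT x. x * fst (D (x, y)) + \<phi> (x, y)) = 0" for y
    proof (rule integral_derivative_zero[where F = "\<lambda>x. x * \<phi> (x, y)"])
      show "((\<lambda>x. x * \<phi> (x, y)) has_real_derivative x * fst (D (x, y)) + \<phi> (x, y)) (at x)" for x
        using test_function_slices(1)[OF t] by (auto intro!: derivative_eq_intros)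
      show "continuous_on UNIV (\<lambda>x. x * fst (D (x, y)) + \<phi> (x, y))"
        by (intro continuous_intros test_function_slices(3)[OF t] continuous_on_compose2[OF test_functionD(3)[OF t]]) auto
    qed (use R in auto)
    then show ?thesis by simp
  qed
  finally show "(LBINT z. fst z * fst (D z)) = - (LBINT z. \<phi> z)" by simp
qed

section \<open>The dual energy as a lower bound for the Dirichlet energy\<close>

lemma open_subgraph: assumes l: "lsc h" shows "open (subgraph h)"
proof -
  have "\<exists>T. open T \<and> z \<in> T \<and> T \<subseteq> subgraph h" if z: "z \<in> subgraph h" for z
  proof -
    obtain x y where xy: "z = (x, y)" "0 < y" "y < h x" using z by (auto simp: subgraph_def)
    then obtain c where c: "y < c" "c < h x" using dense by blast
    obtain d where d: "d > 0" "\<And>x'. \<bar>x' - x\<bar> < d \<Longrightarrow> c < h x'" using lscD[OF l c(2)] by blast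
    show ?thesis
    proof (intro exI conjI)
      show "open ({x - d<..<x + d} \<times> {0<..<c})" by (rule open_rectangle)
      show "z \<in> {x - d<..<x + d} \<times> {0<..<c}" using xy c d by auto
      show "{x - d<..<x + d} \<times> {0<..<c} \<subseteq> subgraph h"
      proof
        fix w assume "w \<in> {x - d<..<x + d} \<times> {0<..<c}"
        then have "\<bar>fst w - x\<bar> < d" "0 < snd w" "snd w < c" by auto
        then show "w \<in> subgraph h" using d(2)[of "fst w"] by (cases w) (auto simp: subgraph_def)
      qed
    qed
  qed
  then show ?thesis by (subst open_subopen) blast
qed

text \<open>By lower semicontinuity, countably many rectangles with rational data standing on the
  axis cover the subgraph, so the exceptional null sets of the single formulas can be
  united.\<close>

lemma trace_on_subgraph:
  assumes l: "lsc h" and tr: "trace_on_support h u (\<lambda>x. x)"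
    and G: "wgrad (subgraph h) (\<lambda>z. indicator (subgraph h) z *\<^sub>R u z) G"
  shows "AE z in lborel. z \<in> subgraph h \<longrightarrow> u z = fst z + vprim (\<lambda>z. snd (G z)) z"
proof -
  let ?O = "subgraph h"
  let ?Q = "\<lambda>(a, b, c). {real_of_rat a<..<real_of_rat b} \<times> {0<..<real_of_rat c}"
  have "AE z in lborel. \<forall>p\<in>UNIV. ?Q p \<subseteq> ?O \<longrightarrow> z \<in> ?Q p \<longrightarrow> u z = fst z + vprim (\<lambda>z. snd (G z)) z"
  proof (rule AE_ball_countable', clarify)
    fix a' b' c'
    define a b c where "a = real_of_rat a'" and "b = real_of_rat b'" and "c = real_of_rat c'"
    define Q where "Q = {a<..<b} \<times> {0<..<c}"
    have Qm: "Q \<in> sets borel" unfolding Q_def by (rule borel_open[OF open_rectangle])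
    have "AE z in lborel. Q \<subseteq> ?O \<longrightarrow> z \<in> Q \<longrightarrow> u z = fst z + vprim (\<lambda>z. snd (G z)) z"
    proof (cases "Q \<subseteq> ?O \<and> a < b \<and> 0 < c")
      case False
      then have "\<not> Q \<subseteq> ?O \<or> Q = {}" by (auto simp: Q_def)
      then show ?thesis by auto
    next
      case True
      then have "has_bottom_trace a b c u (\<lambda>x. x)" using tr unfolding trace_on_support_def Q_def by blast
      moreover have "wgrad Q (\<lambda>z. indicator Q z *\<^sub>R u z) (\<lambda>z. indicator Q z *\<^sub>R G z)"
      proof -
        have eq: "indicator Q z *\<^sub>R indicator ?O z *\<^sub>R u z = indicator Q z *\<^sub>R u z" for z
          using True by (auto simp: indicator_def)
        have "wgrad Q (\<lambda>z. indicator Q z *\<^sub>R indicator ?O z *\<^sub>R u z) (\<lambda>z. indicator Q z *\<^sub>R G z)"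
          by (rule wgrad_restrict[OF G]) (use True Qm in auto)
        then show ?thesis by (simp only: eq)
      qed
      ultimately have "AE z in lborel. z \<in> Q \<longrightarrow> u z = fst z + vprim (\<lambda>z. snd (indicator Q z *\<^sub>R G z)) z"
        using trace_representation[of a b c u Q "\<lambda>z. indicator Q z *\<^sub>R G z"] True Q_def by simp
      \<comment> \<open>The primitive uses only values between the axis and the point, and these lie
        in the same rectangle.\<close>
      moreover have "vprim (\<lambda>z. snd (indicator Q z *\<^sub>R G z)) z = vprim (\<lambda>z. snd (G z)) z" if "z \<in> Q" for z
        unfolding vprim_def by (rule Bochner_Integration.integral_cong) (use that in \<open>auto simp: Q_def indicator_def\<close>)
      ultimately show ?thesis by (auto elim: eventually_mono)
    qed
    then show "AE z in lborel. {real_of_rat a'<..<real_of_rat b'} \<times> {0<..<real_of_rat c'} \<subseteq> ?O \<longrightarrow>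
      z \<in> {real_of_rat a'<..<real_of_rat b'} \<times> {0<..<real_of_rat c'} \<longrightarrow> u z = fst z + vprim (\<lambda>z. snd (G z)) z"
      unfolding Q_def a_def b_def c_def .
  qed simp
  then show ?thesis
  proof eventually_elim
    case (elim z)
    show ?case
    proof
      assume z: "z \<in> ?O"
      obtain x y where xy: "z = (x, y)" "0 < y" "y < h x" using z by (auto simp: subgraph_def)
      obtain c where c: "y < real_of_rat c" "real_of_rat c < h x" using of_rat_dense[OF xy(3)] by blast
      obtain d where d: "d > 0" "\<And>x'. \<bar>x' - x\<bar> < d \<Longrightarrow> real_of_rat c < h x'" using lscD[OF l c(2)] by blast
      obtain a where a: "x - d < real_of_rat a" "real_of_rat a < x" using of_rat_dense[of "x - d" x] d(1) by auto
      obtain b where b: "x < real_of_rat b" "real_of_rat b < x + d" using of_rat_dense[of x "x + d"] d(1) by auto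
      have "?Q (a, b, c) \<subseteq> ?O"
      proof
        fix w assume "w \<in> ?Q (a, b, c)"
        then have "\<bar>fst w - x\<bar> < d" "0 < snd w" "snd w < real_of_rat c" using a b by auto
        then show "w \<in> ?O" using d(2)[of "fst w"] by (cases w) (auto simp: subgraph_def)
      qed
      moreover have "z \<in> ?Q (a, b, c)" using xy a b c by auto
      ultimately show "u z = fst z + vprim (\<lambda>z. snd (G z)) z" using elim by blast
    qed
  qed
qed

lemma integral_inner_dual_pair:
  assumes G: "sqint lborel G" and t: "test_function \<Omega> \<phi> D"
  shows "(LBINT z. G z \<bullet> dual_pair \<phi> D z) = (LBINT z. \<phi> z * fst (G z)) + (LBINT z. snd (G z) * tail D z)"
proof -
  have i: "integrable lborel (\<lambda>z. \<phi> z * fst (G z))" "integrable lborel (\<lambda>z. snd (G z) * tail D z)"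
  proof -
    show "integrable lborel (\<lambda>z. \<phi> z * fst (G z))" using sqint_inner[OF sqint_test(1)[OF t] sqint_components(1)[OF G]] by simp
    have "sqint lborel (\<lambda>z. snd (dual_pair \<phi> D z))" by (rule sqint_components(2)[OF sqint_dual_pair[OF t]])
    then have "sqint lborel (tail D)" by (simp add: dual_pair_def)
    from sqint_inner[OF sqint_components(2)[OF G] this] show "integrable lborel (\<lambda>z. snd (G z) * tail D z)" by simp
  qed
  have "(LBINT z. G z \<bullet> dual_pair \<phi> D z) = (LBINT z. \<phi> z * fst (G z) + snd (G z) * tail D z)"
    by (rule Bochner_Integration.integral_cong) (auto simp: dual_pair_def inner_prod_def mult.commute)
  then show ?thesis using i by simp
qed

text \<open>Inserting the formula for \<open>u\<close> in the weak equation for the horizontal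
  derivative shows that \<open>G\<close> pairs with every dual pair to the integral of
  \<open>\<phi>\<close>; the squared distance of the two then yields weak duality.\<close>

lemma dual_energy_le_Dirichlet:
  assumes l: "lsc h" and tr: "trace_on_support h u (\<lambda>x. x)"
    and G: "wgrad (subgraph h) (\<lambda>z. indicator (subgraph h) z *\<^sub>R u z) G"
  shows "dual_energy h \<le> (LBINT z. (norm (G z))\<^sup>2)"
proof (rule dual_energy_least)
  fix \<phi> D assume t: "test_function (subgraph h) \<phi> D"
  let ?O = "subgraph h"
  define g where "g z = snd (G z)" for z
  have g: "sqint lborel g" unfolding g_def[abs_def] by (rule sqint_components[OF wgradD(2)[OF G]])
  have Om: "?O \<in> sets borel" by (rule borel_open[OF open_subgraph[OF l]])
  have "(LBINT z. (indicator ?O z *\<^sub>R u z) * fst (D z)) = (LBINT z. fst z * fst (D z) + vprim g z * fst (D z))"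
  proof (rule integral_cong_AE)
    show "AE z in lborel. (indicator ?O z *\<^sub>R u z) * fst (D z) = fst z * fst (D z) + vprim g z * fst (D z)"
      using trace_on_subgraph[OF l tr G]
    proof eventually_elim
      case (elim z)
      show ?case
      proof (cases "z \<in> ?O")
        case False
        then have "D z = 0" using test_functionD(4)[OF t, of z] by blast
        then show ?thesis by simp
      qed (use elim in \<open>simp add: g_def[abs_def] distrib_right\<close>)
    qed
    have m: "(\<lambda>z. fst (D z)) \<in> borel_measurable borel" using test_functionD(5)[OF t] by measurable
    show "(\<lambda>z. (indicator ?O z *\<^sub>R u z) * fst (D z)) \<in> borel_measurable lborel"
      using sqintD(1)[OF wgradD(1)[OF G]] m by (intro borel_measurable_times) auto
    show "(\<lambda>z. fst z * fst (D z) + vprim g z * fst (D z)) \<in> borel_measurable lborel"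
      using borel_measurable_integrable[OF coupling(1)[OF g t]] borel_measurable_integrable[OF coupling(3)[OF g t]] by measurable
  qed
  then have "- (LBINT z. \<phi> z * fst (G z)) = - (LBINT z. \<phi> z) + (LBINT z. g z * tail D z)"
    using wgradD(3)[OF G t] coupling[OF g t] by simp
  then have "(LBINT z. \<phi> z) = (LBINT z. G z \<bullet> dual_pair \<phi> D z)"
    unfolding integral_inner_dual_pair[OF wgradD(2)[OF G] t] by (simp add: g_def)
  moreover have "0 \<le> (LBINT z. (norm (G z + (-1) *\<^sub>R dual_pair \<phi> D z))\<^sup>2)" by (rule Bochner_Integration.integral_nonneg) simp
  ultimately show "dual_functional \<phi> D \<le> (LBINT z. (norm (G z))\<^sup>2)"
    unfolding sqint_add_integral[OF wgradD(2)[OF G] sqint_dual_pair[OF t]] dual_functional_pair[OF t] by simp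
qed

text \<open>Cauchy-Schwarz against the constant 1. In \<open>ennreal\<close> it also covers the case
  of an infinite right side, so it can be applied to every column before integrability is
  known.\<close>

lemma interval_integral_square_le:
  fixes f :: "real \<Rightarrow> real"
  assumes [measurable]: "f \<in> borel_measurable borel" and pq: "p < q"
  shows "ennreal ((LBINT s. indicator {p<..<q} s * f s)\<^sup>2) \<le>
    ennreal (q - p) * (\<integral>\<^sup>+s. indicator {p<..<q} s * ennreal ((f s)\<^sup>2) \<partial>lborel)"
proof -
  let ?F = "\<lambda>s. indicator {p<..<q} s * f s"
  have eq: "indicator {p<..<q} s * ennreal ((f s)\<^sup>2) = ennreal ((?F s)\<^sup>2)" for s by (auto simp: indicator_def)
  show ?thesis
  proof (cases "(\<integral>\<^sup>+s. ennreal ((?F s)\<^sup>2) \<partial>lborel) = \<infinity>")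
    case True
    then show ?thesis using pq by (simp add: eq ennreal_mult_top)
  next
    case False
    have i: "integrable lborel (\<lambda>s. (?F s)\<^sup>2)"
      by (rule integrableI_bounded) (use False in \<open>auto simp: less_top\<close>)
    have s: "sqint lborel ?F" unfolding sqint_def using i by simp
    have i1: "integrable lborel (\<lambda>s. indicator {p<..<q} s :: real)" by (rule integrable_real_indicator) (use pq in auto)
    have s1: "sqint lborel (\<lambda>s. indicator {p<..<q} s :: real)"
      by (rule sqint_bound[OF _ i1]) (auto simp: indicator_def)
    have "(LBINT s. indicator {p<..<q} s \<bullet> ?F s)\<^sup>2 \<le>
        (LBINT s. (norm (indicator {p<..<q} s :: real))\<^sup>2) * (LBINT s. (norm (?F s))\<^sup>2)"
      by (rule sqint_Cauchy_Schwarz[OF s1 s])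
    moreover have "(LBINT s. indicator {p<..<q} s \<bullet> ?F s) = (LBINT s. ?F s)"
      by (rule Bochner_Integration.integral_cong) (auto simp: indicator_def)
    moreover have "(LBINT s. (norm (indicator {p<..<q} s :: real))\<^sup>2) = (LBINT s. indicator {p<..<q} s)"
      by (rule Bochner_Integration.integral_cong) (auto simp: indicator_def)
    ultimately have "(LBINT s. ?F s)\<^sup>2 \<le> (q - p) * (LBINT s. (?F s)\<^sup>2)" using pq by simp
    then have "ennreal ((LBINT s. ?F s)\<^sup>2) \<le> ennreal ((q - p) * (LBINT s. (?F s)\<^sup>2))" by (rule ennreal_leI)
    also have "\<dots> = ennreal (q - p) * (\<integral>\<^sup>+s. ennreal ((?F s)\<^sup>2) \<partial>lborel)"
      using pq nn_integral_eq_integral[OF i] by (simp add: ennreal_mult)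
    finally show ?thesis by (simp only: eq)
  qed
qed

lemma nn_integral_dilate:
  assumes [measurable]: "f \<in> borel_measurable borel" and l: "l \<noteq> 0" "m \<noteq> 0"
  shows "(\<integral>\<^sup>+z. f z \<partial>lborel) = ennreal \<bar>l * m\<bar> * (\<integral>\<^sup>+z. f (dilate c l m z) \<partial>lborel)"
proof -
  have d: "lborel = density (distr lborel borel (dilate c l m)) (\<lambda>_. ennreal \<bar>l * m\<bar>)" by (rule lborel_dilate[OF l])
  have "(\<integral>\<^sup>+z. f z \<partial>lborel) = (\<integral>\<^sup>+z. f z \<partial>density (distr lborel borel (dilate c l m)) (\<lambda>_. ennreal \<bar>l * m\<bar>))" using d by simp
  also have "\<dots> = ennreal \<bar>l * m\<bar> * (\<integral>\<^sup>+z. f (dilate c l m z) \<partial>lborel)"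
    by (simp add: nn_integral_density nn_integral_distr nn_integral_cmult)
  finally show ?thesis .
qed

subsection \<open>Averages over contractions of a rectangle\<close>

text \<open>The contractions \<open>shift \<xi>\<close> keep the rectangle invariant, so averaging over \<open>\<xi>\<close> needs no extension across the
  vertical sides. Smoothing in the horizontal direction suffices for continuity up to the boundary,
  since in the vertical direction the functions in question are primitives.\<close>

locale rectangle_average =
  fixes a b c l :: real
  assumes ab: "a < b" and c: "0 < c" and l: "0 < l" "l < 1"
begin

abbreviation "Q \<equiv> {a<..<b} \<times> {0<..<c}"

text \<open>The contraction of ratio \<open>l\<close> towards the vertical line with abscissa
  \<open>\<xi>\<close>; heights are unchanged.\<close>

abbreviation "shift \<xi> \<equiv> dilate ((1 - l) * \<xi>, 0) l 1"

definition average :: "(real \<times> real \<Rightarrow> real) \<Rightarrow> real \<times> real \<Rightarrow> real" where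
  "average f z = indicator Q z * ((LBINT \<xi>. indicator {a<..<b} \<xi> * f (shift \<xi> z)) / (b - a))"

lemma Q_sets[measurable]: "Q \<in> sets borel" by (rule borel_open[OF open_rectangle])

lemma shift_pair_measurable:
  assumes f: "f \<in> borel_measurable borel"
  shows "(\<lambda>p. f (shift (fst p) (snd p))) \<in> borel_measurable (borel \<Otimes>\<^sub>M borel)"
proof -
  have "(\<lambda>p. shift (fst p) (snd p)) \<in> borel_measurable (borel :: (real \<times> real \<times> real) measure)"
    unfolding dilate_def by (intro borel_measurable_continuous_onI continuous_intros)
  then show ?thesis using f unfolding borel_prod by (rule measurable_compose)
qed

lemma average_measurable[measurable]:
  assumes f: "f \<in> borel_measurable borel"
  shows "average f \<in> borel_measurable borel"
proof -
  have "(\<lambda>p. f (shift (snd p) (fst p))) \<in> borel_measurable (borel \<Otimes>\<^sub>M borel)"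
    using measurable_compose[OF _ shift_pair_measurable[OF f], of "\<lambda>p. (snd p, fst p)" "borel \<Otimes>\<^sub>M borel"] by simp
  then have [measurable]: "(\<lambda>p. f (shift (snd p) (fst p))) \<in> borel_measurable (borel \<Otimes>\<^sub>M lborel)" by measurable
  have "(\<lambda>z. LBINT \<xi>. indicator {a<..<b} \<xi> * f (shift \<xi> z)) \<in> borel_measurable borel"
    by (rule lborel.borel_measurable_lebesgue_integral) (simp add: case_prod_unfold)
  then show ?thesis unfolding average_def[abs_def] by measurable
qed

lemma shift_in_Q: "\<xi> \<in> {a<..<b} \<Longrightarrow> z \<in> Q \<Longrightarrow> shift \<xi> z \<in> Q"
proof -
  assume A: "\<xi> \<in> {a<..<b}" "z \<in> Q"
  have "(1 - l) * a < (1 - l) * \<xi>" "(1 - l) * \<xi> < (1 - l) * b" "l * a < l * fst z" "l * fst z < l * b" using A l by auto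
  then have "a < (1 - l) * \<xi> + l * fst z" "(1 - l) * \<xi> + l * fst z < b" by (simp_all add: algebra_simps)
  then show ?thesis using A by (auto simp: dilate_def)
qed

lemma shift_square_measurable:
  assumes f: "f \<in> borel_measurable borel"
  shows "(\<lambda>p. indicator {a<..<b} (fst p) * ennreal ((f (shift (fst p) (snd p)))\<^sup>2)) \<in> borel_measurable (lborel \<Otimes>\<^sub>M lborel)"
    "(\<lambda>z. \<integral>\<^sup>+\<xi>. indicator {a<..<b} \<xi> * ennreal ((f (shift \<xi> z))\<^sup>2) \<partial>lborel) \<in> borel_measurable lborel"
    "(\<lambda>\<xi>. f (shift \<xi> z)) \<in> borel_measurable borel"
proof -
  have [measurable]: "(\<lambda>p. f (shift (fst p) (snd p))) \<in> borel_measurable (lborel \<Otimes>\<^sub>M lborel)"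
    using shift_pair_measurable[OF f] by simp
  show m: "(\<lambda>p. indicator {a<..<b} (fst p) * ennreal ((f (shift (fst p) (snd p)))\<^sup>2)) \<in> borel_measurable (lborel \<Otimes>\<^sub>M lborel)"
    by measurable
  have m': "(\<lambda>p. indicator {a<..<b} (snd p) * ennreal ((f (shift (snd p) (fst p)))\<^sup>2)) \<in> borel_measurable (lborel \<Otimes>\<^sub>M lborel)"
    using measurable_compose[OF _ m, of "\<lambda>p. (snd p, fst p)" "lborel \<Otimes>\<^sub>M lborel"] by simp
  show "(\<lambda>z. \<integral>\<^sup>+\<xi>. indicator {a<..<b} \<xi> * ennreal ((f (shift \<xi> z))\<^sup>2) \<partial>lborel) \<in> borel_measurable lborel"
    by (rule lborel.borel_measurable_nn_integral) (use m' in \<open>simp add: case_prod_unfold\<close>)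
  have "(\<lambda>\<xi>. shift \<xi> z) \<in> borel_measurable borel"
    unfolding dilate_def by (intro borel_measurable_continuous_onI continuous_intros)
  then show "(\<lambda>\<xi>. f (shift \<xi> z)) \<in> borel_measurable borel" using f by (rule measurable_compose)
qed

text \<open>Each contraction multiplies the squared norm by \<open>1 / l\<close>, whatever its
  centre; Tonelli puts the integral over centres outside.\<close>

lemma shift_norm:
  assumes f[measurable]: "f \<in> borel_measurable borel"
  shows "(\<integral>\<^sup>+z. \<integral>\<^sup>+\<xi>. indicator {a<..<b} \<xi> * ennreal ((f (shift \<xi> z))\<^sup>2) \<partial>lborel \<partial>lborel) =
    ennreal (b - a) * (ennreal (1 / l) * (\<integral>\<^sup>+z. ennreal ((f z)\<^sup>2) \<partial>lborel))"
proof -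
  let ?N = "\<integral>\<^sup>+z. ennreal ((f z)\<^sup>2) \<partial>lborel"
  have "(\<integral>\<^sup>+z. \<integral>\<^sup>+\<xi>. indicator {a<..<b} \<xi> * ennreal ((f (shift \<xi> z))\<^sup>2) \<partial>lborel \<partial>lborel) =
      (\<integral>\<^sup>+\<xi>. \<integral>\<^sup>+z. indicator {a<..<b} \<xi> * ennreal ((f (shift \<xi> z))\<^sup>2) \<partial>lborel \<partial>lborel)"
    by (rule lborel_pair.Fubini') (use shift_square_measurable(1)[OF f] in \<open>simp add: case_prod_unfold\<close>)
  also have "\<dots> = (\<integral>\<^sup>+\<xi>. indicator {a<..<b} \<xi> * (ennreal (1 / l) * ?N) \<partial>lborel)"
  proof (rule nn_integral_cong)
    fix \<xi> :: real
    have "?N = ennreal l * (\<integral>\<^sup>+z. ennreal ((f (shift \<xi> z))\<^sup>2) \<partial>lborel)"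
      using nn_integral_dilate[of "\<lambda>z. ennreal ((f z)\<^sup>2)" l 1 "((1 - l) * \<xi>, 0)"] l by simp
    then have "ennreal (1 / l) * ?N = (ennreal (1 / l) * ennreal l) * (\<integral>\<^sup>+z. ennreal ((f (shift \<xi> z))\<^sup>2) \<partial>lborel)"
      by (simp add: mult.assoc)
    also have "ennreal (1 / l) * ennreal l = 1" using l by (subst ennreal_mult[symmetric]) auto
    finally show "(\<integral>\<^sup>+z. indicator {a<..<b} \<xi> * ennreal ((f (shift \<xi> z))\<^sup>2) \<partial>lborel) = indicator {a<..<b} \<xi> * (ennreal (1 / l) * ?N)"
      by (subst nn_integral_cmult) auto
  qed
  also have "\<dots> = ennreal (b - a) * (ennreal (1 / l) * ?N)"
    using ab by (simp add: nn_integral_multc)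
  finally show ?thesis .
qed

text \<open>Cauchy-Schwarz in \<open>\<xi>\<close> places the square inside the mean, pointwise in
  \<open>z\<close>.\<close>

lemma average_norm:
  assumes f[measurable]: "f \<in> borel_measurable borel"
  shows "(\<integral>\<^sup>+z. ennreal ((average f z)\<^sup>2) \<partial>lborel) \<le> ennreal (1 / l) * (\<integral>\<^sup>+z. ennreal ((f z)\<^sup>2) \<partial>lborel)"
proof -
  let ?L = "b - a"
  have L: "0 < ?L" using ab by simp
  have pt: "ennreal ((average f z)\<^sup>2) \<le> ennreal (1 / ?L) * (\<integral>\<^sup>+\<xi>. indicator {a<..<b} \<xi> * ennreal ((f (shift \<xi> z))\<^sup>2) \<partial>lborel)" for z
  proof -
    let ?I = "LBINT \<xi>. indicator {a<..<b} \<xi> * f (shift \<xi> z)"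
    have "(average f z)\<^sup>2 \<le> (1 / ?L)\<^sup>2 * ?I\<^sup>2"
      by (cases "z \<in> Q") (auto simp: average_def power_divide)
    then have "ennreal ((average f z)\<^sup>2) \<le> ennreal ((1 / ?L)\<^sup>2 * ?I\<^sup>2)" by (rule ennreal_leI)
    also have "\<dots> = ennreal ((1 / ?L)\<^sup>2) * ennreal (?I\<^sup>2)" by (rule ennreal_mult) auto
    also have "\<dots> \<le> ennreal ((1 / ?L)\<^sup>2) * (ennreal ?L * (\<integral>\<^sup>+\<xi>. indicator {a<..<b} \<xi> * ennreal ((f (shift \<xi> z))\<^sup>2) \<partial>lborel))"
      by (intro mult_left_mono interval_integral_square_le ab shift_square_measurable(3)[OF f]) auto
    also have "\<dots> = ennreal (1 / ?L) * (\<integral>\<^sup>+\<xi>. indicator {a<..<b} \<xi> * ennreal ((f (shift \<xi> z))\<^sup>2) \<partial>lborel)"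
    proof -
      have "ennreal ((1 / ?L)\<^sup>2) * ennreal ?L = ennreal (1 / ?L)"
        using L by (subst ennreal_mult[symmetric]) (auto simp: power2_eq_square)
      then show ?thesis by (simp add: mult.assoc[symmetric])
    qed
    finally show ?thesis .
  qed
  have "(\<integral>\<^sup>+z. ennreal ((average f z)\<^sup>2) \<partial>lborel) \<le>
      (\<integral>\<^sup>+z. ennreal (1 / ?L) * (\<integral>\<^sup>+\<xi>. indicator {a<..<b} \<xi> * ennreal ((f (shift \<xi> z))\<^sup>2) \<partial>lborel) \<partial>lborel)"
    by (rule nn_integral_mono) (rule pt)
  also have "\<dots> = ennreal (1 / ?L) * (ennreal ?L * (ennreal (1 / l) * (\<integral>\<^sup>+z. ennreal ((f z)\<^sup>2) \<partial>lborel)))"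
    unfolding shift_norm[OF f, symmetric] by (rule nn_integral_cmult[OF shift_square_measurable(2)[OF f]])
  also have "\<dots> = ennreal (1 / l) * (\<integral>\<^sup>+z. ennreal ((f z)\<^sup>2) \<partial>lborel)"
  proof -
    have "ennreal (1 / ?L) * ennreal ?L = 1" using L by (subst ennreal_mult[symmetric]) auto
    then show ?thesis by (simp add: mult.assoc[symmetric])
  qed
  finally show ?thesis .
qed

text \<open>The mean is additive only where the slices in \<open>\<xi>\<close> are integrable;
  finiteness of the double integral provides this for almost every \<open>z\<close>.\<close>

lemma shift_slice_integrable:
  fixes f :: "real \<times> real \<Rightarrow> real"
  assumes f: "sqint lborel f"
  shows "AE z in lborel. integrable lborel (\<lambda>\<xi>. indicator {a<..<b} \<xi> * f (shift \<xi> z))"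
proof -
  have fm: "f \<in> borel_measurable borel" using sqintD(1)[OF f] by simp
  have "(\<integral>\<^sup>+z. ennreal ((f z)\<^sup>2) \<partial>lborel) = ennreal (LBINT z. (f z)\<^sup>2)"
    by (rule nn_integral_eq_integral) (use sqintD(2)[OF f] in auto)
  then have "(\<integral>\<^sup>+z. \<integral>\<^sup>+\<xi>. indicator {a<..<b} \<xi> * ennreal ((f (shift \<xi> z))\<^sup>2) \<partial>lborel \<partial>lborel) \<noteq> \<infinity>"
    by (simp add: shift_norm[OF fm] ennreal_mult_eq_top_iff)
  then have "AE z in lborel. (\<integral>\<^sup>+\<xi>. indicator {a<..<b} \<xi> * ennreal ((f (shift \<xi> z))\<^sup>2) \<partial>lborel) \<noteq> \<infinity>"
    by (rule nn_integral_PInf_AE[OF shift_square_measurable(2)[OF fm]])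
  then show ?thesis
  proof eventually_elim
    case (elim z)
    let ?F = "\<lambda>\<xi>. indicator {a<..<b} \<xi> * f (shift \<xi> z)"
    note [measurable] = shift_square_measurable(3)[OF fm, of z]
    have eq: "indicator {a<..<b} \<xi> * ennreal ((f (shift \<xi> z))\<^sup>2) = ennreal ((?F \<xi>)\<^sup>2)" for \<xi>
      by (auto simp: indicator_def)
    have "integrable lborel (\<lambda>\<xi>. (?F \<xi>)\<^sup>2)"
      by (rule integrableI_bounded) (use elim in \<open>auto simp: eq less_top\<close>)
    then have "integrable lborel (\<lambda>\<xi>. (?F \<xi>)\<^sup>2 + indicator {a<..<b} \<xi>)"
      by (intro Bochner_Integration.integrable_add integrable_real_indicator) (use ab in auto)
    then show ?case
    proof (rule Bochner_Integration.integrable_bound)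
      have "\<bar>?F \<xi>\<bar> \<le> (?F \<xi>)\<^sup>2 + indicator {a<..<b} \<xi>" for \<xi>
      proof (cases "\<xi> \<in> {a<..<b}")
        case True
        have "0 \<le> (\<bar>f (shift \<xi> z)\<bar> - 1)\<^sup>2" "0 \<le> \<bar>f (shift \<xi> z)\<bar>" by auto
        then show ?thesis using True by (simp add: power2_diff)
      qed simp
      then show "AE \<xi> in lborel. norm (?F \<xi>) \<le> norm ((?F \<xi>)\<^sup>2 + indicator {a<..<b} \<xi>)"
        by (intro AE_I2) (metis abs_ge_self order_trans real_norm_def)
    qed measurable
  qed
qed

lemma average_add:
  assumes f: "sqint lborel f" and g: "sqint lborel g"
  shows "AE z in lborel. average (\<lambda>z. f z + g z) z = average f z + average g z"
  using shift_slice_integrable[OF f] shift_slice_integrable[OF g]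
  by eventually_elim (simp add: average_def distrib_left add_divide_distrib)

lemma sqint_shift:
  assumes f: "sqint lborel f"
  shows "sqint lborel (\<lambda>z. f (shift \<xi> z))" "(LBINT z. (norm (f (shift \<xi> z)))\<^sup>2) = (LBINT z. (norm (f z))\<^sup>2) / l"
proof -
  have [measurable]: "f \<in> borel_measurable borel" using sqintD(1)[OF f] by simp
  have m: "(\<lambda>z. (norm (f z))\<^sup>2) \<in> borel_measurable borel" by measurable
  note i = integral_dilate[OF m, of l 1 "((1 - l) * \<xi>, 0)"]
  show "sqint lborel (\<lambda>z. f (shift \<xi> z))" unfolding sqint_def using i(2) l sqintD(2)[OF f] by simp
  show "(LBINT z. (norm (f (shift \<xi> z)))\<^sup>2) = (LBINT z. (norm (f z))\<^sup>2) / l" using i(1) l by simp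
qed

lemma sqint_average:
  assumes f: "sqint lborel f"
  shows "sqint lborel (average f)" "(LBINT z. (average f z)\<^sup>2) \<le> (LBINT z. (f z)\<^sup>2) / l"
proof -
  have [measurable]: "f \<in> borel_measurable borel" using sqintD(1)[OF f] by simp
  have i: "integrable lborel (\<lambda>z. (f z)\<^sup>2)" using sqintD(2)[OF f] by simp
  have "(\<integral>\<^sup>+z. ennreal ((average f z)\<^sup>2) \<partial>lborel) \<le> ennreal (1 / l) * ennreal (LBINT z. (f z)\<^sup>2)"
    using average_norm[of f] nn_integral_eq_integral[OF i] by simp
  also have "\<dots> = ennreal ((LBINT z. (f z)\<^sup>2) / l)" using l by (subst ennreal_mult[symmetric]) auto
  finally have le: "(\<integral>\<^sup>+z. ennreal ((average f z)\<^sup>2) \<partial>lborel) \<le> ennreal ((LBINT z. (f z)\<^sup>2) / l)" .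
  have i': "integrable lborel (\<lambda>z. (average f z)\<^sup>2)"
    by (rule integrableI_bounded) (use le_less_trans[OF le ennreal_less_top] in auto)
  then show "sqint lborel (average f)" unfolding sqint_def by simp
  have "ennreal (LBINT z. (average f z)\<^sup>2) \<le> ennreal ((LBINT z. (f z)\<^sup>2) / l)"
    using le nn_integral_eq_integral[OF i'] by simp
  then show "(LBINT z. (average f z)\<^sup>2) \<le> (LBINT z. (f z)\<^sup>2) / l"
    using l by (subst (asm) ennreal_le_iff) auto
qed

text \<open>With the mean over \<open>\<xi>\<close> outside, a single contraction at a time can be
  handled by a change of variables.\<close>

lemma average_adjoint:
  assumes f: "sqint lborel f" and k: "sqint lborel k" and k0: "\<And>z. z \<notin> Q \<Longrightarrow> k z = 0"
  shows "(LBINT z. average f z * k z) =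
    (LBINT \<xi>. indicator {a<..<b} \<xi> * (LBINT z. f (shift \<xi> z) * k z)) / (b - a)"
proof -
  have fm[measurable]: "f \<in> borel_measurable borel" and [measurable]: "k \<in> borel_measurable borel"
    using sqintD(1)[OF f] sqintD(1)[OF k] by auto
  let ?F = "\<lambda>\<xi> z. indicator {a<..<b} \<xi> * (f (shift \<xi> z) * k z)"
  have m: "(\<lambda>(\<xi>, z). ?F \<xi> z) \<in> borel_measurable (lborel \<Otimes>\<^sub>M lborel)"
  proof -
    have [measurable]: "(\<lambda>p. f (shift (fst p) (snd p))) \<in> borel_measurable (lborel \<Otimes>\<^sub>M lborel)"
      using shift_pair_measurable[OF fm] by simp
    show ?thesis unfolding case_prod_unfold by measurable
  qed
  have ik: "integrable lborel (\<lambda>z. f (shift \<xi> z) * k z)" for \<xi>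
    using sqint_inner[OF sqint_shift(1)[OF f] k] by simp
  let ?C = "(LBINT z. (norm (f z))\<^sup>2) / l + (LBINT z. (norm (k z))\<^sup>2)"
  have "integrable (lborel \<Otimes>\<^sub>M lborel) (\<lambda>(\<xi>, z). ?F \<xi> z)"
  proof (rule lborel_pair.Fubini_integrable[OF m])
    show "AE \<xi> in lborel. integrable lborel (\<lambda>z. case (\<xi>, z) of (\<xi>, z) \<Rightarrow> ?F \<xi> z)" using ik by simp
    show "integrable lborel (\<lambda>\<xi>. LBINT z. norm (case (\<xi>, z) of (\<xi>, z) \<Rightarrow> ?F \<xi> z))"
    proof (rule Bochner_Integration.integrable_bound)
      show "integrable lborel (\<lambda>\<xi>. ?C * indicator {a<..<b} \<xi>)" by (intro integrable_mult_right integrable_real_indicator) (use ab in auto)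
      show "(\<lambda>\<xi>. LBINT z. norm (case (\<xi>, z) of (\<xi>, z) \<Rightarrow> ?F \<xi> z)) \<in> borel_measurable lborel"
        by (rule lborel.borel_measurable_lebesgue_integral) (use m in \<open>simp add: case_prod_unfold\<close>)
      have "\<bar>LBINT z. \<bar>?F \<xi> z\<bar>\<bar> \<le> \<bar>?C * indicator {a<..<b} \<xi>\<bar>" for \<xi>
      proof -
        have 0: "0 \<le> (LBINT z. \<bar>f (shift \<xi> z) * k z\<bar>)" by (rule Bochner_Integration.integral_nonneg) simp
        have "(LBINT z. \<bar>f (shift \<xi> z) * k z\<bar>) \<le> (LBINT z. (norm (f (shift \<xi> z)))\<^sup>2 + (norm (k z))\<^sup>2)"
        proof (rule integral_mono)
          show "integrable lborel (\<lambda>z. \<bar>f (shift \<xi> z) * k z\<bar>)" using ik by auto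
          show "integrable lborel (\<lambda>z. (norm (f (shift \<xi> z)))\<^sup>2 + (norm (k z))\<^sup>2)"
            using sqintD(2)[OF sqint_shift(1)[OF f]] sqintD(2)[OF k] by auto
          fix z
          have "0 \<le> (\<bar>f (shift \<xi> z)\<bar> - \<bar>k z\<bar>)\<^sup>2" "0 \<le> \<bar>f (shift \<xi> z)\<bar> * \<bar>k z\<bar>" by auto
          then show "\<bar>f (shift \<xi> z) * k z\<bar> \<le> (norm (f (shift \<xi> z)))\<^sup>2 + (norm (k z))\<^sup>2"
            unfolding abs_mult real_norm_def power2_diff by linarith
        qed
        also have "\<dots> = ?C" using sqintD(2)[OF sqint_shift(1)[OF f]] sqintD(2)[OF k] sqint_shift(2)[OF f] by simp
        finally show ?thesis using 0 by (cases "\<xi> \<in> {a<..<b}") auto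
      qed
      then show "AE \<xi> in lborel. norm (LBINT z. norm (case (\<xi>, z) of (\<xi>, z) \<Rightarrow> ?F \<xi> z)) \<le> norm (?C * indicator {a<..<b} \<xi>)"
        by (intro AE_I2) (simp only: prod.case real_norm_def)
    qed
  qed
  from lborel_pair.Fubini_integral[OF this]
  have eq: "(LBINT z. LBINT \<xi>. ?F \<xi> z) = (LBINT \<xi>. LBINT z. ?F \<xi> z)" by simp
  have "average f z * k z = (LBINT \<xi>. ?F \<xi> z) / (b - a)" for z
  proof (cases "z \<in> Q")
    case True
    have "(LBINT \<xi>. ?F \<xi> z) = (LBINT \<xi>. (indicator {a<..<b} \<xi> * f (shift \<xi> z)) * k z)"
      by (rule Bochner_Integration.integral_cong) (auto simp: mult.assoc)
    then show ?thesis using True by (simp add: average_def)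
  next
    case False
    then show ?thesis using k0 by simp
  qed
  then have "(LBINT z. average f z * k z) = (LBINT z. LBINT \<xi>. ?F \<xi> z) / (b - a)" by simp
  also have "\<dots> = (LBINT \<xi>. indicator {a<..<b} \<xi> * (LBINT z. f (shift \<xi> z) * k z)) / (b - a)"
    unfolding eq by simp
  finally show ?thesis .
qed

text \<open>The chain rule for one contraction gives the factor \<open>l\<close> in the horizontal
  component. Composing a test function with the inverse keeps its support in the rectangle, since
  contractions map the rectangle into itself.\<close>

lemma wgrad_average:
  assumes u: "wgrad Q v (\<lambda>z. (G z, g z))"
  shows "wgrad Q (average v) (\<lambda>z. (l * average G z, average g z))"
proof -
  have v: "sqint lborel v" by (rule wgradD(1)[OF u])
  have G: "sqint lborel G" and g: "sqint lborel g" using sqint_components[OF wgradD(2)[OF u]] by auto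
  have vm: "v \<in> borel_measurable borel" "G \<in> borel_measurable borel" "g \<in> borel_measurable borel"
    using sqintD(1)[OF v] sqintD(1)[OF G] sqintD(1)[OF g] by auto
  have s2: "sqint lborel (\<lambda>z. (l * average G z, average g z))"
  proof (rule sqint_bound)
    show "(\<lambda>z. (l * average G z, average g z)) \<in> borel_measurable lborel" using average_measurable vm by simp
    show "integrable lborel (\<lambda>z. l\<^sup>2 * (norm (average G z))\<^sup>2 + (norm (average g z))\<^sup>2)"
      using sqintD(2)[OF sqint_average(1)[OF G]] sqintD(2)[OF sqint_average(1)[OF g]] by simp
    show "(norm (l * average G z, average g z))\<^sup>2 \<le> l\<^sup>2 * (norm (average G z))\<^sup>2 + (norm (average g z))\<^sup>2" for z
      by (simp add: norm_Pair power_mult_distrib)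
  qed
  show ?thesis unfolding wgrad_def
  proof (intro conjI allI impI)
    show "sqint lborel (average v)" by (rule sqint_average(1)[OF v])
    show "sqint lborel (\<lambda>z. (l * average G z, average g z))" by (rule s2)
    fix \<phi> D assume t: "test_function Q \<phi> D"
    note sD = sqint_components[OF sqint_test(2)[OF t]] and s\<phi> = sqint_test(1)[OF t]
    have D0: "fst (D z) = 0" "snd (D z) = 0" "\<phi> z = 0" if "z \<notin> Q" for z
    proof -
      have "\<phi> z = 0 \<and> D z = 0" using test_functionD(4)[OF t, of z] that by blast
      then show "fst (D z) = 0" "snd (D z) = 0" "\<phi> z = 0" by auto
    qed
    have [measurable]: "\<phi> \<in> borel_measurable borel" "D \<in> borel_measurable borel" using test_functionD(5,6)[OF t] by auto
    have slice: "(LBINT z. v (shift \<xi> z) * fst (D z)) = - l * (LBINT z. G (shift \<xi> z) * \<phi> z)"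
      "(LBINT z. v (shift \<xi> z) * snd (D z)) = - (LBINT z. g (shift \<xi> z) * \<phi> z)" if x: "\<xi> \<in> {a<..<b}" for \<xi>
    proof -
      define S where "S = dilate (- (1 - l) * \<xi> / l, 0) (1 / l) 1"
      have inv: "S (shift \<xi> z) = z" "shift \<xi> (S z) = z" for z using l by (auto simp: S_def dilate_def prod_eq_iff field_simps)
      have [measurable]: "S \<in> borel_measurable borel" unfolding S_def by simp
      \<comment> \<open>The support of the pulled back function lies in the image of the rectangle
        under the contraction.\<close>
      have sub: "z \<in> Q" if "S z \<in> Q" for z using shift_in_Q[OF x that] inv(2)[of z] by simp
      have t': "test_function Q (\<lambda>z. \<phi> (S z)) (\<lambda>z. (1 / l * fst (D (S z)), 1 * snd (D (S z))))"
        unfolding S_def by (rule test_function_dilate[OF t]) (use l sub S_def in auto)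
      have ch: "(LBINT z. p (shift \<xi> z) * k z) = (LBINT z. p z * k (S z)) / l"
        if [measurable]: "p \<in> borel_measurable borel" "k \<in> borel_measurable borel" for p k :: "real \<times> real \<Rightarrow> real"
        using integral_dilate(1)[of "\<lambda>z. p z * k (S z)" l 1 "((1 - l) * \<xi>, 0)"] l inv by simp
      have [measurable]: "(\<lambda>z. fst (D z)) \<in> borel_measurable borel" "(\<lambda>z. snd (D z)) \<in> borel_measurable borel"
        using sqintD(1)[OF sD(1)] sqintD(1)[OF sD(2)] by auto
      have "(LBINT z. v (shift \<xi> z) * fst (D z)) = (LBINT z. v z * fst (D (S z))) / l"
        using ch[of v "\<lambda>z. fst (D z)"] vm by simp
      also have "\<dots> = (LBINT z. v z * fst (1 / l * fst (D (S z)), 1 * snd (D (S z))))" by simp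
      also have "\<dots> = - (LBINT z. \<phi> (S z) * G z)" using wgradD(3)[OF u t'] by simp
      also have "\<dots> = - l * (LBINT z. G (shift \<xi> z) * \<phi> z)" using ch[of G \<phi>] vm l by (simp add: mult.commute)
      finally show "(LBINT z. v (shift \<xi> z) * fst (D z)) = - l * (LBINT z. G (shift \<xi> z) * \<phi> z)" .
      have "(LBINT z. v (shift \<xi> z) * snd (D z)) = (LBINT z. v z * snd (D (S z))) / l"
        using ch[of v "\<lambda>z. snd (D z)"] vm by simp
      also have "\<dots> = (LBINT z. v z * snd (1 / l * fst (D (S z)), 1 * snd (D (S z)))) / l" by simp
      also have "\<dots> = - (LBINT z. \<phi> (S z) * g z) / l" using wgradD(4)[OF u t'] by simp
      also have "\<dots> = - (LBINT z. g (shift \<xi> z) * \<phi> z)" using ch[of g \<phi>] vm by (simp add: mult.commute)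
      finally show "(LBINT z. v (shift \<xi> z) * snd (D z)) = - (LBINT z. g (shift \<xi> z) * \<phi> z)" .
    qed
    have "(LBINT \<xi>. indicator {a<..<b} \<xi> * (LBINT z. v (shift \<xi> z) * fst (D z))) =
        (LBINT \<xi>. - l * (indicator {a<..<b} \<xi> * (LBINT z. G (shift \<xi> z) * \<phi> z)))"
      by (rule Bochner_Integration.integral_cong) (auto simp: indicator_def slice(1))
    then show "(LBINT z. average v z * fst (D z)) = - (LBINT z. \<phi> z * fst (l * average G z, average g z))"
      using average_adjoint[OF v sD(1) D0(1)] average_adjoint[OF G s\<phi> D0(3)] by (simp add: mult.commute mult.left_commute)
    have "(LBINT \<xi>. indicator {a<..<b} \<xi> * (LBINT z. v (shift \<xi> z) * snd (D z))) =
        (LBINT \<xi>. - (indicator {a<..<b} \<xi> * (LBINT z. g (shift \<xi> z) * \<phi> z)))"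
      by (rule Bochner_Integration.integral_cong) (auto simp: indicator_def slice(2))
    then show "(LBINT z. average v z * snd (D z)) = - (LBINT z. \<phi> z * snd (l * average G z, average g z))"
      using average_adjoint[OF v sD(2) D0(2)] average_adjoint[OF g s\<phi> D0(3)] by (simp add: mult.commute)
  qed
qed

end

section \<open>Density of continuous functions and convergence of the averages\<close>

definition truncate_at :: "real \<Rightarrow> real \<Rightarrow> real" where
  "truncate_at M x = max (- M) (min M x)"

lemma truncate_at_bounds:
  assumes "0 \<le> M"
  shows "\<bar>truncate_at M x\<bar> \<le> M" "\<bar>x - truncate_at M x\<bar> \<le> \<bar>x\<bar>" "\<bar>x\<bar> \<le> M \<Longrightarrow> truncate_at M x = x" "truncate_at M 0 = 0"
  using assms by (auto simp: truncate_at_def max_def min_def)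

lemma continuous_truncate_at: "continuous_on S (truncate_at M)"
  unfolding truncate_at_def by (intro continuous_intros)

lemma truncate_at_measurable[measurable]: "truncate_at M \<in> borel_measurable borel"
  by (rule borel_measurable_continuous_onI[OF continuous_truncate_at])

text \<open>The notion \<open>measurable_on\<close> from gauge integration asks for exactly such a
  sequence off a negligible set, and it agrees with Lebesgue measurability.\<close>

lemma continuous_AE_approximation:
  fixes f :: "'a::euclidean_space \<Rightarrow> real"
  assumes "f \<in> borel_measurable borel"
  shows "\<exists>p. (\<forall>n::nat. continuous_on UNIV (p n)) \<and> (AE z in lborel. (\<lambda>n. p n z) \<longlonglongrightarrow> f z)"
proof -
  have "f \<in> borel_measurable lebesgue" by (rule measurable_completion) (simp add: assms)
  then have "f measurable_on UNIV" by (rule lebesgue_measurable_imp_measurable_on_real) simp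
  then obtain N p where p: "negligible N" "\<And>n. continuous_on UNIV (p n)" "\<And>z. z \<notin> N \<Longrightarrow> (\<lambda>n. p n z) \<longlonglongrightarrow> f z"
    unfolding measurable_on_def by auto
  have "AE z in lebesgue. z \<notin> N" using p(1) by (simp add: negligible_iff_null_sets AE_not_in)
  then have "AE z in lborel. z \<notin> N" by (simp add: AE_completion_iff)
  then have "AE z in lborel. (\<lambda>n. p n z) \<longlonglongrightarrow> f z" by eventually_elim (rule p(3))
  then show ?thesis using p(2) by blast
qed

text \<open>Truncation at a height \<open>n\<close> comes first; almost everywhere approximants
  truncated at the same height are then uniformly bounded, and dominated convergence applies on the
  set \<open>S\<close> of finite measure.\<close>

lemma L2_continuous_approximation:
  fixes f :: "'a::euclidean_space \<Rightarrow> real"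
  assumes f: "sqint lborel f" and S: "S \<in> sets borel" "emeasure lborel S < \<infinity>" and f0: "\<And>z. z \<notin> S \<Longrightarrow> f z = 0" and e: "0 < e"
  shows "\<exists>p M. continuous_on UNIV p \<and> (\<forall>z. \<bar>p z\<bar> \<le> M) \<and> (LBINT z. (f z - indicator S z * p z)\<^sup>2) < e"
proof -
  note [measurable] = S(1)
  have fm[measurable]: "f \<in> borel_measurable borel" using sqintD(1)[OF f] by simp
  let ?T = "\<lambda>n::nat. truncate_at (real n)"
  have fi: "integrable lborel (\<lambda>z. (f z)\<^sup>2)" using sqintD(2)[OF f] by simp
  have bd: "(f z - ?T n (f z))\<^sup>2 \<le> (f z)\<^sup>2" for n z
    using truncate_at_bounds(2)[of "real n" "f z"] by (simp add: abs_le_square_iff)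
  have "(\<lambda>n. LBINT z. (f z - ?T n (f z))\<^sup>2) \<longlonglongrightarrow> integral\<^sup>L lborel (\<lambda>z::'a. 0 :: real)"
  proof (rule integral_dominated_convergence[where w = "\<lambda>z. (f z)\<^sup>2"])
    show "AE z in lborel. (\<lambda>n. (f z - ?T n (f z))\<^sup>2) \<longlonglongrightarrow> 0"
    proof (rule AE_I2, rule tendsto_eventually)
      fix z
      obtain m where m: "\<bar>f z\<bar> \<le> real m" using real_arch_simple by blast
      show "\<forall>\<^sub>F n in sequentially. (f z - ?T n (f z))\<^sup>2 = 0"
        using eventually_ge_at_top[of m] by eventually_elim (use m in \<open>simp add: truncate_at_bounds(3)\<close>)
    qed
  qed (use fi bd in auto)
  then have "\<forall>\<^sub>F n in sequentially. (LBINT z. (f z - ?T n (f z))\<^sup>2) < e / 4"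
    by (rule order_tendstoD) (use e in simp)
  then obtain n where n: "(LBINT z. (f z - ?T n (f z))\<^sup>2) < e / 4" using eventually_happens by force
  obtain q where q: "\<And>k::nat. continuous_on UNIV (q k)" "AE z in lborel. (\<lambda>k. q k z) \<longlonglongrightarrow> f z"
    using continuous_AE_approximation[OF fm] by blast
  have [measurable]: "q k \<in> borel_measurable borel" for k by (rule borel_measurable_continuous_onI[OF q(1)])
  let ?d = "\<lambda>k z. indicator S z * (?T n (f z) - ?T n (q k z))\<^sup>2"
  have wi: "integrable lborel (\<lambda>z. (2 * real n)\<^sup>2 * indicator S z)"
    by (intro integrable_mult_right integrable_real_indicator) (use S in auto)
  have db: "norm (?d k z) \<le> (2 * real n)\<^sup>2 * indicator S z" for k z
  proof (cases "z \<in> S")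
    case True
    have "\<bar>?T n (f z) - ?T n (q k z)\<bar> \<le> 2 * real n"
      using truncate_at_bounds(1)[of "real n" "f z"] truncate_at_bounds(1)[of "real n" "q k z"] by linarith
    then have "\<bar>?T n (f z) - ?T n (q k z)\<bar>\<^sup>2 \<le> (2 * real n)\<^sup>2" by (rule power_mono) simp
    then show ?thesis using True by simp
  qed simp
  have "(\<lambda>k. LBINT z. ?d k z) \<longlonglongrightarrow> integral\<^sup>L lborel (\<lambda>z::'a. 0 :: real)"
  proof (rule integral_dominated_convergence[where w = "\<lambda>z. (2 * real n)\<^sup>2 * indicator S z", OF _ _ wi])
    show "AE z in lborel. (\<lambda>k. ?d k z) \<longlonglongrightarrow> 0"
      using q(2)
    proof eventually_elim
      case (elim z)
      have "isCont (?T n) (f z)" using continuous_truncate_at[of UNIV] by (simp add: continuous_on_eq_continuous_at)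
      from isCont_tendsto_compose[OF this elim] have "(\<lambda>k. ?d k z) \<longlonglongrightarrow> indicator S z * (?T n (f z) - ?T n (f z))\<^sup>2"
        by (intro tendsto_intros)
      then show ?case by simp
    qed
    show "AE z in lborel. norm (?d k z) \<le> (2 * real n)\<^sup>2 * indicator S z" for k by (rule AE_I2) (rule db)
  qed measurable
  then have "\<forall>\<^sub>F k in sequentially. (LBINT z. ?d k z) < e / 4"
    by (intro order_tendstoD) (use e in auto)
  then obtain k where k: "(LBINT z. ?d k z) < e / 4" using eventually_happens by force
  let ?p = "\<lambda>z. ?T n (q k z)"
  have i1: "integrable lborel (\<lambda>z. (f z - ?T n (f z))\<^sup>2)"
    by (rule Bochner_Integration.integrable_bound[OF fi]) (use bd in auto)
  have i2: "integrable lborel (?d k)"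
    by (rule Bochner_Integration.integrable_bound[OF wi]) (use db in \<open>auto intro: order_trans\<close>)
  have "(LBINT z. (f z - indicator S z * ?p z)\<^sup>2) \<le> (LBINT z. 2 * (f z - ?T n (f z))\<^sup>2 + 2 * ?d k z)"
  proof (rule integral_mono_AE')
    show "integrable lborel (\<lambda>z. 2 * (f z - ?T n (f z))\<^sup>2 + 2 * ?d k z)" using i1 i2 by auto
    show "AE z in lborel. (f z - indicator S z * ?p z)\<^sup>2 \<le> 2 * (f z - ?T n (f z))\<^sup>2 + 2 * ?d k z"
    proof (rule AE_I2)
      fix z
      show "(f z - indicator S z * ?p z)\<^sup>2 \<le> 2 * (f z - ?T n (f z))\<^sup>2 + 2 * ?d k z"
      proof (cases "z \<in> S")
        case True
        then show ?thesis using norm_add_square_le[of "f z - ?T n (f z)" "?T n (f z) - ?p z"] by simp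
      next
        case False
        then show ?thesis using f0 by simp
      qed
    qed
  qed simp
  also have "\<dots> < e" using i1 i2 n k by simp
  finally have "(LBINT z. (f z - indicator S z * ?p z)\<^sup>2) < e" .
  moreover have "continuous_on UNIV ?p"
    by (rule continuous_on_compose2[OF continuous_truncate_at[of UNIV] q(1)]) simp
  moreover have "\<forall>z. \<bar>?p z\<bar> \<le> real n" by (simp add: truncate_at_bounds(1))
  ultimately show ?thesis by blast
qed

text \<open>A density argument: averaging at most doubles the squared norm because
  \<open>L n\<close> is at least 1 / 2, and for a bounded continuous function on the rectangle the
  averages converge pointwise.\<close>

lemma average_tendsto:
  assumes ab: "a < b" and c: "0 < c" and L: "\<And>n. 1 / 2 \<le> L n" "\<And>n. L n < 1" "L \<longlonglongrightarrow> 1"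
    and f: "sqint lborel f" and f0: "\<And>z. z \<notin> {a<..<b} \<times> {0<..<c} \<Longrightarrow> f z = 0"
  shows "(\<lambda>n::nat. LBINT z. (rectangle_average.average a b c (L n) f z - f z)\<^sup>2) \<longlonglongrightarrow> 0"
proof (rule order_tendstoI)
  interpret R: rectangle_average a b c "L n" for n
    by standard (use ab c L(1)[of n] L(2)[of n] in auto)
  let ?Q = "{a<..<b} \<times> {0<..<c}"
  have Qm[measurable]: "?Q \<in> sets borel" by (rule borel_open[OF open_rectangle])
  have Qfin: "emeasure lborel ?Q < \<infinity>" by (rule emeasure_rectangle)
  fix e :: real
  show "\<forall>\<^sub>F n in sequentially. e < (LBINT z. (R.average n f z - f z)\<^sup>2)" if "e < 0"
  proof (intro always_eventually allI)
    fix n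
    have "0 \<le> (LBINT z. (R.average n f z - f z)\<^sup>2)" by (rule Bochner_Integration.integral_nonneg) simp
    then show "e < (LBINT z. (R.average n f z - f z)\<^sup>2)" using that by linarith
  qed
  assume e: "0 < e"
  \<comment> \<open>The remainder enters with weight 4 for itself and 4 times 2 for its average, in
    total half of \<open>e\<close>; the other half comes from the continuous part.\<close>
  obtain p M where p: "continuous_on UNIV p" "\<And>z. \<bar>p z\<bar> \<le> M" "(LBINT z. (f z - indicator ?Q z * p z)\<^sup>2) < e / 24"
    using L2_continuous_approximation[OF f Qm Qfin f0, of "e / 24"] e by auto
  define q where "q z = indicator ?Q z * p z" for z
  have [measurable]: "p \<in> borel_measurable borel" by (rule borel_measurable_continuous_onI[OF p(1)])
  have qm[measurable]: "q \<in> borel_measurable borel" unfolding q_def[abs_def] by measurable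
  have M: "0 \<le> M" using p(2)[of 0] by linarith
  have qb: "\<bar>q z\<bar> \<le> M * indicator ?Q z" for z using p(2)[of z] by (auto simp: q_def indicator_def)
  have qM: "\<bar>q z\<bar> \<le> M" for z using p(2)[of z] M by (auto simp: q_def indicator_def)
  have iQ: "integrable lborel (\<lambda>z. K * indicator ?Q z)" for K :: real
    by (intro integrable_mult_right integrable_real_indicator) (use Qfin in auto)
  have qs: "sqint lborel q"
  proof (rule sqint_bound[OF _ iQ[of "M\<^sup>2"]])
    fix z
    have "\<bar>q z\<bar>\<^sup>2 \<le> (M * indicator ?Q z)\<^sup>2" by (rule power_mono[OF qb]) simp
    then show "(norm (q z))\<^sup>2 \<le> M\<^sup>2 * indicator ?Q z" by (auto simp: indicator_def split: if_splits)
  qed simp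
  have rs: "sqint lborel (\<lambda>z. f z - q z)" by (rule sqint_diff[OF f qs])
  have lim: "(\<lambda>n. LBINT z. (R.average n q z - q z)\<^sup>2) \<longlonglongrightarrow> integral\<^sup>L lborel (\<lambda>z::real \<times> real. 0 :: real)"
  proof (rule integral_dominated_convergence[where w = "\<lambda>z. (2 * M)\<^sup>2 * indicator ?Q z", OF _ _ iQ])
    show "(\<lambda>z. (R.average n q z - q z)\<^sup>2) \<in> borel_measurable lborel" for n
      using R.average_measurable[OF qm, of n] by simp
    have iJ: "integrable lborel (\<lambda>\<xi>. K * indicator {a<..<b} \<xi>)" for K :: real
      by (intro integrable_mult_right integrable_real_indicator) (use ab in auto)
    have qsb: "norm (indicator {a<..<b} \<xi> * q (R.shift n \<xi> z)) \<le> M * indicator {a<..<b} \<xi>" for n \<xi> z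
      using qM[of "R.shift n \<xi> z"] by (auto simp: indicator_def)
    have qsm: "(\<lambda>\<xi>. indicator {a<..<b} \<xi> * q (R.shift n \<xi> z)) \<in> borel_measurable lborel" for n z
      using R.shift_square_measurable(3)[OF qm, of n z] by simp
    show "AE z in lborel. norm ((R.average n q z - q z)\<^sup>2) \<le> (2 * M)\<^sup>2 * indicator ?Q z" for n
    proof (rule AE_I2)
      fix z
      show "norm ((R.average n q z - q z)\<^sup>2) \<le> (2 * M)\<^sup>2 * indicator ?Q z"
      proof (cases "z \<in> ?Q")
        case True
        have "norm (LBINT \<xi>. indicator {a<..<b} \<xi> * q (R.shift n \<xi> z)) \<le> (LBINT \<xi>. M * indicator {a<..<b} \<xi>)"
          by (rule Bochner_Integration.integral_norm_bound_integral[OF _ iJ])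
            (use Bochner_Integration.integrable_bound[OF iJ[of M] qsm] qsb M in \<open>auto\<close>)
        then have "\<bar>LBINT \<xi>. indicator {a<..<b} \<xi> * q (R.shift n \<xi> z)\<bar> \<le> M * (b - a)" using ab by simp
        then have "\<bar>R.average n q z\<bar> \<le> M" using True ab by (simp add: R.average_def pos_divide_le_eq)
        moreover have "\<bar>q z\<bar> \<le> M" using qb[of z] True by simp
        ultimately have "\<bar>R.average n q z - q z\<bar> \<le> 2 * M" by linarith
        then have "\<bar>R.average n q z - q z\<bar>\<^sup>2 \<le> (2 * M)\<^sup>2" by (rule power_mono) simp
        then show ?thesis using True by simp
      next
        case False
        then have "R.average n q z = 0" "q z = 0" by (simp_all add: R.average_def q_def)
        then show ?thesis by simp
      qed
    qed
    show "AE z in lborel. (\<lambda>n. (R.average n q z - q z)\<^sup>2) \<longlonglongrightarrow> 0"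
    proof (rule AE_I2)
      fix z
      show "(\<lambda>n. (R.average n q z - q z)\<^sup>2) \<longlonglongrightarrow> 0"
      proof (cases "z \<in> ?Q")
        case True
        have "(\<lambda>n. LBINT \<xi>. indicator {a<..<b} \<xi> * q (R.shift n \<xi> z)) \<longlonglongrightarrow> (LBINT \<xi>. indicator {a<..<b} \<xi> * p z)"
        proof (rule integral_dominated_convergence[OF _ qsm iJ[of M]])
          show "AE \<xi> in lborel. (\<lambda>n. indicator {a<..<b} \<xi> * q (R.shift n \<xi> z)) \<longlonglongrightarrow> indicator {a<..<b} \<xi> * p z"
          proof (rule AE_I2)
            fix \<xi> :: real
            show "(\<lambda>n. indicator {a<..<b} \<xi> * q (R.shift n \<xi> z)) \<longlonglongrightarrow> indicator {a<..<b} \<xi> * p z"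
            proof (cases "\<xi> \<in> {a<..<b}")
              case x: True
              have "(\<lambda>n. R.shift n \<xi> z) \<longlonglongrightarrow> ((1 - 1) * \<xi> + 1 * fst z, 0 + 1 * snd z)"
                unfolding dilate_def fst_conv snd_conv by (intro tendsto_intros L(3))
              then have lz: "(\<lambda>n. R.shift n \<xi> z) \<longlonglongrightarrow> z" by simp
              have "isCont p z" using p(1) continuous_on_eq_continuous_at[OF open_UNIV, of p] by blast
              from isCont_tendsto_compose[OF this lz] have "(\<lambda>n. p (R.shift n \<xi> z)) \<longlonglongrightarrow> p z" .
              \<comment> \<open>Contracted points stay in the rectangle, where \<open>q\<close>
                agrees with the continuous \<open>p\<close>.\<close>
              then show ?thesis using x R.shift_in_Q[OF x True] by (simp add: q_def)
            qed simp
          qed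
          show "AE \<xi> in lborel. norm (indicator {a<..<b} \<xi> * q (R.shift n \<xi> z)) \<le> M * indicator {a<..<b} \<xi>" for n
            by (rule AE_I2) (rule qsb)
        qed simp
        then have "(\<lambda>n. (LBINT \<xi>. indicator {a<..<b} \<xi> * q (R.shift n \<xi> z)) / (b - a)) \<longlonglongrightarrow> (LBINT \<xi>. indicator {a<..<b} \<xi> * p z) / (b - a)"
          by (rule tendsto_divide[OF _ tendsto_const]) (use ab in simp)
        then have "(\<lambda>n. R.average n q z) \<longlonglongrightarrow> q z" using True ab by (simp add: R.average_def q_def)
        from tendsto_power[OF tendsto_diff[OF this tendsto_const[of "q z"]], of 2] show ?thesis by simp
      next
        case False
        then show ?thesis by (simp add: R.average_def q_def)
      qed
    qed
  qed simp
  then have ev: "\<forall>\<^sub>F n in sequentially. (LBINT z. (R.average n q z - q z)\<^sup>2) < e / 4"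
    by (intro order_tendstoD) (use e in auto)
  have main: "(LBINT z. (R.average n f z - f z)\<^sup>2) < e" if n: "(LBINT z. (R.average n q z - q z)\<^sup>2) < e / 4" for n
  proof -
    let ?r = "\<lambda>z. f z - q z"
    have a1: "(LBINT z. (R.average n ?r z)\<^sup>2) \<le> 2 * (LBINT z. (?r z)\<^sup>2)"
    proof -
      have "(LBINT z. (R.average n ?r z)\<^sup>2) \<le> (LBINT z. (?r z)\<^sup>2) / L n" by (rule R.sqint_average(2)[OF rs])
      also have "\<dots> \<le> (LBINT z. (?r z)\<^sup>2) / (1 / 2)"
        by (rule divide_left_mono) (use L(1)[of n] in \<open>auto intro!: Bochner_Integration.integral_nonneg mult_pos_pos\<close>)
      finally show ?thesis by simp
    qed
    have i: "integrable lborel (\<lambda>z. (R.average n ?r z)\<^sup>2)" "integrable lborel (\<lambda>z. (?r z)\<^sup>2)"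
      "integrable lborel (\<lambda>z. (R.average n q z - q z)\<^sup>2)"
      using sqintD(2)[OF R.sqint_average(1)[OF rs, of n]] sqintD(2)[OF rs]
        sqintD(2)[OF sqint_diff[OF R.sqint_average(1)[OF qs, of n] qs]] by auto
    have "(LBINT z. (R.average n f z - f z)\<^sup>2) \<le>
        (LBINT z. 4 * (R.average n ?r z)\<^sup>2 + 4 * (?r z)\<^sup>2 + 2 * (R.average n q z - q z)\<^sup>2)"
    proof (rule integral_mono_AE')
      show "integrable lborel (\<lambda>z. 4 * (R.average n ?r z)\<^sup>2 + 4 * (?r z)\<^sup>2 + 2 * (R.average n q z - q z)\<^sup>2)"
        using i by auto
      show "AE z in lborel. (R.average n f z - f z)\<^sup>2 \<le>
          4 * (R.average n ?r z)\<^sup>2 + 4 * (?r z)\<^sup>2 + 2 * (R.average n q z - q z)\<^sup>2"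
        using R.average_add[OF rs qs, of n]
      proof eventually_elim
        case (elim z)
        then have eq: "R.average n f z - f z = (R.average n ?r z - ?r z) + (R.average n q z - q z)" by simp
        have "(R.average n f z - f z)\<^sup>2 \<le> 2 * (R.average n ?r z - ?r z)\<^sup>2 + 2 * (R.average n q z - q z)\<^sup>2"
          unfolding eq using norm_add_square_le[of "R.average n ?r z - ?r z" "R.average n q z - q z"] by simp
        moreover have "(R.average n ?r z - ?r z)\<^sup>2 \<le> 2 * (R.average n ?r z)\<^sup>2 + 2 * (?r z)\<^sup>2"
          using norm_diff_square_le[of "R.average n ?r z" "?r z"] by simp
        ultimately show ?case by linarith
      qed
    qed simp
    also have "\<dots> = 4 * (LBINT z. (R.average n ?r z)\<^sup>2) + 4 * (LBINT z. (?r z)\<^sup>2) + 2 * (LBINT z. (R.average n q z - q z)\<^sup>2)"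
      using i by simp
    also have "\<dots> < e" using a1 n p(3) by (simp add: q_def)
    finally show ?thesis .
  qed
  from ev show "\<forall>\<^sub>F n in sequentially. (LBINT z. (R.average n f z - f z)\<^sup>2) < e"
    by eventually_elim (rule main)
qed

section \<open>Integrals over moving rectangles\<close>

lemma eventually_less_eq:
  fixes X :: "nat \<Rightarrow> real"
  assumes X: "X \<longlonglongrightarrow> x" and n: "x \<noteq> y"
  shows "\<forall>\<^sub>F n in sequentially. (X n < y) = (x < y)" "\<forall>\<^sub>F n in sequentially. (y < X n) = (y < x)"
proof -
  consider "x < y" | "y < x" using n by linarith
  then have "(\<forall>\<^sub>F n in sequentially. (X n < y) = (x < y)) \<and> (\<forall>\<^sub>F n in sequentially. (y < X n) = (y < x))"
  proof cases
    case 1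
    have "\<forall>\<^sub>F n in sequentially. X n < y" by (rule order_tendstoD(2)[OF X 1])
    then show ?thesis using 1 by (auto elim: eventually_mono)
  next
    case 2
    have "\<forall>\<^sub>F n in sequentially. y < X n" by (rule order_tendstoD(1)[OF X 2])
    then show ?thesis using 2 by (auto elim: eventually_mono)
  qed
  then show "\<forall>\<^sub>F n in sequentially. (X n < y) = (x < y)" "\<forall>\<^sub>F n in sequentially. (y < X n) = (y < x)" by auto
qed

lemma AE_coordinate_neq:
  "AE z in (lborel :: (real \<times> real) measure). fst z \<noteq> c" "AE z in (lborel :: (real \<times> real) measure). snd z \<noteq> c"
proof -
  have "negligible {z :: real \<times> real. z \<bullet> k = c}" if "k \<in> Basis" for k using negligible_standard_hyperplane[OF that] .
  then have *: "AE z in lborel. (z :: real \<times> real) \<bullet> k \<noteq> c" if "k \<in> Basis" for k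
  proof -
    have "AE z in lebesgue. (z :: real \<times> real) \<notin> {z. z \<bullet> k = c}"
      by (rule AE_not_in) (use negligible_standard_hyperplane[OF that, of c] in \<open>simp only: negligible_iff_null_sets\<close>)
    then have "AE z in lborel. (z :: real \<times> real) \<notin> {z. z \<bullet> k = c}" by (simp only: AE_completion_iff)
    then show ?thesis by simp
  qed
  have B: "(1, 0) \<in> (Basis :: (real \<times> real) set)" "(0, 1) \<in> (Basis :: (real \<times> real) set)" by (auto simp: Basis_prod_def)
  show "AE z in (lborel :: (real \<times> real) measure). fst z \<noteq> c" using *[OF B(1)] by (simp add: inner_prod_def)
  show "AE z in (lborel :: (real \<times> real) measure). snd z \<noteq> c" using *[OF B(2)] by (simp add: inner_prod_def)
qed

text \<open>Off the lines through three edges of the limiting rectangle, a null set, the indicators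
  are eventually constant along a convergent sequence. The bottom edge does not move.\<close>

lemma continuous_rectangle_integral:
  fixes k :: "real \<times> real \<Rightarrow> real" and p q y :: "'a::metric_space \<Rightarrow> real"
  assumes k: "integrable lborel k" and c: "continuous_on S p" "continuous_on S q" "continuous_on S y"
  shows "continuous_on S (\<lambda>z. LBINT \<zeta>. indicator ({p z<..<q z} \<times> {0<..<y z}) \<zeta> * k \<zeta>)"
  unfolding continuous_on_sequentially comp_def
proof (intro allI ballI impI)
  fix X z assume z: "z \<in> S" and A: "(\<forall>n. X n \<in> S) \<and> X \<longlonglongrightarrow> z"
  note [measurable] = borel_measurable_integrable[OF k, simplified]
  have lim: "(\<lambda>n. p (X n)) \<longlonglongrightarrow> p z" "(\<lambda>n. q (X n)) \<longlonglongrightarrow> q z" "(\<lambda>n. y (X n)) \<longlonglongrightarrow> y z"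
    using c z A unfolding continuous_on_sequentially comp_def by blast+
  have [measurable]: "{p w<..<q w} \<times> {0<..<y w} \<in> sets borel" for w by (rule borel_open[OF open_rectangle])
  show "(\<lambda>n. LBINT \<zeta>. indicator ({p (X n)<..<q (X n)} \<times> {0<..<y (X n)}) \<zeta> * k \<zeta>) \<longlonglongrightarrow>
    (LBINT \<zeta>. indicator ({p z<..<q z} \<times> {0<..<y z}) \<zeta> * k \<zeta>)"
  proof (rule integral_dominated_convergence[where w = "\<lambda>\<zeta>. norm (k \<zeta>)"])
    show "integrable lborel (\<lambda>\<zeta>. norm (k \<zeta>))" using k by simp
    show "AE \<zeta> in lborel. (\<lambda>n. indicator ({p (X n)<..<q (X n)} \<times> {0<..<y (X n)}) \<zeta> * k \<zeta>) \<longlonglongrightarrow>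
        indicator ({p z<..<q z} \<times> {0<..<y z}) \<zeta> * k \<zeta>"
      using AE_coordinate_neq(1)[of "p z"] AE_coordinate_neq(1)[of "q z"] AE_coordinate_neq(2)[of "y z"]
    proof eventually_elim
      case (elim \<zeta>)
      have "\<forall>\<^sub>F n in sequentially. indicator ({p (X n)<..<q (X n)} \<times> {0<..<y (X n)}) \<zeta> * k \<zeta> =
          indicator ({p z<..<q z} \<times> {0<..<y z}) \<zeta> * k \<zeta>"
        using eventually_less_eq(1)[OF lim(1) elim(1)[symmetric]] eventually_less_eq(2)[OF lim(2) elim(2)[symmetric]]
          eventually_less_eq(2)[OF lim(3) elim(3)[symmetric]]
        by eventually_elim (simp add: indicator_def mem_Times_iff)
      then show ?case by (rule tendsto_eventually)
    qed
    show "AE \<zeta> in lborel. norm (indicator ({p (X n)<..<q (X n)} \<times> {0<..<y (X n)}) \<zeta> * k \<zeta>) \<le> norm (k \<zeta>)" for n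
      by (rule AE_I2) (simp add: indicator_def)
  qed measurable
qed

text \<open>Integrating a column first gives the primitive at the upper edge, so a horizontal mean
  of primitives is an area integral.\<close>

lemma rectangle_integral_vprim:
  fixes k :: "real \<times> real \<Rightarrow> real"
  assumes k: "integrable lborel k"
  shows "integrable lborel (\<lambda>x. indicator {p<..<q} x * vprim k (x, y))"
    "(LBINT \<zeta>. indicator ({p<..<q} \<times> {0<..<y}) \<zeta> * k \<zeta>) = (LBINT x. indicator {p<..<q} x * vprim k (x, y))"
proof -
  have m: "{p<..<q} \<times> {0<..<y} \<in> sets borel" by (rule borel_open[OF open_rectangle])
  have i: "integrable (lborel \<Otimes>\<^sub>M lborel) (\<lambda>\<zeta>. indicator ({p<..<q} \<times> {0<..<y}) \<zeta> * k \<zeta>)"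
    using integrable_mult_indicator[of "{p<..<q} \<times> {0<..<y}" lborel k] m k by (simp add: lborel_prod)
  have e: "(LBINT s. indicator ({p<..<q} \<times> {0<..<y}) (x, s) * k (x, s)) = indicator {p<..<q} x * vprim k (x, y)" for x
    unfolding vprim_def fst_conv snd_conv integral_mult_right_zero[symmetric]
    by (rule Bochner_Integration.integral_cong) (auto simp: indicator_def)
  show "integrable lborel (\<lambda>x. indicator {p<..<q} x * vprim k (x, y))"
    using lborel_pair.integrable_fst'[OF i] by (simp only: e)
  show "(LBINT \<zeta>. indicator ({p<..<q} \<times> {0<..<y}) \<zeta> * k \<zeta>) = (LBINT x. indicator {p<..<q} x * vprim k (x, y))"
    using lborel_pair.integral_fst'[OF i] by (simp only: e lborel_prod)
qed

lemma integral_affine_interval: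
  assumes "a < (b :: real)"
  shows "has_bochner_integral lborel (\<lambda>x. indicator {a<..<b} x * (m * x + r)) ((b - a) * (m * (a + b) / 2 + r))"
proof -
  have "has_bochner_integral lborel (\<lambda>x. (m * x + r) * indicator {a..b} x) ((m * b\<^sup>2 / 2 + r * b) - (m * a\<^sup>2 / 2 + r * a))"
    by (rule has_bochner_integral_FTC_Icc_real) (use assms in \<open>auto intro!: derivative_eq_intros\<close>)
  moreover have "(m * b\<^sup>2 / 2 + r * b) - (m * a\<^sup>2 / 2 + r * a) = (b - a) * (m * (a + b) / 2 + r)"
    by (simp add: power2_eq_square field_simps)
  ultimately have "has_bochner_integral lborel (\<lambda>x. (m * x + r) * indicator {a..b} x) ((b - a) * (m * (a + b) / 2 + r))" by simp
  then show ?thesis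
  proof (rule has_bochner_integralI_AE)
    show "AE x in lborel. (m * x + r) * indicator {a..b} x = indicator {a<..<b} x * (m * x + r)"
      using AE_lborel_singleton[of a] AE_lborel_singleton[of b]
      by eventually_elim (auto simp: indicator_def)
  qed auto
qed

context rectangle_average
begin

text \<open>By a change of variables, the average of \<open>fst z + vprim g z\<close> is an affine function plus an area
  integral of \<open>g\<close>; this form is continuous up to the boundary.\<close>

definition lift :: "(real \<times> real \<Rightarrow> real) \<Rightarrow> real \<times> real \<Rightarrow> real" where
  "lift g z = (1 - l) * (a + b) / 2 + l * fst z +
    (LBINT \<zeta>. indicator ({(1 - l) * a + l * fst z<..<(1 - l) * b + l * fst z} \<times> {0<..<snd z}) \<zeta> * g \<zeta>) / ((b - a) * (1 - l))"

lemma continuous_lift: "integrable lborel g \<Longrightarrow> continuous_on S (lift g)"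
  unfolding lift_def[abs_def]
  by (intro continuous_intros continuous_rectangle_integral) (use ab l in auto)

lemma average_eq_lift:
  assumes g: "integrable lborel g" and z: "z \<in> Q"
  shows "average (\<lambda>z. indicator Q z * (fst z + vprim g z)) z = lift g z"
proof -
  let ?A = "(1 - l) * a + l * fst z" and ?B = "(1 - l) * b + l * fst z"
  let ?J = "LBINT \<zeta>. indicator ({?A<..<?B} \<times> {0<..<snd z}) \<zeta> * g \<zeta>"
  let ?F = "\<lambda>x. indicator {?A<..<?B} x * vprim g (x, snd z)"
  let ?t = "\<lambda>\<xi>. (1 - l) * \<xi> + l * fst z"
  \<comment> \<open>The abscissa of the contracted point, as a function of \<open>\<xi>\<close>,
    maps \<open>(a, b)\<close> affinely onto the interval from \<open>?A\<close> to
    \<open>?B\<close>.\<close>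
  have Ft: "?F (l * fst z + (1 - l) * \<xi>) = indicator {a<..<b} \<xi> * vprim g (shift \<xi> z)" for \<xi>
    using l by (simp add: indicator_def dilate_def add.commute)
  have Fi: "integrable lborel (\<lambda>\<xi>. indicator {a<..<b} \<xi> * vprim g (shift \<xi> z))"
    using lborel_integrable_real_affine[OF rectangle_integral_vprim(1)[OF g, of ?A ?B "snd z"], of "1 - l" "l * fst z"] l
    unfolding Ft by simp
  have "?J = \<bar>1 - l\<bar> *\<^sub>R (LBINT \<xi>. ?F (l * fst z + (1 - l) * \<xi>))"
    unfolding rectangle_integral_vprim(2)[OF g] by (rule lborel_integral_real_affine) (use l in simp)
  then have J: "?J = (1 - l) * (LBINT \<xi>. indicator {a<..<b} \<xi> * vprim g (shift \<xi> z))"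
    unfolding Ft using l by simp
  note lin = integral_affine_interval[OF ab, of "1 - l" "l * fst z"]
  have "(LBINT \<xi>. indicator {a<..<b} \<xi> * (indicator Q (shift \<xi> z) * (fst (shift \<xi> z) + vprim g (shift \<xi> z)))) =
      (LBINT \<xi>. indicator {a<..<b} \<xi> * ((1 - l) * \<xi> + l * fst z) + indicator {a<..<b} \<xi> * vprim g (shift \<xi> z))"
  proof (rule Bochner_Integration.integral_cong[OF refl])
    fix \<xi> :: real
    have "fst (shift \<xi> z) = (1 - l) * \<xi> + l * fst z" by (simp add: dilate_def)
    moreover have "shift \<xi> z \<in> Q" if "\<xi> \<in> {a<..<b}" using shift_in_Q[OF that z] .
    ultimately show "indicator {a<..<b} \<xi> * (indicator Q (shift \<xi> z) * (fst (shift \<xi> z) + vprim g (shift \<xi> z))) =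
        indicator {a<..<b} \<xi> * ((1 - l) * \<xi> + l * fst z) + indicator {a<..<b} \<xi> * vprim g (shift \<xi> z)"
      by (cases "\<xi> \<in> {a<..<b}") (auto simp: distrib_left)
  qed
  also have "\<dots> = (b - a) * ((1 - l) * (a + b) / 2 + l * fst z) + ?J / (1 - l)"
    using lin Fi l by (simp add: has_bochner_integral_iff J)
  finally have "average (\<lambda>z. indicator Q z * (fst z + vprim g z)) z =
      ((b - a) * ((1 - l) * (a + b) / 2 + l * fst z) + ?J / (1 - l)) / (b - a)"
    using z by (simp add: average_def)
  also have "\<dots> = lift g z" using ab l by (simp add: lift_def add_divide_distrib mult.commute)
  finally show ?thesis .
qed

end

subsection \<open>Admissibility of the minimizer\<close>

text \<open>Averages with ratio tending to 1 approximate \<open>u\<close> in H^1 and extend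
  continuously to the closed rectangle. On the bottom edge they are affine functions tending to x,
  so the trace is read off directly.\<close>

lemma has_bottom_trace_identity:
  assumes ab: "a < b" and c: "0 < c" and Q: "Q = {a<..<b} \<times> {0<..<c}"
    and u: "\<And>z. z \<in> Q \<Longrightarrow> u z = fst z + vprim g z"
    and w: "wgrad Q (\<lambda>z. indicator Q z *\<^sub>R u z) (\<lambda>z. (G z, g z))"
    and G0: "\<And>z. z \<notin> Q \<Longrightarrow> G z = 0" and g0: "\<And>z. z \<notin> Q \<Longrightarrow> g z = 0"
  shows "has_bottom_trace a b c u (\<lambda>x. x)"
proof -
  \<comment> \<open>The ratios start at 1 / 2, the uniform lower bound that
    \<open>average_tendsto\<close> asks for.\<close>
  define L where "L n = 1 - 1 / (real n + 2)" for n
  have L: "1 / 2 \<le> L n" "L n < 1" for n by (auto simp: L_def field_simps)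
  have L1: "L \<longlonglongrightarrow> 1" unfolding L_def by real_asymp
  interpret R: rectangle_average a b c "L n" for n
    by standard (use ab c L(1)[of n] L(2)[of n] in auto)
  let ?v = "\<lambda>z. indicator Q z *\<^sub>R u z"
  have Qm[measurable]: "Q \<in> sets borel" unfolding Q by (rule borel_open[OF open_rectangle])
  have Qo: "open Q" unfolding Q by (rule open_rectangle)
  have Qfin: "emeasure lborel Q < \<infinity>" unfolding Q by (rule emeasure_rectangle)
  have v: "sqint lborel ?v" by (rule wgradD(1)[OF w])
  have Gs: "sqint lborel G" and gs: "sqint lborel g" using sqint_components[OF wgradD(2)[OF w]] by auto
  have "indicator Q z * g z = g z" for z using g0[of z] by (auto simp: indicator_def)
  then have gi: "integrable lborel g" using integrable_rectangle[OF gs Qm Qfin] by (simp only:)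
  have v_eq: "?v = (\<lambda>z. indicator Q z * (fst z + vprim g z))" using u by (auto simp: indicator_def fun_eq_iff)
  define W where "W n = R.lift n g" for n
  define H where "H n z = (L n * R.average n G z, R.average n g z)" for n z
  have avg: "indicator Q z *\<^sub>R W n z = R.average n ?v z" for n z
  proof (cases "z \<in> Q")
    case True
    then show ?thesis using R.average_eq_lift[OF gi, of z n] unfolding v_eq W_def by (simp add: Q)
  next
    case False
    then show ?thesis by (simp add: R.average_def Q)
  qed
  have wW: "wgrad Q (\<lambda>z. indicator Q z *\<^sub>R W n z) (H n)" for n
    unfolding avg H_def using R.wgrad_average[of ?v G g n] w by (simp only: Q)
  have H0: "H n z = 0" if "z \<notin> Q" for n z using that by (simp add: H_def R.average_def Q zero_prod_def)
  have H1u: "H1 Q u" by (rule H1I(1)[OF w]) (simp add: G0 g0 zero_prod_def)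
  have H1W: "H1 Q (W n)" for n by (rule H1I(1)[OF wW H0])
  let ?a = "\<lambda>n. LBINT z. (R.average n ?v z - ?v z)\<^sup>2" and ?b = "\<lambda>n. LBINT z. (R.average n G z - G z)\<^sup>2"
    and ?c = "\<lambda>n. LBINT z. (R.average n g z - g z)\<^sup>2"
  have norm_le: "H1_norm Q (\<lambda>z. W n z - u z) \<le> sqrt (?a n + (2 * ?b n + 2 * (1 - L n)\<^sup>2 * (LBINT z. (G z)\<^sup>2) + ?c n))"
    and norm_ge: "0 \<le> H1_norm Q (\<lambda>z. W n z - u z)" for n
  proof -
    let ?d = "\<lambda>z. W n z - u z" and ?K = "\<lambda>z. H n z + (-1) *\<^sub>R (G z, g z)"
    have eq: "indicator Q z *\<^sub>R W n z + (-1) * (indicator Q z *\<^sub>R u z) = indicator Q z *\<^sub>R ?d z" for z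
      by (simp add: algebra_simps)
    have wd: "wgrad Q (\<lambda>z. indicator Q z *\<^sub>R ?d z) ?K"
      using wgrad_lin[OF wW w, of n "-1"] unfolding eq .
    have K0: "?K z = 0" if "z \<notin> Q" for z using H0[OF that] G0[OF that] g0[OF that] by (simp add: zero_prod_def)
    note h = H1_wgrad[OF H1I(1)[OF wd K0]]
    \<comment> \<open>\<open>H1_norm\<close> uses a chosen weak gradient; uniqueness replaces it by
      the explicit difference of fields.\<close>
    have "AE z in lborel. z \<in> Q \<longrightarrow> indicator Q z *\<^sub>R weak_gradient Q ?d z = ?K z"
      by (rule wgrad_unique[OF Qo h(2) wd])
    then have AE: "AE z in lborel. indicator Q z *\<^sub>R weak_gradient Q ?d z = ?K z"
      by eventually_elim (use K0 in \<open>auto simp: indicator_def\<close>)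
    have grad: "(LINT z:Q|lborel. (norm (weak_gradient Q ?d z))\<^sup>2) = (LBINT z. (norm (?K z))\<^sup>2)"
      unfolding set_integral_norm_square
    proof (rule integral_cong_AE)
      show "AE z in lborel. (norm (indicator Q z *\<^sub>R weak_gradient Q ?d z))\<^sup>2 = (norm (?K z))\<^sup>2"
        using AE by eventually_elim simp
    qed (use sqintD[OF wgradD(2)[OF h(2)]] sqintD[OF wgradD(2)[OF wd]] in auto)
    have val: "(LINT z:Q|lborel. (?d z)\<^sup>2) = ?a n"
    proof -
      have "(LINT z:Q|lborel. (?d z)\<^sup>2) = (LBINT z. (norm (indicator Q z *\<^sub>R ?d z))\<^sup>2)"
        using set_integral_norm_square[of Q ?d] by simp
      also have "\<dots> = ?a n" unfolding eq[symmetric] avg by simp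
      finally show ?thesis .
    qed
    have i: "integrable lborel (\<lambda>z. (R.average n G z - G z)\<^sup>2)" "integrable lborel (\<lambda>z. (R.average n g z - g z)\<^sup>2)"
      "integrable lborel (\<lambda>z. (G z)\<^sup>2)"
      using sqintD(2)[OF sqint_diff[OF R.sqint_average(1)[OF Gs, of n] Gs]]
        sqintD(2)[OF sqint_diff[OF R.sqint_average(1)[OF gs, of n] gs]] sqintD(2)[OF Gs] by auto
    have "(LBINT z. (norm (?K z))\<^sup>2) \<le> (LBINT z. 2 * (R.average n G z - G z)\<^sup>2 + 2 * (1 - L n)\<^sup>2 * (G z)\<^sup>2 + (R.average n g z - g z)\<^sup>2)"
    proof (rule integral_mono)
      show "integrable lborel (\<lambda>z. (norm (?K z))\<^sup>2)" using sqintD(2)[OF wgradD(2)[OF wd]] .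
      show "integrable lborel (\<lambda>z. 2 * (R.average n G z - G z)\<^sup>2 + 2 * (1 - L n)\<^sup>2 * (G z)\<^sup>2 + (R.average n g z - g z)\<^sup>2)"
        using i by auto
      fix z
      let ?A = "R.average n G z"
      have "(norm (?K z))\<^sup>2 = (L n * ?A - G z)\<^sup>2 + (R.average n g z - g z)\<^sup>2" by (simp add: H_def norm_Pair)
      moreover have "(L n * ?A - G z)\<^sup>2 \<le> 2 * (?A - G z)\<^sup>2 + 2 * (1 - L n)\<^sup>2 * (G z)\<^sup>2"
      proof -
        have "(L n * (?A - G z))\<^sup>2 \<le> (?A - G z)\<^sup>2"
        proof -
          have "\<bar>L n * (?A - G z)\<bar> \<le> 1 * \<bar>?A - G z\<bar>" unfolding abs_mult by (rule mult_right_mono) (use L(1)[of n] L(2)[of n] in auto)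
          then show ?thesis by (simp add: abs_le_square_iff)
        qed
        \<comment> \<open>The factor \<open>L n\<close> in the horizontal derivative is separated
          from the averaging error; its own contribution vanishes as \<open>L n\<close> tends to
          1.\<close>
        moreover have "L n * ?A - G z = L n * (?A - G z) + (- ((1 - L n) * G z))" by (simp add: algebra_simps)
        moreover have "(L n * (?A - G z) + (- ((1 - L n) * G z)))\<^sup>2 \<le> 2 * (L n * (?A - G z))\<^sup>2 + 2 * ((1 - L n) * G z)\<^sup>2"
          using norm_add_square_le[of "L n * (?A - G z)" "- ((1 - L n) * G z)"] by simp
        ultimately show ?thesis by (simp add: power_mult_distrib)
      qed
      ultimately show "(norm (?K z))\<^sup>2 \<le> 2 * (?A - G z)\<^sup>2 + 2 * (1 - L n)\<^sup>2 * (G z)\<^sup>2 + (R.average n g z - g z)\<^sup>2" by linarith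
    qed
    also have "\<dots> = 2 * ?b n + 2 * (1 - L n)\<^sup>2 * (LBINT z. (G z)\<^sup>2) + ?c n" using i by simp
    finally show "H1_norm Q ?d \<le> sqrt (?a n + (2 * ?b n + 2 * (1 - L n)\<^sup>2 * (LBINT z. (G z)\<^sup>2) + ?c n))"
      unfolding H1_norm_def grad val by simp
    show "0 \<le> H1_norm Q ?d" unfolding H1_norm_def grad val
      by (intro real_sqrt_ge_zero add_nonneg_nonneg Bochner_Integration.integral_nonneg) auto
  qed
  have lims: "?a \<longlonglongrightarrow> 0" "?b \<longlonglongrightarrow> 0" "?c \<longlonglongrightarrow> 0"
    using average_tendsto[OF ab c L L1 v] average_tendsto[OF ab c L L1 Gs] average_tendsto[OF ab c L L1 gs] G0 g0
    unfolding Q by auto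
  have "(\<lambda>n. sqrt (?a n + (2 * ?b n + 2 * (1 - L n)\<^sup>2 * (LBINT z. (G z)\<^sup>2) + ?c n))) \<longlonglongrightarrow>
      sqrt (0 + (2 * 0 + 2 * (1 - 1)\<^sup>2 * (LBINT z. (G z)\<^sup>2) + 0))"
    by (intro tendsto_intros lims L1)
  then have sq: "(\<lambda>n. sqrt (?a n + (2 * ?b n + 2 * (1 - L n)\<^sup>2 * (LBINT z. (G z)\<^sup>2) + ?c n))) \<longlonglongrightarrow> 0" by simp
  have conv: "(\<lambda>n. H1_norm Q (\<lambda>z. W n z - u z)) \<longlonglongrightarrow> 0"
    by (rule tendsto_sandwich[OF _ _ tendsto_const sq]) (use norm_le norm_ge in auto)
  \<comment> \<open>On the edge the area integral in \<open>lift\<close> is empty.\<close>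
  have "(LINT x:{a<..<b}|lborel. (W n (x, 0) - x)\<^sup>2) = (1 - L n)\<^sup>2 * (LINT x:{a<..<b}|lborel. ((a + b) / 2 - x)\<^sup>2)" for n
  proof -
    have "W n (x, 0) - x = (1 - L n) * ((a + b) / 2 - x)" for x by (simp add: W_def R.lift_def field_simps)
    then show ?thesis by (simp add: power_mult_distrib)
  qed
  moreover have "(\<lambda>n. (1 - L n)\<^sup>2 * (LINT x:{a<..<b}|lborel. ((a + b) / 2 - x)\<^sup>2)) \<longlonglongrightarrow> (1 - 1)\<^sup>2 * (LINT x:{a<..<b}|lborel. ((a + b) / 2 - x)\<^sup>2)"
    by (intro tendsto_intros L1)
  ultimately have tr: "(\<lambda>n. LINT x:{a<..<b}|lborel. (W n (x, 0) - x)\<^sup>2) \<longlonglongrightarrow> 0" by simp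
  have "L2 {a<..<b} (\<lambda>x. x)"
  proof -
    have "sqint lborel (\<lambda>x. indicator {a<..<b} x *\<^sub>R x)"
      by (rule sqint_bounded_support[where B = "\<bar>a\<bar> + \<bar>b\<bar>" and R = "\<bar>a\<bar> + \<bar>b\<bar>"]) (auto simp: indicator_def)
    then show ?thesis by (simp only: L2_iff_sqint)
  qed
  moreover have "continuous_on ({a..b} \<times> {0..c}) (W n)" for n unfolding W_def by (rule R.continuous_lift[OF gi])
  ultimately show ?thesis unfolding has_bottom_trace_def Let_def Q[symmetric]
    using H1u H1W conv tr by blast
qed

lemma square_integrable_subgraphI:
  fixes f :: "real \<times> real \<Rightarrow> real"
  assumes [measurable]: "f \<in> borel_measurable borel" and S: "S \<in> sets borel"
    and fin: "(\<integral>\<^sup>+z. indicator S z * ennreal ((f z)\<^sup>2) \<partial>lborel) < \<infinity>"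
  shows "sqint lborel (\<lambda>z. indicator S z * f z)"
proof -
  note [measurable] = S
  have "indicator S z * ennreal ((f z)\<^sup>2) = ennreal ((indicator S z * f z)\<^sup>2)" for z by (auto simp: indicator_def)
  then have "integrable lborel (\<lambda>z. (indicator S z * f z)\<^sup>2)" by (intro integrableI_bounded) (use fin in auto)
  then show ?thesis unfolding sqint_def by simp
qed

text \<open>This is where the second moment of the profile enters: it is the squared L^2 norm of x
  on the subgraph.\<close>

lemma subgraph_fst_square:
  assumes h[measurable]: "h \<in> borel_measurable borel" and h0: "\<And>x. 0 \<le> h x"
  shows "(\<integral>\<^sup>+z. indicator (subgraph h) z * ennreal ((fst z)\<^sup>2) \<partial>lborel) = (\<integral>\<^sup>+x. ennreal (x\<^sup>2 * h x) \<partial>lborel)"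
proof -
  note [measurable] = subgraph_measurable[OF h]
  have "(\<lambda>z. indicator (subgraph h) z * ennreal ((fst z)\<^sup>2)) \<in> borel_measurable borel" by measurable
  then have m: "(\<lambda>z. indicator (subgraph h) z * ennreal ((fst z)\<^sup>2)) \<in> borel_measurable (lborel \<Otimes>\<^sub>M lborel)"
    by (simp add: lborel_prod)
  have "(\<integral>\<^sup>+z. indicator (subgraph h) z * ennreal ((fst z)\<^sup>2) \<partial>lborel) =
      (\<integral>\<^sup>+x. \<integral>\<^sup>+y. indicator (subgraph h) (x, y) * ennreal ((fst (x, y))\<^sup>2) \<partial>lborel \<partial>lborel)"
    using lborel.nn_integral_fst[OF m] by (simp add: lborel_prod)
  also have "\<dots> = (\<integral>\<^sup>+x. ennreal (x\<^sup>2 * h x) \<partial>lborel)"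
  proof (rule nn_integral_cong)
    fix x
    have "(\<integral>\<^sup>+y. indicator (subgraph h) (x, y) * ennreal ((fst (x, y))\<^sup>2) \<partial>lborel) = (\<integral>\<^sup>+y. ennreal (x\<^sup>2) * indicator {0<..<h x} y \<partial>lborel)"
      by (rule nn_integral_cong) (auto simp: subgraph_def indicator_def)
    also have "\<dots> = ennreal (x\<^sup>2 * h x)" using h0[of x] by (simp add: nn_integral_cmult_indicator ennreal_mult)
    finally show "(\<integral>\<^sup>+y. indicator (subgraph h) (x, y) * ennreal ((fst (x, y))\<^sup>2) \<partial>lborel) = ennreal (x\<^sup>2 * h x)" .
  qed
  finally show ?thesis .
qed

text \<open>On a column of height at most \<open>T\<close>, Cauchy-Schwarz gives one factor
  \<open>T\<close>, and integrating over the height gives another.\<close>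

lemma subgraph_vprim_square:
  assumes h[measurable]: "h \<in> borel_measurable borel" and T: "\<And>x. h x \<le> T" "0 \<le> T" and g[measurable]: "g \<in> borel_measurable borel"
  shows "(\<integral>\<^sup>+z. indicator (subgraph h) z * ennreal ((vprim g z)\<^sup>2) \<partial>lborel) \<le>
    ennreal (T\<^sup>2) * (\<integral>\<^sup>+z. ennreal ((g z)\<^sup>2) \<partial>lborel)"
proof -
  note [measurable] = subgraph_measurable[OF h]
  have gm: "(\<lambda>z. ennreal ((g z)\<^sup>2)) \<in> borel_measurable (lborel \<Otimes>\<^sub>M lborel)"
    unfolding lborel_prod by measurable
  have m: "(\<lambda>z. indicator (subgraph h) z * ennreal ((vprim g z)\<^sup>2)) \<in> borel_measurable (lborel \<Otimes>\<^sub>M lborel)"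
    unfolding lborel_prod by measurable
  have gx: "(\<lambda>s. g (x, s)) \<in> borel_measurable borel" for x
    using measurable_Pair2[OF borel_measurable_pairI[OF g], of x] by simp
  let ?N = "\<lambda>x. \<integral>\<^sup>+s. ennreal ((g (x, s))\<^sup>2) \<partial>lborel"
  have pt: "indicator (subgraph h) (x, y) * ennreal ((vprim g (x, y))\<^sup>2) \<le> (ennreal T * ?N x) * indicator {0<..<T} y" for x y
  proof (cases "(x, y) \<in> subgraph h")
    case True
    then have y: "0 < y" "y < T" using T(1)[of x] by (auto simp: subgraph_def)
    have "ennreal ((vprim g (x, y))\<^sup>2) \<le> ennreal (y - 0) * (\<integral>\<^sup>+s. indicator {0<..<y} s * ennreal ((g (x, s))\<^sup>2) \<partial>lborel)"
      unfolding vprim_def fst_conv snd_conv by (rule interval_integral_square_le[OF gx y(1)])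
    also have "\<dots> \<le> ennreal T * ?N x"
      by (intro mult_mono ennreal_leI nn_integral_mono) (use y in \<open>auto simp: indicator_def\<close>)
    finally show ?thesis using True y by simp
  qed simp
  have "(\<integral>\<^sup>+z. indicator (subgraph h) z * ennreal ((vprim g z)\<^sup>2) \<partial>lborel) =
      (\<integral>\<^sup>+x. \<integral>\<^sup>+y. indicator (subgraph h) (x, y) * ennreal ((vprim g (x, y))\<^sup>2) \<partial>lborel \<partial>lborel)"
    using lborel.nn_integral_fst[OF m] by (simp add: lborel_prod)
  also have "\<dots> \<le> (\<integral>\<^sup>+x. \<integral>\<^sup>+y. (ennreal T * ?N x) * indicator {0<..<T} y \<partial>lborel \<partial>lborel)"
    by (intro nn_integral_mono pt)
  also have "\<dots> = (\<integral>\<^sup>+x. ennreal (T\<^sup>2) * ?N x \<partial>lborel)"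
  proof (rule nn_integral_cong)
    fix x
    have "(\<integral>\<^sup>+y. (ennreal T * ?N x) * indicator {0<..<T} y \<partial>lborel) = (ennreal T * ?N x) * ennreal T"
      using T(2) by (simp add: nn_integral_cmult_indicator)
    also have "\<dots> = ennreal (T\<^sup>2) * ?N x" using T(2) by (simp add: power2_eq_square ennreal_mult mult_ac)
    finally show "(\<integral>\<^sup>+y. (ennreal T * ?N x) * indicator {0<..<T} y \<partial>lborel) = ennreal (T\<^sup>2) * ?N x" .
  qed
  also have "\<dots> = ennreal (T\<^sup>2) * (\<integral>\<^sup>+z. ennreal ((g z)\<^sup>2) \<partial>lborel)"
    using lborel.borel_measurable_nn_integral_fst[OF gm] lborel.nn_integral_fst[OF gm]
    by (simp add: nn_integral_cmult lborel_prod)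
  finally show ?thesis .
qed

lemma energy_eq:
  assumes u: "H1 (subgraph h) u"
  shows "energy u h = ennreal (LBINT z. (norm (indicator (subgraph h) z *\<^sub>R weak_gradient (subgraph h) u z))\<^sup>2) + pointwise_variation h"
proof -
  let ?G = "\<lambda>z. indicator (subgraph h) z *\<^sub>R weak_gradient (subgraph h) u z"
  have "ennreal ((norm (weak_gradient (subgraph h) u z))\<^sup>2) * indicator (subgraph h) z = ennreal ((norm (?G z))\<^sup>2)" for z
    by (auto simp: indicator_def)
  then show ?thesis unfolding energy_def
    using nn_integral_eq_integral[OF sqintD(2)[OF wgradD(2)[OF H1_wgrad(2)[OF u]]]] by simp
qed

text \<open>\<open>BV\<close> depends on \<open>h\<close> up to null sets and does not bound the
  pointwise variation; finite energy does, and so turns \<open>h\<close> into a profile.\<close>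

lemma denergy_le_energy:
  assumes uh: "(u, h) \<in> admissible V" and fin: "energy u h < \<infinity>"
  shows "profile h" "(LBINT x. h x) = V" "ennreal (denergy h) \<le> energy u h"
proof -
  have a: "BV h" "lsc h" "\<And>x. 0 \<le> h x" "H1 (subgraph h) u" "trace_on_support h u (\<lambda>x. x)"
    and V: "(LBINT x. h x) = V" using uh by (auto simp: admissible_def)
  show "(LBINT x. h x) = V" by (rule V)
  have "pointwise_variation h \<le> energy u h" unfolding energy_def by (simp add: add_increasing)
  then have b: "bdd_var h" using fin le_less_trans bdd_var_if_finite by blast
  show p: "profile h" unfolding profile_def using a b by (auto simp: BV_def)
  let ?E = "LBINT z. (norm (indicator (subgraph h) z *\<^sub>R weak_gradient (subgraph h) u z))\<^sup>2"
  have "ennreal (denergy h) \<le> ennreal (?E + tv h)"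
    unfolding denergy_def by (intro ennreal_leI add_right_mono dual_energy_le_Dirichlet[OF a(2) a(5) H1_wgrad(2)[OF a(4)]])
  also have "\<dots> = ennreal ?E + ennreal (tv h)"
    by (rule ennreal_plus[OF Bochner_Integration.integral_nonneg tv_nonneg[OF b]]) simp
  finally show "ennreal (denergy h) \<le> energy u h" unfolding energy_eq[OF a(4)] pointwise_variation_eq[OF b] .
qed

text \<open>The optimal field is the gradient of an explicit function: its identity against dual
  pairs is the weak equation for the horizontal derivative, and the vertical one holds by
  construction. Minimality enters through the second moment, which makes that function square
  integrable.\<close>

lemma minimizer_admissible:
  assumes h: "is_minimizer h" and V: "(LBINT x. h x) = V" "0 < V"
  shows "\<exists>u. (u, h) \<in> admissible V \<and> energy u h = ennreal (denergy h)"
proof -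
  let ?O = "subgraph h"
  have p: "profile h" using h by (simp add: is_minimizer_def)
  have hm[measurable]: "h \<in> borel_measurable borel" by (rule profileD[OF p])
  have Om[measurable]: "?O \<in> sets borel" by (rule subgraph_measurable[OF hm])
  have Oo: "open ?O" by (rule open_subgraph[OF profileD(1)[OF p]])
  obtain G where G: "sqint lborel G" "\<And>z. z \<notin> ?O \<Longrightarrow> G z = 0" "(LBINT z. (norm (G z))\<^sup>2) = dual_energy h"
    "\<And>\<phi> D. test_function ?O \<phi> D \<Longrightarrow> (LBINT z. G z \<bullet> dual_pair \<phi> D z) = (LBINT z. \<phi> z)"
    using optimal_field[OF p] by blast
  define g where "g z = snd (G z)" for z
  define u where "u z = fst z + vprim g z" for z
  have gs: "sqint lborel g" unfolding g_def[abs_def] by (rule sqint_components(2)[OF G(1)])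
  have gm[measurable]: "g \<in> borel_measurable borel" using sqintD(1)[OF gs] by simp
  have us: "sqint lborel (\<lambda>z. indicator ?O z *\<^sub>R u z)"
  proof -
    have "sqint lborel (\<lambda>z. indicator ?O z * fst z)"
      by (rule square_integrable_subgraphI)
        (use subgraph_fst_square[OF hm profileD(2)[OF p]] minimizer_second_moment[OF h] V in auto)
    moreover have "sqint lborel (\<lambda>z. indicator ?O z * vprim g z)"
    proof (rule square_integrable_subgraphI)
      have "(\<integral>\<^sup>+z. indicator ?O z * ennreal ((vprim g z)\<^sup>2) \<partial>lborel) \<le> ennreal ((tv h)\<^sup>2) * (\<integral>\<^sup>+z. ennreal ((g z)\<^sup>2) \<partial>lborel)"
        by (rule subgraph_vprim_square) (use profile_le_tv[OF p] tv_nonneg[OF profileD(4)[OF p]] in auto)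
      also have "(\<integral>\<^sup>+z. ennreal ((g z)\<^sup>2) \<partial>lborel) = ennreal (LBINT z. (g z)\<^sup>2)"
        by (rule nn_integral_eq_integral) (use sqintD(2)[OF gs] in auto)
      finally have "(\<integral>\<^sup>+z. indicator ?O z * ennreal ((vprim g z)\<^sup>2) \<partial>lborel) \<le> ennreal ((tv h)\<^sup>2) * ennreal (LBINT z. (g z)\<^sup>2)" .
      also have "\<dots> < \<infinity>" by (simp add: ennreal_mult_less_top)
      finally show "(\<integral>\<^sup>+z. indicator ?O z * ennreal ((vprim g z)\<^sup>2) \<partial>lborel) < \<infinity>" .
    qed auto
    ultimately have "sqint lborel (\<lambda>z. indicator ?O z * fst z + indicator ?O z * vprim g z)" by (rule sqint_add)
    then show ?thesis by (simp add: u_def distrib_left)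
  qed
  have w: "wgrad ?O (\<lambda>z. indicator ?O z *\<^sub>R u z) G"
    unfolding wgrad_def
  proof (intro conjI allI impI us G(1))
    fix \<phi> D assume t: "test_function ?O \<phi> D"
    have 0: "\<phi> z = 0 \<and> D z = 0" if "z \<notin> ?O" for z using test_functionD(4)[OF t, of z] that by blast
    note c = coupling[OF gs t]
    \<comment> \<open>The defining identity of \<open>G\<close> in components, to be matched with
      the two horizontal terms of \<open>coupling\<close>.\<close>
    have "(LBINT z. \<phi> z * fst (G z)) + (LBINT z. g z * tail D z) = (LBINT z. \<phi> z)"
      using integral_inner_dual_pair[OF G(1) t] G(4)[OF t] by (simp add: g_def)
    moreover have "(LBINT z. indicator ?O z *\<^sub>R u z * fst (D z)) = (LBINT z. fst z * fst (D z) + vprim g z * fst (D z))"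
      by (rule Bochner_Integration.integral_cong) (use 0 in \<open>auto simp: u_def indicator_def distrib_right\<close>)
    ultimately show "(LBINT z. indicator ?O z *\<^sub>R u z * fst (D z)) = - (LBINT z. \<phi> z * fst (G z))" using c by simp
    have "(LBINT z. indicator ?O z *\<^sub>R u z * snd (D z)) = (LBINT z. fst z * snd (D z) + vprim g z * snd (D z))"
      by (rule Bochner_Integration.integral_cong) (use 0 in \<open>auto simp: u_def indicator_def distrib_right\<close>)
    also have "\<dots> = - (LBINT z. g z * (if 0 < snd z then \<phi> z else 0))" using c by simp
    also have "(LBINT z. g z * (if 0 < snd z then \<phi> z else 0)) = (LBINT z. \<phi> z * snd (G z))"
    proof (rule Bochner_Integration.integral_cong[OF refl])
      fix z show "g z * (if 0 < snd z then \<phi> z else 0) = \<phi> z * snd (G z)"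
        using 0[of z] by (cases "z \<in> ?O") (auto simp: g_def subgraph_def)
    qed
    finally show "(LBINT z. indicator ?O z *\<^sub>R u z * snd (D z)) = - (LBINT z. \<phi> z * snd (G z))" .
  qed
  have H: "H1 ?O u" by (rule H1I(1)[OF w G(2)])
  have "trace_on_support h u (\<lambda>x. x)"
    unfolding trace_on_support_def
  proof (intro allI impI)
    fix a b c :: real assume ab: "a < b" "0 < c" and sub: "{a<..<b} \<times> {0<..<c} \<subseteq> ?O"
    let ?Q = "{a<..<b} \<times> {0<..<c}"
    let ?i = "\<lambda>f z. indicator ?Q z * (f z :: real)"
    have Qm: "?Q \<in> sets borel" by (rule borel_open[OF open_rectangle])
    show "has_bottom_trace a b c u (\<lambda>x. x)"
    proof (rule has_bottom_trace_identity[OF ab refl])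
      show "u z = fst z + vprim (?i g) z" if z: "z \<in> ?Q" for z
      proof -
        \<comment> \<open>Cutting \<open>g\<close> to the rectangle changes nothing on the column
          below \<open>z\<close>, which lies in the rectangle.\<close>
        have "vprim g z = vprim (?i g) z"
          unfolding vprim_def by (rule Bochner_Integration.integral_cong) (use z in \<open>auto simp: indicator_def\<close>)
        then show ?thesis by (simp add: u_def)
      qed
      have "indicator ?Q z *\<^sub>R indicator ?O z *\<^sub>R u z = indicator ?Q z *\<^sub>R u z" for z
        using sub by (auto simp: indicator_def)
      moreover have "indicator ?Q z *\<^sub>R G z = (?i (\<lambda>z. fst (G z)) z, ?i g z)" for z by (simp add: g_def prod_eq_iff)
      ultimately show "wgrad ?Q (\<lambda>z. indicator ?Q z *\<^sub>R u z) (\<lambda>z. (?i (\<lambda>z. fst (G z)) z, ?i g z))"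
        using wgrad_restrict[OF w sub Qm] by (simp only:)
    qed simp_all
  qed
  then have adm: "(u, h) \<in> admissible V"
    using profile_BV[OF p] profileD(1,2)[OF p] H V(1) by (simp add: admissible_def)
  have "AE z in lborel. z \<in> ?O \<longrightarrow> indicator ?O z *\<^sub>R weak_gradient ?O u z = G z"
    by (rule wgrad_unique[OF Oo H1_wgrad(2)[OF H] w])
  then have AE: "AE z in lborel. (norm (indicator ?O z *\<^sub>R weak_gradient ?O u z))\<^sup>2 = (norm (G z))\<^sup>2"
    by eventually_elim (use G(2) in \<open>auto simp: indicator_def\<close>)
  have "(LBINT z. (norm (indicator ?O z *\<^sub>R weak_gradient ?O u z))\<^sup>2) = dual_energy h"
    unfolding G(3)[symmetric]
    by (rule integral_cong_AE[OF _ _ AE]) (use sqintD(2)[OF wgradD(2)[OF H1_wgrad(2)[OF H]]] sqintD(2)[OF G(1)] in auto)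
  then have "energy u h = ennreal (dual_energy h) + ennreal (tv h)"
    by (simp add: energy_eq[OF H] pointwise_variation_eq[OF profileD(4)[OF p]])
  also have "\<dots> = ennreal (denergy h)"
    unfolding denergy_def using dual_energy_nonneg tv_nonneg[OF profileD(4)[OF p]] p by (simp add: ennreal_plus)
  finally show ?thesis using adm by blast
qed

theorem proposition4p10:
  fixes V :: real
  assumes "V > 0"
    and "F_l V < ennreal V"
  shows "\<exists>u h. (u, h) \<in> admissible V \<and> energy u h = F_l V"
proof -
  \<comment> \<open>The strict inequality for the infimum passes to one competitor, and its profile
    supplies the strict inequality of the reduced problem.\<close>
  obtain u k where uk: "(u, k) \<in> admissible V" "energy u k < ennreal V"
    using assms(2) by (auto simp: F_l_def INF_less_iff)
  have "energy u k < \<infinity>" using uk(2) ennreal_less_top less_trans by fastforce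
  note k = denergy_le_energy[OF uk(1) this]
  have "ennreal (denergy k) < ennreal V" using k(3) uk(2) by (rule le_less_trans)
  then have "denergy k < V" using denergy_nonneg[OF k(1)] by (simp add: ennreal_less_iff)
  then obtain h where h: "is_minimizer h" "(LBINT x. h x) = V" using dual_minimizer[OF assms(1) k(1,2)] by blast
  obtain v where v: "(v, h) \<in> admissible V" "energy v h = ennreal (denergy h)"
    using minimizer_admissible[OF h assms(1)] by blast
  have "ennreal (denergy h) \<le> energy w q" if wq: "(w, q) \<in> admissible V" for w q
  \<comment> \<open>Pairs of infinite energy have no associated profile in the sense used here and
    satisfy the bound trivially.\<close>
  proof (cases "energy w q < \<infinity>")
    case True
    note q = denergy_le_energy[OF wq True]
    have "denergy h \<le> denergy q" using h q(1,2) by (simp add: is_minimizer_def)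
    then show ?thesis using q(3) ennreal_leI order_trans by blast
  next
    case False
    then show ?thesis by (simp add: not_less top_unique)
  qed
  then have "ennreal (denergy h) \<le> F_l V" unfolding F_l_def by (intro INF_greatest) auto
  moreover have "F_l V \<le> energy v h" unfolding F_l_def by (rule INF_lower2[OF v(1)]) simp
  ultimately show ?thesis using v by (intro exI[of _ v] exI[of _ h]) auto
qed

end
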